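(* Let $k$ be a perfect field, $X$ a smooth, projective, geometrically irreducible curve over $k$, $G$ a finite subgroup of $\mathrm{Aut}(X/k)$, and assume that the canonical projection $\pi:X\to Y=X/G$ is tamely ramified. Let $P\in X$ be a closed point and $d\in\{1,\ldots,e_P^t-1\}$. (a) If $\mathrm{Gal}(k(P)/k(\pi(P)))$ is abelian, then $W_{P,d}\cong(\mathfrak m_P/\mathfrak m_P^2)^{\otimes(-d)}$ as $k[G_P]$-modules. (b) If $I_P$ is central in $G_P$, then $W_{P,d}$ is of the form $W_{P,d}\cong\mathrm{Ind}_{I_P}^{G_P}(\chi_d)$ for some $k[I_P]$-module $\chi_d$. If moreover $G_P\cong I_P\times G_P/I_P$, then $W_{P,d}\cong(\mathfrak m_P/\mathfrak m_P^2)^{\otimes(-d)}$ as $k[G_P]$-modules.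
   Context: All modules are finitely generated. For a closed point $P\in X$: $k(P)$ is the residue field, $\mathfrak m_P$ the maximal ideal of $\mathcal O_{X,P}$; $G_P=\{\sigma\in G:\sigma(P)=P\}$ is the decomposition group; $I_P=\ker(G_P\to\mathrm{Aut}(k(P)/k))$ is the inertia group; $G_{P,s}$ ($s\ge-1$) is the $s$-th ramification group (lower numbering) of the extension of local fields obtained by completing $K(X)/K(X)^G$ at $P$ and $\pi(P)$, with $G_{P,0}=I_P$. $\pi$ is tamely ramified if $G_{P,s}$ is trivial for all $s\ge1$ and all $P$. $e_P^t=|G_{P,0}/G_{P,1}|$ is the tame part of the ramification index (equal to $e_P=|I_P|$ in the tame case) and $f_P=[k(P):k(\pi(P))]$. $G_P$ acts $k(P)$-semilinearly, and $I_P$ acts $k(P)$-linearly, on the one-dimensional $k(P)$-vector space $\mathfrak m_P/\mathfrak m_P^2$; tensor powers are over $k(P)$, negative powers being powers of the dual; they are viewed as $k[G_P]$-modules (or, by restriction, $k[I_P]$-modules). $W_{P,d}$ denotes the projective $k[G_P]$-module, which exists and is unique up to isomorphism, such that $\mathrm{Ind}_{I_P}^{G_P}(\mathrm{Cov}((\mathfrak m_P/\mathfrak m_P^2)^{\otimes(-d)}))\cong\bigoplus^{f_P}W_{P,d}$ ($f_P$ copies) as $k[G_P]$-modules, where $\mathrm{Cov}$ denotes the $k[I_P]$-projective cover. The isomorphism $G_P\cong I_P\times G_P/I_P$ in (b) is understood to be compatible with the inclusion $I_P\subseteq G_P$ and the projection $G_P\to G_P/I_P$. *)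

theory Defs
  imports
    "HOL-Analysis.Abstract_Topology"
    "HOL-Algebra.Algebra"
    "HOL-Algebra.Algebraic_Closure_Type"
    "HOL-Library.Poly_Mapping"
    "HOL-Computational_Algebra.Polynomial"
begin

section \<open>Ringed spaces over a field\<close>

text \<open>
  A topological space with a sheaf of k-algebras: \<open>sec \<C> U\<close> is the ring of sections over an
  open set \<open>U\<close>, \<open>res \<C> U V\<close> the restriction from \<open>U\<close> to \<open>V\<close>, and \<open>scal \<C> U\<close> the structure
  map from k.  The field k is a type.
\<close>

record ('k, 'p, 's) rspace =
  tspace :: "'p topology"
  sec :: "'p set \<Rightarrow> 's ring"
  res :: "'p set \<Rightarrow> 'p set \<Rightarrow> 's \<Rightarrow> 's"
  scal :: "'p set \<Rightarrow> 'k \<Rightarrow> 's"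

type_synonym ('p, 's) germs = "('p set \<times> 's) set"

definition germ :: "('k, 'p, 's) rspace \<Rightarrow> 'p \<Rightarrow> 'p set \<Rightarrow> 's \<Rightarrow> ('p, 's) germs" where
  "germ \<C> P U s = {(V, t). openin (tspace \<C>) V \<and> P \<in> V \<and> t \<in> carrier (sec \<C> V) \<and>
     (\<exists>W. openin (tspace \<C>) W \<and> P \<in> W \<and> W \<subseteq> U \<inter> V \<and> res \<C> U W s = res \<C> V W t)}"

definition stalk :: "('k, 'p, 's) rspace \<Rightarrow> 'p \<Rightarrow> ('p, 's) germs ring" where
  "stalk \<C> P =
    \<lparr>carrier = {germ \<C> P U s |U s. openin (tspace \<C>) U \<and> P \<in> U \<and> s \<in> carrier (sec \<C> U)},
     monoid.mult = (\<lambda>A B. \<Union>(U, s)\<in>A. \<Union>(V, t)\<in>B.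
       germ \<C> P (U \<inter> V) (res \<C> U (U \<inter> V) s \<otimes>\<^bsub>sec \<C> (U \<inter> V)\<^esub> res \<C> V (U \<inter> V) t)),
     one = germ \<C> P (topspace (tspace \<C>)) \<one>\<^bsub>sec \<C> (topspace (tspace \<C>))\<^esub>,
     ring.zero = germ \<C> P (topspace (tspace \<C>)) \<zero>\<^bsub>sec \<C> (topspace (tspace \<C>))\<^esub>,
     add = (\<lambda>A B. \<Union>(U, s)\<in>A. \<Union>(V, t)\<in>B.
       germ \<C> P (U \<inter> V) (res \<C> U (U \<inter> V) s \<oplus>\<^bsub>sec \<C> (U \<inter> V)\<^esub> res \<C> V (U \<inter> V) t))\<rparr>"

definition stalk_scal :: "('k, 'p, 's) rspace \<Rightarrow> 'p \<Rightarrow> 'k \<Rightarrow> ('p, 's) germs" where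
  "stalk_scal \<C> P c = germ \<C> P (topspace (tspace \<C>)) (scal \<C> (topspace (tspace \<C>)) c)"

text \<open>The maximal ideal of a local ring is its set of non-units.\<close>

definition maxid :: "('k, 'p, 's) rspace \<Rightarrow> 'p \<Rightarrow> ('p, 's) germs set" where
  "maxid \<C> P = carrier (stalk \<C> P) - Units (stalk \<C> P)"

primrec maxid_pow :: "('k, 'p, 's) rspace \<Rightarrow> 'p \<Rightarrow> nat \<Rightarrow> ('p, 's) germs set" where
  "maxid_pow \<C> P 0 = carrier (stalk \<C> P)"
| "maxid_pow \<C> P (Suc n) = ideal_prod (stalk \<C> P) (maxid_pow \<C> P n) (maxid \<C> P)"

definition resfield :: "('k, 'p, 's) rspace \<Rightarrow> 'p \<Rightarrow> ('p, 's) germs set ring" where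
  "resfield \<C> P = stalk \<C> P Quot maxid \<C> P"

definition reduct :: "('k, 'p, 's) rspace \<Rightarrow> 'p \<Rightarrow> ('p, 's) germs \<Rightarrow> ('p, 's) germs set" where
  "reduct \<C> P a = maxid \<C> P +>\<^bsub>stalk \<C> P\<^esub> a"

text \<open>The cotangent space, as a module over \<open>resfield \<C> P\<close>.\<close>

definition cotangent ::
    "('k, 'p, 's) rspace \<Rightarrow> 'p \<Rightarrow> (('p, 's) germs set, ('p, 's) germs set) module" where
  "cotangent \<C> P =
    \<lparr>carrier = {maxid_pow \<C> P 2 +>\<^bsub>stalk \<C> P\<^esub> x |x. x \<in> maxid \<C> P},
     monoid.mult = undefined, one = undefined,
     ring.zero = maxid_pow \<C> P 2,
     add = set_add (stalk \<C> P),
     module.smult = (\<lambda>A B. \<Union>a\<in>A. \<Union>x\<in>B. maxid_pow \<C> P 2 +>\<^bsub>stalk \<C> P\<^esub> (a \<otimes>\<^bsub>stalk \<C> P\<^esub> x))\<rparr>"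

text \<open>
  An automorphism over k is a pair of a homeomorphism \<open>\<phi>\<close> and the family of the maps
  \<open>\<psi> U\<close> from \<open>O(U)\<close> to \<open>O(\<phi>\<^sup>-\<^sup>1 U)\<close>; both are required to be extensional, so that
  equality of automorphisms is equality of pairs.  The induced maps on the stalks are local
  because they are bijective.
\<close>

type_synonym ('p, 's) morph = "('p \<Rightarrow> 'p) \<times> ('p set \<Rightarrow> 's \<Rightarrow> 's)"

definition preim :: "('k, 'p, 's) rspace \<Rightarrow> ('p \<Rightarrow> 'q) \<Rightarrow> 'q set \<Rightarrow> 'p set" where
  "preim \<C> \<phi> U = {p \<in> topspace (tspace \<C>). \<phi> p \<in> U}"

definition is_aut :: "('k, 'p, 's) rspace \<Rightarrow> ('p, 's) morph \<Rightarrow> bool" where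
  "is_aut \<C> \<sigma> \<longleftrightarrow> (case \<sigma> of (\<phi>, \<psi>) \<Rightarrow>
     \<phi> \<in> extensional (topspace (tspace \<C>)) \<and> homeomorphic_map (tspace \<C>) (tspace \<C>) \<phi> \<and>
     \<psi> \<in> extensional {U. openin (tspace \<C>) U} \<and>
     (\<forall>U. openin (tspace \<C>) U \<longrightarrow>
        \<psi> U \<in> extensional (carrier (sec \<C> U)) \<and>
        \<psi> U \<in> ring_iso (sec \<C> U) (sec \<C> (preim \<C> \<phi> U)) \<and>
        (\<forall>c. \<psi> U (scal \<C> U c) = scal \<C> (preim \<C> \<phi> U) c) \<and>
        (\<forall>V s. openin (tspace \<C>) V \<and> V \<subseteq> U \<and> s \<in> carrier (sec \<C> U) \<longrightarrow>
           \<psi> V (res \<C> U V s) = res \<C> (preim \<C> \<phi> U) (preim \<C> \<phi> V) (\<psi> U s))))"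

definition Aut :: "('k, 'p, 's) rspace \<Rightarrow> ('p, 's) morph monoid" where
  "Aut \<C> =
    \<lparr>carrier = {\<sigma>. is_aut \<C> \<sigma>},
     monoid.mult = (\<lambda>(\<phi>1, \<psi>1) (\<phi>2, \<psi>2).
       (compose (topspace (tspace \<C>)) \<phi>1 \<phi>2,
        \<lambda>U\<in>{U. openin (tspace \<C>) U}. compose (carrier (sec \<C> U)) (\<psi>2 (preim \<C> \<phi>1 U)) (\<psi>1 U))),
     one = (\<lambda>p\<in>topspace (tspace \<C>). p,
            \<lambda>U\<in>{U. openin (tspace \<C>) U}. \<lambda>s\<in>carrier (sec \<C> U). s)\<rparr>"

text \<open>
  The map of stalks, with values in the stalk of \<open>\<C>\<close> at \<open>P\<close>, induced by a morphism
  \<open>(\<phi>, \<psi>)\<close> from \<open>\<C>\<close> to some ringed space; its arguments are germs at \<open>\<phi> P\<close>.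
\<close>

definition stalk_map ::
    "('k, 'p, 's) rspace \<Rightarrow> 'p \<Rightarrow> ('p \<Rightarrow> 'q) \<Rightarrow> ('q set \<Rightarrow> 's \<Rightarrow> 's) \<Rightarrow>
     ('q, 's) germs \<Rightarrow> ('p, 's) germs" where
  "stalk_map \<C> P \<phi> \<psi> A = (\<Union>(U, s)\<in>A. germ \<C> P (preim \<C> \<phi> U) (\<psi> U s))"

text \<open>The left action of an automorphism \<open>\<sigma>\<close> fixing \<open>P\<close>: pull back along \<open>\<sigma>\<^sup>-\<^sup>1\<close>.\<close>

definition stalk_act ::
    "('k, 'p, 's) rspace \<Rightarrow> 'p \<Rightarrow> ('p, 's) morph \<Rightarrow> ('p, 's) germs \<Rightarrow> ('p, 's) germs" where
  "stalk_act \<C> P \<sigma> = stalk_map \<C> P (fst (inv\<^bsub>Aut \<C>\<^esub> \<sigma>)) (snd (inv\<^bsub>Aut \<C>\<^esub> \<sigma>))"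

text \<open>
  The induced action on cosets of ideals of the stalk, i.e. on residue field and cotangent space.
\<close>

definition coset_act ::
    "('k, 'p, 's) rspace \<Rightarrow> 'p \<Rightarrow> ('p, 's) morph \<Rightarrow> ('p, 's) germs set \<Rightarrow> ('p, 's) germs set" where
  "coset_act \<C> P \<sigma> A = stalk_act \<C> P \<sigma> ` A"


section \<open>The quotient by a group of automorphisms\<close>

definition orbit_of :: "('p, 's) morph set \<Rightarrow> 'p \<Rightarrow> 'p set" where
  "orbit_of G P = (\<lambda>\<sigma>. fst \<sigma> P) ` G"

definition quot_top :: "('k, 'p, 's) rspace \<Rightarrow> ('p, 's) morph set \<Rightarrow> 'p set topology" where
  "quot_top \<C> G = topology (\<lambda>V. V \<subseteq> orbit_of G ` topspace (tspace \<C>) \<and>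
      openin (tspace \<C>) (preim \<C> (orbit_of G) V))"

lemma openin_quot_top:
  "openin (quot_top \<C> G) V \<longleftrightarrow>
     V \<subseteq> orbit_of G ` topspace (tspace \<C>) \<and> openin (tspace \<C>) (preim \<C> (orbit_of G) V)"
proof -
  have "istopology (\<lambda>V. V \<subseteq> orbit_of G ` topspace (tspace \<C>) \<and>
      openin (tspace \<C>) (preim \<C> (orbit_of G) V))"
    unfolding istopology_def
  proof (intro conjI allI impI)
    fix S T
    assume S: "S \<subseteq> orbit_of G ` topspace (tspace \<C>) \<and> openin (tspace \<C>) (preim \<C> (orbit_of G) S)"
      and T: "T \<subseteq> orbit_of G ` topspace (tspace \<C>) \<and> openin (tspace \<C>) (preim \<C> (orbit_of G) T)"
    then show "S \<inter> T \<subseteq> orbit_of G ` topspace (tspace \<C>)" by blast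
    have "preim \<C> (orbit_of G) (S \<inter> T) = preim \<C> (orbit_of G) S \<inter> preim \<C> (orbit_of G) T"
      by (auto simp: preim_def)
    with S T show "openin (tspace \<C>) (preim \<C> (orbit_of G) (S \<inter> T))" by auto
  next
    fix \<K>
    assume K: "\<forall>K\<in>\<K>. K \<subseteq> orbit_of G ` topspace (tspace \<C>) \<and>
      openin (tspace \<C>) (preim \<C> (orbit_of G) K)"
    then show "\<Union>\<K> \<subseteq> orbit_of G ` topspace (tspace \<C>)" by blast
    have "preim \<C> (orbit_of G) (\<Union>\<K>) = (\<Union>K\<in>\<K>. preim \<C> (orbit_of G) K)"
      by (auto simp: preim_def)
    with K show "openin (tspace \<C>) (preim \<C> (orbit_of G) (\<Union>\<K>))" by auto
  qed
  then show ?thesis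
    by (simp add: quot_top_def topology_inverse')
qed

text \<open>The sections of \<open>\<C>/G\<close> over \<open>V\<close> are the G-invariant sections of \<open>\<C>\<close> over \<open>\<pi>\<^sup>-\<^sup>1 V\<close>.\<close>

definition quot_space ::
    "('k, 'p, 's) rspace \<Rightarrow> ('p, 's) morph set \<Rightarrow> ('k, 'p set, 's) rspace" where
  "quot_space \<C> G =
    \<lparr>tspace = quot_top \<C> G,
     sec = (\<lambda>V. (sec \<C> (preim \<C> (orbit_of G) V))
       \<lparr>carrier := {s \<in> carrier (sec \<C> (preim \<C> (orbit_of G) V)).
          \<forall>\<sigma>\<in>G. snd \<sigma> (preim \<C> (orbit_of G) V) s = s}\<rparr>),
     res = (\<lambda>V W. res \<C> (preim \<C> (orbit_of G) V) (preim \<C> (orbit_of G) W)),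
     scal = (\<lambda>V. scal \<C> (preim \<C> (orbit_of G) V))\<rparr>"


section \<open>Decomposition, inertia and ramification groups\<close>

definition decomp :: "('p, 's) morph set \<Rightarrow> 'p \<Rightarrow> ('p, 's) morph set" where
  "decomp G P = {\<sigma> \<in> G. fst \<sigma> P = P}"

definition inertia ::
    "('k, 'p, 's) rspace \<Rightarrow> ('p, 's) morph set \<Rightarrow> 'p \<Rightarrow> ('p, 's) morph set" where
  "inertia \<C> G P = {\<sigma> \<in> decomp G P. \<forall>A\<in>carrier (resfield \<C> P). coset_act \<C> P \<sigma> A = A}"

text \<open>
  Lower numbering, for \<open>s \<ge> -1\<close>: the elements of the decomposition group acting trivially on the
  valuation ring modulo the power \<open>s + 1\<close> of its maximal ideal.  This quotient does not change
  when the local ring at \<open>P\<close> is completed.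
\<close>

definition ram_group ::
    "('k, 'p, 's) rspace \<Rightarrow> ('p, 's) morph set \<Rightarrow> 'p \<Rightarrow> int \<Rightarrow> ('p, 's) morph set" where
  "ram_group \<C> G P s = {\<sigma> \<in> decomp G P. \<forall>x\<in>carrier (stalk \<C> P).
     stalk_act \<C> P \<sigma> x \<ominus>\<^bsub>stalk \<C> P\<^esub> x \<in> maxid_pow \<C> P (nat (s + 1))}"

definition closed_point :: "('k, 'p, 's) rspace \<Rightarrow> 'p \<Rightarrow> bool" where
  "closed_point \<C> P \<longleftrightarrow> P \<in> topspace (tspace \<C>) \<and> closedin (tspace \<C>) {P}"

definition tamely_ramified :: "('k, 'p, 's) rspace \<Rightarrow> ('p, 's) morph set \<Rightarrow> bool" where
  "tamely_ramified \<C> G \<longleftrightarrow>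
     (\<forall>P s. closed_point \<C> P \<and> s \<ge> 1 \<longrightarrow> ram_group \<C> G P s = {\<one>\<^bsub>Aut \<C>\<^esub>})"

definition tame_index :: "('k, 'p, 's) rspace \<Rightarrow> ('p, 's) morph set \<Rightarrow> 'p \<Rightarrow> nat" where
  "tame_index \<C> G P =
     Coset.order (((Aut \<C>)\<lparr>carrier := ram_group \<C> G P 0\<rparr>) Mod ram_group \<C> G P 1)"

text \<open>The residue field of \<open>\<C>/G\<close> at the image of \<open>P\<close>, embedded in the residue field at \<open>P\<close>.\<close>

definition base_resfield ::
    "('k, 'p, 's) rspace \<Rightarrow> ('p, 's) morph set \<Rightarrow> 'p \<Rightarrow> ('p, 's) germs set set" where
  "base_resfield \<C> G P =
     (\<lambda>A. reduct \<C> P (stalk_map \<C> P (orbit_of G) (\<lambda>U s. s) A)) `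
       carrier (stalk (quot_space \<C> G) (orbit_of G P))"

definition res_degree :: "('k, 'p, 's) rspace \<Rightarrow> ('p, 's) morph set \<Rightarrow> 'p \<Rightarrow> nat" where
  "res_degree \<C> G P = ring.dim (resfield \<C> P) (base_resfield \<C> G P) (carrier (resfield \<C> P))"

definition res_gal ::
    "('k, 'p, 's) rspace \<Rightarrow> ('p, 's) morph set \<Rightarrow> 'p \<Rightarrow>
     (('p, 's) germs set \<Rightarrow> ('p, 's) germs set) monoid" where
  "res_gal \<C> G P = (BijGroup (carrier (resfield \<C> P)))
     \<lparr>carrier := {\<tau> \<in> Bij (carrier (resfield \<C> P)).
        \<tau> \<in> ring_hom (resfield \<C> P) (resfield \<C> P) \<and> (\<forall>a\<in>base_resfield \<C> G P. \<tau> a = a)}\<rparr>"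


section \<open>Modules over a group algebra\<close>

text \<open>
  A module over k[\<open>\<Gamma>\<close>] is a k-vector space with a k-linear action of \<open>\<Gamma>\<close>.  The fields \<open>mult\<close>
  and \<open>one\<close> inherited from the library's record of modules are irrelevant.
\<close>

record ('k, 'm, 'g) gmod = "('k, 'm) module" +
  act :: "'g \<Rightarrow> 'm \<Rightarrow> 'm"

abbreviation basefield :: "'k::field ring" where
  "basefield \<equiv> ring_of_type_algebra"

definition grp_module :: "'g monoid \<Rightarrow> ('k::field, 'm, 'g) gmod \<Rightarrow> bool" where
  "grp_module \<Gamma> V \<longleftrightarrow> Module.module basefield V \<and>
     (\<forall>g\<in>carrier \<Gamma>. \<forall>v\<in>carrier V. act V g v \<in> carrier V \<and>
        (\<forall>w\<in>carrier V. act V g (v \<oplus>\<^bsub>V\<^esub> w) = act V g v \<oplus>\<^bsub>V\<^esub> act V g w) \<and>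
        (\<forall>c. act V g (c \<odot>\<^bsub>V\<^esub> v) = c \<odot>\<^bsub>V\<^esub> act V g v) \<and>
        (\<forall>h\<in>carrier \<Gamma>. act V (g \<otimes>\<^bsub>\<Gamma>\<^esub> h) v = act V g (act V h v))) \<and>
     (\<forall>v\<in>carrier V. act V \<one>\<^bsub>\<Gamma>\<^esub> v = v)"

definition grp_submodule :: "'g monoid \<Rightarrow> ('k::field, 'm, 'g) gmod \<Rightarrow> 'm set \<Rightarrow> bool" where
  "grp_submodule \<Gamma> V N \<longleftrightarrow> submodule N basefield V \<and> (\<forall>g\<in>carrier \<Gamma>. act V g ` N \<subseteq> N)"

definition fg_module :: "'g monoid \<Rightarrow> ('k::field, 'm, 'g) gmod \<Rightarrow> bool" where
  "fg_module \<Gamma> V \<longleftrightarrow> grp_module \<Gamma> V \<and>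
     (\<exists>S. finite S \<and> S \<subseteq> carrier V \<and>
        (\<forall>N. grp_submodule \<Gamma> V N \<and> S \<subseteq> N \<longrightarrow> N = carrier V))"

definition grp_hom ::
    "'g monoid \<Rightarrow> ('k::field, 'm, 'g) gmod \<Rightarrow> ('k, 'w, 'g) gmod \<Rightarrow> ('m \<Rightarrow> 'w) set" where
  "grp_hom \<Gamma> V W = {f \<in> carrier V \<rightarrow> carrier W. \<forall>v\<in>carrier V.
     (\<forall>w\<in>carrier V. f (v \<oplus>\<^bsub>V\<^esub> w) = f v \<oplus>\<^bsub>W\<^esub> f w) \<and>
     (\<forall>c. f (c \<odot>\<^bsub>V\<^esub> v) = c \<odot>\<^bsub>W\<^esub> f v) \<and>
     (\<forall>g\<in>carrier \<Gamma>. f (act V g v) = act W g (f v))}"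

definition grp_iso ::
    "'g monoid \<Rightarrow> ('k::field, 'm, 'g) gmod \<Rightarrow> ('k, 'w, 'g) gmod \<Rightarrow> bool" where
  "grp_iso \<Gamma> V W \<longleftrightarrow> (\<exists>f\<in>grp_hom \<Gamma> V W. bij_betw f (carrier V) (carrier W))"

definition dir_power :: "nat \<Rightarrow> ('k, 'm, 'g) gmod \<Rightarrow> ('k, nat \<Rightarrow> 'm, 'g) gmod" where
  "dir_power n V =
    \<lparr>carrier = {..<n} \<rightarrow>\<^sub>E carrier V, monoid.mult = undefined, one = undefined,
     ring.zero = (\<lambda>i\<in>{..<n}. \<zero>\<^bsub>V\<^esub>), add = (\<lambda>x y. \<lambda>i\<in>{..<n}. x i \<oplus>\<^bsub>V\<^esub> y i),
     module.smult = (\<lambda>c x. \<lambda>i\<in>{..<n}. c \<odot>\<^bsub>V\<^esub> x i), act = (\<lambda>g x. \<lambda>i\<in>{..<n}. act V g (x i))\<rparr>"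

text \<open>
  For a finite group, k[\<open>\<Gamma>\<close>] as a left module over itself: the function \<open>f\<close> stands for
  the sum of all \<open>f x\<close> times \<open>x\<close>.
\<close>

definition group_algebra :: "'g monoid \<Rightarrow> ('k::field, 'g \<Rightarrow> 'k, 'g) gmod" where
  "group_algebra \<Gamma> =
    \<lparr>carrier = carrier \<Gamma> \<rightarrow>\<^sub>E UNIV, monoid.mult = undefined, one = undefined,
     ring.zero = (\<lambda>x\<in>carrier \<Gamma>. 0), add = (\<lambda>f f'. \<lambda>x\<in>carrier \<Gamma>. f x + f' x),
     module.smult = (\<lambda>c f. \<lambda>x\<in>carrier \<Gamma>. c * f x),
     act = (\<lambda>g f. \<lambda>x\<in>carrier \<Gamma>. f (inv\<^bsub>\<Gamma>\<^esub> g \<otimes>\<^bsub>\<Gamma>\<^esub> x))\<rparr>"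

text \<open>Finitely generated projective: a direct summand of a free module of finite rank.\<close>

definition projective_module :: "'g monoid \<Rightarrow> ('k::field, 'm, 'g) gmod \<Rightarrow> bool" where
  "projective_module \<Gamma> V \<longleftrightarrow> grp_module \<Gamma> V \<and>
     (\<exists>n. \<exists>i\<in>grp_hom \<Gamma> V (dir_power n (group_algebra \<Gamma>)).
          \<exists>p\<in>grp_hom \<Gamma> (dir_power n (group_algebra \<Gamma>)) V. \<forall>v\<in>carrier V. p (i v) = v)"

text \<open>A projective cover: an essential epimorphism from a projective module.\<close>

definition projective_cover ::
    "'g monoid \<Rightarrow> ('k::field, 'm, 'g) gmod \<Rightarrow> ('k, 'w, 'g) gmod \<Rightarrow> bool" where
  "projective_cover \<Gamma> C M \<longleftrightarrow> projective_module \<Gamma> C \<and>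
     (\<exists>q\<in>grp_hom \<Gamma> C M. q ` carrier C = carrier M \<and>
        (\<forall>N. grp_submodule \<Gamma> C N \<and> q ` N = carrier M \<longrightarrow> N = carrier C))"

text \<open>
  Induction from a subgroup \<open>H\<close> of a finite group \<open>\<Gamma>\<close>.  A function \<open>f\<close> with
  \<open>f (x h) = h\<^sup>-\<^sup>1 f x\<close> stands for the element of the tensor product of k[\<open>\<Gamma>\<close>] and \<open>V\<close> over
  k[\<open>H\<close>] which is the sum, over representatives \<open>x\<close> of the cosets \<open>x H\<close>, of the tensors of
  \<open>x\<close> and \<open>f x\<close>.
\<close>

definition Ind :: "'g monoid \<Rightarrow> 'g set \<Rightarrow> ('k, 'm, 'g) gmod \<Rightarrow> ('k, 'g \<Rightarrow> 'm, 'g) gmod" where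
  "Ind \<Gamma> H V =
    \<lparr>carrier = {f \<in> carrier \<Gamma> \<rightarrow>\<^sub>E carrier V.
        \<forall>x\<in>carrier \<Gamma>. \<forall>h\<in>H. f (x \<otimes>\<^bsub>\<Gamma>\<^esub> h) = act V (inv\<^bsub>\<Gamma>\<^esub> h) (f x)},
     monoid.mult = undefined, one = undefined,
     ring.zero = (\<lambda>x\<in>carrier \<Gamma>. \<zero>\<^bsub>V\<^esub>), add = (\<lambda>f f'. \<lambda>x\<in>carrier \<Gamma>. f x \<oplus>\<^bsub>V\<^esub> f' x),
     module.smult = (\<lambda>c f. \<lambda>x\<in>carrier \<Gamma>. c \<odot>\<^bsub>V\<^esub> f x),
     act = (\<lambda>g f. \<lambda>x\<in>carrier \<Gamma>. f (inv\<^bsub>\<Gamma>\<^esub> g \<otimes>\<^bsub>\<Gamma>\<^esub> x))\<rparr>"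

text \<open>
  The tensor power of the cotangent space with exponent \<open>-d\<close>: the d-th tensor power over the
  residue field of the dual space, realised as the space of d-linear forms, with the
  contragredient semilinear action.
\<close>

definition cotangent_neg_pow ::
    "('k::field, 'p, 's) rspace \<Rightarrow> 'p \<Rightarrow> nat \<Rightarrow>
     ('k, (nat \<Rightarrow> ('p, 's) germs set) \<Rightarrow> ('p, 's) germs set, ('p, 's) morph) gmod" where
  "cotangent_neg_pow \<C> P d = (let T = cotangent \<C> P; K = resfield \<C> P;
       E = {..<d} \<rightarrow>\<^sub>E carrier T in
    \<lparr>carrier = {\<beta> \<in> E \<rightarrow>\<^sub>E carrier K. \<forall>v\<in>E. \<forall>i<d. \<forall>x\<in>carrier T.
        (\<forall>y\<in>carrier T. \<beta> (v(i := x \<oplus>\<^bsub>T\<^esub> y)) = \<beta> (v(i := x)) \<oplus>\<^bsub>K\<^esub> \<beta> (v(i := y))) \<and>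
        (\<forall>a\<in>carrier K. \<beta> (v(i := a \<odot>\<^bsub>T\<^esub> x)) = a \<otimes>\<^bsub>K\<^esub> \<beta> (v(i := x)))},
     monoid.mult = undefined, one = undefined,
     ring.zero = (\<lambda>v\<in>E. \<zero>\<^bsub>K\<^esub>), add = (\<lambda>\<beta> \<gamma>. \<lambda>v\<in>E. \<beta> v \<oplus>\<^bsub>K\<^esub> \<gamma> v),
     module.smult = (\<lambda>c \<beta>. \<lambda>v\<in>E. reduct \<C> P (stalk_scal \<C> P c) \<otimes>\<^bsub>K\<^esub> \<beta> v),
     act = (\<lambda>\<sigma> \<beta>. \<lambda>v\<in>E. coset_act \<C> P \<sigma>
       (\<beta> (\<lambda>i\<in>{..<d}. coset_act \<C> P (inv\<^bsub>Aut \<C>\<^esub> \<sigma>) (v i))))\<rparr>)"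

definition decomp_grp ::
    "('k, 'p, 's) rspace \<Rightarrow> ('p, 's) morph set \<Rightarrow> 'p \<Rightarrow> ('p, 's) morph monoid" where
  "decomp_grp \<C> G P = (Aut \<C>)\<lparr>carrier := decomp G P\<rparr>"

definition inertia_grp ::
    "('k, 'p, 's) rspace \<Rightarrow> ('p, 's) morph set \<Rightarrow> 'p \<Rightarrow> ('p, 's) morph monoid" where
  "inertia_grp \<C> G P = (Aut \<C>)\<lparr>carrier := inertia \<C> G P\<rparr>"

text \<open>
  The property characterising the module \<open>W\<close> attached to \<open>P\<close> and \<open>d\<close>; \<open>C\<close> is the projective
  cover occurring in it.
\<close>

definition is_W ::
    "('k::field, 'p, 's) rspace \<Rightarrow> ('p, 's) morph set \<Rightarrow> 'p \<Rightarrow> nat \<Rightarrow>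
     ('k, 'c, ('p, 's) morph) gmod \<Rightarrow> ('k, 'w, ('p, 's) morph) gmod \<Rightarrow> bool" where
  "is_W \<C> G P d C W \<longleftrightarrow>
     projective_cover (inertia_grp \<C> G P) C (cotangent_neg_pow \<C> P d) \<and>
     projective_module (decomp_grp \<C> G P) W \<and>
     grp_iso (decomp_grp \<C> G P) (Ind (decomp_grp \<C> G P) (inertia \<C> G P) C)
       (dir_power (res_degree \<C> G P) W)"

definition inertia_central ::
    "('k, 'p, 's) rspace \<Rightarrow> ('p, 's) morph set \<Rightarrow> 'p \<Rightarrow> bool" where
  "inertia_central \<C> G P \<longleftrightarrow>
     (\<forall>\<sigma>\<in>inertia \<C> G P. \<forall>\<tau>\<in>decomp G P. \<sigma> \<otimes>\<^bsub>Aut \<C>\<^esub> \<tau> = \<tau> \<otimes>\<^bsub>Aut \<C>\<^esub> \<sigma>)"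

definition decomp_splits ::
    "('k, 'p, 's) rspace \<Rightarrow> ('p, 's) morph set \<Rightarrow> 'p \<Rightarrow> bool" where
  "decomp_splits \<C> G P \<longleftrightarrow>
     (\<exists>h \<in> iso (decomp_grp \<C> G P)
              (inertia_grp \<C> G P \<times>\<times> (decomp_grp \<C> G P Mod inertia \<C> G P)).
        (\<forall>\<sigma>\<in>inertia \<C> G P. h \<sigma> = (\<sigma>, \<one>\<^bsub>decomp_grp \<C> G P Mod inertia \<C> G P\<^esub>)) \<and>
        (\<forall>\<tau>\<in>decomp G P. snd (h \<tau>) = inertia \<C> G P #>\<^bsub>decomp_grp \<C> G P\<^esub> \<tau>))"


section \<open>Closed subschemes of projective space\<close>

text \<open>
  Polynomials in the variables indexed by the finite type \<open>'n\<close>, the homogeneous coordinates of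
  projective space of dimension \<open>CARD('n) - 1\<close>.
\<close>

type_synonym ('k, 'n) mpoly = "('n \<Rightarrow>\<^sub>0 nat) \<Rightarrow>\<^sub>0 'k"

abbreviation polyring :: "('k::field, 'n::finite) mpoly ring" where
  "polyring \<equiv> ring_of_type_algebra"

definition homog :: "nat \<Rightarrow> ('k::field, 'n::finite) mpoly \<Rightarrow> bool" where
  "homog d f \<longleftrightarrow> (\<forall>m\<in>Poly_Mapping.keys f. (\<Sum>i\<in>UNIV. Poly_Mapping.lookup m i) = d)"

definition homog_ideal :: "('k::field, 'n::finite) mpoly set \<Rightarrow> bool" where
  "homog_ideal I \<longleftrightarrow> ideal I polyring \<and> I = Idl\<^bsub>polyring\<^esub> {f \<in> I. \<exists>d. homog d f}"

definition mconst :: "'k::field \<Rightarrow> ('k, 'n::finite) mpoly" where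
  "mconst c = Poly_Mapping.single 0 c"

definition mvar :: "'n::finite \<Rightarrow> ('k::field, 'n) mpoly" where
  "mvar i = Poly_Mapping.single (Poly_Mapping.single i 1) 1"

text \<open>
  The scheme \<open>Proj (S/I)\<close> for the polynomial ring \<open>S\<close>, that is, the closed subscheme of
  projective space defined by the homogeneous ideal \<open>I\<close>.  Homogeneous primes of \<open>S/I\<close> are
  represented by their preimages in \<open>S\<close>.
\<close>

definition proj_points :: "('k::field, 'n::finite) mpoly set \<Rightarrow> ('k, 'n) mpoly set set" where
  "proj_points I = {p. primeideal p polyring \<and> homog_ideal p \<and> I \<subseteq> p \<and> \<not> range mvar \<subseteq> p}"

definition proj_top :: "('k::field, 'n::finite) mpoly set \<Rightarrow> ('k, 'n) mpoly set topology" where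
  "proj_top I = topology_generated_by {{p \<in> proj_points I. f \<notin> p} |f. \<exists>d. homog d f}"

text \<open>
  The class of the fraction \<open>a/f\<close> in the degree zero part of the localisation of \<open>S/I\<close> at the
  homogeneous elements outside \<open>p\<close>.
\<close>

definition hfrac ::
    "('k::field, 'n::finite) mpoly set \<Rightarrow> ('k, 'n) mpoly set \<Rightarrow> ('k, 'n) mpoly \<Rightarrow> ('k, 'n) mpoly \<Rightarrow>
     (('k, 'n) mpoly \<times> ('k, 'n) mpoly) set" where
  "hfrac I p a f = {(b, g). (\<exists>d. homog d b \<and> homog d g) \<and> g \<notin> p \<and>
     (\<exists>h e. homog e h \<and> h \<notin> p \<and> h * (a * g - b * f) \<in> I)}"

definition hom_loc ::
    "('k::field, 'n::finite) mpoly set \<Rightarrow> ('k, 'n) mpoly set \<Rightarrow>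
     (('k, 'n) mpoly \<times> ('k, 'n) mpoly) set ring" where
  "hom_loc I p =
    \<lparr>carrier = {hfrac I p a f |a f. (\<exists>d. homog d a \<and> homog d f) \<and> f \<notin> p},
     monoid.mult = (\<lambda>A B. \<Union>(a, f)\<in>A. \<Union>(b, g)\<in>B. hfrac I p (a * b) (f * g)),
     one = hfrac I p 1 1, ring.zero = hfrac I p 0 1,
     add = (\<lambda>A B. \<Union>(a, f)\<in>A. \<Union>(b, g)\<in>B. hfrac I p (a * g + b * f) (f * g))\<rparr>"

type_synonym ('k, 'n) proj_section =
  "('k, 'n) mpoly set \<Rightarrow> (('k, 'n) mpoly \<times> ('k, 'n) mpoly) set"

text \<open>Sections are functions into the local rings that are locally given by one fraction.\<close>

definition proj_sec ::
    "('k::field, 'n::finite) mpoly set \<Rightarrow> ('k, 'n) mpoly set set \<Rightarrow> ('k, 'n) proj_section ring" where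
  "proj_sec I U =
    \<lparr>carrier = {s \<in> (\<Pi>\<^sub>E p\<in>U. carrier (hom_loc I p)).
        \<forall>p\<in>U. \<exists>V a f. openin (proj_top I) V \<and> p \<in> V \<and> V \<subseteq> U \<and> (\<exists>d. homog d a \<and> homog d f) \<and>
          (\<forall>q\<in>V. f \<notin> q \<and> s q = hfrac I q a f)},
     monoid.mult = (\<lambda>s t. \<lambda>p\<in>U. s p \<otimes>\<^bsub>hom_loc I p\<^esub> t p),
     one = (\<lambda>p\<in>U. \<one>\<^bsub>hom_loc I p\<^esub>), ring.zero = (\<lambda>p\<in>U. \<zero>\<^bsub>hom_loc I p\<^esub>),
     add = (\<lambda>s t. \<lambda>p\<in>U. s p \<oplus>\<^bsub>hom_loc I p\<^esub> t p)\<rparr>"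

definition Proj ::
    "('k::field, 'n::finite) mpoly set \<Rightarrow> ('k, ('k, 'n) mpoly set, ('k, 'n) proj_section) rspace" where
  "Proj I =
    \<lparr>tspace = proj_top I, sec = proj_sec I, res = (\<lambda>U V s. restrict s V),
     scal = (\<lambda>U c. \<lambda>p\<in>U. hfrac I p (mconst c) 1)\<rparr>"


section \<open>Smooth, geometrically irreducible curves\<close>

definition perfect_field :: "'k::field itself \<Rightarrow> bool" where
  "perfect_field _ \<longleftrightarrow> (\<forall>f :: 'k poly. Factorial_Ring.irreducible f \<longrightarrow> coprime f (pderiv f))"

definition irred_subset :: "'p topology \<Rightarrow> 'p set \<Rightarrow> bool" where
  "irred_subset T Z \<longleftrightarrow> Z \<subseteq> topspace T \<and> Z \<noteq> {} \<and>
     (\<forall>A B. closedin T A \<and> closedin T B \<and> Z \<subseteq> A \<union> B \<longrightarrow> Z \<subseteq> A \<or> Z \<subseteq> B)"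

definition irred_chain :: "'p topology \<Rightarrow> nat \<Rightarrow> (nat \<Rightarrow> 'p set) \<Rightarrow> bool" where
  "irred_chain T n Z \<longleftrightarrow>
     (\<forall>i\<le>n. closedin T (Z i) \<and> irred_subset T (Z i)) \<and> (\<forall>i<n. Z i \<subset> Z (Suc i))"

definition top_dim_eq :: "'p topology \<Rightarrow> nat \<Rightarrow> bool" where
  "top_dim_eq T n \<longleftrightarrow> (\<exists>Z. irred_chain T n Z) \<and> \<not> (\<exists>Z. irred_chain T (Suc n) Z)"

text \<open>The base change of \<open>Proj (S/I)\<close> to an algebraic closure is irreducible.\<close>

definition geom_irreducible :: "('k::field, 'n::finite) mpoly set \<Rightarrow> bool" where
  "geom_irreducible I \<longleftrightarrow>
     (let J = Idl\<^bsub>polyring\<^esub> (Poly_Mapping.map to_ac ` I) :: ('k alg_closure, 'n) mpoly set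
      in irred_subset (proj_top J) (topspace (proj_top J)))"

text \<open>
  k-linear derivations of the local ring at \<open>x\<close> into its residue field.  By the universal
  property of differentials they form the dual of the fibre at \<open>x\<close> of the sheaf of
  differentials of \<open>\<C>\<close> over k.
\<close>

definition derivations ::
    "('k, 'p, 's) rspace \<Rightarrow> 'p \<Rightarrow> (('p, 's) germs \<Rightarrow> ('p, 's) germs set) set" where
  "derivations \<C> x = (let A = stalk \<C> x; K = resfield \<C> x in
     {D \<in> carrier A \<rightarrow>\<^sub>E carrier K.
        (\<forall>a\<in>carrier A. \<forall>b\<in>carrier A.
           D (a \<oplus>\<^bsub>A\<^esub> b) = D a \<oplus>\<^bsub>K\<^esub> D b \<and>
           D (a \<otimes>\<^bsub>A\<^esub> b) = (reduct \<C> x a \<otimes>\<^bsub>K\<^esub> D b) \<oplus>\<^bsub>K\<^esub> (reduct \<C> x b \<otimes>\<^bsub>K\<^esub> D a)) \<and>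
        (\<forall>c. D (stalk_scal \<C> x c) = \<zero>\<^bsub>K\<^esub>)})"

text \<open>
  Smooth of relative dimension 1 over k, for \<open>\<C>\<close> of finite type and of pure dimension 1: at every
  point, closed or not, the fibre of the sheaf of differentials has dimension 1.
\<close>

definition smooth_dim1 :: "('k, 'p, 's) rspace \<Rightarrow> bool" where
  "smooth_dim1 \<C> \<longleftrightarrow> (\<forall>x\<in>topspace (tspace \<C>).
     \<exists>D0\<in>derivations \<C> x. (\<exists>a\<in>carrier (stalk \<C> x). D0 a \<noteq> \<zero>\<^bsub>resfield \<C> x\<^esub>) \<and>
       (\<forall>D\<in>derivations \<C> x. \<exists>c\<in>carrier (resfield \<C> x).
          \<forall>a\<in>carrier (stalk \<C> x). D a = c \<otimes>\<^bsub>resfield \<C> x\<^esub> D0 a))"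

definition smooth_proj_geom_irred_curve :: "('k::field, 'n::finite) mpoly set \<Rightarrow> bool" where
  "smooth_proj_geom_irred_curve I \<longleftrightarrow> homog_ideal I \<and> top_dim_eq (proj_top I) 1 \<and>
     geom_irreducible I \<and> smooth_dim1 (Proj I)"

end

theory Submission
  imports Defs "HOL-Library.Function_Algebras"
begin

text \<open>
Write K for the residue field at P, R for the stalk, m for its maximal ideal, T = m/m^2, D for the
decomposition group, H for the inertia group, F for the residue field of the quotient, and V for the
(-d)-th tensor power of T. Both parts follow from W being isomorphic to V, together with a form of V
over F when H is central. The argument has four parts.

Geometry: F is all of K^D (base_resfield_eq). As D acts on K with kernel H and, as shown below, |H|
is nonzero in k, some c in K has trace 1 over D. Given a in K^D, choose a section near the orbit of
P with residue a c at P that vanishes at the other points of the orbit; the sum of its conjugates is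
invariant and has residue a Tr(c) = a. Such sections are quotients of forms (proj_separation). Hence
f_P = [K:F].

Local algebra: T is nonzero because 0 < d < e_P^t, so K embeds in V. The projective cover C of V
lies in a finite power of the group algebra of H, so chains of k-subspaces of C, and then of V and
K, have bounded length. Hence every element of K is algebraic over k, and separable because k is
perfect. So K lifts to a subalgebra of R modulo m^2, and every K-linear form on T extends to a
derivation R to K (ex_derivation). Smoothness makes the derivations a line over K, so T is a line
(cotangent_one_dim). Therefore V is K with the twisted action g z = lam(g) s_g(z). If p = char k
divided |H|, an element of order p in H would act on T by a p-th root of unity of K, that is by 1,
and so would lie in the first ramification group (auto_trivial); that group is trivial. So |H| is
invertible (inertia_order_nonzero), and C is isomorphic to V by averaging (cover_iso).

Descent: with n = [K:F], a basis y of K over F and its dual basis for the trace form divided by |H|,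
the map sending v to the function (x |-> sum of y_i (x^-1 v_i)) is an isomorphism from V^n to Ind V
(power_iso_Ind). So W^n = Ind C = Ind V = V^n. If H is central, lam maps H into F, whence F is an
H-stable form of V with V = F^n over H (power_VF_iso), and (Ind F)^n = Ind V = W^n.

Cancellation: modules of bounded length have the Krull-Schmidt property, so n-th powers may be
cancelled (power_cancel). This gives W = V, and W = Ind F in the central case.
\<close>

section \<open>Modules with operators\<close>

text \<open>Krull-Schmidt theory needs submodules, images, kernels and powers, all inside one
  ambient structure. They are taken here as subsets of an abelian group type on which a type of
  operators acts; for modules over k[G] an operator is a scalar or a group element.\<close>
definition opmod :: "('o => 'a::ab_group_add => 'a) => 'a set => bool" where
 "opmod op S \<longleftrightarrow> 0 : S \<and> (\<forall>x\<in>S. \<forall>y\<in>S. x - y : S) \<and>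
  (\<forall>w. \<forall>x\<in>S. op w x : S \<and> (\<forall>y\<in>S. op w (x - y) = op w x - op w y))"

definition opmap :: "('o => 'a::ab_group_add => 'a) => 'a set => ('o => 'b::ab_group_add => 'b) => 'b set =>
  ('a => 'b) => bool" where
 "opmap op S op' T f \<longleftrightarrow> (\<forall>x\<in>S. f x : T \<and> (\<forall>y\<in>S. f (x - y) = f x - f y) \<and>
  (\<forall>w. f (op w x) = op' w (f x)))"

definition opiso :: "('o => 'a::ab_group_add => 'a) => 'a set => ('o => 'b::ab_group_add => 'b) => 'b set =>
  bool" where
 "opiso op S op' T \<longleftrightarrow> (\<exists>f. opmap op S op' T f \<and> bij_betw f S T)"

text \<open>A strictly monotone bounded rank on submodules stands in for finite length. It passes to
  submodules and extensions at once and needs no composition series.\<close>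
definition finlen :: "('o => 'a::ab_group_add => 'a) => 'a set => bool" where
 "finlen op S \<longleftrightarrow> opmod op S \<and>
  (\<exists>l::'a set => nat. \<forall>A B. opmod op A \<and> opmod op B \<and> A \<subset> B \<and> B <= S --> l A < l B)"

definition dsum :: "('o => 'a::ab_group_add => 'a) => 'a set => 'a set => 'a set => bool" where
 "dsum op S Q Y \<longleftrightarrow> opmod op S \<and> opmod op Q \<and> opmod op Y \<and> Q <= S \<and> Y <= S \<and> Q \<inter> Y = {0} \<and>
  (\<forall>s\<in>S. \<exists>x\<in>Q. \<exists>y\<in>Y. s = x + y)"

definition indec :: "('o => 'a::ab_group_add => 'a) => 'a set => bool" where
 "indec op Q \<longleftrightarrow> opmod op Q \<and> Q \<noteq> {0} \<and> (\<forall>A B. dsum op Q A B --> A = {0} \<or> B = {0})"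

lemma opmod_0: "opmod op S ==> 0 : S"
 and opmod_diff: "opmod op S ==> x : S ==> y : S ==> x - y : S"
 and opmod_op: "opmod op S ==> x : S ==> op w x : S"
 and opmod_op_diff: "opmod op S ==> x : S ==> y : S ==> op w (x - y) = op w x - op w y"
 by (auto simp: opmod_def)

lemma opmod_minus: "opmod op S ==> x : S ==> - x : S"
 using opmod_diff[of op S 0 x] opmod_0 by auto

lemma opmod_add: "opmod op S ==> x : S ==> y : S ==> x + y : S"
 using opmod_diff[of op S x "- y"] opmod_minus by auto

lemma opmod_op_0: "opmod op S ==> op w 0 = 0"
 using opmod_op_diff[of op S 0 0 w] opmod_0 by auto

lemma opmod_op_minus: "opmod op S ==> x : S ==> op w (- x) = - op w x"
 using opmod_op_diff[of op S 0 x w] opmod_0 opmod_op_0 by fastforce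

lemma opmod_op_add: "opmod op S ==> x : S ==> y : S ==> op w (x + y) = op w x + op w y"
 using opmod_op_diff[of op S x "- y" w] opmod_minus opmod_op_minus by fastforce

lemmas opmod_rules = opmod_0 opmod_diff opmod_op opmod_minus opmod_add

lemma opmap_in: "opmap op S op' T f ==> x : S ==> f x : T"
 and opmap_diff: "opmap op S op' T f ==> x : S ==> y : S ==> f (x - y) = f x - f y"
 and opmap_op: "opmap op S op' T f ==> x : S ==> f (op w x) = op' w (f x)"
 by (auto simp: opmap_def)

lemma opmap_0: "opmap op S op' T f ==> opmod op S ==> f 0 = 0"
 using opmap_diff[of op S op' T f 0 0] opmod_0 by auto

lemma opmap_minus: "opmap op S op' T f ==> opmod op S ==> x : S ==> f (- x) = - f x"
 using opmap_diff[of op S op' T f 0 x] opmod_0 opmap_0 by fastforce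

lemma opmap_add: "opmap op S op' T f ==> opmod op S ==> x : S ==> y : S ==> f (x + y) = f x + f y"
 using opmap_diff[of op S op' T f x "- y"] opmod_minus opmap_minus by fastforce

lemma opmap_comp:
 "opmap op S op' T f ==> opmap op' T op'' U g ==> opmap op S op'' U (\<lambda>x. g (f x))"
 by (simp add: opmap_def)

lemma opmap_plus:
 assumes "opmap op S op' T f" "opmap op S op' T g" "opmod op' T"
 shows "opmap op S op' T (\<lambda>x. f x + g x)"
 using assms unfolding opmap_def by (auto simp: opmod_add opmod_op_add algebra_simps)

lemma opmap_uminus:
 assumes "opmap op S op' T f" "opmod op' T"
 shows "opmap op S op' T (\<lambda>x. - f x)"
 using assms unfolding opmap_def by (auto simp: opmod_minus opmod_op_minus algebra_simps)

lemma opmap_id: "opmap op S op S (\<lambda>x. x)"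
 if "opmod op S" using that by (simp add: opmap_def)

lemma opmap_subset: "opmap op S op' T f ==> S' <= S ==> f ` S' <= T' ==> opmap op S' op' T' f"
 by (auto simp: opmap_def subset_iff)

lemma opmod_image:
 assumes f: "opmap op S op' T f" and S: "opmod op S" and T: "opmod op' T" and A: "opmod op A" "A <= S"
 shows "opmod op' (f ` A)"
 unfolding opmod_def
proof (intro conjI ballI allI)
 show "0 : f ` A" using opmap_0[OF f S] opmod_0[OF A(1)] by force
next
 fix x y assume "x : f ` A" "y : f ` A"
 then obtain a b where ab: "a : A" "b : A" "x = f a" "y = f b" by blast
 then have "x - y = f (a - b)" using opmap_diff[OF f, of a b] A by (simp add: subset_iff)
 then show "x - y : f ` A" using ab opmod_diff[OF A(1)] by auto
next
 fix w x assume "x : f ` A"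
 then obtain a where a: "a : A" "x = f a" by blast
 then have "op' w x = f (op w a)" using opmap_op[OF f] A by auto
 then show "op' w x : f ` A" using a opmod_op[OF A(1)] by auto
next
 fix w x y assume "x : f ` A" "y : f ` A"
 then have "x : T" "y : T" using opmap_in[OF f] A by auto
 then show "op' w (x - y) = op' w x - op' w y" by (rule opmod_op_diff[OF T])
qed

lemma opmod_vimage:
 assumes f: "opmap op S op' T f" and S: "opmod op S" and B: "opmod op' B"
 shows "opmod op {x\<in>S. f x : B}"
 unfolding opmod_def
proof (intro conjI ballI allI)
 show "0 : {x\<in>S. f x : B}" using opmod_0[OF S] opmod_0[OF B] opmap_0[OF f S] by simp
 show "x - y : {x\<in>S. f x : B}" if "x : {x\<in>S. f x : B}" "y : {x\<in>S. f x : B}" for x y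
  using that opmod_diff[OF S] opmod_diff[OF B] opmap_diff[OF f] by simp
 show "op w x : {x\<in>S. f x : B}" if "x : {x\<in>S. f x : B}" for w x
  using that opmod_op[OF S] opmod_op[OF B] opmap_op[OF f] by simp
 show "op w (x - y) = op w x - op w y" if "x : {x\<in>S. f x : B}" "y : {x\<in>S. f x : B}" for w x y
  using that opmod_op_diff[OF S] by simp
qed

lemma opmod_zero: "opmod op S ==> opmod op {0}"
 using opmod_op_0[of op S] by (auto simp: opmod_def)

lemma opmod_Int: "opmod op A ==> opmod op B ==> opmod op (A \<inter> B)"
 by (auto simp: opmod_def)

lemma opmap_ker: "opmap op S op' T f ==> opmod op S ==> opmod op' T ==> opmod op {x\<in>S. f x = 0}"
 using opmod_vimage[of op S op' T f "{0}"] opmod_zero[of op' T] by simp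

lemma opmod_sum:
 assumes S: "opmod op S" and A: "opmod op A" "A <= S" and B: "opmod op B" "B <= S"
 shows "opmod op {a + b |a b. a : A \<and> b : B}"
 unfolding opmod_def
proof (intro conjI ballI allI)
 show "0 : {a + b |a b. a : A \<and> b : B}" using opmod_0[OF A(1)] opmod_0[OF B(1)] by force
next
 fix x y assume "x : {a + b |a b. a : A \<and> b : B}" "y : {a + b |a b. a : A \<and> b : B}"
 then obtain a b c d where *: "a : A" "b : B" "c : A" "d : B" "x = a + b" "y = c + d" by blast
 then have "x - y = (a - c) + (b - d)" by simp
 then show "x - y : {a + b |a b. a : A \<and> b : B}"
  using * opmod_diff[OF A(1)] opmod_diff[OF B(1)] by blast
next
 fix w x assume "x : {a + b |a b. a : A \<and> b : B}"
 then obtain a b where *: "a : A" "b : B" "x = a + b" by blast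
 then have "op w x = op w a + op w b" using opmod_op_add[OF S, of a b w] A B by auto
 then show "op w x : {a + b |a b. a : A \<and> b : B}"
  using * opmod_op[OF A(1)] opmod_op[OF B(1)] by blast
next
 fix w x y assume "x : {a + b |a b. a : A \<and> b : B}" "y : {a + b |a b. a : A \<and> b : B}"
 then have "x : S" "y : S" using A B opmod_add[OF S] by auto
 then show "op w (x - y) = op w x - op w y" by (rule opmod_op_diff[OF S])
qed

lemma opmap_inv_into:
 assumes f: "opmap op S op' T f" "bij_betw f S T" and S: "opmod op S"
 shows "opmap op' T op S (inv_into S f)" "bij_betw (inv_into S f) T S"
proof -
 let ?g = "inv_into S f"
 show "bij_betw ?g T S" using f(2) by (rule bij_betw_inv_into)
 have inj: "inj_on f S" and g: "\<And>y. y : T ==> ?g y : S" "\<And>y. y : T ==> f (?g y) = y"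
  using f(2) by (auto simp: bij_betw_def intro: inv_into_into f_inv_into_f)
 show "opmap op' T op S ?g"
  unfolding opmap_def
 proof (intro ballI conjI allI)
  fix x y assume xy: "x : T" "y : T"
  have "f (?g x - ?g y) = x - y" using opmap_diff[OF f(1)] g xy by auto
  then show "?g (x - y) = ?g x - ?g y"
   using inv_into_f_f[OF inj, of "?g x - ?g y"] opmod_diff[OF S] g xy by auto
 next
  fix x w assume x: "x : T"
  have "f (op w (?g x)) = op' w x" using opmap_op[OF f(1)] g x by auto
  then show "?g (op' w x) = op w (?g x)"
   using inv_into_f_f[OF inj, of "op w (?g x)"] opmod_op[OF S] g x by auto
 qed (use g in auto)
qed

lemma opiso_sym: "opiso op S op' T ==> opmod op S ==> opiso op' T op S"
 unfolding opiso_def using opmap_inv_into by blast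

lemma opiso_trans: "opiso op S op' T ==> opiso op' T op'' U ==> opiso op S op'' U"
 unfolding opiso_def using opmap_comp bij_betw_trans[unfolded comp_def] by blast

lemma opiso_image:
 assumes "opmap op S op' T f" "inj_on f S" "A <= S"
 shows "opiso op A op' (f ` A)"
 unfolding opiso_def
 using opmap_subset[OF assms(1,3), of "f ` A"] inj_on_imp_bij_betw[OF inj_on_subset[OF assms(2,3)]]
 by blast

lemma opmap_inj:
 assumes "opmap op S op' T f" "opmod op S" "\<And>x. x : S ==> f x = 0 ==> x = 0"
 shows "inj_on f S"
proof (rule inj_onI)
 fix x y assume xy: "x : S" "y : S" "f x = f y"
 then have "f (x - y) = 0" using opmap_diff[OF assms(1)] by auto
 then show "x = y" using assms(3)[of "x - y"] opmod_diff[OF assms(2)] xy by auto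
qed

subsection \<open>Fitting\<close>

lemma opmap_funpow:
 assumes "opmap op S op S f" "opmod op S"
 shows "opmap op S op S (f ^^ n)"
proof (induction n)
 case 0 then show ?case using opmap_id[OF assms(2)] by (simp add: id_def)
next
 case (Suc n)
 show ?case using opmap_comp[OF Suc.IH assms(1)] by (simp add: comp_def)
qed

lemma mono_bounded_stable:
 fixes h :: "nat => nat"
 assumes "\<And>n. h n \<le> h (Suc n)" "\<And>n. h n \<le> b"
 shows "\<exists>n. \<forall>m\<ge>n. h m = h n"
proof -
 have mono: "mono h" using assms(1) by (simp add: mono_iff_le_Suc)
 have "range h <= {..b}" using assms(2) by (simp add: image_subset_iff)
 then have fin: "finite (range h)" using finite_subset finite_atMost by blast
 then have "Max (range h) : range h" by (rule Max_in) simp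
 then obtain n where n: "h n = Max (range h)" by (metis imageE)
 have "h m = h n" if "m \<ge> n" for m
 proof -
  have "h n \<le> h m" by (rule monoD[OF mono that])
  moreover have "h m \<le> h n" unfolding n by (rule Max_ge[OF fin]) simp
  ultimately show ?thesis by simp
 qed
 then show ?thesis by blast
qed

lemma finlen_opmod: "finlen op S ==> opmod op S"
 by (simp add: finlen_def)

lemma finlen_subset: "finlen op S ==> opmod op T ==> T <= S ==> finlen op T"
 unfolding finlen_def by (meson order_trans)

text \<open>Iterates of f have decreasing images and increasing kernels; once the ranks of both are
  stable, image and kernel of the same iterate are complementary.\<close>
lemma Fitting:
 assumes S: "finlen op S" and f: "opmap op S op S f"
 obtains n where "n > 0" "dsum op S ((f ^^ n) ` S) {x\<in>S. (f ^^ n) x = 0}"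
proof -
 have mS: "opmod op S" and "\<exists>l::'b set => nat. \<forall>A B. opmod op A \<and> opmod op B \<and> A \<subset> B \<and> B <= S --> l A < l B"
  using S by (simp_all add: finlen_def)
 then obtain l :: "'b set => nat" where
   l: "\<And>A B. opmod op A ==> opmod op B ==> A \<subset> B ==> B <= S ==> l A < l B"
  by metis
 have l': "l A \<le> l B" "l A = l B ==> A = B" if "opmod op A" "opmod op B" "A <= B" "B <= S" for A B
 proof -
  have "A = B \<or> l A < l B" using l[OF that(1,2) _ that(4)] that(3) by blast
  then show "l A \<le> l B" "l A = l B ==> A = B" by auto
 qed
 let ?I = "\<lambda>n. (f ^^ n) ` S" and ?K = "\<lambda>n. {x\<in>S. (f ^^ n) x = 0}"
 have fn: "opmap op S op S (f ^^ n)" for n by (rule opmap_funpow[OF f mS])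
 have I: "opmod op (?I n)" "?I n <= S" for n
  using opmod_image[OF fn mS mS mS] opmap_in[OF fn] by auto
 have K: "opmod op (?K n)" for n using opmap_ker[OF fn mS mS] .
 have Isub: "?I (Suc n) <= ?I n" for n
  using opmap_in[OF f] by (auto simp: funpow_Suc_right simp del: funpow.simps)
 have Ksub: "?K n <= ?K (Suc n)" for n using opmap_0[OF f mS] by auto
 have lI: "l (?I (Suc n)) \<le> l (?I n)" "l (?I n) \<le> l S" for n
  using l'(1)[OF I(1) I(1) Isub I(2)] l'(1)[OF I(1) mS I(2) order_refl] by blast+
 have lK: "l (?K n) \<le> l (?K (Suc n))" "l (?K n) \<le> l S" for n
  by (rule l'(1)[OF K K Ksub], blast) (rule l'(1)[OF K mS _ order_refl], blast)
 have "\<exists>n. \<forall>m\<ge>n. (l S - l (?I m)) = l S - l (?I n)"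
  by (rule mono_bounded_stable[where b="l S"]) (use lI(1) in "simp_all add: diff_le_mono2")
 then obtain n1 where n1: "\<And>m. m \<ge> n1 ==> l S - l (?I m) = l S - l (?I n1)" by blast
 have "\<exists>n. \<forall>m\<ge>n. l (?K m) = l (?K n)"
  by (rule mono_bounded_stable[where b="l S" and h="\<lambda>n. l (?K n)", OF lK])
 then obtain n2 where n2: "\<And>m. m \<ge> n2 ==> l (?K m) = l (?K n2)" by blast
 define n where "n = Suc (max n1 n2)"
 have "l (?I (n + n)) = l (?I n)"
 proof -
  have "l S - l (?I (n + n)) = l S - l (?I n)" using n1[of n] n1[of "n+n"] by (simp add: n_def)
  then show ?thesis using lI(2)[of n] lI(2)[of "n + n"] by linarith
 qed
 moreover have "?I (n + n) <= ?I n" by (rule lift_Suc_antimono_le[of ?I, OF Isub]) simp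
 ultimately have eqI: "?I (n + n) = ?I n" using l'(2)[OF I(1)[of "n+n"] I(1)[of n] _ I(2)] by blast
 have "l (?K (n + n)) = l (?K n)" using n2[of n] n2[of "n+n"] by (simp add: n_def)
 moreover have "?K n <= ?K (n + n)" by (rule lift_Suc_mono_le[of ?K, OF Ksub]) simp
 ultimately have eqK: "?K n = ?K (n + n)" using l'(2)[OF K[of n] K[of "n+n"]] by (metis (no_types, lifting) mem_Collect_eq subsetI)
 have "dsum op S (?I n) (?K n)"
  unfolding dsum_def
 proof (intro conjI ballI)
  show "?I n \<inter> ?K n = {0}"
  proof (intro equalityI subsetI)
   fix x assume "x : ?I n \<inter> ?K n"
   then obtain t where t: "t : S" "x = (f ^^ n) t" "(f ^^ n) x = 0" by blast
   then have "t : ?K (n + n)" by (simp add: funpow_add)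
   then show "x : {0}" using eqK t by auto
  qed (use opmod_0[OF I(1)] opmod_0[OF K] in auto)
 next
  fix s assume s: "s : S"
  then have "(f ^^ n) s : ?I (n + n)" using eqI by auto
  then obtain t where t: "t : S" "(f ^^ n) s = (f ^^ n) ((f ^^ n) t)" by (auto simp: funpow_add)
  have ft: "(f ^^ n) t : S" using opmap_in[OF fn] t by auto
  then have "s - (f ^^ n) t : ?K n" using t s opmod_diff[OF mS] opmap_diff[OF fn s ft] by auto
  then show "\<exists>x\<in>?I n. \<exists>y\<in>?K n. s = x + y" using t
   by (intro bexI[of _ "(f ^^ n) t"] bexI[of _ "s - (f ^^ n) t"]) auto
 qed (use mS I K in auto)
 then show ?thesis using that[of n] by (simp add: n_def)
qed

lemma finlen_inj_bij:
 assumes S: "finlen op S" and f: "opmap op S op S f" "inj_on f S"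
 shows "bij_betw f S S"
proof -
 have mS: "opmod op S" using S by (rule finlen_opmod)
 obtain n where n: "n > 0" "dsum op S ((f ^^ n) ` S) {x\<in>S. (f ^^ n) x = 0}"
  using Fitting[OF S f(1)] by blast
 have fS: "f ` S <= S" using opmap_in[OF f(1)] by auto
 have "x = 0" if "x : S" "(f ^^ m) x = 0" for x m using that
 proof (induction m arbitrary: x)
  case (Suc m)
  then have "f x = 0" using Suc.IH[of "f x"] fS by (auto simp: funpow_Suc_right simp del: funpow.simps)
  then show ?case using inj_onD[OF f(2), of x 0] opmap_0[OF f(1) mS] opmod_0[OF mS] Suc.prems by auto
 qed auto
 then have "{x\<in>S. (f ^^ n) x = 0} <= {0}" by blast
 then have "S <= (f ^^ n) ` S" using n(2) unfolding dsum_def by force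
 moreover have "(f ^^ n) ` S <= f ` S"
 proof -
  obtain m where "n = Suc m" using n(1) gr0_implies_Suc by blast
  moreover have "(f ^^ m) ` S <= S" using opmap_in[OF opmap_funpow[OF f(1) mS]] by auto
  ultimately show ?thesis by (auto simp: image_subset_iff)
 qed
 ultimately show ?thesis using fS f(2) by (auto simp: bij_betw_def)
qed

text \<open>Endomorphism rings of indecomposables are local. After composing with the inverse of f +
  g one may assume f + g = 1; by Fitting's lemma f is nilpotent or bijective, and in the nilpotent
  case g = 1 - f is injective.\<close>
lemma indec_local:
 assumes Q: "finlen op Q" "indec op Q" and f: "opmap op Q op Q f" and g: "opmap op Q op Q g"
  and bij: "bij_betw (\<lambda>x. f x + g x) Q Q"
 shows "bij_betw f Q Q \<or> bij_betw g Q Q"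
proof -
 have mX: "opmod op Q" using Q(1) by (rule finlen_opmod)
 let ?h = "\<lambda>x. f x + g x"
 let ?u = "inv_into Q ?h"
 have h: "opmap op Q op Q ?h" by (rule opmap_plus[OF f g mX])
 note u = opmap_inv_into[OF h bij mX]
 define F where "F = (\<lambda>x. ?u (f x))"
 define G where "G = (\<lambda>x. ?u (g x))"
 have F: "opmap op Q op Q F" unfolding F_def by (rule opmap_comp[OF f u(1)])
 have G: "opmap op Q op Q G" unfolding G_def by (rule opmap_comp[OF g u(1)])
 have FG: "F x + G x = x" if "x : Q" for x
 proof -
  have "F x + G x = ?u (f x + g x)" unfolding F_def G_def
   using opmap_add[OF u(1) mX] opmap_in[OF f that] opmap_in[OF g that] by simp
  also have "\<dots> = x" using bij that by (auto simp: bij_betw_def intro: inv_into_f_f)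
  finally show ?thesis .
 qed
 have bijF: "bij_betw f Q Q" if "bij_betw F Q Q"
 proof -
  have "bij_betw (\<lambda>x. ?h (F x)) Q Q" using bij_betw_trans[OF that bij] by (simp add: comp_def)
  moreover have "?h (F x) = f x" if "x : Q" for x unfolding F_def
   using f_inv_into_f[of "f x" ?h Q] bij opmap_in[OF f that] by (auto simp: bij_betw_def)
  ultimately show ?thesis using bij_betw_cong[of Q "\<lambda>x. ?h (F x)" f] by auto
 qed
 have bijG: "bij_betw g Q Q" if "bij_betw G Q Q"
 proof -
  have "bij_betw (\<lambda>x. ?h (G x)) Q Q" using bij_betw_trans[OF that bij] by (simp add: comp_def)
  moreover have "?h (G x) = g x" if "x : Q" for x unfolding G_def
   using f_inv_into_f[of "g x" ?h Q] bij opmap_in[OF g that] by (auto simp: bij_betw_def)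
  ultimately show ?thesis using bij_betw_cong[of Q "\<lambda>x. ?h (G x)" g] by auto
 qed
 obtain n where n: "n > 0" "dsum op Q ((F ^^ n) ` Q) {x\<in>Q. (F ^^ n) x = 0}"
  using Fitting[OF Q(1) F] by blast
 then consider "(F ^^ n) ` Q = {0}" | "{x\<in>Q. (F ^^ n) x = 0} = {0}"
  using Q(2) unfolding indec_def by blast
 then show ?thesis
 proof cases
  case 1
  have "inj_on G Q"
  proof (rule opmap_inj[OF G mX])
   fix x assume x: "x : Q" "G x = 0"
   then have "F x = x" using FG[of x] by simp
   then have "(F ^^ m) x = x" for m by (induction m) auto
   then show "x = 0" using 1 x by (metis imageI singletonD)
  qed
  then show ?thesis using bijG finlen_inj_bij[OF Q(1) G] by blast
 next
  case 2
  obtain m where m: "n = Suc m" using n(1) gr0_implies_Suc by blast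
  have "inj_on F Q"
  proof (rule opmap_inj[OF F mX])
   fix x assume x: "x : Q" "F x = 0"
   then have "(F ^^ n) x = (F ^^ m) 0" using m by (simp add: funpow_Suc_right del: funpow.simps)
   also have "\<dots> = 0" using opmap_0[OF opmap_funpow[OF F mX] mX] .
   finally show "x = 0" using 2 x by auto
  qed
  then show ?thesis using bijF finlen_inj_bij[OF Q(1) F] by blast
 qed
qed

lemma indec_local_sum:
 assumes Q: "finlen op Q" "indec op Q" and f: "\<And>j. j < n ==> opmap op Q op Q (f j)"
  and bij: "bij_betw (\<lambda>x. \<Sum>j<n. f j x) Q Q"
 shows "\<exists>j<(n::nat). bij_betw (f j) Q Q"
 using f bij
proof (induction n)
 case 0
 then have "Q = {0}" using opmod_0[of op Q] Q(2) by (auto simp: bij_betw_def indec_def)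
 then show ?case using Q(2) by (simp add: indec_def)
next
 case (Suc n)
 have mQ: "opmod op Q" using Q(1) by (rule finlen_opmod)
 have Suc_f: "opmap op Q op Q (f m)" if "m \<le> n" for m using Suc.prems(1) that by auto
 have s: "opmap op Q op Q (\<lambda>x. \<Sum>j<m. f j x)" if "m \<le> n" for m using that
 proof (induction m)
  case 0 then show ?case using opmod_0[OF mQ] opmod_op_0[OF mQ] by (simp add: opmap_def)
 next
  case (Suc m)
  then show ?case using opmap_plus[OF Suc.IH Suc_f mQ] by simp
 qed
 have "bij_betw (\<lambda>x. \<Sum>j<n. f j x) Q Q \<or> bij_betw (f n) Q Q"
  using indec_local[OF Q s[OF order_refl] Suc_f[OF le_refl]] Suc.prems(2) by simp
 then show ?case
 proof
  assume "bij_betw (\<lambda>x. \<Sum>j<n. f j x) Q Q"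
  then obtain j where "j < n" "bij_betw (f j) Q Q" using Suc.IH Suc_f by auto
  then show ?thesis by (auto intro: less_SucI)
 qed auto
qed

section \<open>Cancellation of direct summands\<close>

lemma dsumD:
 assumes "dsum op S U V"
 shows "opmod op S" "opmod op U" "opmod op V" "U <= S" "V <= S" "U \<inter> V = {0}"
  "\<And>s. s : S ==> \<exists>x\<in>U. \<exists>y\<in>V. s = x + y"
 using assms by (auto simp: dsum_def)

lemma dsum_sym: "dsum op S U V ==> dsum op S V U"
 unfolding dsum_def by (metis Int_commute add.commute)

text \<open>The projection onto U along V.\<close>
definition pr :: "'a::ab_group_add set => 'a set => 'a => 'a" where
 "pr U V s = (THE x. x : U \<and> s - x : V)"

lemma pr_eqI:
 assumes d: "dsum op S U V" and "x : U" "s - x : V"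
 shows "pr U V s = x"
 unfolding pr_def
proof (rule the_equality)
 show "x : U \<and> s - x : V" using assms by simp
 fix x' assume x': "x' : U \<and> s - x' : V"
 have "x' - x : U" using opmod_diff[OF dsumD(2)[OF d]] x' assms(2) by blast
 moreover have "x' - x : V"
 proof -
  have "x' - x = (s - x) - (s - x')" by simp
  then show ?thesis using opmod_diff[OF dsumD(3)[OF d]] x' assms(3) by metis
 qed
 ultimately have "x' - x = 0" using dsumD(6)[OF d] by blast
 then show "x' = x" by simp
qed

lemma pr_in:
 assumes d: "dsum op S U V" and s: "s : S"
 shows "pr U V s : U" "s - pr U V s : V"
proof -
 obtain x y where xy: "x : U" "y : V" "s = x + y" using dsumD(7)[OF d s] by blast
 then have "s - x : V" by simp
 then have "pr U V s = x" using pr_eqI[OF d xy(1)] by blast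
 then show "pr U V s : U" "s - pr U V s : V" using xy by auto
qed

lemma pr_opmap:
 assumes d: "dsum op S U V"
 shows "opmap op S op U (pr U V)"
 unfolding opmap_def
proof (intro ballI conjI allI)
 fix x y assume xy: "x : S" "y : S"
 show "pr U V (x - y) = pr U V x - pr U V y"
 proof (rule pr_eqI[OF d])
  show "pr U V x - pr U V y : U" using opmod_diff[OF dsumD(2)[OF d]] pr_in(1)[OF d] xy by blast
  have "x - y - (pr U V x - pr U V y) = (x - pr U V x) - (y - pr U V y)" by simp
  then show "x - y - (pr U V x - pr U V y) : V"
   using opmod_diff[OF dsumD(3)[OF d]] pr_in(2)[OF d] xy by metis
 qed
next
 fix x w assume x: "x : S"
 note p = pr_in[OF d x]
 have pS: "pr U V x : S" using p dsumD(4)[OF d] by blast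
 show "pr U V (op w x) = op w (pr U V x)"
 proof (rule pr_eqI[OF d])
  show "op w (pr U V x) : U" using opmod_op[OF dsumD(2)[OF d] p(1)] .
  show "op w x - op w (pr U V x) : V"
   using opmod_op[OF dsumD(3)[OF d] p(2), of w] opmod_op_diff[OF dsumD(1)[OF d] x pS] by simp
 qed
qed (use pr_in[OF d] in blast)

lemma pr_id: "dsum op S U V ==> x : U ==> pr U V x = x"
 using pr_eqI[of op S U V x x] opmod_0[of op V] by (simp add: dsum_def)

lemma pr_0_iff: "dsum op S U V ==> s : S ==> pr U V s = 0 \<longleftrightarrow> s : V"
 using pr_eqI[of op S U V 0 s] pr_in[of op S U V s] dsumD(2)[THEN opmod_0, of op S U V] by auto

lemma pr_add_pr: "dsum op S U V ==> s : S ==> pr U V s + pr V U s = s"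
 using pr_eqI[of op S V U "s - pr U V s" s] dsum_sym[of op S U V] pr_in[of op S U V s] by simp

lemma dsum_retract:
 assumes mS: "opmod op S" and p: "opmap op S op' Q p" and z: "opmap op' Q op S z"
  and mQ: "opmod op' Q" and bij: "bij_betw (\<lambda>x. p (z x)) Q Q"
 shows "dsum op S (z ` Q) {s\<in>S. p s = 0}" "inj_on z Q"
proof -
 show inj: "inj_on z Q" using bij by (auto simp: bij_betw_def inj_on_def)
 have pz0: "x = 0" if "x : Q" "p (z x) = 0" for x
  using bij that opmap_0[OF opmap_comp[OF z p] mQ] opmod_0[OF mQ]
  by (auto simp: bij_betw_def inj_on_def)
 show "dsum op S (z ` Q) {s\<in>S. p s = 0}"
  unfolding dsum_def
 proof (intro conjI ballI)
  show "opmod op (z ` Q)" by (rule opmod_image[OF z mQ mS mQ order_refl])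
  show "opmod op {s\<in>S. p s = 0}" by (rule opmap_ker[OF p mS mQ])
  show "z ` Q <= S" using opmap_in[OF z] by blast
  show "z ` Q \<inter> {s\<in>S. p s = 0} = {0}"
   using pz0 opmap_0[OF z mQ] opmod_0[OF mS] opmap_0[OF p mS] opmod_0[OF mQ] by force
  fix s assume s: "s : S"
  have "p s : (\<lambda>x. p (z x)) ` Q" using bij opmap_in[OF p s] by (simp add: bij_betw_def)
  then obtain x where x: "x : Q" "p s = p (z x)" by blast
  have zx: "z x : S" using opmap_in[OF z x(1)] .
  then have "s - z x : {s\<in>S. p s = 0}" using x s opmap_diff[OF p s zx] opmod_diff[OF mS] by simp
  then show "\<exists>a\<in>z ` Q. \<exists>b\<in>{s\<in>S. p s = 0}. s = a + b"
   using x(1) by (intro bexI[of _ "z x"] bexI[of _ "s - z x"]) auto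
 qed (use mS in auto)
qed

lemma complement_unique:
 assumes da: "dsum op S Z U" and db: "dsum op S Z V"
 shows "opiso op U op V"
proof -
 have U: "U <= S" "opmod op U" and V: "V <= S" "opmod op V" using dsumD[OF da] dsumD[OF db] by auto
 let ?f = "pr V Z"
 have f: "opmap op U op V ?f"
  by (rule opmap_subset[OF pr_opmap[OF dsum_sym[OF db]] U(1)])
   (use pr_in(1)[OF dsum_sym[OF db]] U(1) in blast)
 have "inj_on ?f U"
 proof (rule opmap_inj[OF f U(2)])
  fix x assume x: "x : U" "?f x = 0"
  then have "x : Z" using pr_0_iff[OF dsum_sym[OF db]] U(1) by blast
  then show "x = 0" using x(1) dsumD(6)[OF da] by blast
 qed
 moreover have "?f ` U = V"
 proof (intro equalityI subsetI)
  fix b assume b: "b : V"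
  then obtain z a where za: "z : Z" "a : U" "b = z + a" using dsumD(7)[OF da] V(1) by blast
  then have "a - b : Z" using opmod_minus[OF dsumD(2)[OF da] za(1)] by simp
  then have "?f a = b" using pr_eqI[OF dsum_sym[OF db] b] by blast
  then show "b : ?f ` U" using za(2) by blast
 qed (use opmap_in[OF f] in blast)
 ultimately show ?thesis using f unfolding opiso_def bij_betw_def by blast
qed

text \<open>An exchange argument: it suffices to find one submodule that is a complement of both A
  and B. Let th be the isomorphism of Q with Y and p the projection to Q. Either p th is bijective
  on Q, and Y itself is such a complement, or locality of End Q forces the projection of the
  B-component of Q to be bijective, and the image of th + (B-component) is one.\<close>
lemma cancel_indec:
 assumes dA: "dsum op S Q A" and dB: "dsum op S Y B" and fin: "finlen op S"
  and iso: "opiso op Q op Y" and ind: "indec op Q"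
 shows "opiso op A op B"
proof -
 note mS = finlen_opmod[OF fin]
 note D = dsumD[OF dA] and E = dsumD[OF dB]
 note mQ = D(2)
 have finQ: "finlen op Q" using finlen_subset[OF fin D(2,4)] .
 obtain th where th: "opmap op Q op Y th" "bij_betw th Q Y" using iso by (auto simp: opiso_def)
 note thi = opmap_inv_into[OF th mQ]
 let ?p = "pr Q A" and ?y = "pr Y B" and ?b = "pr B Y"
 note p = pr_opmap[OF dA] and y = pr_opmap[OF dB] and b = pr_opmap[OF dsum_sym[OF dB]]
 have kerp: "{s\<in>S. ?p s = 0} = A" using pr_0_iff[OF dA] D(5) by blast
 have y': "opmap op Q op Y ?y" by (rule opmap_subset[OF y D(4)]) (use opmap_in[OF y] D(4) in blast)
 have b': "opmap op Q op B ?b" by (rule opmap_subset[OF b D(4)]) (use opmap_in[OF b] D(4) in blast)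
 have pY: "opmap op Y op Q ?p" by (rule opmap_subset[OF p E(4)]) (use opmap_in[OF p] E(4) in blast)
 have pB: "opmap op B op Q ?p" by (rule opmap_subset[OF p E(5)]) (use opmap_in[OF p] E(5) in blast)
 have py: "opmap op Q op Q (\<lambda>x. ?p (?y x))" by (rule opmap_comp[OF y' pY])
 have pb: "opmap op Q op Q (\<lambda>x. ?p (?b x))" by (rule opmap_comp[OF b' pB])
 have pth: "opmap op Q op Q (\<lambda>x. ?p (th x))" by (rule opmap_comp[OF th(1) pY])
 have thS: "opmap op Q op S th" using th(1) E(4) unfolding opmap_def by blast
 have sum1: "?p (?y x) + ?p (?b x) = x" if x: "x : Q" for x
 proof -
  have xS: "x : S" using x D(4) by blast
  have "?p (?y x) + ?p (?b x) = ?p (?y x + ?b x)"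
  proof -
   have "?y x : S" "?b x : S" using opmap_in[OF y xS] opmap_in[OF b xS] E(4,5) by blast+
   then show ?thesis using opmap_add[OF p mS] by simp
  qed
  also have "\<dots> = x" using pr_add_pr[OF dB xS] pr_id[OF dA x] by (simp only:)
  finally show ?thesis .
 qed
 show ?thesis
 proof (cases "bij_betw (\<lambda>x. ?p (th x)) Q Q")
  case True
  have "dsum op S (th ` Q) A" using dsum_retract(1)[OF mS p thS mQ True] kerp by simp
  moreover have "th ` Q = Y" using th(2) by (simp add: bij_betw_def)
  ultimately show ?thesis using complement_unique dB by blast
 next
  case False
  (* p y factors through th, so if it were bijective then p th would be bijective as well. *)
  have npy: "\<not> bij_betw (\<lambda>x. ?p (?y x)) Q Q"
  proof
   assume *: "bij_betw (\<lambda>x. ?p (?y x)) Q Q"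
   let ?r = "\<lambda>x. inv_into Q th (?y x)"
   have r: "opmap op Q op Q ?r" by (rule opmap_comp[OF y' thi(1)])
   have thr: "th (?r x) = ?y x" if "x : Q" for x
    using th(2) opmap_in[OF y' that] by (auto simp: bij_betw_def intro: f_inv_into_f)
   have "inj_on ?r Q"
   proof (rule inj_onI)
    fix u v assume uv: "u : Q" "v : Q" "?r u = ?r v"
    then have "?y u = ?y v" using thr by metis
    then show "u = v" using * uv(1,2) by (auto simp: bij_betw_def inj_on_def)
   qed
   then have rb: "bij_betw ?r Q Q" by (rule finlen_inj_bij[OF finQ r])
   then have rQ: "?r ` Q = Q" by (simp add: bij_betw_def)
   have "(\<lambda>x. ?p (th x)) ` Q = (\<lambda>x. ?p (th x)) ` ?r ` Q" using rQ by simp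
   also have "\<dots> = (\<lambda>x. ?p (?y x)) ` Q" using thr by (simp add: image_image)
   also have "\<dots> = Q" using * by (simp add: bij_betw_def)
   finally have "(\<lambda>x. ?p (th x)) ` Q = Q" .
   moreover have "inj_on (\<lambda>x. ?p (th x)) Q"
   proof (rule inj_onI)
    fix u v assume uv: "u : Q" "v : Q" "?p (th u) = ?p (th v)"
    have ur: "u : ?r ` Q" "v : ?r ` Q" using uv(1,2) by (simp_all only: rQ)
    obtain u' where u': "?r u' = u" "u' : Q" using ur(1) by (elim imageE) simp
    obtain v' where v': "?r v' = v" "v' : Q" using ur(2) by (elim imageE) simp
    have "?p (?y u') = ?p (?y v')" using uv(3) thr[OF u'(2)] thr[OF v'(2)] unfolding u'(1) v'(1) by (simp only:)
    then have "u' = v'" using * u'(2) v'(2) by (auto simp: bij_betw_def inj_on_def)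
    then show "u = v" using u'(1) v'(1) by (simp only:)
   qed
   ultimately show False using False by (simp add: bij_betw_def)
  qed
  have "bij_betw (\<lambda>x. ?p (?y x) + ?p (?b x)) Q Q"
   using sum1 bij_betw_cong[of Q "\<lambda>x. ?p (?y x) + ?p (?b x)" "\<lambda>x. x" Q] bij_betw_id[of Q] by (simp add: id_def)
  then have bpb: "bij_betw (\<lambda>x. ?p (?b x)) Q Q" using indec_local[OF finQ ind py pb] npy by blast
  (* Adding th does not change bijectivity after p, since p th is not bijective, and th is recovered
     as the Y-component. *)
  let ?z = "\<lambda>x. th x + ?b x"
  have bS: "opmap op Q op S ?b" using b' E(5) unfolding opmap_def by blast
  have z: "opmap op Q op S ?z" by (rule opmap_plus[OF thS bS mS])
  have pz: "?p (?z x) = ?p (th x) + ?p (?b x)" if "x : Q" for x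
   using opmap_add[OF p mS] opmap_in[OF thS that] opmap_in[OF bS that] by blast
  have bijpz: "bij_betw (\<lambda>x. ?p (?z x)) Q Q"
  proof (rule ccontr)
   assume n: "\<not> bij_betw (\<lambda>x. ?p (?z x)) Q Q"
   have m: "opmap op Q op Q (\<lambda>x. - ?p (th x))" by (rule opmap_uminus[OF pth mQ])
   have "bij_betw (\<lambda>x. ?p (?z x) + - ?p (th x)) Q Q"
    using bpb bij_betw_cong[of Q "\<lambda>x. ?p (?z x) + - ?p (th x)" "\<lambda>x. ?p (?b x)" Q] pz by simp
   then have "bij_betw (\<lambda>x. - ?p (th x)) Q Q"
    using indec_local[OF finQ ind opmap_comp[OF z p] m] n by blast
   moreover have "bij_betw uminus Q Q"
    using opmod_minus[OF mQ] by (intro bij_betwI[of _ _ _ uminus]) auto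
   ultimately have "bij_betw (\<lambda>x. - (- ?p (th x))) Q Q"
    using bij_betw_trans[of "\<lambda>x. - ?p (th x)" Q Q uminus Q] by (simp add: comp_def)
   then show False using False by simp
  qed
  have d1: "dsum op S (?z ` Q) A" using dsum_retract(1)[OF mS p z mQ bijpz] kerp by simp
  have yz: "?y (?z x) = th x" if x: "x : Q" for x
  proof (rule pr_eqI[OF dB])
   show "th x : Y" using opmap_in[OF th(1) x] .
   show "?z x - th x : B" using opmap_in[OF b' x] by simp
  qed
  have y2: "opmap op S op Q (\<lambda>s. inv_into Q th (?y s))" by (rule opmap_comp[OF y thi(1)])
  have "inv_into Q th (?y (?z x)) = x" if "x : Q" for x
   using yz[OF that] th(2) that by (simp add: bij_betw_def)
  then have bij2: "bij_betw (\<lambda>x. inv_into Q th (?y (?z x))) Q Q"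
   using bij_betw_cong[of Q "\<lambda>x. inv_into Q th (?y (?z x))" "\<lambda>x. x" Q] bij_betw_id[of Q] by (simp add: id_def)
  have "{s\<in>S. inv_into Q th (?y s) = 0} = B"
  proof -
   have "inv_into Q th (?y s) = 0 \<longleftrightarrow> ?y s = 0" if "s : S" for s
    using opmap_0[OF thi(1) E(2)] opmap_0[OF th(1) mQ] th(2) opmap_in[OF y that]
    by (metis bij_betw_def f_inv_into_f)
   then show ?thesis using pr_0_iff[OF dB] E(5) by blast
  qed
  then have d2: "dsum op S (?z ` Q) B" using dsum_retract(1)[OF mS y2 z mQ bij2] by simp
  show ?thesis by (rule complement_unique[OF d1 d2])
 qed
qed

lemma dsum_assoc:
 assumes d: "dsum op S Q A" and e: "dsum op Q U V"
 shows "dsum op S U {v + a |v a. v : V \<and> a : A}" "dsum op {v + a |v a. v : V \<and> a : A} V A"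
proof -
 note D = dsumD[OF d] and E = dsumD[OF e]
 let ?W = "{v + a |v a. v : V \<and> a : A}"
 have VS: "V <= S" and US: "U <= S" using E(4,5) D(4) by auto
 have mW: "opmod op ?W" by (rule opmod_sum[OF D(1) E(3) VS D(3) D(5)])
 have WS: "?W <= S" using opmod_add[OF D(1)] VS D(5) by blast
 show "dsum op ?W V A"
  unfolding dsum_def
 proof (intro conjI)
  show "V \<inter> A = {0}" using D(6) E(5) opmod_0[OF E(3)] opmod_0[OF D(3)] by blast
  show "V <= ?W" using opmod_0[OF D(3)] by force
  show "A <= ?W" using opmod_0[OF E(3)] by force
 qed (use mW E D in blast)+
 show "dsum op S U ?W"
  unfolding dsum_def
 proof (intro conjI ballI)
  show "U \<inter> ?W = {0}"
  proof (intro equalityI subsetI)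
   fix u assume "u : U \<inter> ?W"
   then obtain v a where *: "u : U" "v : V" "a : A" "u = v + a" by blast
   then have "u - v : Q" using opmod_diff[OF D(2)] E(4,5) by blast
   then have "u - v = 0" using * D(6) by auto
   then show "u : {0}" using * E(6) by auto
  qed (use opmod_0[OF E(2)] opmod_0[OF mW] in blast)
  fix s assume "s : S"
  then obtain q a where q: "q : Q" "a : A" "s = q + a" using D(7) by blast
  then obtain u v where "u : U" "v : V" "q = u + v" using E(7) by blast
  then show "\<exists>x\<in>U. \<exists>y\<in>?W. s = x + y" using q
   by (intro bexI[of _ u] bexI[of _ "v + a"]) (auto simp: add.assoc)
 qed (use D E US WS mW in blast)+
qed

lemma dsum_image:
 assumes d: "dsum op S U V" and f: "opmap op S op' T f" "bij_betw f S T" and T: "opmod op' T"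
 shows "dsum op' T (f ` U) (f ` V)"
proof -
 note D = dsumD[OF d]
 have inj: "inj_on f S" and fS: "f ` S = T" using f(2) by (auto simp: bij_betw_def)
 show ?thesis
  unfolding dsum_def
 proof (intro conjI ballI)
  show "opmod op' (f ` U)" by (rule opmod_image[OF f(1) D(1) T D(2,4)])
  show "opmod op' (f ` V)" by (rule opmod_image[OF f(1) D(1) T D(3,5)])
  have "f ` U \<inter> f ` V = f ` (U \<inter> V)" using inj_on_image_Int[OF inj D(4,5)] by simp
  then show "f ` U \<inter> f ` V = {0}" using D(6) opmap_0[OF f(1) D(1)] by simp
  fix t assume "t : T"
  then obtain s where s: "s : S" "t = f s" using fS by blast
  then obtain x y where xy: "x : U" "y : V" "s = x + y" using D(7) by blast
  moreover from xy have "t = f x + f y" using s opmap_add[OF f(1) D(1)] D(4,5) by blast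
  ultimately show "\<exists>x\<in>f ` U. \<exists>y\<in>f ` V. t = x + y" by blast
 qed (use T D(4,5) fS in blast)+
qed

lemma dsum_zero: "dsum op S {0} A ==> A = S"
 by (force simp: dsum_def)

text \<open>Induction on the rank of Q: split Q and its image into smaller summands until the
  summand is indecomposable.\<close>
theorem cancel:
 assumes "finlen op S" and l: "\<And>A B. opmod op A ==> opmod op B ==> A \<subset> B ==> B <= S ==> l A < (l B::nat)"
  and "T <= S" "dsum op T Q A" "dsum op T Y B" "opiso op Q op Y"
 shows "opiso op A op B"
 using assms(3-)
proof (induction "l Q" arbitrary: T Q A Y B rule: less_induct)
 case less
 note D = dsumD[OF less.prems(2)] and E = dsumD[OF less.prems(3)]
 have finT: "finlen op T" by (rule finlen_subset[OF assms(1) D(1) less.prems(1)])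
 show ?case
 proof (cases "indec op Q")
  case True
  then show ?thesis using cancel_indec[OF less.prems(2,3) finT less.prems(4)] by blast
 next
  case nind: False
  obtain th where th: "opmap op Q op Y th" "bij_betw th Q Y" using less.prems(4) by (auto simp: opiso_def)
  show ?thesis
  proof (cases "Q = {0}")
   case True
   then have "Y = {0}" using th opmap_0[OF th(1) D(2)] by (auto simp: bij_betw_def)
   then have "A = T" "B = T" using True dsum_zero less.prems(2,3) by blast+
   then show ?thesis using opmap_id[OF D(1)] bij_betw_id[of T] unfolding opiso_def id_def by blast
  next
   case False
   then obtain U V where UV: "dsum op Q U V" "U \<noteq> {0}" "V \<noteq> {0}"
    using nind D(2) unfolding indec_def by blast
   note F = dsumD[OF UV(1)]
   have nU: "U \<noteq> Q" using F UV by blast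
   have nV: "V \<noteq> Q" using F UV by blast
   have QS: "Q <= S" using D(4) less.prems(1) by blast
   have lU: "l U < l Q" using l[OF F(2) D(2) _ QS] nU F(4) by blast
   have lV: "l V < l Q" using l[OF F(3) D(2) _ QS] nV F(5) by blast
   have dY: "dsum op Y (th ` U) (th ` V)" by (rule dsum_image[OF UV(1) th E(2)])
   have inj: "inj_on th Q" using th(2) by (simp add: bij_betw_def)
   let ?A = "{v + a |v a. v : V \<and> a : A}" and ?B = "{v + a |v a. v : th ` V \<and> a : B}"
   note dA = dsum_assoc[OF less.prems(2) UV(1)] and dB = dsum_assoc[OF less.prems(3) dY]
   have "opiso op ?A op ?B"
    by (rule less.hyps[OF lU less.prems(1) dA(1) dB(1) opiso_image[OF th(1) inj F(4)]])
   then obtain ps where ps: "opmap op ?A op ?B ps" "bij_betw ps ?A ?B" by (auto simp: opiso_def)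
   note psi = opmap_inv_into[OF ps dsumD(1)[OF dA(2)]]
   let ?g = "inv_into ?A ps"
   have injg: "inj_on ?g ?B" using psi(2) by (simp add: bij_betw_def)
   note d3 = dsum_image[OF dB(2) psi dsumD(1)[OF dA(2)]]
   have AS: "?A <= S" using dsumD(5)[OF dA(1)] less.prems(1) by blast
   have i1: "opiso op V op (?g ` th ` V)"
    by (rule opiso_trans[OF opiso_image[OF th(1) inj F(5)]
       opiso_image[OF psi(1) injg dsumD(4)[OF dB(2)]]])
   have i2: "opiso op A op (?g ` B)" by (rule less.hyps[OF lV AS dA(2) d3 i1])
   have "opiso op B op (?g ` B)" by (rule opiso_image[OF psi(1) injg dsumD(5)[OF dB(2)]])
   then show ?thesis using opiso_trans[OF i2] opiso_sym E(3) by blast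
  qed
 qed
qed

section \<open>Powers of a module\<close>

definition pw :: "'i set => 'a::ab_group_add set => ('i => 'a) set" where
 "pw J S = {x. \<forall>i. (i : J --> x i : S) \<and> (i \<notin> J --> x i = 0)}"

definition pop :: "('o => 'a => 'a) => 'o => ('i => 'a) => 'i => 'a" where
 "pop op w x = (\<lambda>i. op w (x i))"

lemma sum_apply: "sum f A i = (\<Sum>j\<in>A. f j i)" for f :: "'j => 'i => 'a::ab_group_add"
 by (induction A rule: infinite_finite_induct) simp_all

lemma opmod_pw:
 assumes "opmod op S" shows "opmod (pop op) (pw J S)"
 unfolding opmod_def
proof (intro conjI ballI allI)
 show "pop op w (x - y) = pop op w x - pop op w y" if "x : pw J S" "y : pw J S" for w x y
 proof
  fix i show "pop op w (x - y) i = (pop op w x - pop op w y) i"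
   using that opmod_op_diff[OF assms] opmod_op_0[OF assms] by (cases "i : J") (auto simp: pop_def pw_def)
 qed
qed (use assms opmod_op_0[OF assms] in "auto simp: pw_def pop_def opmod_rules")

lemma opmap_proj: "opmod op S ==> opmap (pop op) (pw J S) op S (\<lambda>x. x i)"
 using opmod_0[of op S] unfolding opmap_def pw_def pop_def by (cases "i : J") auto

definition inj_at :: "'i => 'a::zero => 'i => 'a" where
 "inj_at i x = (\<lambda>j. if j = i then x else 0)"

lemma opmap_inj_at: "opmod op S ==> i : J ==> opmap op S (pop op) (pw J S) (inj_at i)"
 using opmod_0[of op S] by (auto simp: opmap_def pw_def pop_def inj_at_def fun_eq_iff opmod_op_0)

lemma inj_at_in: "opmod op S ==> i : J ==> x : S ==> inj_at i x : pw J S"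
 using opmap_in[OF opmap_inj_at] .

lemma inj_at_same [simp]: "inj_at i x i = x"
 by (simp add: inj_at_def)

lemma opmap_sum:
 assumes "opmap op S op' T f" "opmod op S" "\<And>j. j : J ==> x j : S"
 shows "f (\<Sum>j\<in>J. x j) = (\<Sum>j\<in>J. f (x j))" "(\<Sum>j\<in>J. x j) : S"
proof -
 have "f (\<Sum>j\<in>J. x j) = (\<Sum>j\<in>J. f (x j)) \<and> (\<Sum>j\<in>J. x j) : S"
  using assms(3)
 proof (induction J rule: infinite_finite_induct)
  case (insert j J)
  then show ?case using opmap_add[OF assms(1,2)] opmod_add[OF assms(2)] by simp
 qed (use opmap_0[OF assms(1,2)] opmod_0[OF assms(2)] in simp_all)
 then show "f (\<Sum>j\<in>J. x j) = (\<Sum>j\<in>J. f (x j))" "(\<Sum>j\<in>J. x j) : S" by auto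
qed

text \<open>The rank of a submodule is the rank of its image plus the rank of its intersection with
  the kernel.\<close>
lemma finlen_extension:
 assumes mS: "opmod op S" and f: "opmap op S op' T f" and T: "finlen op' T"
  and K: "finlen op {x\<in>S. f x = 0}"
 shows "finlen op S"
proof -
 let ?K = "{x\<in>S. f x = 0}"
 have mT: "opmod op' T" using T by (rule finlen_opmod)
 from T obtain l1 :: "'c set => nat" where
  l1: "\<And>A B. opmod op' A ==> opmod op' B ==> A \<subset> B ==> B <= T ==> l1 A < l1 B"
  unfolding finlen_def by metis
 from K obtain l2 :: "'b set => nat" where
  l2: "\<And>A B. opmod op A ==> opmod op B ==> A \<subset> B ==> B <= ?K ==> l2 A < l2 B"
  unfolding finlen_def by metis
 have "l1 (f ` A) + l2 (A \<inter> ?K) < l1 (f ` B) + l2 (B \<inter> ?K)"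
  if A: "opmod op A" and B: "opmod op B" and AB: "A \<subset> B" and BS: "B <= S" for A B
 proof -
  have AS: "A <= S" using AB BS by blast
  have fA: "opmod op' (f ` A)" and fB: "opmod op' (f ` B)"
   using opmod_image[OF f mS mT] A B AS BS by blast+
  have kA: "opmod op (A \<inter> ?K)" and kB: "opmod op (B \<inter> ?K)"
   using opmod_Int A B finlen_opmod[OF K] by blast+
  have fAB: "f ` A <= f ` B" and kAB: "A \<inter> ?K <= B \<inter> ?K" using AB by blast+
  have fBT: "f ` B <= T" using opmap_in[OF f] BS by blast
  have "f ` A \<subset> f ` B \<or> A \<inter> ?K \<subset> B \<inter> ?K"
  proof (rule ccontr)
   assume "\<not> ?thesis"
   then have e: "f ` A = f ` B" "A \<inter> ?K = B \<inter> ?K" using fAB kAB by blast+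
   have "B <= A"
   proof
    fix b assume b: "b : B"
    then obtain a where a: "a : A" "f b = f a" using e(1) by blast
    have "b - a : B" using opmod_diff[OF B b] a(1) AB by blast
    moreover have "f (b - a) = 0" using opmap_diff[OF f, of b a] a b AS BS by (simp add: subset_iff)
    ultimately have "b - a : A" using e(2) BS by blast
    then have "(b - a) + a : A" using opmod_add[OF A] a(1) by blast
    then show "b : A" by simp
   qed
   then show False using AB by blast
  qed
  moreover have "l1 (f ` A) < l1 (f ` B)" if "f ` A \<subset> f ` B"
   using l1[OF fA fB that fBT] .
  moreover have "l2 (A \<inter> ?K) < l2 (B \<inter> ?K)" if "A \<inter> ?K \<subset> B \<inter> ?K"
   using l2[OF kA kB that] by blast
  moreover have "f ` A = f ` B \<or> f ` A \<subset> f ` B" "A \<inter> ?K = B \<inter> ?K \<or> A \<inter> ?K \<subset> B \<inter> ?K"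
   using fAB kAB by blast+
  ultimately show ?thesis by (elim disjE) auto
 qed
 then show ?thesis using mS unfolding finlen_def
  by (intro conjI exI[of _ "\<lambda>A. l1 (f ` A) + l2 (A \<inter> ?K)"]) auto
qed

lemma finlen_zero: "opmod op S ==> finlen op {0}"
 unfolding finlen_def using opmod_zero opmod_0 by blast

lemma finlen_pw:
 fixes S :: "'a::ab_group_add set" and J :: "'i set"
 assumes S: "finlen op S" and "finite J"
 shows "finlen (pop op) (pw J S)"
 using \<open>finite J\<close>
proof induction
 case empty
 have "pw {} S = {0 :: 'i => 'a}" by (auto simp: pw_def)
 then show ?case using finlen_zero[OF opmod_pw[OF finlen_opmod[OF S]]] by simp
next
 case (insert j J)
 have mS: "opmod op S" using S by (rule finlen_opmod)
 have "{x : pw (insert j J) S. x j = 0} = pw J S"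
 proof (intro equalityI subsetI)
  fix x assume "x : {x : pw (insert j J) S. x j = 0}"
  then show "x : pw J S" unfolding pw_def by (simp; metis)
 next
  fix x assume "x : pw J S"
  then show "x : {x : pw (insert j J) S. x j = 0}"
   using insert.hyps(2) opmod_0[OF mS] unfolding pw_def by simp
 qed
 then show ?case
  using finlen_extension[OF opmod_pw[OF mS, of "insert j J"] opmap_proj[OF mS, of "insert j J" j] S] insert.IH by simp
qed

lemma pw_opiso:
 assumes "opmap op S op' T f" "bij_betw f S T" "opmod op S"
 shows "opiso (pop op) (pw J S) (pop op') (pw J T)"
 unfolding opiso_def
proof (intro exI conjI)
 let ?F = "\<lambda>x i. f (x i)"
 have f0: "f 0 = 0" using opmap_0[OF assms(1,3)] .
 have 0: "0 : S" using opmod_0[OF assms(3)] .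
 show "opmap (pop op) (pw J S) (pop op') (pw J T) ?F"
 proof -
  have xi: "x i : S" if "x : pw J S" for x i using that 0 unfolding pw_def by (cases "i : J") simp_all
  have "?F x : pw J T" if "x : pw J S" for x using that opmap_in[OF assms(1)] f0 unfolding pw_def by simp
  moreover have "?F (x - y) = ?F x - ?F y" if "x : pw J S" "y : pw J S" for x y
   using opmap_diff[OF assms(1) xi[OF that(1)] xi[OF that(2)]] by (simp add: fun_eq_iff)
  moreover have "?F (pop op w x) = pop op' w (?F x)" if "x : pw J S" for w x
   using opmap_op[OF assms(1) xi[OF that]] by (simp add: pop_def)
  ultimately show ?thesis unfolding opmap_def by blast
 qed
 note g = opmap_inv_into[OF assms]
 show "bij_betw ?F (pw J S) (pw J T)"
 proof (rule bij_betwI[of _ _ _ "\<lambda>x i. if i : J then inv_into S f (x i) else 0"])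
  show "?F : pw J S \<rightarrow> pw J T" using f0 opmap_in[OF assms(1)] by (auto simp: pw_def)
  show "(\<lambda>x i. if i : J then inv_into S f (x i) else 0) : pw J T \<rightarrow> pw J S"
   using opmap_in[OF g(1)] by (auto simp: pw_def)
  show "(\<lambda>i. if i : J then inv_into S f (f (x i)) else 0) = x" if "x : pw J S" for x
   using that assms(2) by (auto simp: fun_eq_iff pw_def bij_betw_def)
  show "(\<lambda>i. f (if i : J then inv_into S f (y i) else 0)) = y" if "y : pw J T" for y
   using that assms(2) f0 by (auto simp: fun_eq_iff pw_def bij_betw_def f_inv_into_f)
 qed
qed

lemma dsum_pw:
 assumes d: "dsum op S U V"
 shows "dsum (pop op) (pw J S) (pw J U) (pw J V)"
proof -
 note D = dsumD[OF d]
 show ?thesis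
  unfolding dsum_def
 proof (intro conjI ballI)
  show "pw J U \<inter> pw J V = {0}"
  proof (intro equalityI subsetI)
   fix x assume x: "x : pw J U \<inter> pw J V"
   have "x i = 0" for i using x D(6) unfolding pw_def by (cases "i : J") auto
   then show "x : {0}" by (simp add: fun_eq_iff)
  qed (use opmod_0[OF D(2)] opmod_0[OF D(3)] in "auto simp: pw_def")
  fix s assume s: "s : pw J S"
  have si: "s i : S" for i using s opmod_0[OF D(1)] by (cases "i : J") (auto simp: pw_def)
  have p0: "pr U V 0 = 0" "pr V U 0 = 0"
   using opmap_0[OF pr_opmap[OF d] D(1)] opmap_0[OF pr_opmap[OF dsum_sym[OF d]] D(1)] by auto
  show "\<exists>x\<in>pw J U. \<exists>y\<in>pw J V. s = x + y"
  proof (intro bexI)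
   show "s = (\<lambda>i. pr U V (s i)) + (\<lambda>i. pr V U (s i))" using pr_add_pr[OF d si] by (simp add: fun_eq_iff)
   show "(\<lambda>i. pr U V (s i)) : pw J U" using pr_in(1)[OF d] s p0 by (auto simp: pw_def)
   show "(\<lambda>i. pr V U (s i)) : pw J V" using pr_in(1)[OF dsum_sym[OF d]] s p0 by (auto simp: pw_def)
  qed
 qed (use D(4,5) opmod_pw[OF D(1)] opmod_pw[OF D(2)] opmod_pw[OF D(3)] in "auto simp: pw_def")
qed

lemma ex_indec_summand:
 assumes fin: "finlen op M" and ne: "M \<noteq> {0}"
 obtains Q A where "dsum op M Q A" "indec op Q"
proof -
 have mM: "opmod op M" using fin by (rule finlen_opmod)
 from fin obtain l :: "'b set => nat" where
  l: "\<And>A B. opmod op A ==> opmod op B ==> A \<subset> B ==> B <= M ==> l A < l B"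
  unfolding finlen_def by metis
 let ?P = "\<lambda>Q. Q \<noteq> {0} \<and> (\<exists>A. dsum op M Q A)"
 have "dsum op M M {0}" using mM opmod_zero[OF mM] opmod_0[OF mM] by (force simp: dsum_def)
 then have "?P M" using ne by blast
 then obtain Q where Q: "?P Q" and least: "\<And>Q'. ?P Q' ==> l Q \<le> l Q'"
  using ex_has_least_nat[of ?P M l] by blast
 then obtain A where A: "dsum op M Q A" by blast
 note D = dsumD[OF A]
 have "indec op Q"
  unfolding indec_def
 proof (intro conjI allI impI)
  fix U V assume UV: "dsum op Q U V"
  note E = dsumD[OF UV]
  show "U = {0} \<or> V = {0}"
  proof (rule ccontr)
   assume n: "\<not> ?thesis"
   then have "l Q \<le> l U" using least[of U] dsum_assoc(1)[OF A UV] by blast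
   moreover have "U \<noteq> Q" using n E(5,6) by blast
   ultimately show False using l[OF E(2) D(2) _ D(4)] E(4) by fastforce
  qed
 qed (use Q D in auto)
 then show ?thesis using that A by blast
qed

text \<open>Following a copy of Q through the isomorphism, the n coordinates of N, and back, writes
  the identity of Q as a sum of n endomorphisms that factor through N. By locality one of them is
  bijective, which embeds Q in N as a direct summand.\<close>
lemma common_summand:
 assumes fin: "finlen op M" and mN: "opmod op' N" and n: "n > 0"
  and iso: "opiso (pop op) (pw {..<n::nat} M) (pop op') (pw {..<n} N)"
  and d: "dsum op M Q A" and ind: "indec op Q"
 obtains Y B where "dsum op' N Y B" "opiso op Q op' Y"
proof -
 note D = dsumD[OF d]
 have finQ: "finlen op Q" using finlen_subset[OF fin D(2,4)] .
 let ?M = "pw {..<n} M" and ?N = "pw {..<n} N"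
 obtain f where f: "opmap (pop op) ?M (pop op') ?N f" "bij_betw f ?M ?N" using iso by (auto simp: opiso_def)
 note mPM = opmod_pw[OF D(1), of "{..<n}"]
 note fi = opmap_inv_into[OF f mPM]
 let ?fi = "inv_into ?M f"
 have mQ: "opmod op Q" by (rule D(2))
 have Q0: "Q \<noteq> {0}" using ind by (simp add: indec_def)
 have gj: "opmap op Q op' N (\<lambda>x. f (inj_at 0 x) j)" for j
 proof -
  have "opmap op M (pop op) ?M (inj_at 0)" using opmap_inj_at[OF D(1), of 0 "{..<n}"] n by simp
  then have "opmap op Q (pop op) ?M (inj_at 0)" using D(4) opmap_in opmap_subset[of op M "pop op" ?M _ Q ?M] by blast
  then show ?thesis using opmap_comp[OF opmap_comp[OF _ f(1)] opmap_proj[OF mN, of "{..<n}" j]] by blast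
 qed
 have hj: "opmap op' N op Q (\<lambda>y. pr Q A (?fi (inj_at j y) 0))" if "j < n" for j
  using opmap_comp[OF opmap_comp[OF opmap_comp[OF opmap_inj_at[OF mN, of j "{..<n}"] fi(1)]
   opmap_proj[OF D(1), of "{..<n}" 0]] pr_opmap[OF d]] that by simp
 have H: "opmap (pop op') ?N op Q (\<lambda>y. pr Q A (?fi y 0))"
  by (rule opmap_comp[OF opmap_comp[OF fi(1) opmap_proj[OF D(1)]] pr_opmap[OF d]])
 have decomp: "y = (\<Sum>j<n. inj_at j (y j))" if "y : ?N" for y
 proof
  fix i show "y i = (\<Sum>j<n. inj_at j (y j)) i"
  proof (cases "i < n")
   case True
   have "(\<Sum>j<n. inj_at j (y j)) i = (\<Sum>j<n. if j = i then y j else 0)"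
    by (simp add: inj_at_def sum_apply eq_commute cong: if_cong)
   then show ?thesis using True by simp
  next
   case False
   then have "(\<Sum>j<n. inj_at j (y j)) i = 0" by (simp add: inj_at_def sum_apply)
   then show ?thesis using False that by (simp add: pw_def)
  qed
 qed
 have "(\<Sum>j<n. pr Q A (?fi (inj_at j (f (inj_at 0 x) j)) 0)) = x" if x: "x : Q" for x
 proof -
  let ?y = "f (inj_at 0 x)"
  have x0: "inj_at 0 x : ?M" using x D(4) n by (intro inj_at_in[OF D(1)]) auto
  then have y: "?y : ?N" by (rule opmap_in[OF f(1)])
  have yj: "inj_at j (?y j) : ?N" if "j < n" for j
   using opmap_in[OF opmap_inj_at[OF mN, of j "{..<n}"], of "?y j"] that y by (simp add: pw_def)
  have "(\<Sum>j<n. pr Q A (?fi (inj_at j (?y j)) 0)) = pr Q A (?fi (\<Sum>j<n. inj_at j (?y j)) 0)"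
   using opmap_sum[OF H opmod_pw[OF mN], of "{..<n}" "\<lambda>j. inj_at j (?y j)"] yj by simp
  also have "\<dots> = pr Q A (inj_at (0::nat) x 0)"
   using decomp[OF y] f(2) x0 by (simp add: bij_betw_def)
  also have "\<dots> = x" using pr_id[OF d x] by simp
  finally show ?thesis .
 qed
 then have "bij_betw (\<lambda>x. \<Sum>j<n. pr Q A (?fi (inj_at j (f (inj_at 0 x) j)) 0)) Q Q"
  using bij_betw_cong[of Q "\<lambda>x. \<Sum>j<n. pr Q A (?fi (inj_at j (f (inj_at 0 x) j)) 0)" "\<lambda>x. x" Q]
   bij_betw_id[of Q] by (simp add: id_def)
 then obtain j where j: "j < n" "bij_betw (\<lambda>x. pr Q A (?fi (inj_at j (f (inj_at 0 x) j)) 0)) Q Q"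
  using indec_local_sum[OF finQ ind, of n "\<lambda>j x. pr Q A (?fi (inj_at j (f (inj_at 0 x) j)) 0)"]
   opmap_comp[OF gj hj] by blast
 note r = dsum_retract[OF mN hj[OF j(1)] gj mQ j(2)]
 show ?thesis by (rule that[OF r(1) opiso_image[OF gj r(2) order_refl]])
qed

lemma opiso_dsum:
 assumes d: "dsum op M Q A" and e: "dsum op' N Y B" and i: "opiso op Q op' Y" and j: "opiso op A op' B"
 shows "opiso op M op' N"
proof -
 note D = dsumD[OF d] and E = dsumD[OF e]
 obtain f where f: "opmap op Q op' Y f" "bij_betw f Q Y" using i by (auto simp: opiso_def)
 obtain g where g: "opmap op A op' B g" "bij_betw g A B" using j by (auto simp: opiso_def)
 let ?h = "\<lambda>m. f (pr Q A m) + g (pr A Q m)"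
 have f': "opmap op Q op' N f" by (rule opmap_subset[OF f(1) order_refl]) (use opmap_in[OF f(1)] E(4) in auto)
 have g': "opmap op A op' N g" by (rule opmap_subset[OF g(1) order_refl]) (use opmap_in[OF g(1)] E(5) in auto)
 have h: "opmap op M op' N ?h"
  by (rule opmap_plus[OF opmap_comp[OF pr_opmap[OF d] f'] opmap_comp[OF pr_opmap[OF dsum_sym[OF d]] g'] E(1)])
 have "inj_on ?h M"
 proof (rule opmap_inj[OF h D(1)])
  fix m assume m: "m : M" "?h m = 0"
  have p: "pr Q A m : Q" "pr A Q m : A" using pr_in(1)[OF d m(1)] pr_in(1)[OF dsum_sym[OF d] m(1)] .
  have fY: "f (pr Q A m) : Y" "g (pr A Q m) : B" using opmap_in[OF f(1)] opmap_in[OF g(1)] p by auto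
  have "f (pr Q A m) = - g (pr A Q m)" using m(2) by (simp add: eq_neg_iff_add_eq_0)
  then have "f (pr Q A m) = 0" using fY opmod_minus[OF E(3)] E(6) by fastforce
  moreover from this have "g (pr A Q m) = 0" using m(2) by simp
  ultimately have "pr Q A m = 0" "pr A Q m = 0"
   using opmap_0[OF f(1) D(2)] opmap_0[OF g(1) D(3)] p opmod_0[OF D(2)] opmod_0[OF D(3)] f(2) g(2)
   by (metis bij_betw_def inj_onD)+
  then show "m = 0" using pr_add_pr[OF d m(1)] by simp
 qed
 moreover have "?h ` M = N"
 proof (intro equalityI subsetI)
  fix t assume "t : N"
  then obtain y b where yb: "y : Y" "b : B" "t = y + b" using E(7) by blast
  then obtain q a where qa: "q : Q" "f q = y" "a : A" "g a = b" using f(2) g(2) by (auto simp: bij_betw_def)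
  have "q + a : M" using opmod_add[OF D(1)] qa D(4,5) by blast
  moreover have "pr Q A (q + a) = q" "pr A Q (q + a) = a"
   using pr_eqI[OF d, of q "q + a"] pr_eqI[OF dsum_sym[OF d], of a "q + a"] qa by auto
  ultimately show "t : ?h ` M" using qa yb by (intro image_eqI[of _ _ "q + a"]) auto
 qed (use opmap_in[OF h] in blast)
 ultimately show ?thesis using h unfolding opiso_def bij_betw_def by blast
qed

text \<open>Induction on the rank of M: an indecomposable summand of M is a summand of N too, its
  n-th power cancels from both sides, and the complements have smaller rank.\<close>
theorem pw_cancel:
 assumes "finlen op M" "opmod op' N" "n > 0" "opiso (pop op) (pw {..<n::nat} M) (pop op') (pw {..<n} N)"
 shows "opiso op M op' N"
proof -
 from assms(1) obtain l :: "'b set => nat" where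
  l: "\<And>A B. opmod op A ==> opmod op B ==> A \<subset> B ==> B <= M ==> l A < l B"
  unfolding finlen_def by metis
 have "opiso op M' op' N'" if "opmod op M'" "M' <= M" "opmod op' N'"
   "opiso (pop op) (pw {..<n} M') (pop op') (pw {..<n} N')" for M' N'
  using that
 proof (induction "l M'" arbitrary: M' N' rule: less_induct)
  case less
  note mM = less.prems(1) and mN = less.prems(3)
  have fin: "finlen op M'" by (rule finlen_subset[OF assms(1) mM less.prems(2)])
  show ?case
  proof (cases "M' = {0}")
   case True
   obtain f where f: "opmap (pop op) (pw {..<n} M') (pop op') (pw {..<n} N') f"
     "bij_betw f (pw {..<n} M') (pw {..<n} N')" using less.prems(4) by (auto simp: opiso_def)
   have "pw {..<n} M' = {0}" using True by (auto simp: pw_def fun_eq_iff)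
   then have N0: "pw {..<n} N' = {0}"
    using f(2) opmap_0[OF f(1) opmod_pw[OF mM]] by (auto simp: bij_betw_def)
   have "N' <= {0}"
   proof
    fix x assume "x : N'"
    then have "inj_at 0 x : pw {..<n} N'" using assms(3) by (intro inj_at_in[OF mN]) auto
    then have "inj_at 0 x (0::nat) = 0" using N0 by auto
    then show "x : {0}" by simp
   qed
   then have "N' = {0}" using opmod_0[OF mN] by blast
   then show ?thesis using True opmod_op_0[OF mM] opmod_op_0[OF mN] unfolding opiso_def
    by (intro exI[of _ "\<lambda>_. 0"]) (auto simp: opmap_def)
  next
   case False
   obtain Q A where d: "dsum op M' Q A" and ind: "indec op Q" using ex_indec_summand[OF fin False] .
   obtain Y B where e: "dsum op' N' Y B" and i: "opiso op Q op' Y"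
    using common_summand[OF fin mN assms(3) less.prems(4) d ind] .
   note D = dsumD[OF d] and E = dsumD[OF e]
   let ?J = "{..<n}"
   note mP = opmod_pw[OF mM, of ?J]
   have finP: "finlen (pop op) (pw ?J M')" by (rule finlen_pw[OF fin]) simp
   then obtain l' :: "(nat => 'b) set => nat" where
    l': "\<And>A B. opmod (pop op) A ==> opmod (pop op) B ==> A \<subset> B ==> B <= pw ?J M' ==> l' A < l' B"
    unfolding finlen_def by metis
   obtain f where f: "opmap (pop op) (pw ?J M') (pop op') (pw ?J N') f" "bij_betw f (pw ?J M') (pw ?J N')"
    using less.prems(4) by (auto simp: opiso_def)
   note g = opmap_inv_into[OF f mP]
   let ?g = "inv_into (pw ?J M') f"
   have injg: "inj_on ?g (pw ?J N')" using g(2) by (simp add: bij_betw_def)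
   note dN = dsum_pw[OF e, of ?J]
   note d1 = dsum_pw[OF d, of ?J] and d2 = dsum_image[OF dN g mP]
   obtain t where t: "opmap op Q op' Y t" "bij_betw t Q Y" using i by (auto simp: opiso_def)
   have iQ: "opiso (pop op) (pw ?J Q) (pop op) (?g ` pw ?J Y)"
    by (rule opiso_trans[OF pw_opiso[OF t D(2)] opiso_image[OF g(1) injg dsumD(4)[OF dN]]])
   have "opiso (pop op) (pw ?J A) (pop op) (?g ` pw ?J B)"
    by (rule cancel[OF finP l' order_refl d1 d2 iQ])
   moreover have "opiso (pop op) (?g ` pw ?J B) (pop op') (pw ?J B)"
    by (rule opiso_sym[OF opiso_image[OF g(1) injg dsumD(5)[OF dN]] opmod_pw[OF E(3)]])
   ultimately have pAB: "opiso (pop op) (pw ?J A) (pop op') (pw ?J B)" by (rule opiso_trans)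
   have "A \<noteq> M'"
   proof
    assume "A = M'"
    then show False using D(4,6) ind by (auto simp: indec_def)
   qed
   then have "l A < l M'" using l[OF D(3) mM _ less.prems(2)] D(5) by blast
   then have "opiso op A op' B"
    using less.hyps[OF _ D(3) _ E(3) pAB] D(5) less.prems(2) by blast
   then show ?thesis by (rule opiso_dsum[OF d e i])
  qed
 qed
 then show ?thesis using assms finlen_opmod by blast
qed

lemma opmod_Inter:
 assumes "\<And>N. N : F ==> opmod op N" "F \<noteq> {}"
 shows "opmod op (\<Inter>F)"
 unfolding opmod_def
proof (intro conjI ballI allI)
 show "op w (x - y) = op w x - op w y" if "x : \<Inter>F" "y : \<Inter>F" for w x y
  using assms that opmod_op_diff by (metis Inter_iff ex_in_conv)
 show "0 : \<Inter>F" using assms(1) opmod_0 by auto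
 show "x - y : \<Inter>F" if "x : \<Inter>F" "y : \<Inter>F" for x y
  using that opmod_diff[OF assms(1)] by auto
 show "op w x : \<Inter>F" if "x : \<Inter>F" for w x
  using that opmod_op[OF assms(1)] by auto
qed

lemma finlen_finitely_generated:
 assumes "finlen op S"
 shows "\<exists>B. finite B \<and> B <= S \<and> (\<forall>N. opmod op N \<and> B <= N \<and> N <= S --> N = S)"
proof -
 have mS: "opmod op S" using assms by (rule finlen_opmod)
 from assms obtain l :: "'b set => nat" where
  l: "\<And>A B. opmod op A ==> opmod op B ==> A \<subset> B ==> B <= S ==> l A < l B"
  unfolding finlen_def by metis
 define gen where "gen B = \<Inter>{N. opmod op N \<and> B <= N \<and> N <= S}" for B
 have gen: "opmod op (gen B)" "B <= gen B" "gen B <= S" if "B <= S" for B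
 proof -
  show "opmod op (gen B)"
   unfolding gen_def using that mS by (intro opmod_Inter) auto
  show "B <= gen B" "gen B <= S" using that mS by (auto simp: gen_def)
 qed
 let ?P = "\<lambda>B. finite B \<and> B <= S"
 have "?P {}" by simp
 moreover have "\<forall>B. ?P B --> l (gen B) < Suc (l S)"
 proof (intro allI impI)
  fix B assume B: "?P B"
  show "l (gen B) < Suc (l S)"
  proof (cases "gen B = S")
   case False
   then have "gen B \<subset> S" using gen(3) B by blast
   then show ?thesis using l[OF gen(1) mS _ order_refl] B by (simp add: less_SucI)
  qed simp
 qed
 ultimately have "\<exists>B. ?P B \<and> (\<forall>B'. ?P B' --> l (gen B') \<le> l (gen B))"
  by (rule ex_has_greatest_nat)
 then obtain B where B: "?P B" and max: "\<And>B'. ?P B' ==> l (gen B') \<le> l (gen B)"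
  by metis
 have "gen B = S"
 proof (rule ccontr)
  assume "gen B \<noteq> S"
  then obtain s where s: "s : S" "s \<notin> gen B" using gen(3) B by blast
  have sub: "insert s B <= S" using s B by simp
  have "gen B <= gen (insert s B)" by (auto simp: gen_def)
  moreover have "s : gen (insert s B)" using gen(2)[OF sub] by simp
  ultimately have "l (gen B) < l (gen (insert s B))"
   using l[OF gen(1) gen(1)[OF sub] _ gen(3)[OF sub]] B s(2) by blast
  then show False using max[of "insert s B"] B s(1) by fastforce
 qed
 then have "N = S" if "opmod op N" "B <= N" "N <= S" for N
  using that by (auto simp: gen_def)
 then show ?thesis using B by blast
qed

section \<open>Modules over a group algebra\<close>

lemma basefield_simps [simp]:
 "carrier (basefield :: 'k::field ring) = UNIV" "a \<otimes>\<^bsub>(basefield :: 'k ring)\<^esub> b = a * b"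
 "a \<oplus>\<^bsub>(basefield :: 'k ring)\<^esub> b = a + b" "\<one>\<^bsub>(basefield :: 'k ring)\<^esub> = 1" "\<zero>\<^bsub>(basefield :: 'k ring)\<^esub> = 0"
 by (simp_all add: ring_of_type_algebra_def)

lemma grp_moduleD:
 fixes V :: "('k::field, 'm, 'g) gmod"
 assumes "grp_module G V"
 shows "abelian_group V"
  "\<And>c v. v : carrier V ==> c \<odot>\<^bsub>V\<^esub> v : carrier V"
  "\<And>c e v. v : carrier V ==> (c + e) \<odot>\<^bsub>V\<^esub> v = c \<odot>\<^bsub>V\<^esub> v \<oplus>\<^bsub>V\<^esub> e \<odot>\<^bsub>V\<^esub> v"
  "\<And>c v w. v : carrier V ==> w : carrier V ==> c \<odot>\<^bsub>V\<^esub> (v \<oplus>\<^bsub>V\<^esub> w) = c \<odot>\<^bsub>V\<^esub> v \<oplus>\<^bsub>V\<^esub> c \<odot>\<^bsub>V\<^esub> w"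
  "\<And>c e v. v : carrier V ==> (c * e) \<odot>\<^bsub>V\<^esub> v = c \<odot>\<^bsub>V\<^esub> (e \<odot>\<^bsub>V\<^esub> v)"
  "\<And>v. v : carrier V ==> 1 \<odot>\<^bsub>V\<^esub> v = v"
  "\<And>g v. g : carrier G ==> v : carrier V ==> act V g v : carrier V"
  "\<And>g v w. g : carrier G ==> v : carrier V ==> w : carrier V ==> act V g (v \<oplus>\<^bsub>V\<^esub> w) = act V g v \<oplus>\<^bsub>V\<^esub> act V g w"
  "\<And>g c v. g : carrier G ==> v : carrier V ==> act V g (c \<odot>\<^bsub>V\<^esub> v) = c \<odot>\<^bsub>V\<^esub> act V g v"
  "\<And>g h v. g : carrier G ==> h : carrier G ==> v : carrier V ==> act V (g \<otimes>\<^bsub>G\<^esub> h) v = act V g (act V h v)"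
  "\<And>v. v : carrier V ==> act V \<one>\<^bsub>G\<^esub> v = v"
  "Module.module basefield V"
proof -
 show m: "Module.module basefield V" using assms by (simp add: grp_module_def)
 then interpret m: Module.module basefield V .
 show "abelian_group V" ..
 show "\<And>c v. v : carrier V ==> c \<odot>\<^bsub>V\<^esub> v : carrier V" using m.smult_closed by simp
 show "\<And>c e v. v : carrier V ==> (c + e) \<odot>\<^bsub>V\<^esub> v = c \<odot>\<^bsub>V\<^esub> v \<oplus>\<^bsub>V\<^esub> e \<odot>\<^bsub>V\<^esub> v"
  using m.smult_l_distr by simp
 show "\<And>c v w. v : carrier V ==> w : carrier V ==> c \<odot>\<^bsub>V\<^esub> (v \<oplus>\<^bsub>V\<^esub> w) = c \<odot>\<^bsub>V\<^esub> v \<oplus>\<^bsub>V\<^esub> c \<odot>\<^bsub>V\<^esub> w"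
  using m.smult_r_distr by simp
 show "\<And>c e v. v : carrier V ==> (c * e) \<odot>\<^bsub>V\<^esub> v = c \<odot>\<^bsub>V\<^esub> (e \<odot>\<^bsub>V\<^esub> v)"
  using m.smult_assoc1 by simp
 show "\<And>v. v : carrier V ==> 1 \<odot>\<^bsub>V\<^esub> v = v" using m.smult_one by simp
qed (use assms in "simp_all add: grp_module_def")

lemma grp_moduleI:
 fixes V :: "('k::field, 'm, 'g) gmod"
 assumes "abelian_group V"
  "\<And>c v. v : carrier V ==> c \<odot>\<^bsub>V\<^esub> v : carrier V"
  "\<And>c e v. v : carrier V ==> (c + e) \<odot>\<^bsub>V\<^esub> v = c \<odot>\<^bsub>V\<^esub> v \<oplus>\<^bsub>V\<^esub> e \<odot>\<^bsub>V\<^esub> v"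
  "\<And>c v w. v : carrier V ==> w : carrier V ==> c \<odot>\<^bsub>V\<^esub> (v \<oplus>\<^bsub>V\<^esub> w) = c \<odot>\<^bsub>V\<^esub> v \<oplus>\<^bsub>V\<^esub> c \<odot>\<^bsub>V\<^esub> w"
  "\<And>c e v. v : carrier V ==> (c * e) \<odot>\<^bsub>V\<^esub> v = c \<odot>\<^bsub>V\<^esub> (e \<odot>\<^bsub>V\<^esub> v)"
  "\<And>v. v : carrier V ==> 1 \<odot>\<^bsub>V\<^esub> v = v"
  "\<And>g v. g : carrier G ==> v : carrier V ==> act V g v : carrier V"
  "\<And>g v w. g : carrier G ==> v : carrier V ==> w : carrier V ==> act V g (v \<oplus>\<^bsub>V\<^esub> w) = act V g v \<oplus>\<^bsub>V\<^esub> act V g w"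
  "\<And>g c v. g : carrier G ==> v : carrier V ==> act V g (c \<odot>\<^bsub>V\<^esub> v) = c \<odot>\<^bsub>V\<^esub> act V g v"
  "\<And>g h v. g : carrier G ==> h : carrier G ==> v : carrier V ==> act V (g \<otimes>\<^bsub>G\<^esub> h) v = act V g (act V h v)"
  "\<And>v. v : carrier V ==> act V \<one>\<^bsub>G\<^esub> v = v"
 shows "grp_module G V"
 unfolding grp_module_def
proof (intro conjI)
 show "Module.module basefield V"
  by (rule Module.moduleI) (use assms cring_from_type_algebra in simp_all)
qed (use assms in simp_all)

lemma grp_homD:
 assumes "f : grp_hom G V W"
 shows "\<And>v. v : carrier V ==> f v : carrier W"
  "\<And>v w. v : carrier V ==> w : carrier V ==> f (v \<oplus>\<^bsub>V\<^esub> w) = f v \<oplus>\<^bsub>W\<^esub> f w"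
  "\<And>c v. v : carrier V ==> f (c \<odot>\<^bsub>V\<^esub> v) = c \<odot>\<^bsub>W\<^esub> f v"
  "\<And>g v. g : carrier G ==> v : carrier V ==> f (act V g v) = act W g (f v)"
 using assms by (auto simp: grp_hom_def)

lemma grp_homI:
 assumes "\<And>v. v : carrier V ==> f v : carrier W"
  "\<And>v w. v : carrier V ==> w : carrier V ==> f (v \<oplus>\<^bsub>V\<^esub> w) = f v \<oplus>\<^bsub>W\<^esub> f w"
  "\<And>c v. v : carrier V ==> f (c \<odot>\<^bsub>V\<^esub> v) = c \<odot>\<^bsub>W\<^esub> f v"
  "\<And>g v. g : carrier G ==> v : carrier V ==> f (act V g v) = act W g (f v)"
 shows "f : grp_hom G V W"
 using assms by (auto simp: grp_hom_def)

lemma grp_hom_comp: "f : grp_hom G V W ==> g : grp_hom G W U ==> (\<lambda>v. g (f v)) : grp_hom G V U"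
 by (rule grp_homI) (simp_all add: grp_homD)

lemma grp_iso_trans: "grp_iso G V W ==> grp_iso G W U ==> grp_iso G V U"
 unfolding grp_iso_def using grp_hom_comp bij_betw_trans[unfolded comp_def] by blast

lemma grp_hom_inv_into:
 assumes V: "grp_module G V" and f: "f : grp_hom G V W" "bij_betw f (carrier V) (carrier W)"
 shows "inv_into (carrier V) f : grp_hom G W V"
proof -
 let ?g = "inv_into (carrier V) f"
 note v = grp_moduleD[OF V] and h = grp_homD[OF f(1)]
 interpret abelian_group V by (rule v(1))
 have inj: "inj_on f (carrier V)" using f(2) by (simp add: bij_betw_def)
 have g: "?g w : carrier V" "f (?g w) = w" if "w : carrier W" for w
  using that f(2) by (auto simp: bij_betw_def intro: inv_into_into f_inv_into_f)
 have gI: "?g y = x" if "x : carrier V" "f x = y" for x y using that inv_into_f_f[OF inj] by blast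
 show ?thesis
  by (rule grp_homI) (auto intro!: gI simp: g h v)
qed

lemma grp_iso_sym: "grp_module G V ==> grp_iso G V W ==> grp_iso G W V"
 unfolding grp_iso_def using grp_hom_inv_into bij_betw_inv_into by blast

subsection \<open>Models of modules inside abelian group types\<close>

lemma additive_finsum:
 assumes V: "abelian_group V" and W: "abelian_group W" and cl: "\<And>x. x : carrier V ==> h x : carrier W"
  and add: "\<And>x y. x : carrier V ==> y : carrier V ==> h (x \<oplus>\<^bsub>V\<^esub> y) = h x \<oplus>\<^bsub>W\<^esub> h y"
 shows "h \<zero>\<^bsub>V\<^esub> = \<zero>\<^bsub>W\<^esub>" "k : J \<rightarrow> carrier V ==> h (\<Oplus>\<^bsub>V\<^esub>j\<in>J. k j) = (\<Oplus>\<^bsub>W\<^esub>j\<in>J. h (k j))"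
  "x : carrier V ==> h (\<ominus>\<^bsub>V\<^esub> x) = \<ominus>\<^bsub>W\<^esub> h x"
proof -
 interpret V: abelian_group V by (rule V)
 interpret W: abelian_group W by (rule W)
 show z: "h \<zero>\<^bsub>V\<^esub> = \<zero>\<^bsub>W\<^esub>"
  using add[of "\<zero>\<^bsub>V\<^esub>" "\<zero>\<^bsub>V\<^esub>"] cl[of "\<zero>\<^bsub>V\<^esub>"] W.add.l_cancel_one'[of "h \<zero>\<^bsub>V\<^esub>" "h \<zero>\<^bsub>V\<^esub>"] by simp
 show "h (\<Oplus>\<^bsub>V\<^esub>j\<in>J. k j) = (\<Oplus>\<^bsub>W\<^esub>j\<in>J. h (k j))" if "k : J \<rightarrow> carrier V"
  using that by (induction J rule: infinite_finite_induct) (auto simp: z cl add Pi_def intro!: V.finsum_closed)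
 show "h (\<ominus>\<^bsub>V\<^esub> x) = \<ominus>\<^bsub>W\<^esub> h x" if "x : carrier V"
  using add[of "\<ominus>\<^bsub>V\<^esub> x" x] that cl z W.minus_equality[of "h (\<ominus>\<^bsub>V\<^esub> x)" "h x"] by (simp add: V.l_neg)
qed

lemma grp_module_null:
 fixes V :: "('k::field, 'm, 'g) gmod"
 assumes V: "grp_module G V"
 shows "v : carrier V ==> 0 \<odot>\<^bsub>V\<^esub> v = \<zero>\<^bsub>V\<^esub>" "c \<odot>\<^bsub>V\<^esub> \<zero>\<^bsub>V\<^esub> = \<zero>\<^bsub>V\<^esub>" "v : carrier V ==> (- c) \<odot>\<^bsub>V\<^esub> v = \<ominus>\<^bsub>V\<^esub> (c \<odot>\<^bsub>V\<^esub> v)"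
proof -
 note d = grp_moduleD[OF V]
 interpret V: abelian_group V by (rule d(1))
 show 0: "0 \<odot>\<^bsub>V\<^esub> v = \<zero>\<^bsub>V\<^esub>" if "v : carrier V" for v
  using d(3)[OF that, of 0 0] d(2)[OF that, of 0] by (simp add: V.add.l_cancel_one')
 show "c \<odot>\<^bsub>V\<^esub> \<zero>\<^bsub>V\<^esub> = \<zero>\<^bsub>V\<^esub>" by (rule additive_finsum(1)[OF d(1,1,2,4)])
 show "(- c) \<odot>\<^bsub>V\<^esub> v = \<ominus>\<^bsub>V\<^esub> (c \<odot>\<^bsub>V\<^esub> v)" if "v : carrier V"
  using d(3)[OF that, of "- c" c] V.minus_equality[of "(- c) \<odot>\<^bsub>V\<^esub> v" "c \<odot>\<^bsub>V\<^esub> v"] d(2)[OF that] 0[OF that] by simp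
qed

text \<open>Transport of a module given as a record to a module with operators k + G. Group elements
  outside the carrier act as the identity, so that they impose no condition.\<close>
definition model :: "'g monoid => ('k::field, 'm, 'g) gmod => ('k + 'g => 'a::ab_group_add => 'a) => 'a set =>
  ('m => 'a) => bool" where
 "model G V op S j \<longleftrightarrow> bij_betw j (carrier V) S \<and> opmod op S \<and>
  (\<forall>v\<in>carrier V. (\<forall>w\<in>carrier V. v \<oplus>\<^bsub>V\<^esub> w : carrier V \<and> j (v \<oplus>\<^bsub>V\<^esub> w) = j v + j w) \<and>
   (\<forall>c. c \<odot>\<^bsub>V\<^esub> v : carrier V \<and> j (c \<odot>\<^bsub>V\<^esub> v) = op (Inl c) (j v)) \<and>
   (\<forall>g\<in>carrier G. act V g v : carrier V \<and> j (act V g v) = op (Inr g) (j v)) \<and>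
   (\<forall>g. g \<notin> carrier G --> op (Inr g) (j v) = j v))"

lemma modelD:
 assumes "model G V op S j"
 shows "bij_betw j (carrier V) S" "opmod op S"
  "\<And>v w. v : carrier V ==> w : carrier V ==> v \<oplus>\<^bsub>V\<^esub> w : carrier V"
  "\<And>v w. v : carrier V ==> w : carrier V ==> j (v \<oplus>\<^bsub>V\<^esub> w) = j v + j w"
  "\<And>c v. v : carrier V ==> c \<odot>\<^bsub>V\<^esub> v : carrier V"
  "\<And>c v. v : carrier V ==> j (c \<odot>\<^bsub>V\<^esub> v) = op (Inl c) (j v)"
  "\<And>g v. g : carrier G ==> v : carrier V ==> act V g v : carrier V"
  "\<And>g v. g : carrier G ==> v : carrier V ==> j (act V g v) = op (Inr g) (j v)"
  "\<And>g v. g \<notin> carrier G ==> v : carrier V ==> op (Inr g) (j v) = j v"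
 using assms unfolding model_def by blast+

lemma model_exists:
 assumes V: "grp_module G V" and j: "inj_on j (carrier V)"
  and add: "\<And>v w. v : carrier V ==> w : carrier V ==> j (v \<oplus>\<^bsub>V\<^esub> w) = j v + j w"
 obtains op where "model G V op (j ` carrier V) j"
proof -
 note v = grp_moduleD[OF V]
 interpret abelian_group V by (rule v(1))
 let ?g = "inv_into (carrier V) j"
 define op where "op = (\<lambda>w y. case w of Inl c => j (c \<odot>\<^bsub>V\<^esub> ?g y)
  | Inr g => if g : carrier G then j (act V g (?g y)) else y)"
 have gj: "?g (j v) = v" if "v : carrier V" for v using inv_into_f_f[OF j that] .
 have j0: "j \<zero>\<^bsub>V\<^esub> = 0" using add[of "\<zero>\<^bsub>V\<^esub>" "\<zero>\<^bsub>V\<^esub>"] by simp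
 have jm: "j (\<ominus>\<^bsub>V\<^esub> v) = - j v" if "v : carrier V" for v
  using add[of v "\<ominus>\<^bsub>V\<^esub> v"] that j0 r_neg[OF that] by (simp add: eq_neg_iff_add_eq_0 add.commute)
 have jd: "j (v \<ominus>\<^bsub>V\<^esub> w) = j v - j w" if "v : carrier V" "w : carrier V" for v w
  using add[of v "\<ominus>\<^bsub>V\<^esub> w"] jm that by (simp add: a_minus_def)
 have opadd: "op w (j x + j y) = op w (j x) + op w (j y) \<and> op w (j x) : j ` carrier V"
  if "x : carrier V" "y : carrier V" for w x y
  using that by (cases w) (auto simp: op_def gj add[symmetric] v)
 have "model G V op (j ` carrier V) j"
  unfolding model_def
 proof (intro conjI ballI allI impI)
  show "bij_betw j (carrier V) (j ` carrier V)" using j by (simp add: bij_betw_def)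
  show "opmod op (j ` carrier V)"
   unfolding opmod_def
  proof (intro conjI ballI allI)
   show "0 : j ` carrier V" using j0 by force
   show "x - y : j ` carrier V" if "x : j ` carrier V" "y : j ` carrier V" for x y
   proof -
    obtain a b where "a : carrier V" "x = j a" "b : carrier V" "y = j b"
     using \<open>x : j ` carrier V\<close> \<open>y : j ` carrier V\<close> by blast
    then show ?thesis using jd[of a b] by (metis imageI minus_closed)
   qed
   show "op w x : j ` carrier V" if "x : j ` carrier V" for w x using that opadd by blast
   show "op w (x - y) = op w x - op w y" if "x : j ` carrier V" "y : j ` carrier V" for w x y
   proof -
    obtain a b where ab: "a : carrier V" "x = j a" "b : carrier V" "y = j b"
     using \<open>x : j ` carrier V\<close> \<open>y : j ` carrier V\<close> by blast
    have "op w (x - y) + op w y = op w x"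
     using opadd[of "a \<ominus>\<^bsub>V\<^esub> b" b w] ab jd[of a b] by simp
    then show ?thesis by (simp add: eq_diff_eq)
   qed
  qed
 qed (auto simp: op_def gj add v)
 then show ?thesis using that by blast
qed

lemma model_opiso_iff:
 assumes m: "model G V op S j" and m': "model G W op' T j'"
 shows "opiso op S op' T \<longleftrightarrow> grp_iso G V W"
proof
 note d = modelD[OF m] and d' = modelD[OF m']
 let ?g = "inv_into (carrier V) j" and ?g' = "inv_into (carrier W) j'"
 have g: "?g y : carrier V" "j (?g y) = y" if "y : S" for y
  using that d(1) by (auto simp: bij_betw_def intro: inv_into_into f_inv_into_f)
 have gj: "?g (j v) = v" if "v : carrier V" for v using that d(1) by (simp add: bij_betw_def)
 have g': "?g' y : carrier W" "j' (?g' y) = y" if "y : T" for y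
  using that d'(1) by (auto simp: bij_betw_def intro: inv_into_into f_inv_into_f)
 have gj': "?g' (j' v) = v" if "v : carrier W" for v using that d'(1) by (simp add: bij_betw_def)
 have jS: "j v : S" if "v : carrier V" for v using that d(1) by (auto simp: bij_betw_def)
 have jT: "j' v : T" if "v : carrier W" for v using that d'(1) by (auto simp: bij_betw_def)
 { assume "grp_iso G V W"
  then obtain f where f: "f : grp_hom G V W" "bij_betw f (carrier V) (carrier W)" by (auto simp: grp_iso_def)
  note h = grp_homD[OF f(1)]
  let ?F = "\<lambda>y. j' (f (?g y))"
  have Fj: "?F (j v) = j' (f v)" if "v : carrier V" for v using gj that by simp
  have add: "?F (x + y) = ?F x + ?F y" if xy: "x : S" "y : S" for x y
  proof -
   have "?F (j (?g x) + j (?g y)) = ?F (j (?g x \<oplus>\<^bsub>V\<^esub> ?g y))" using d(4) g xy by simp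
   also have "\<dots> = ?F x + ?F y" using d(3) d'(4) h g xy gj by simp
   finally show ?thesis using g xy by simp
  qed
  have "opmap op S op' T ?F"
   unfolding opmap_def
  proof (intro ballI conjI allI)
   fix x y assume xy: "x : S" "y : S"
   have "?F (x - y) + ?F y = ?F x" using add[of "x - y" y] opmod_diff[OF d(2) xy] xy by simp
   then show "?F (x - y) = ?F x - ?F y" by (simp add: eq_diff_eq)
  next
   fix x w assume x: "x : S"
   then obtain v where v: "v : carrier V" "x = j v" using g by metis
   show "?F (op w x) = op' w (?F x)"
   proof (cases w)
    case (Inl c)
    then show ?thesis using v Fj[of "c \<odot>\<^bsub>V\<^esub> v"] Fj[of v] d(5,6)[of v c] d'(6) h by simp
   next
    case (Inr a)
    show ?thesis
    proof (cases "a : carrier G")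
     case True
     then show ?thesis using Inr v Fj[of "act V a v"] Fj[of v] d(7,8)[of a v] d'(8) h by simp
    next
     case False
     then show ?thesis using Inr v Fj[of v] d(9) d'(9) h by simp
    qed
   qed
  next
   show "?F x : T" if "x : S" for x using that g jT h by simp
  qed
  moreover have "bij_betw ?F S T"
   using bij_betw_trans[OF bij_betw_trans[OF bij_betw_inv_into[OF d(1)] f(2)] d'(1)] by (simp add: comp_def)
  ultimately show "opiso op S op' T" unfolding opiso_def by blast
 next
  assume "opiso op S op' T"
  then obtain F where F: "opmap op S op' T F" "bij_betw F S T" by (auto simp: opiso_def)
  let ?f = "\<lambda>v. ?g' (F (j v))"
  have FT: "F (j v) : T" if "v : carrier V" for v using opmap_in[OF F(1)] jS that by blast
  have fI: "?f v = w" if "w : carrier W" "F (j v) = j' w" for v w using gj' that by simp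
  have fW: "?f v : carrier W" "j' (?f v) = F (j v)" if "v : carrier V" for v using g' FT that by auto
  have "?f : grp_hom G V W"
  proof (rule grp_homI)
   fix v w assume vw: "v : carrier V" "w : carrier V"
   show "?f (v \<oplus>\<^bsub>V\<^esub> w) = ?f v \<oplus>\<^bsub>W\<^esub> ?f w"
   proof (rule fI)
    show "F (j (v \<oplus>\<^bsub>V\<^esub> w)) = j' (?f v \<oplus>\<^bsub>W\<^esub> ?f w)"
     using d'(4) fW vw d(4) opmap_add[OF F(1) d(2)] jS by simp
   qed (use d'(3) fW vw in auto)
  next
   fix c v assume v: "v : carrier V"
   show "?f (c \<odot>\<^bsub>V\<^esub> v) = c \<odot>\<^bsub>W\<^esub> ?f v"
    by (rule fI) (use d'(5,6) fW v d(6) opmap_op[OF F(1)] jS in auto)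
  next
   fix c v assume c: "c : carrier G" and v: "v : carrier V"
   show "?f (act V c v) = act W c (?f v)"
    by (rule fI) (use d'(7,8) fW v c d(8) opmap_op[OF F(1)] jS in auto)
  qed (use fW in auto)
  moreover have "bij_betw ?f (carrier V) (carrier W)"
   using bij_betw_trans[OF bij_betw_trans[OF d(1) F(2)] bij_betw_inv_into[OF d'(1)]] by (simp add: comp_def)
  ultimately show "grp_iso G V W" unfolding grp_iso_def by blast }
qed

definition zext :: "'i set => ('m => 'a::zero) => ('i => 'm) => 'i => 'a" where
 "zext J j x = (\<lambda>i. if i : J then j (x i) else 0)"

lemma model_dir_power:
 assumes m: "model G V op S j"
 shows "model G (dir_power n V) (pop op) (pw {..<n} S) (zext {..<n} j)"
proof -
 note d = modelD[OF m]
 let ?J = "{..<n}" and ?g = "inv_into (carrier V) j"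
 have g: "?g y : carrier V" "j (?g y) = y" if "y : S" for y
  using that d(1) by (auto simp: bij_betw_def intro: inv_into_into f_inv_into_f)
 have gj: "?g (j v) = v" if "v : carrier V" for v using that d(1) by (simp add: bij_betw_def)
 have op0: "op w 0 = 0" for w using opmod_op_0[OF d(2)] .
 have xi: "x i : carrier V" if "x : ?J \<rightarrow>\<^sub>E carrier V" "i < n" for x i using that by auto
 show ?thesis
  unfolding model_def
 proof (intro conjI ballI allI impI)
  show "bij_betw (zext ?J j) (carrier (dir_power n V)) (pw ?J S)"
  proof (rule bij_betwI[of _ _ _ "\<lambda>y. \<lambda>i\<in>?J. ?g (y i)"])
   show "zext ?J j : carrier (dir_power n V) \<rightarrow> pw ?J S"
    using bij_betwE[OF d(1)] by (auto simp: dir_power_def zext_def pw_def)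
   show "(\<lambda>y. \<lambda>i\<in>?J. ?g (y i)) : pw ?J S \<rightarrow> carrier (dir_power n V)"
    using g by (auto simp: dir_power_def pw_def)
   show "(\<lambda>i\<in>?J. ?g (zext ?J j x i)) = x" if "x : carrier (dir_power n V)" for x
    using that gj by (auto simp: dir_power_def zext_def fun_eq_iff PiE_def extensional_def)
   show "zext ?J j (\<lambda>i\<in>?J. ?g (y i)) = y" if "y : pw ?J S" for y
    using that g by (auto simp: zext_def fun_eq_iff pw_def)
  qed
  show "opmod (pop op) (pw ?J S)" by (rule opmod_pw[OF d(2)])
 qed (auto simp: dir_power_def zext_def pop_def fun_eq_iff op0 d xi)
qed

text \<open>More operators leave fewer submodules, so bounded rank over k is enough for bounded rank
  over k[G].\<close>
lemma finlen_coarser: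
 assumes "finlen op1 S" "opmod op2 S" "\<And>c. \<exists>w. \<forall>y\<in>S. op2 w y = op1 c y"
 shows "finlen op2 S"
proof -
 have *: "opmod op1 A" if "opmod op2 A" "A <= S" for A
  unfolding opmod_def
 proof (intro conjI ballI allI)
  fix c x assume x: "x : A"
  obtain w where w: "\<forall>y\<in>S. op2 w y = op1 c y" using assms(3) by blast
  show "op1 c x : A" using w x that opmod_op[OF that(1) x, of w] by auto
  fix y assume y: "y : A"
  have "x - y : A" using opmod_diff[OF that(1) x y] .
  then show "op1 c (x - y) = op1 c x - op1 c y"
   using w x y that(2) opmod_op_diff[OF that(1) x y, of w] by (simp add: subset_iff)
 qed (use that opmod_rules in auto)
 from assms(1) obtain l :: "'b set => nat" where
  l: "\<And>A B. opmod op1 A ==> opmod op1 B ==> A \<subset> B ==> B <= S ==> l A < l B"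
  unfolding finlen_def by metis
 have "l A < l B" if "opmod op2 A" "opmod op2 B" "A \<subset> B" "B <= S" for A B
  using l[OF *[OF that(1)] *[OF that(2,4)] that(3,4)] that by blast
 then show ?thesis unfolding finlen_def using assms(2) by blast
qed

definition kscal :: "'k::field => (nat => 'g => 'k) => nat => 'g => 'k" where
 "kscal = pop (pop (\<lambda>c x. c * x))"

lemma finlen_kspace:
 "finite J ==> finlen (kscal :: 'k::field => _) (pw {..<n} (pw (J :: 'g set) UNIV))"
 unfolding kscal_def
proof (intro finlen_pw)
 have m: "opmod (\<lambda>c x::'k. c * x) UNIV" by (simp add: opmod_def algebra_simps)
 have "A = {0}" if A: "opmod (\<lambda>c x::'k. c * x) A" "A \<noteq> UNIV" for A
 proof (rule ccontr)
  assume "A \<noteq> {0}"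
  then obtain a where a: "a : A" "a \<noteq> 0" using opmod_0[OF A(1)] by blast
  have "x : A" for x using opmod_op[OF A(1) a(1), of "x / a"] a(2) by simp
  then show False using A(2) by blast
 qed
 then show "finlen (\<lambda>c x::'k. c * x) UNIV"
  unfolding finlen_def using m by (intro conjI exI[of _ "\<lambda>A. if A = UNIV then 1 else 0"]) auto
qed auto

text \<open>A module embedded k-linearly in coordinates over k. The group does not enter, so the
  notion restricts to submodules and to subgroups; J will be the group itself, as a basis of its
  group algebra.\<close>
definition kemb :: "nat => 'g set => ('k::field, 'm, 'h) gmod => ('m => nat => 'g => 'k) => bool" where
 "kemb n J V j \<longleftrightarrow> inj_on j (carrier V) \<and> j ` carrier V <= pw {..<n} (pw J UNIV) \<and>
  (\<forall>v\<in>carrier V. (\<forall>w\<in>carrier V. j (v \<oplus>\<^bsub>V\<^esub> w) = j v + j w) \<and> (\<forall>c. j (c \<odot>\<^bsub>V\<^esub> v) = kscal c (j v)))"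

lemma kemb_model:
 assumes V: "grp_module G V" and j: "kemb n J V j" and "finite J"
 obtains op where "model G V op (j ` carrier V) j" "finlen op (j ` carrier V)"
proof -
 obtain op where op: "model G V op (j ` carrier V) j"
  using model_exists[OF V, of j] j by (auto simp: kemb_def)
 note d = modelD[OF op]
 have e: "op (Inl c) y = kscal c y" if "y : j ` carrier V" for c y
  using that j d(6) by (force simp: kemb_def)
 have "opmod kscal (j ` carrier V)"
  unfolding opmod_def
 proof (intro conjI ballI allI)
  fix w x assume x: "x : j ` carrier V"
  show "kscal w x : j ` carrier V" using opmod_op[OF d(2) x, of "Inl w"] e[OF x] by simp
  fix y assume y: "y : j ` carrier V"
  show "kscal w (x - y) = kscal w x - kscal w y" by (simp add: kscal_def pop_def fun_eq_iff algebra_simps)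
 qed (use opmod_rules[OF d(2)] in auto)
 then have "finlen kscal (j ` carrier V)"
  using finlen_subset[OF finlen_kspace[OF \<open>finite J\<close>]] j by (auto simp: kemb_def)
 then have "finlen op (j ` carrier V)"
  by (rule finlen_coarser[OF _ d(2)]) (use e in blast)
 then show ?thesis using that op by blast
qed

lemma projective_kemb:
 fixes W :: "('k::field, 'w, 'g) gmod"
 assumes "projective_module G W"
 obtains n j where "kemb n (carrier G) W j"
proof -
 obtain n i p where i: "i : grp_hom G W (dir_power n (group_algebra G))" and p: "\<forall>v\<in>carrier W. p (i v) = v"
  using assms by (auto simp: projective_module_def)
 note h = grp_homD[OF i]
 define j where "j = (\<lambda>v. zext {..<n} (zext (carrier G) (\<lambda>x. x)) (i v))"
 have iv: "i v : {..<n} \<rightarrow>\<^sub>E (carrier G \<rightarrow>\<^sub>E UNIV)" if "v : carrier W" for v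
  using h(1)[OF that] by (simp add: dir_power_def group_algebra_def)
 have "kemb n (carrier G) W j"
  unfolding kemb_def
 proof (intro conjI ballI allI)
  show "inj_on j (carrier W)"
  proof (rule inj_onI)
   fix v w assume v: "v : carrier W" and w: "w : carrier W" and e: "j v = j w"
   have "i v = i w"
   proof (rule PiE_ext[OF iv[OF v] iv[OF w]])
    fix t assume t: "t : {..<n}"
    show "i v t = i w t"
    proof (rule PiE_ext[of _ "carrier G" "\<lambda>_. UNIV"])
     fix x assume "x : carrier G"
     then show "i v t x = i w t x" using t fun_cong[OF fun_cong[OF e, of t], of x] by (simp add: j_def zext_def)
    qed (use iv[OF v] iv[OF w] t in auto)
   qed
   then show "v = w" using p v w by metis
  qed
  show "j ` carrier W <= pw {..<n} (pw (carrier G) UNIV)" by (auto simp: j_def zext_def pw_def)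
 qed (auto simp: j_def h zext_def fun_eq_iff dir_power_def group_algebra_def kscal_def pop_def)
 then show ?thesis using that by blast
qed

lemma kemb_finitely_generated:
 assumes V: "grp_module G V" and j: "kemb n J V j" "finite J"
 shows "fg_module G V"
proof -
 obtain op where m: "model G V op (j ` carrier V) j" and f: "finlen op (j ` carrier V)"
  using kemb_model[OF V j] .
 note d = modelD[OF m]
 interpret m: Module.module basefield V using grp_moduleD(12)[OF V] .
 from finlen_finitely_generated[OF f] obtain B where B: "finite B" "B <= j ` carrier V"
  "\<And>N. opmod op N ==> B <= N ==> N <= j ` carrier V ==> N = j ` carrier V"
  by metis
 obtain S where S: "finite S" "S <= carrier V" "B = j ` S" using finite_subset_image[OF B(1,2)] by blast
 have "N = carrier V" if N: "grp_submodule G V N" "S <= N" for N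
 proof -
  have sm: "submodule N basefield V" and actN: "\<And>g. g : carrier G ==> act V g ` N <= N"
   using N(1) by (auto simp: grp_submodule_def)
  note s = m.submoduleE[OF sm]
  have NV: "N <= carrier V" by (rule s(1))
  have "opmod op (j ` N)"
   unfolding opmod_def
  proof (intro conjI ballI allI)
   have j0: "j \<zero>\<^bsub>V\<^esub> = 0" using d(4)[of "\<zero>\<^bsub>V\<^esub>" "\<zero>\<^bsub>V\<^esub>"] by simp
   have z: "\<zero>\<^bsub>V\<^esub> : N" using subgroup.one_closed[OF submodule.axioms(1)[OF sm]] by simp
   then show "0 : j ` N" using j0 by force
   have "j v - j w : j ` N" if "v : N" "w : N" for v w
   proof -
    have vw: "v : carrier V" "w : carrier V" using that NV by auto
    have "j (v \<ominus>\<^bsub>V\<^esub> w) + j w = j (v \<ominus>\<^bsub>V\<^esub> w \<oplus>\<^bsub>V\<^esub> w)" using d(4) vw by simp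
    also have "v \<ominus>\<^bsub>V\<^esub> w \<oplus>\<^bsub>V\<^esub> w = v" using vw by (simp add: a_minus_def m.a_assoc m.l_neg)
    finally have "j v - j w = j (v \<ominus>\<^bsub>V\<^esub> w)" by (metis add_diff_cancel_right')
    moreover have "v \<ominus>\<^bsub>V\<^esub> w : N" using s that by (simp add: a_minus_def)
    ultimately show ?thesis by simp
   qed
   then show "x - y : j ` N" if "x : j ` N" "y : j ` N" for x y using that by blast
   show "op w x : j ` N" if "x : j ` N" for w x
   proof -
    obtain v where v: "v : N" "x = j v" using \<open>x : j ` N\<close> by blast
    have vV: "v : carrier V" using v NV by blast
    show ?thesis
    proof (cases w)
     case (Inl c)
     have "c \<odot>\<^bsub>V\<^esub> v : N" using s(4)[of c v] v by simp
     then show ?thesis using Inl v d(6)[OF vV, of c] by (metis imageI)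
    next
     case (Inr g)
     then show ?thesis using v d(8,9)[of g v] vV actN[of g] by (cases "g : carrier G") (metis imageI image_subset_iff)+
    qed
   qed
   show "op w (x - y) = op w x - op w y" if "x : j ` N" "y : j ` N" for w x y
    using that NV opmod_op_diff[OF d(2)] by blast
  qed
  then have "j ` N = j ` carrier V" using B(3)[of "j ` N"] N(2) S(3) NV by blast
  then show "N = carrier V" using NV d(1) by (metis bij_betw_imp_inj_on inj_on_image_eq_iff order_refl)
 qed
 then show ?thesis using V S unfolding fg_module_def by blast
qed

text \<open>Only W is projective, and so of bounded rank; the hypothesis on powers embeds M in W^n,
  which makes M a module of the same kind.\<close>
theorem power_cancel:
 fixes W :: "('k::field, 'w, 'g) gmod" and M :: "('k, 'm, 'g) gmod"
 assumes W: "projective_module G W" and fin: "finite (carrier G)" and M: "grp_module G M"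
  and n: "n > 0" and iso: "grp_iso G (dir_power n M) (dir_power n W)"
 shows "grp_iso G M W"
proof -
 have gW: "grp_module G W" using W by (simp add: projective_module_def)
 note w = grp_moduleD[OF gW] and m = grp_moduleD[OF M]
 interpret m: abelian_group M by (rule m(1))
 obtain n' j where j: "kemb n' (carrier G) W j" using projective_kemb[OF W] .
 obtain op where op: "model G W op (j ` carrier W) j" and fl: "finlen op (j ` carrier W)"
  using kemb_model[OF gW j fin] .
 obtain f where f: "f : grp_hom G (dir_power n M) (dir_power n W)"
  "bij_betw f (carrier (dir_power n M)) (carrier (dir_power n W))" using iso by (auto simp: grp_iso_def)
 note mp = model_dir_power[OF op, of n]
 define e where "e = (\<lambda>v. \<lambda>i\<in>{..<n}. if i = 0 then v else \<zero>\<^bsub>M\<^esub>)"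
 have e: "e v : carrier (dir_power n M)" if "v : carrier M" for v
  using that by (auto simp: e_def dir_power_def)
 define j' where "j' = (\<lambda>v. zext {..<n} j (f (e v)))"
 have "inj_on j' (carrier M)"
 proof (rule inj_onI)
  fix v w assume v: "v : carrier M" and w: "w : carrier M" and eq: "j' v = j' w"
  have "f (e v) = f (e w)"
   using eq modelD(1)[OF mp] grp_homD(1)[OF f(1)] e v w by (simp add: j'_def bij_betw_def inj_on_def)
  then have "e v = e w" using f(2) e v w by (simp add: bij_betw_def inj_on_def)
  then have "e v 0 = e w 0" by simp
  then show "v = w" using n by (simp add: e_def)
 qed
 moreover have "j' (v \<oplus>\<^bsub>M\<^esub> w) = j' v + j' w" if v: "v : carrier M" "w : carrier M" for v w
 proof -
  have "e (v \<oplus>\<^bsub>M\<^esub> w) = e v \<oplus>\<^bsub>dir_power n M\<^esub> e w" using v by (auto simp: e_def dir_power_def fun_eq_iff)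
  then show ?thesis
   using grp_homD(2)[OF f(1) e[OF v(1)] e[OF v(2)]] modelD(4)[OF mp grp_homD(1)[OF f(1) e[OF v(1)]] grp_homD(1)[OF f(1) e[OF v(2)]]]
   by (simp add: j'_def)
 qed
 ultimately obtain op' where op': "model G M op' (j' ` carrier M) j'" using model_exists[OF M] by metis
 have "opiso (pop op') (pw {..<n} (j' ` carrier M)) (pop op) (pw {..<n} (j ` carrier W))"
  using model_opiso_iff[OF model_dir_power[OF op'] mp] iso by blast
 then have "opiso (pop op) (pw {..<n} (j ` carrier W)) (pop op') (pw {..<n} (j' ` carrier M))"
  by (rule opiso_sym[OF _ opmod_pw[OF modelD(2)[OF op']]])
 then have "opiso op (j ` carrier W) op' (j' ` carrier M)"
  by (rule pw_cancel[OF fl modelD(2)[OF op'] n])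
 then have "opiso op' (j' ` carrier M) op (j ` carrier W)" by (rule opiso_sym[OF _ modelD(2)[OF op]])
 then show ?thesis using model_opiso_iff[OF op' op] by blast
qed

section \<open>Finite groups acting on a field\<close>

lemma (in abelian_monoid) finsum_swap:
 assumes "finite A" "finite B" "\<And>a b. a : A ==> b : B ==> f a b : carrier G"
 shows "(\<Oplus>a\<in>A. \<Oplus>b\<in>B. f a b) = (\<Oplus>b\<in>B. \<Oplus>a\<in>A. f a b)"
 using assms(1,3)
proof (induction A rule: finite_induct)
 case empty
 have "(\<Oplus>b\<in>B. \<zero>) = \<zero>" by (rule add.finprod_one)
 then show ?case by simp
next
 case (insert x A)
 have "(\<Oplus>b\<in>B. \<Oplus>a\<in>insert x A. f a b) = (\<Oplus>b\<in>B. f x b \<oplus> (\<Oplus>a\<in>A. f a b))"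
  by (intro finsum_cong') (use insert in "auto simp: Pi_def")
 also have "\<dots> = (\<Oplus>b\<in>B. f x b) \<oplus> (\<Oplus>b\<in>B. \<Oplus>a\<in>A. f a b)"
  by (intro finsum_addf) (use insert in "auto simp: Pi_def")
 finally show ?case using insert by (simp add: Pi_def)
qed

text \<open>H will be the kernel of the action and F the fixed field. The trace is taken over G, not
  over G/H, and so is |H| times the trace of K over F.\<close>
locale field_action = K?: field K + G: group G for K :: "('a, 'm) ring_scheme" (structure) and G :: "'g monoid" (structure) +
 fixes s :: "'g => 'a => 'a"
 assumes fin: "finite (carrier G)"
  and s_hom: "g : carrier G ==> s g : ring_hom K K"
  and s_mult: "g : carrier G ==> h : carrier G ==> a : carrier K ==> s (g \<otimes>\<^bsub>G\<^esub> h) a = s g (s h a)"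
  and s_one: "a : carrier K ==> s \<one>\<^bsub>G\<^esub> a = a"
begin

lemma s_in [simp, intro]: "g : carrier G ==> a : carrier K ==> s g a : carrier K"
 and s_m [simp]: "g : carrier G ==> a : carrier K ==> b : carrier K ==> s g (a \<otimes> b) = s g a \<otimes> s g b"
 and s_a [simp]: "g : carrier G ==> a : carrier K ==> b : carrier K ==> s g (a \<oplus> b) = s g a \<oplus> s g b"
 and s_1 [simp]: "g : carrier G ==> s g \<one> = \<one>"
 using ring_hom_memE[OF s_hom] by auto

lemma s_rhc: "g : carrier G ==> ring_hom_cring K K (s g)"
 by (intro ring_hom_cringI K.is_cring ring_hom_ringI2 K.ring_axioms) (simp_all add: s_hom ring_hom_ringI2 K.ring_axioms)

lemma s_0 [simp]: "g : carrier G ==> s g \<zero> = \<zero>"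
 using ring_hom_cring.hom_zero[OF s_rhc] .

lemma s_finsum: "g : carrier G ==> f : A \<rightarrow> carrier K ==> s g (\<Oplus>i\<in>A. f i) = (\<Oplus>i\<in>A. s g (f i))"
 using ring_hom_cring.hom_finsum[OF s_rhc, of g f A] by (simp add: comp_def)

lemma s_inv [simp]: "g : carrier G ==> a : carrier K ==> s g (s (inv\<^bsub>G\<^esub> g) a) = a"
 "g : carrier G ==> a : carrier K ==> s (inv\<^bsub>G\<^esub> g) (s g a) = a"
 using s_mult[of g "inv\<^bsub>G\<^esub> g" a] s_mult[of "inv\<^bsub>G\<^esub> g" g a] by (simp_all add: s_one)

definition H where "H = {g : carrier G. \<forall>a\<in>carrier K. s g a = a}"
definition F where "F = {a : carrier K. \<forall>g\<in>carrier G. s g a = a}"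
definition Tr where "Tr a = (\<Oplus>x\<in>carrier G. s x a)"
definition nH where "nH = add_pow K (card H) \<one>"
definition u where "u = inv\<^bsub>K\<^esub> nH"

lemma nH_in [simp]: "nH : carrier K" by (simp add: nH_def)

lemma H_sub: "H <= carrier G" "finite H"
 using fin by (auto simp: H_def)

lemma H_subgroup: "subgroup H G"
proof (rule G.subgroupI)
 show "inv\<^bsub>G\<^esub> a : H" if "a : H" for a
  using that s_inv(2)[of a] by (auto simp: H_def)
 show "a \<otimes>\<^bsub>G\<^esub> b : H" if "a : H" "b : H" for a b
  using that by (auto simp: H_def s_mult)
qed (auto simp: H_def s_one)

lemma inv_in_H_iff: "x : carrier G ==> inv\<^bsub>G\<^esub> x : H \<longleftrightarrow> x : H"
 using subgroup.m_inv_closed[OF H_subgroup] by (metis G.inv_inv)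

lemma F_in: "a : F ==> a : carrier K" by (simp add: F_def)

lemma Tr_in [simp]: "a : carrier K ==> Tr a : carrier K"
 unfolding Tr_def by (intro K.finsum_closed) auto

lemma bij_lmult: "g : carrier G ==> bij_betw (\<lambda>x. g \<otimes>\<^bsub>G\<^esub> x) (carrier G) (carrier G)"
 by (rule bij_betwI[of _ _ _ "\<lambda>x. inv\<^bsub>G\<^esub> g \<otimes>\<^bsub>G\<^esub> x"]) (auto simp: G.m_assoc[symmetric])

lemma finsum_lmult:
 assumes "g : carrier G" "f : carrier G \<rightarrow> carrier K"
 shows "(\<Oplus>x\<in>carrier G. f (g \<otimes>\<^bsub>G\<^esub> x)) = (\<Oplus>x\<in>carrier G. f x)"
 using K.finsum_reindex[of f "\<lambda>x. g \<otimes>\<^bsub>G\<^esub> x" "carrier G"] bij_lmult[OF assms(1)] assms(2)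
 by (simp add: bij_betw_def)

lemma finsum_inv:
 assumes "f : carrier G \<rightarrow> carrier K"
 shows "(\<Oplus>x\<in>carrier G. f (inv\<^bsub>G\<^esub> x)) = (\<Oplus>x\<in>carrier G. f x)"
proof -
 have "bij_betw (\<lambda>x. inv\<^bsub>G\<^esub> x) (carrier G) (carrier G)"
  by (rule bij_betwI[of _ _ _ "\<lambda>x. inv\<^bsub>G\<^esub> x"]) auto
 then show ?thesis
  using K.finsum_reindex[of f "\<lambda>x. inv\<^bsub>G\<^esub> x" "carrier G"] assms by (simp add: bij_betw_def)
qed

lemma Tr_F [simp]: "a : carrier K ==> Tr a : F"
proof -
 assume a: "a : carrier K"
 have "s g (Tr a) = Tr a" if g: "g : carrier G" for g
 proof -
  have "s g (Tr a) = (\<Oplus>x\<in>carrier G. s g (s x a))" unfolding Tr_def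
   by (rule s_finsum) (use a g in auto)
  also have "\<dots> = (\<Oplus>x\<in>carrier G. s (g \<otimes>\<^bsub>G\<^esub> x) a)"
   by (intro K.finsum_cong') (use a g in "auto simp: s_mult")
  also have "\<dots> = Tr a" unfolding Tr_def
   by (rule finsum_lmult[OF g, of "\<lambda>x. s x a"]) (use a in auto)
  finally show ?thesis .
 qed
 then show ?thesis using a by (simp add: F_def)
qed

lemma Tr_add: "a : carrier K ==> b : carrier K ==> Tr (a \<oplus> b) = Tr a \<oplus> Tr b"
proof -
 assume ab: "a : carrier K" "b : carrier K"
 have "Tr (a \<oplus> b) = (\<Oplus>x\<in>carrier G. s x a \<oplus> s x b)" unfolding Tr_def
  by (intro K.finsum_cong') (use ab in auto)
 also have "\<dots> = Tr a \<oplus> Tr b" unfolding Tr_def by (intro K.finsum_addf) (use ab in auto)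
 finally show ?thesis .
qed

lemma Tr_lin: "c : F ==> a : carrier K ==> Tr (c \<otimes> a) = c \<otimes> Tr a"
proof -
 assume c: "c : F" and a: "a : carrier K"
 have "Tr (c \<otimes> a) = (\<Oplus>x\<in>carrier G. c \<otimes> s x a)" unfolding Tr_def
  by (intro K.finsum_cong') (use a c in "auto simp: F_def")
 also have "\<dots> = c \<otimes> Tr a" unfolding Tr_def
  by (intro K.finsum_rdistr[symmetric]) (use a c fin in "auto simp: F_def")
 finally show ?thesis .
qed

lemma subring_F: "subring F K"
proof (rule K.subringI)
 show "\<ominus> a : F" if "a : F" for a
  using that ring_hom_cring.hom_a_inv[OF s_rhc] by (auto simp: F_def)
qed (auto simp: F_def)

lemma subfield_F: "subfield F K"
proof (rule K.subfieldI'[OF subring_F])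
 fix k assume k: "k : F - {\<zero>}"
 then have kU: "k : carrier K" "k \<noteq> \<zero>" by (auto simp: F_def)
 then have i: "inv\<^bsub>K\<^esub> k : carrier K" "inv\<^bsub>K\<^esub> k \<otimes> k = \<one>" using K.field_Units by auto
 have "s g (inv\<^bsub>K\<^esub> k) = inv\<^bsub>K\<^esub> k" if g: "g : carrier G" for g
 proof -
  have "s g k = k" using k g by (simp add: F_def)
  then have "s g (inv\<^bsub>K\<^esub> k) \<otimes> k = s g (inv\<^bsub>K\<^esub> k \<otimes> k)" using s_m[OF g i(1) kU(1)] by simp
  also have "\<dots> = inv\<^bsub>K\<^esub> k \<otimes> k" using i g by simp
  finally show ?thesis using K.m_rcancel[OF kU(2,1), of "s g (inv\<^bsub>K\<^esub> k)" "inv\<^bsub>K\<^esub> k"] i g by simp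
 qed
 then show "inv\<^bsub>K\<^esub> k : F" using i by (simp add: F_def)
qed

text \<open>The K-span, in functions on G, of the evaluations of the x in G at elements of
  K.\<close>
inductive Lam :: "('g => 'a) => bool" where
 base: "a : carrier K ==> b : carrier K ==> Lam (\<lambda>x. a \<otimes> s x b)"
| plus: "Lam f ==> Lam f' ==> Lam (\<lambda>x. f x \<oplus> f' x)"
| ext: "Lam f ==> (\<And>x. x : carrier G ==> f x = f' x) ==> Lam f'"

lemma Lam_in: "Lam f ==> x : carrier G ==> f x : carrier K"
 by (induction rule: Lam.induct) auto

lemma Lam_scale: "Lam f ==> c : carrier K ==> Lam (\<lambda>x. c \<otimes> f x)"
proof (induction rule: Lam.induct)
 case (base a b) then show ?case
  by (intro Lam.ext[OF Lam.base[of "c \<otimes> a" b]]) (auto simp: K.m_assoc)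
next
 case (plus f f') then show ?case
  by (intro Lam.ext[OF Lam.plus[OF plus.IH]]) (auto simp: K.r_distr Lam_in)
next
 case (ext f f') then show ?case by (intro Lam.ext[OF ext.IH]) auto
qed

lemma Lam_shift: "Lam f ==> c : carrier K ==> Lam (\<lambda>x. s x c \<otimes> f x)"
proof (induction rule: Lam.induct)
 case (base a b) then show ?case
  by (intro Lam.ext[OF Lam.base[of a "c \<otimes> b"]]) (auto simp: K.m_ac)
next
 case (plus f f') then show ?case
  by (intro Lam.ext[OF Lam.plus[OF plus.IH]]) (auto simp: K.r_distr Lam_in)
next
 case (ext f f') then show ?case by (intro Lam.ext[OF ext.IH]) auto
qed

text \<open>Artin's argument. If y moves c, then multiplying f(x) by s_x(c) - s_y(c) kills the value
  at y and multiplies the value at all of H by the nonzero constant c - s_y(c), which can be divided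
  out.\<close>
lemma Lam_separate:
 assumes "finite Y" "Y <= carrier G - H"
 shows "\<exists>f. Lam f \<and> (\<forall>h\<in>H. f h = \<one>) \<and> (\<forall>x\<in>Y. f x = \<zero>)"
 using assms
proof (induction Y rule: finite_induct)
 case empty
 have "Lam (\<lambda>x. \<one> \<otimes> s x \<one>)" by (rule Lam.base) auto
 then show ?case using H_sub by (intro exI[of _ "\<lambda>x. \<one> \<otimes> s x \<one>"]) auto
next
 case (insert y Y)
 then obtain f where f: "Lam f" "\<forall>h\<in>H. f h = \<one>" "\<forall>x\<in>Y. f x = \<zero>" by auto
 have y: "y : carrier G" "y \<notin> H" using insert.prems by auto
 then obtain c where c: "c : carrier K" "s y c \<noteq> c" by (auto simp: H_def)
 let ?d = "c \<ominus> s y c"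
 have d: "?d : carrier K" "?d \<noteq> \<zero>" using c y K.r_right_minus_eq[of c "s y c"] by auto
 then have dU: "inv\<^bsub>K\<^esub> ?d : carrier K" "inv\<^bsub>K\<^esub> ?d \<otimes> ?d = \<one>" using K.field_Units by auto
 let ?m = "\<ominus> s y c"
 have m: "?m : carrier K" using c y by simp
 let ?f = "\<lambda>x. inv\<^bsub>K\<^esub> ?d \<otimes> (s x c \<otimes> f x \<oplus> ?m \<otimes> f x)"
 have "Lam ?f"
  by (intro Lam_scale Lam.plus Lam_shift) (use f dU(1) c(1) m in auto)
 moreover have "?f h = \<one>" if "h : H" for h
  using that f(2) c(1) m dU d by (auto simp: H_def a_minus_def)
 moreover have "?f x = \<zero>" if "x : insert y Y" for x
 proof (cases "x = y")
  case True
  have fy: "f y : carrier K" using Lam_in[OF f(1) y(1)] .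
  have "s y c \<otimes> f y \<oplus> ?m \<otimes> f y = \<zero>"
   using fy c y m by (simp add: K.l_distr[symmetric] K.r_neg)
  then show ?thesis using True dU by simp
 next
  case False
  then have "f x = \<zero>" using that f(3) by auto
  then show ?thesis using insert.prems that c(1) m dU by auto
 qed
 ultimately show ?case by blast
qed

lemma Lam_indicator: "Lam (\<lambda>x. if x : H then \<one> else \<zero>)"
proof -
 obtain f where f: "Lam f" "\<forall>h\<in>H. f h = \<one>" "\<forall>x\<in>carrier G - H. f x = \<zero>"
  using Lam_separate[of "carrier G - H"] fin by auto
 then show ?thesis by (intro Lam.ext[OF f(1)]) auto
qed

lemma finsum_indicator:
 assumes "c : carrier K"
 shows "(\<Oplus>x\<in>carrier G. if x : H then c else \<zero>) = nH \<otimes> c"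
proof -
 have "(\<Oplus>x\<in>carrier G. if x : H then c else \<zero>) = (\<Oplus>x\<in>H \<union> (carrier G - H). if x : H then c else \<zero>)"
  using H_sub by (simp add: Un_absorb1)
 also have "\<dots> = (\<Oplus>x\<in>H. if x : H then c else \<zero>) \<oplus> (\<Oplus>x\<in>carrier G - H. if x : H then c else \<zero>)"
  by (rule K.finsum_Un_disjoint) (use assms H_sub fin in auto)
 also have "(\<Oplus>x\<in>H. if x : H then c else \<zero>) = (\<Oplus>x\<in>H. c)"
  by (intro K.finsum_cong') (use assms in auto)
 also have "\<dots> = add_pow K (card H) c" using K.add.finprod_const[OF assms, of H] by simp
 also have "\<dots> = nH \<otimes> c" using K.add_pow_ldistr[of "\<one>" c "card H"] assms by (simp add: nH_def)
 also have "(\<Oplus>x\<in>carrier G - H. if x : H then c else \<zero>) = (\<Oplus>x\<in>carrier G - H. \<zero>)"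
  by (intro K.finsum_cong') auto
 also have "\<dots> = \<zero>" by (rule K.add.finprod_one)
 finally show ?thesis using assms by simp
qed

text \<open>For f(x) = a s_x(b) the sum is Tr(a) b.\<close>
lemma Lam_trace_zero:
 assumes "Lam f" "\<And>a. a : carrier K ==> Tr a = \<zero>"
 shows "(\<Oplus>x\<in>carrier G. s x (f (inv\<^bsub>G\<^esub> x))) = \<zero>"
 using assms(1)
proof (induction rule: Lam.induct)
 case (base a b)
 have "(\<Oplus>x\<in>carrier G. s x (a \<otimes> s (inv\<^bsub>G\<^esub> x) b)) = (\<Oplus>x\<in>carrier G. s x a \<otimes> b)"
  by (intro K.finsum_cong') (use base in auto)
 also have "\<dots> = Tr a \<otimes> b" unfolding Tr_def
  by (intro K.finsum_ldistr[symmetric]) (use base fin in auto)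
 finally show ?case using assms(2) base by simp
next
 case (plus f f')
 have "(\<Oplus>x\<in>carrier G. s x (f (inv\<^bsub>G\<^esub> x) \<oplus> f' (inv\<^bsub>G\<^esub> x)))
  = (\<Oplus>x\<in>carrier G. s x (f (inv\<^bsub>G\<^esub> x)) \<oplus> s x (f' (inv\<^bsub>G\<^esub> x)))"
  by (intro K.finsum_cong') (use plus in "auto simp: Lam_in")
 also have "\<dots> = \<zero>"
  by (subst K.finsum_addf) (use plus in "auto simp: Lam_in")
 finally show ?case .
next
 case (ext f f')
 have f': "f' x : carrier K" if "x : carrier G" for x using Lam_in[OF Lam.ext[OF ext(1,2)] that] .
 have "(\<Oplus>x\<in>carrier G. s x (f' (inv\<^bsub>G\<^esub> x))) = (\<Oplus>x\<in>carrier G. s x (f (inv\<^bsub>G\<^esub> x)))"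
  by (intro K.finsum_cong') (use ext f' in auto)
 then show ?case using ext by simp
qed

text \<open>If the trace vanished, evaluating the preceding sum at the indicator of H would give |H|
  = 0. A nonzero trace is rescaled inside F.\<close>
lemma ex_trace_one:
 assumes "nH \<noteq> \<zero>"
 shows "\<exists>c\<in>carrier K. Tr c = \<one>"
proof -
 have "\<exists>a\<in>carrier K. Tr a \<noteq> \<zero>"
 proof (rule ccontr)
  assume "\<not> ?thesis"
  then have "(\<Oplus>x\<in>carrier G. s x (if inv\<^bsub>G\<^esub> x : H then \<one> else \<zero>)) = \<zero>"
   using Lam_trace_zero[OF Lam_indicator] by blast
  moreover have "(\<Oplus>x\<in>carrier G. s x (if inv\<^bsub>G\<^esub> x : H then \<one> else \<zero>))
   = (\<Oplus>x\<in>carrier G. if x : H then \<one> else \<zero>)"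
   by (intro K.finsum_cong') (auto simp: inv_in_H_iff)
  ultimately show False using finsum_indicator[of "\<one>"] assms by simp
 qed
 then obtain a where a: "a : carrier K" "Tr a \<noteq> \<zero>" by blast
 have "inv\<^bsub>K\<^esub> Tr a : F" using K.subfield_m_inv(1)[OF subfield_F, of "Tr a"] a by auto
 then have "Tr (inv\<^bsub>K\<^esub> Tr a \<otimes> a) = inv\<^bsub>K\<^esub> Tr a \<otimes> Tr a" using Tr_lin a by simp
 also have "\<dots> = \<one>" using K.subfield_m_inv(3)[OF subfield_F, of "Tr a"] a by auto
 finally show ?thesis using \<open>inv\<^bsub>K\<^esub> Tr a : F\<close> a(1) F_in by blast
qed

lemma u_F: "nH \<noteq> \<zero> ==> u : F" and u_nH: "nH \<noteq> \<zero> ==> u \<otimes> nH = \<one>"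
proof -
 assume nz: "nH \<noteq> \<zero>"
 show "u \<otimes> nH = \<one>" using nz K.field_Units by (auto simp: u_def)
 have n: "nH = (\<Oplus>x\<in>H. \<one>)" using K.add.finprod_const[of "\<one>" H] by (simp add: nH_def)
 have "s g nH = nH" if "g : carrier G" for g
  unfolding n using s_finsum[OF that, of "\<lambda>_. \<one>" H] that by simp
 then have "nH : F" by (simp add: F_def)
 then show "u : F" using K.subfield_m_inv(1)[OF subfield_F, of nH] nz by (auto simp: u_def)
qed

text \<open>A basis y of K over F and the basis z dual to it for the trace form divided by |H|. The
  second condition says that the matrices (s_x y_l) and (s_x z_l), with x running over G/H, are
  inverse to each other up to transposition.\<close>
definition dual_pair where
 "dual_pair n y z \<longleftrightarrow> (\<forall>i<n::nat. y i : carrier K \<and> z i : carrier K) \<and>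
  (\<forall>x\<in>carrier G. (\<Oplus>l\<in>{..<n}. z l \<otimes> s x (y l)) = (if x : H then \<one> else \<zero>)) \<and>
  (\<forall>a\<in>carrier K. (\<Oplus>l\<in>{..<n}. (u \<otimes> Tr (a \<otimes> z l)) \<otimes> y l) = a) \<and>
  (\<forall>i<n. \<forall>l<n. u \<otimes> Tr (y i \<otimes> z l) = (if i = l then \<one> else \<zero>))"

lemma dual_pairD:
 assumes "dual_pair n y z"
 shows "i < n ==> y i : carrier K" "i < n ==> z i : carrier K"
  "x : carrier G ==> (\<Oplus>l\<in>{..<n}. z l \<otimes> s x (y l)) = (if x : H then \<one> else \<zero>)"
  "a : carrier K ==> (\<Oplus>l\<in>{..<n}. (u \<otimes> Tr (a \<otimes> z l)) \<otimes> y l) = a"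
  "i < n ==> l < n ==> u \<otimes> Tr (y i \<otimes> z l) = (if i = l then \<one> else \<zero>)"
 using assms by (auto simp: dual_pair_def)

text \<open>z is read off from the indicator of H, which lies in the span of the functions x |->
  s_x(y_l). Tracing the resulting identity against an element of K gives its expansion in the basis,
  and duality follows by linear independence.\<close>
lemma dual_basis:
 fixes y :: "nat => 'a"
 assumes nz: "nH \<noteq> \<zero>" and y: "\<And>i. i < n ==> y i : carrier K"
  and sp: "\<And>a. a : carrier K ==> \<exists>b. (\<forall>i<n. b i : F) \<and> a = (\<Oplus>i\<in>{..<n}. b i \<otimes> y i)"
  and ind: "\<And>b. (\<forall>i<n. b i : F) ==> (\<Oplus>i\<in>{..<n}. b i \<otimes> y i) = \<zero> ==> \<forall>i<n. b i = \<zero>"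
 shows "\<exists>z. dual_pair n y z"
proof -
 have "\<exists>z. (\<forall>i<n. z i : carrier K) \<and> (\<forall>x\<in>carrier G. f x = (\<Oplus>l\<in>{..<n}. z l \<otimes> s x (y l)))" if "Lam f" for f
  using that
 proof (induction rule: Lam.induct)
  case (base a b)
  obtain be where be: "\<forall>i<n. be i : F" "b = (\<Oplus>i\<in>{..<n}. be i \<otimes> y i)" using sp base by blast
  have beK: "be i : carrier K" if "i < n" for i using be that F_in by blast
  have "a \<otimes> s x b = (\<Oplus>l\<in>{..<n}. a \<otimes> be l \<otimes> s x (y l))" if x: "x : carrier G" for x
  proof -
   have "s x b = (\<Oplus>i\<in>{..<n}. s x (be i \<otimes> y i))" unfolding be(2)
    by (rule s_finsum) (use x beK y in auto)
   also have "\<dots> = (\<Oplus>i\<in>{..<n}. be i \<otimes> s x (y i))"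
    by (intro K.finsum_cong') (use x beK y be in "auto simp: F_def")
   also have "a \<otimes> \<dots> = (\<Oplus>i\<in>{..<n}. a \<otimes> (be i \<otimes> s x (y i)))"
    by (intro K.finsum_rdistr) (use x beK y base in auto)
   also have "\<dots> = (\<Oplus>l\<in>{..<n}. a \<otimes> be l \<otimes> s x (y l))"
    by (intro K.finsum_cong') (use x beK y base in "auto simp: K.m_assoc")
   finally show ?thesis .
  qed
  then show ?case using beK base by (intro exI[of _ "\<lambda>l. a \<otimes> be l"]) auto
 next
  case (plus f f')
  then obtain z z' where z: "\<forall>i<n. z i : carrier K" "\<forall>x\<in>carrier G. f x = (\<Oplus>l\<in>{..<n}. z l \<otimes> s x (y l))"
   and z': "\<forall>i<n. z' i : carrier K" "\<forall>x\<in>carrier G. f' x = (\<Oplus>l\<in>{..<n}. z' l \<otimes> s x (y l))" by blast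
  have "f x \<oplus> f' x = (\<Oplus>l\<in>{..<n}. (z l \<oplus> z' l) \<otimes> s x (y l))" if x: "x : carrier G" for x
  proof -
   have "(\<Oplus>l\<in>{..<n}. (z l \<oplus> z' l) \<otimes> s x (y l)) = (\<Oplus>l\<in>{..<n}. z l \<otimes> s x (y l) \<oplus> z' l \<otimes> s x (y l))"
    by (intro K.finsum_cong') (use x z z' y in "auto simp: K.l_distr")
   also have "\<dots> = f x \<oplus> f' x" using z(2) z'(2) x
    by (subst K.finsum_addf) (use x z(1) z'(1) y in auto)
   finally show ?thesis by simp
  qed
  then show ?case using z(1) z'(1) by (intro exI[of _ "\<lambda>l. z l \<oplus> z' l"]) auto
 next
  case (ext f f') then show ?case by auto
 qed
 from this[OF Lam_indicator] obtain z where z: "\<And>i. i < n ==> z i : carrier K"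
  and zd: "\<And>x. x : carrier G ==> (\<Oplus>l\<in>{..<n}. z l \<otimes> s x (y l)) = (if x : H then \<one> else \<zero>)"
  by metis
 note uF = u_F[OF nz]
 have uK: "u : carrier K" "u \<otimes> nH = \<one>" using F_in[OF uF] u_nH[OF nz] by auto
 have exp: "(\<Oplus>l\<in>{..<n}. (u \<otimes> Tr (a \<otimes> z l)) \<otimes> y l) = a" if a: "a : carrier K" for a
 proof -
  have "(\<Oplus>l\<in>{..<n}. (u \<otimes> Tr (a \<otimes> z l)) \<otimes> y l)
    = (\<Oplus>l\<in>{..<n}. u \<otimes> (\<Oplus>x\<in>carrier G. s x a \<otimes> (s x (z l) \<otimes> y l)))"
  proof (intro K.finsum_cong')
   fix l assume "l : {..<n}"
   then have l: "z l : carrier K" "y l : carrier K" using z y by auto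
   have "Tr (a \<otimes> z l) \<otimes> y l = (\<Oplus>x\<in>carrier G. s x (a \<otimes> z l) \<otimes> y l)" unfolding Tr_def
    by (intro K.finsum_ldistr) (use l a fin in auto)
   also have "\<dots> = (\<Oplus>x\<in>carrier G. s x a \<otimes> (s x (z l) \<otimes> y l))"
    by (intro K.finsum_cong') (use l a in "auto simp: K.m_assoc")
   finally show "(u \<otimes> Tr (a \<otimes> z l)) \<otimes> y l = u \<otimes> (\<Oplus>x\<in>carrier G. s x a \<otimes> (s x (z l) \<otimes> y l))"
    using l a uK by (simp add: K.m_assoc)
  qed (use z y a uK in "auto intro!: K.finsum_closed")
  also have "\<dots> = u \<otimes> (\<Oplus>l\<in>{..<n}. \<Oplus>x\<in>carrier G. s x a \<otimes> (s x (z l) \<otimes> y l))"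
   by (intro K.finsum_rdistr[symmetric]) (use z y a uK in "auto intro!: K.finsum_closed")
  also have "(\<Oplus>l\<in>{..<n}. \<Oplus>x\<in>carrier G. s x a \<otimes> (s x (z l) \<otimes> y l))
    = (\<Oplus>x\<in>carrier G. \<Oplus>l\<in>{..<n}. s x a \<otimes> (s x (z l) \<otimes> y l))"
   by (rule K.finsum_swap) (use z y a fin in auto)
  also have "\<dots> = (\<Oplus>x\<in>carrier G. if x : H then a else \<zero>)"
  proof (intro K.finsum_cong')
   fix x assume x: "x : carrier G"
   have "(\<Oplus>l\<in>{..<n}. s x a \<otimes> (s x (z l) \<otimes> y l)) = s x a \<otimes> (\<Oplus>l\<in>{..<n}. s x (z l) \<otimes> y l)"
    by (intro K.finsum_rdistr[symmetric]) (use z y a x in auto)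
   also have "(\<Oplus>l\<in>{..<n}. s x (z l) \<otimes> y l) = (\<Oplus>l\<in>{..<n}. s x (z l \<otimes> s (inv\<^bsub>G\<^esub> x) (y l)))"
    by (intro K.finsum_cong') (use z y x in auto)
   also have "\<dots> = s x (\<Oplus>l\<in>{..<n}. z l \<otimes> s (inv\<^bsub>G\<^esub> x) (y l))"
    by (rule s_finsum[symmetric]) (use z y x in auto)
   also have "\<dots> = (if x : H then \<one> else \<zero>)" using x by (simp add: zd inv_in_H_iff)
   finally show "(\<Oplus>l\<in>{..<n}. s x a \<otimes> (s x (z l) \<otimes> y l)) = (if x : H then a else \<zero>)"
    using a x by (auto simp: H_def)
  qed (use a in auto)
  also have "\<dots> = nH \<otimes> a" by (rule finsum_indicator[OF a])
  finally show ?thesis using uK a by (simp add: K.m_assoc[symmetric])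
 qed
 have tF: "u \<otimes> Tr b : F" if "b : carrier K" for b
  using uF Tr_F[OF that] by (auto simp: F_def)
 have "u \<otimes> Tr (y i \<otimes> z l) = (if i = l then \<one> else \<zero>)" if il: "i < n" "l < n" for i l
 proof -
  let ?t = "\<lambda>l. u \<otimes> Tr (y i \<otimes> z l)" and ?e = "\<lambda>l. if i = l then \<one> else \<zero>"
  have t: "?t l : F" "?t l : carrier K" if "l < n" for l using tF[of "y i \<otimes> z l"] F_in il that y z by auto
  have e: "?e l : F" "?e l : carrier K" for l by (auto simp: F_def)
  have s1: "(\<Oplus>l\<in>{..<n}. ?t l \<otimes> y l) = y i" using exp[OF y[OF il(1)]] .
  have s2: "(\<Oplus>l\<in>{..<n}. ?e l \<otimes> y l) = y i"
  proof -
   have "(\<Oplus>l\<in>{..<n}. ?e l \<otimes> y l) = (\<Oplus>l\<in>{..<n}. if i = l then y l else \<zero>)"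
    by (intro K.finsum_cong') (use y in auto)
   then show ?thesis using K.finsum_singleton[of i "{..<n}" y] il y by auto
  qed
  let ?b = "\<lambda>l. ?t l \<ominus> ?e l"
  have bF: "?b l : F" if "l < n" for l
   using t(1)[OF that] e(1)[of l] subringE(5,7)[OF subring_F] by (simp only: a_minus_def)
  have "(\<Oplus>l\<in>{..<n}. ?b l \<otimes> y l) \<oplus> y i = y i"
  proof -
   have "(\<Oplus>l\<in>{..<n}. ?t l \<otimes> y l) = (\<Oplus>l\<in>{..<n}. ?b l \<otimes> y l \<oplus> ?e l \<otimes> y l)"
    by (intro K.finsum_cong') (use y t e in "auto simp: K.l_distr[symmetric] a_minus_def K.a_assoc K.l_neg")
   also have "\<dots> = (\<Oplus>l\<in>{..<n}. ?b l \<otimes> y l) \<oplus> (\<Oplus>l\<in>{..<n}. ?e l \<otimes> y l)"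
    by (intro K.finsum_addf) (use y t e in auto)
   finally show ?thesis using s1 s2 by simp
  qed
  then have "(\<Oplus>l\<in>{..<n}. ?b l \<otimes> y l) = \<zero>"
   using K.add.r_cancel_one'[of "y i" "\<Oplus>l\<in>{..<n}. ?b l \<otimes> y l"] y t e il K.finsum_closed[of "\<lambda>l. ?b l \<otimes> y l" "{..<n}"]
   by (simp add: Pi_def)
  then have "?b l = \<zero>" using ind[of ?b] bF il by blast
  then show ?thesis using K.r_right_minus_eq[of "?t l" "?e l"] t(2)[OF il(2)] e(2) by simp
 qed
 then show ?thesis unfolding dual_pair_def using y z zd exp by blast
qed

end

section \<open>Semilinear representations on a line\<close>

lemma (in ring) combine_eq_finsum:
 "length Ks = length Us ==> set Ks <= carrier R ==> set Us <= carrier R ==>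
  combine Ks Us = (\<Oplus>i\<in>{..<length Us}. Ks ! i \<otimes> Us ! i)"
proof (induction Ks Us rule: list_induct2)
 case (Cons k Ks v Us)
 let ?f = "\<lambda>i. (k # Ks) ! i \<otimes> (v # Us) ! i"
 have cl: "?f i : carrier R" if "i < Suc (length Us)" for i
  using that Cons.prems Cons.hyps by (cases i) (auto simp: subset_iff)
 have "(\<Oplus>i\<in>{..<length (v # Us)}. ?f i) = (\<Oplus>i\<in>insert 0 (Suc ` {..<length Us}). ?f i)"
  by (simp add: lessThan_Suc_eq_insert_0)
 also have "\<dots> = ?f 0 \<oplus> (\<Oplus>i\<in>Suc ` {..<length Us}. ?f i)"
  by (rule finsum_insert) (use cl cl[of 0] in "auto simp: Pi_def")
 also have "(\<Oplus>i\<in>Suc ` {..<length Us}. ?f i) = (\<Oplus>i\<in>{..<length Us}. ?f (Suc i))"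
  by (rule finsum_reindex) (use cl in "auto simp: Pi_def")
 finally show ?case using Cons by simp
qed simp

text \<open>A semilinear action on a line over K becomes, once a basis vector is chosen, the action
  g z = lam(g) s_g(z) on K; lam is a 1-cocycle of G with values in the units of K.\<close>
locale twisted = field_action K G s for K :: "('a, 'm) ring_scheme" (structure) and G :: "'g monoid" (structure)
  and s :: "'g => 'a => 'a" +
 fixes \<kappa> :: "'k::field => 'a" and lam :: "'g => 'a"
 assumes nz: "nH \<noteq> \<zero>"
  and kap_in [simp]: "\<kappa> c : carrier K" and kap_add: "\<kappa> (c + e) = \<kappa> c \<oplus> \<kappa> e"
  and kap_mult: "\<kappa> (c * e) = \<kappa> c \<otimes> \<kappa> e" and kap_1: "\<kappa> 1 = \<one>"
  and s_kap: "g : carrier G ==> s g (\<kappa> c) = \<kappa> c"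
  and lam_in [simp]: "g : carrier G ==> lam g : carrier K"
  and lam_mult: "g : carrier G ==> h : carrier G ==> lam (g \<otimes>\<^bsub>G\<^esub> h) = lam g \<otimes> s g (lam h)"
  and lam_1: "lam \<one>\<^bsub>G\<^esub> = \<one>"
begin

definition A where "A g z = lam g \<otimes> s g z"

lemma A_in [simp, intro]: "g : carrier G ==> z : carrier K ==> A g z : carrier K"
 by (simp add: A_def)

lemma A_add: "g : carrier G ==> z : carrier K ==> w : carrier K ==> A g (z \<oplus> w) = A g z \<oplus> A g w"
 by (simp add: A_def K.r_distr)

lemma A_semi: "g : carrier G ==> z : carrier K ==> w : carrier K ==> A g (z \<otimes> w) = s g z \<otimes> A g w"
 by (simp add: A_def K.m_ac)

lemma A_0: "g : carrier G ==> A g \<zero> = \<zero>" by (simp add: A_def)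

lemma A_mult: "g : carrier G ==> h : carrier G ==> z : carrier K ==> A (g \<otimes>\<^bsub>G\<^esub> h) z = A g (A h z)"
 by (simp add: A_def lam_mult s_mult K.m_ac)

lemma A_1: "z : carrier K ==> A \<one>\<^bsub>G\<^esub> z = z"
 by (simp add: A_def lam_1 s_one)

lemma A_inv: "g : carrier G ==> z : carrier K ==> A (inv\<^bsub>G\<^esub> g) (A g z) = z"
 "g : carrier G ==> z : carrier K ==> A g (A (inv\<^bsub>G\<^esub> g) z) = z"
 using A_mult[of "inv\<^bsub>G\<^esub> g" g z] A_mult[of g "inv\<^bsub>G\<^esub> g" z] by (simp_all add: A_1)

lemma A_lin: "h : H ==> z : carrier K ==> w : carrier K ==> A h (z \<otimes> w) = z \<otimes> A h w"
 using A_semi[of h z w] by (simp add: H_def)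

lemma A_finsum: "g : carrier G ==> f : J \<rightarrow> carrier K ==> A g (\<Oplus>i\<in>J. f i) = (\<Oplus>i\<in>J. A g (f i))"
 by (induction J rule: infinite_finite_induct) (auto simp: A_0 A_add Pi_def intro!: K.finsum_closed)

definition Vm :: "('k, 'a, 'g) gmod" where
 "Vm = \<lparr>carrier = carrier K, monoid.mult = undefined, one = undefined, ring.zero = \<zero>,
  add = add K, module.smult = (\<lambda>c z. \<kappa> c \<otimes> z), act = A\<rparr>"

lemma Vm_simps [simp]: "carrier Vm = carrier K" "\<zero>\<^bsub>Vm\<^esub> = \<zero>" "z \<oplus>\<^bsub>Vm\<^esub> w = z \<oplus> w"
 "c \<odot>\<^bsub>Vm\<^esub> z = \<kappa> c \<otimes> z" "act Vm = A"
 by (simp_all add: Vm_def)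

lemma abelian_Vm: "abelian_group Vm"
 by (rule abelian_groupI) (auto simp: K.a_ac intro: K.a_comm bexI[of _ "\<ominus> x" for x] K.l_neg)

lemma grp_module_Vm: "grp_module G Vm"
 by (rule grp_moduleI[OF abelian_Vm])
  (auto simp: kap_add kap_mult kap_1 K.l_distr K.r_distr K.m_assoc A_add A_semi s_kap A_mult A_1)

text \<open>The F-line spanned by the basis vector. It is stable under H when the cocycle maps H
  into F.\<close>
definition VF :: "('k, 'a, 'g) gmod" where "VF = Vm\<lparr>carrier := F\<rparr>"

lemma VF_simps [simp]: "carrier VF = F" "\<zero>\<^bsub>VF\<^esub> = \<zero>" "z \<oplus>\<^bsub>VF\<^esub> w = z \<oplus> w"
 "c \<odot>\<^bsub>VF\<^esub> z = \<kappa> c \<otimes> z" "act VF = A"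
 by (simp_all add: VF_def Vm_def)

lemma F_closed: "\<zero> : F" "a : F ==> \<ominus> a : F" "a : F ==> b : F ==> a \<otimes> b : F"
 "a : F ==> b : F ==> a \<oplus> b : F" "\<kappa> c : F"
 using subringE[OF subring_F] s_kap by (auto simp: F_def)

lemma abelian_VF: "abelian_group VF"
proof (rule abelian_groupI)
 fix x assume "x : carrier VF"
 then show "\<exists>y\<in>carrier VF. y \<oplus>\<^bsub>VF\<^esub> x = \<zero>\<^bsub>VF\<^esub>"
  using F_closed(2) F_in K.l_neg by (intro bexI[of _ "\<ominus> x"]) auto
qed (use F_in K.a_ac F_closed in auto)

lemma grp_module_VF:
 assumes "\<And>h. h : H ==> lam h : F"
 shows "grp_module (G\<lparr>carrier := H\<rparr>) VF"
proof (rule grp_moduleI[OF abelian_VF])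
 have HG: "h : H ==> h : carrier G" for h by (simp add: H_def)
 show "act VF g v : carrier VF" if "g : carrier (G\<lparr>carrier := H\<rparr>)" "v : carrier VF" for g v
 proof -
  have "A g v = lam g \<otimes> v" using that F_in by (simp add: A_def H_def)
  then show ?thesis using that assms[of g] F_closed(3) by simp
 qed
qed (use F_in F_closed in "auto simp: kap_add kap_mult kap_1 K.l_distr K.r_distr K.m_assoc A_add A_semi s_kap A_mult A_1 H_def")

lemma ex_dual_basis:
 assumes fd: "set Us0 <= carrier K" "K.Span F Us0 = carrier K"
 obtains y z where "dual_pair (K.dim F (carrier K)) y z" "K.dim F (carrier K) > 0"
proof -
 have "K.finite_dimension F (carrier K)" using K.Span_finite_dimension[OF subfield_F fd(1)] fd(2) by simp
 then obtain n where n: "K.dimension n F (carrier K)" unfolding K.finite_dimension_def by blast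
 have dim: "K.dim F (carrier K) = n" using K.dimI[OF subfield_F n] by (simp add: over_def)
 obtain Vs where Vs: "set Vs <= carrier K" "K.independent F Vs" "length Vs = n" "K.Span F Vs = carrier K"
  using K.exists_base[OF subfield_F n] by blast
 let ?y = "\<lambda>i. Vs ! i"
 have y: "?y i : carrier K" if "i < n" for i using that Vs by (metis nth_mem subsetD)
 have comb: "K.combine (map b [0..<n]) Vs = (\<Oplus>i\<in>{..<n}. b i \<otimes> ?y i)" if "\<forall>i<n. b i : F" for b
 proof -
  have "K.combine (map b [0..<n]) Vs = (\<Oplus>i\<in>{..<n}. map b [0..<n] ! i \<otimes> ?y i)"
   using K.combine_eq_finsum[of "map b [0..<n]" Vs] Vs(1,3) that F_in by (simp add: image_subset_iff)
  also have "\<dots> = (\<Oplus>i\<in>{..<n}. b i \<otimes> ?y i)"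
   by (intro K.finsum_cong') (use y that F_in in auto)
  finally show ?thesis .
 qed
 have npos: "n > 0"
 proof (rule ccontr)
  assume "\<not> n > 0"
  then have "carrier K = {\<zero>}" using Vs(3,4) by simp
  then show False using K.one_closed K.one_not_zero by auto
 qed
 have "\<exists>z. dual_pair n ?y z"
 proof (rule dual_basis[OF nz, of n ?y])
  fix a assume "a : carrier K"
  then have "a : K.Span F Vs" using Vs(4) by simp
  then obtain Ks where Ks: "set Ks <= F" "length Ks = length Vs" "a = K.combine Ks Vs"
   using K.Span_mem_iff_length_version[OF subfield_F Vs(1)] by blast
  have "map (\<lambda>i. Ks ! i) [0..<n] = Ks" using Ks(2) Vs(3) by (metis map_nth)
  moreover have b: "\<forall>i<n. Ks ! i : F" using Ks Vs(3) by (metis nth_mem subsetD)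
  ultimately show "\<exists>b. (\<forall>i<n. b i : F) \<and> a = (\<Oplus>i\<in>{..<n}. b i \<otimes> ?y i)"
   using comb[OF b] Ks(3) by (intro exI[of _ "\<lambda>i. Ks ! i"]) simp
 next
  fix b assume b: "\<forall>i<n. b i : F" and z: "(\<Oplus>i\<in>{..<n}. b i \<otimes> ?y i) = \<zero>"
  have "set (take (length Vs) (map b [0..<n])) <= {\<zero>}"
   by (rule K.independent_imp_trivial_combine[OF subfield_F Vs(2)]) (use b z comb[OF b] in auto)
  then show "\<forall>i<n. b i = \<zero>" using Vs(3) by (auto simp: subset_iff)
 qed (use y in blast)+
 then show ?thesis using that npos unfolding dim by blast
qed

lemma IndI:
 assumes "\<And>x. x : carrier G ==> f x : carrier V" "f : extensional (carrier G)"
  "\<And>x h. x : carrier G ==> h : H ==> f (x \<otimes>\<^bsub>G\<^esub> h) = act V (inv\<^bsub>G\<^esub> h) (f x)"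
 shows "f : carrier (Ind G H V)"
 using assms by (auto simp: Ind_def PiE_def)

lemma HG: "h : H ==> h : carrier G" and H_inv: "h : H ==> inv\<^bsub>G\<^esub> h : H"
 using subgroup.m_inv_closed[OF H_subgroup] by (auto simp: H_def)

text \<open>Galois descent in explicit form. Ph combines the x^-1 v_i with the coefficients y_i, and
  Ps recovers the coordinates with the dual basis z. That they are mutually inverse is what the two
  orthogonality relations of a dual pair say; Ph v is H-equivariant because H acts
  K-linearly.\<close>
theorem power_iso_Ind:
 assumes fd: "set Us0 <= carrier K" "K.Span F Us0 = carrier K"
 shows "grp_iso G (dir_power (K.dim F (carrier K)) Vm) (Ind G H Vm)"
proof -
 define n where "n = K.dim F (carrier K)"
 obtain y z where dp: "dual_pair n y z" by (rule ex_dual_basis[OF fd, folded n_def])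
 note y = dual_pairD(1)[OF dp] and z = dual_pairD(2)[OF dp] and zy = dual_pairD(3)[OF dp] and exp = dual_pairD(4)[OF dp]
  and dual = dual_pairD(5)[OF dp]
 have uK: "u : carrier K" "u \<otimes> nH = \<one>" using F_in[OF u_F[OF nz]] u_nH[OF nz] by auto
 define Ph where "Ph = (\<lambda>v. \<lambda>x\<in>carrier G. \<Oplus>i\<in>{..<n}. y i \<otimes> A (inv\<^bsub>G\<^esub> x) (v i))"
 define Ps where "Ps = (\<lambda>f. \<lambda>l\<in>{..<n}. u \<otimes> (\<Oplus>x\<in>carrier G. s x (z l) \<otimes> A x (f x)))"
 have vK: "v i : carrier K" if "v : carrier (dir_power n Vm)" "i < n" for v i
  using that by (auto simp: dir_power_def)
 have Phx: "Ph v x : carrier K" if "v : carrier (dir_power n Vm)" "x : carrier G" for v x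
  using that vK y by (auto simp: Ph_def intro!: K.finsum_closed)
 have APh: "A x (Ph v x) = (\<Oplus>i\<in>{..<n}. s x (y i) \<otimes> v i)"
  if v: "v : carrier (dir_power n Vm)" and x: "x : carrier G" for v x
 proof -
  have "A x (Ph v x) = (\<Oplus>i\<in>{..<n}. A x (y i \<otimes> A (inv\<^bsub>G\<^esub> x) (v i)))"
   using x by (simp add: Ph_def) (rule A_finsum, use x vK[OF v] y in auto)
  also have "\<dots> = (\<Oplus>i\<in>{..<n}. s x (y i) \<otimes> v i)"
   by (intro K.finsum_cong') (use x vK[OF v] y in "auto simp: A_semi A_inv")
  finally show ?thesis .
 qed
 have PhInd: "Ph v : carrier (Ind G H Vm)" if v: "v : carrier (dir_power n Vm)" for v
 proof (rule IndI)
  show "Ph v x : carrier Vm" if "x : carrier G" for x using Phx[OF v that] by simp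
  show "Ph v : extensional (carrier G)" by (simp add: Ph_def)
  fix x h assume x: "x : carrier G" and h: "h : H"
  have "Ph v (x \<otimes>\<^bsub>G\<^esub> h) = (\<Oplus>i\<in>{..<n}. A (inv\<^bsub>G\<^esub> h) (y i \<otimes> A (inv\<^bsub>G\<^esub> x) (v i)))"
   using x HG[OF h] by (simp add: Ph_def)
    (intro K.finsum_cong', use x h HG H_inv vK[OF v] y in "auto simp: A_lin A_mult G.inv_mult_group")
  also have "\<dots> = A (inv\<^bsub>G\<^esub> h) (Ph v x)" using x HG[OF h]
   by (simp add: Ph_def) (rule A_finsum[symmetric], use x vK[OF v] y in auto)
  finally show "Ph v (x \<otimes>\<^bsub>G\<^esub> h) = act Vm (inv\<^bsub>G\<^esub> h) (Ph v x)" by simp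
 qed
 have fK: "f x : carrier K" if "f : carrier (Ind G H Vm)" "x : carrier G" for f x
  using that by (auto simp: Ind_def)
 have PsD: "Ps f : carrier (dir_power n Vm)" if f: "f : carrier (Ind G H Vm)" for f
  using fK[OF f] z uK by (auto simp: Ps_def dir_power_def intro!: K.finsum_closed)
 have PsPh: "Ps (Ph v) = v" if v: "v : carrier (dir_power n Vm)" for v
 proof -
  have "u \<otimes> (\<Oplus>x\<in>carrier G. s x (z l) \<otimes> A x (Ph v x)) = v l" if l: "l < n" for l
  proof -
   have "(\<Oplus>x\<in>carrier G. s x (z l) \<otimes> A x (Ph v x)) = (\<Oplus>x\<in>carrier G. \<Oplus>i\<in>{..<n}. s x (y i \<otimes> z l) \<otimes> v i)"
   proof (intro K.finsum_cong')
    fix x assume x: "x : carrier G"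
    have "s x (z l) \<otimes> A x (Ph v x) = (\<Oplus>i\<in>{..<n}. s x (z l) \<otimes> (s x (y i) \<otimes> v i))"
     unfolding APh[OF v x] by (intro K.finsum_rdistr) (use z l x y vK[OF v] in auto)
    also have "\<dots> = (\<Oplus>i\<in>{..<n}. s x (y i \<otimes> z l) \<otimes> v i)"
     by (intro K.finsum_cong') (use z l x y vK[OF v] in "auto simp: K.m_ac")
    finally show "s x (z l) \<otimes> A x (Ph v x) = (\<Oplus>i\<in>{..<n}. s x (y i \<otimes> z l) \<otimes> v i)" .
   qed (use z l y vK[OF v] in "auto intro!: K.finsum_closed")
   also have "\<dots> = (\<Oplus>i\<in>{..<n}. \<Oplus>x\<in>carrier G. s x (y i \<otimes> z l) \<otimes> v i)"
    by (rule K.finsum_swap) (use z l y vK[OF v] fin in auto)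
   also have "\<dots> = (\<Oplus>i\<in>{..<n}. Tr (y i \<otimes> z l) \<otimes> v i)" unfolding Tr_def
    by (intro K.finsum_cong' refl K.finsum_ldistr[symmetric]) (use z l y vK[OF v] fin in "auto intro!: K.finsum_closed")
   also have "u \<otimes> \<dots> = (\<Oplus>i\<in>{..<n}. u \<otimes> (Tr (y i \<otimes> z l) \<otimes> v i))"
    by (intro K.finsum_rdistr) (use z l y vK[OF v] uK in auto)
   also have "\<dots> = (\<Oplus>i\<in>{..<n}. if l = i then v i else \<zero>)"
    by (intro K.finsum_cong') (use z l y vK[OF v] uK dual in "auto simp: K.m_assoc[symmetric]")
   also have "\<dots> = v l" using K.finsum_singleton[of l "{..<n}" v] l vK[OF v] by auto
   finally show ?thesis .
  qed
  then show ?thesis using v by (auto simp: Ps_def dir_power_def fun_eq_iff PiE_def extensional_def)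
 qed
 have PhPs: "Ph (Ps f) = f" if f: "f : carrier (Ind G H Vm)" for f
 proof -
  let ?g = "\<lambda>x. A x (f x)"
  have gK: "?g x : carrier K" if "x : carrier G" for x using fK[OF f that] that by simp
  have gH: "?g (x \<otimes>\<^bsub>G\<^esub> h) = ?g x" if x: "x : carrier G" and h: "h : H" for x h
  proof -
   have "f (x \<otimes>\<^bsub>G\<^esub> h) = A (inv\<^bsub>G\<^esub> h) (f x)" using f x h by (auto simp: Ind_def)
   then show ?thesis using x HG[OF h] fK[OF f x] by (simp add: A_mult A_inv)
  qed
  have "A x (Ph (Ps f) x) = ?g x" if x: "x : carrier G" for x
  proof -
   have "A x (Ph (Ps f) x) = (\<Oplus>i\<in>{..<n}. u \<otimes> (\<Oplus>w\<in>carrier G. s x (y i) \<otimes> (s w (z i) \<otimes> ?g w)))"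
    unfolding APh[OF PsD[OF f] x]
   proof (intro K.finsum_cong')
    fix i assume "i : {..<n}"
    then have i: "i < n" by simp
    have "s x (y i) \<otimes> Ps f i = u \<otimes> (s x (y i) \<otimes> (\<Oplus>w\<in>carrier G. s w (z i) \<otimes> ?g w))"
     using i x y z uK gK K.finsum_closed[of "\<lambda>w. s w (z i) \<otimes> ?g w" "carrier G"]
     by (simp add: Ps_def K.m_lcomm Pi_def)
    also have "s x (y i) \<otimes> (\<Oplus>w\<in>carrier G. s w (z i) \<otimes> ?g w) = (\<Oplus>w\<in>carrier G. s x (y i) \<otimes> (s w (z i) \<otimes> ?g w))"
     by (intro K.finsum_rdistr) (use i x y z gK fin in auto)
    finally show "s x (y i) \<otimes> Ps f i = u \<otimes> (\<Oplus>w\<in>carrier G. s x (y i) \<otimes> (s w (z i) \<otimes> ?g w))" .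
   qed (use x y z gK uK in "auto intro!: K.finsum_closed")
   also have "\<dots> = u \<otimes> (\<Oplus>i\<in>{..<n}. \<Oplus>w\<in>carrier G. s x (y i) \<otimes> (s w (z i) \<otimes> ?g w))"
    by (intro K.finsum_rdistr[symmetric]) (use x y z gK uK in "auto intro!: K.finsum_closed")
   also have "(\<Oplus>i\<in>{..<n}. \<Oplus>w\<in>carrier G. s x (y i) \<otimes> (s w (z i) \<otimes> ?g w))
     = (\<Oplus>w\<in>carrier G. \<Oplus>i\<in>{..<n}. s x (y i) \<otimes> (s w (z i) \<otimes> ?g w))"
    by (rule K.finsum_swap) (use x y z gK fin in auto)
   also have "\<dots> = (\<Oplus>w\<in>carrier G. if inv\<^bsub>G\<^esub> w \<otimes>\<^bsub>G\<^esub> x : H then ?g w else \<zero>)"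
   proof (intro K.finsum_cong')
    fix w assume w: "w : carrier G"
    have "(\<Oplus>i\<in>{..<n}. s x (y i) \<otimes> (s w (z i) \<otimes> ?g w))
      = (\<Oplus>i\<in>{..<n}. s w (z i \<otimes> s (inv\<^bsub>G\<^esub> w \<otimes>\<^bsub>G\<^esub> x) (y i)) \<otimes> ?g w)"
     by (intro K.finsum_cong') (use x w y z gK in "auto simp: s_mult K.m_ac")
    also have "\<dots> = (\<Oplus>i\<in>{..<n}. s w (z i \<otimes> s (inv\<^bsub>G\<^esub> w \<otimes>\<^bsub>G\<^esub> x) (y i))) \<otimes> ?g w"
     by (intro K.finsum_ldistr[symmetric]) (use x w y z gK in auto)
    also have "(\<Oplus>i\<in>{..<n}. s w (z i \<otimes> s (inv\<^bsub>G\<^esub> w \<otimes>\<^bsub>G\<^esub> x) (y i)))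
      = s w (\<Oplus>i\<in>{..<n}. z i \<otimes> s (inv\<^bsub>G\<^esub> w \<otimes>\<^bsub>G\<^esub> x) (y i))"
     by (rule s_finsum[symmetric]) (use x w y z in auto)
    finally show "(\<Oplus>i\<in>{..<n}. s x (y i) \<otimes> (s w (z i) \<otimes> ?g w)) = (if inv\<^bsub>G\<^esub> w \<otimes>\<^bsub>G\<^esub> x : H then ?g w else \<zero>)"
     using x w zy[of "inv\<^bsub>G\<^esub> w \<otimes>\<^bsub>G\<^esub> x"] gK by auto
   qed (use gK in auto)
   also have "\<dots> = (\<Oplus>w\<in>carrier G. if inv\<^bsub>G\<^esub> (x \<otimes>\<^bsub>G\<^esub> w) \<otimes>\<^bsub>G\<^esub> x : H then ?g (x \<otimes>\<^bsub>G\<^esub> w) else \<zero>)"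
    by (rule finsum_lmult[OF x, symmetric]) (use gK in auto)
   also have "\<dots> = (\<Oplus>w\<in>carrier G. if w : H then ?g x else \<zero>)"
   proof (intro K.finsum_cong')
    fix w assume w: "w : carrier G"
    have "inv\<^bsub>G\<^esub> (x \<otimes>\<^bsub>G\<^esub> w) \<otimes>\<^bsub>G\<^esub> x = inv\<^bsub>G\<^esub> w"
     using x w by (simp add: G.inv_mult_group G.m_assoc)
    then show "(if inv\<^bsub>G\<^esub> (x \<otimes>\<^bsub>G\<^esub> w) \<otimes>\<^bsub>G\<^esub> x : H then ?g (x \<otimes>\<^bsub>G\<^esub> w) else \<zero>) = (if w : H then ?g x else \<zero>)"
     using inv_in_H_iff[OF w] gH[OF x] by auto
   qed (use gK[OF x] in auto)
   also have "\<dots> = nH \<otimes> ?g x" by (rule finsum_indicator[OF gK[OF x]])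
   finally show ?thesis using uK gK[OF x] by (simp add: K.m_assoc[symmetric])
  qed
  note A_eq = this
  have "Ph (Ps f) x = f x" if x: "x : carrier G" for x
  proof -
   have "Ph (Ps f) x = A (inv\<^bsub>G\<^esub> x) (A x (Ph (Ps f) x))"
    by (rule A_inv(1)[OF x Phx[OF PsD[OF f] x], symmetric])
   also have "\<dots> = A (inv\<^bsub>G\<^esub> x) (A x (f x))" by (rule arg_cong[OF A_eq[OF x]])
   also have "\<dots> = f x" by (rule A_inv(1)[OF x fK[OF f x]])
   finally show ?thesis .
  qed
  moreover have "Ph (Ps f) : extensional (carrier G)" "f : extensional (carrier G)"
   using f by (auto simp: Ph_def Ind_def PiE_def)
  ultimately show ?thesis by (intro extensionalityI)
 qed
 have hom: "Ph : grp_hom G (dir_power n Vm) (Ind G H Vm)"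
 proof (rule grp_homI)
  fix v w assume v: "v : carrier (dir_power n Vm)" and w: "w : carrier (dir_power n Vm)"
  show "Ph (v \<oplus>\<^bsub>dir_power n Vm\<^esub> w) = Ph v \<oplus>\<^bsub>Ind G H Vm\<^esub> Ph w"
  proof
   fix x
   show "Ph (v \<oplus>\<^bsub>dir_power n Vm\<^esub> w) x = (Ph v \<oplus>\<^bsub>Ind G H Vm\<^esub> Ph w) x"
   proof (cases "x : carrier G")
    case True
    have "Ph (v \<oplus>\<^bsub>dir_power n Vm\<^esub> w) x = (\<Oplus>i\<in>{..<n}. y i \<otimes> A (inv\<^bsub>G\<^esub> x) (v i) \<oplus> y i \<otimes> A (inv\<^bsub>G\<^esub> x) (w i))"
     using True by (simp add: Ph_def) (intro K.finsum_cong', use True vK[OF v] vK[OF w] y in "auto simp: dir_power_def A_add K.r_distr")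
    also have "\<dots> = Ph v x \<oplus> Ph w x" using True
     by (simp add: Ph_def) (intro K.finsum_addf, use True vK[OF v] vK[OF w] y in auto)
    finally show ?thesis using True by (simp add: Ind_def)
   qed (simp add: Ph_def Ind_def)
  qed
 next
  fix c v assume v: "v : carrier (dir_power n Vm)"
  show "Ph (c \<odot>\<^bsub>dir_power n Vm\<^esub> v) = c \<odot>\<^bsub>Ind G H Vm\<^esub> Ph v"
  proof
   fix x
   show "Ph (c \<odot>\<^bsub>dir_power n Vm\<^esub> v) x = (c \<odot>\<^bsub>Ind G H Vm\<^esub> Ph v) x"
   proof (cases "x : carrier G")
    case True
    have "Ph (c \<odot>\<^bsub>dir_power n Vm\<^esub> v) x = (\<Oplus>i\<in>{..<n}. \<kappa> c \<otimes> (y i \<otimes> A (inv\<^bsub>G\<^esub> x) (v i)))"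
     using True by (simp add: Ph_def) (intro K.finsum_cong', use True vK[OF v] y in "auto simp: dir_power_def A_semi s_kap K.m_lcomm")
    also have "\<dots> = \<kappa> c \<otimes> Ph v x" using True
     by (simp add: Ph_def) (intro K.finsum_rdistr[symmetric], use True vK[OF v] y in auto)
    finally show ?thesis using True by (simp add: Ind_def)
   qed (simp add: Ph_def Ind_def)
  qed
 next
  fix g v assume g: "g : carrier G" and v: "v : carrier (dir_power n Vm)"
  show "Ph (act (dir_power n Vm) g v) = act (Ind G H Vm) g (Ph v)"
  proof
   fix x
   show "Ph (act (dir_power n Vm) g v) x = act (Ind G H Vm) g (Ph v) x"
   proof (cases "x : carrier G")
    case True
    then show ?thesis using g
     by (simp add: Ph_def Ind_def)
      (intro K.finsum_cong', use True g vK[OF v] y in "auto simp: dir_power_def A_mult[symmetric] G.inv_mult_group")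
   qed (simp add: Ph_def Ind_def)
  qed
 qed (use PhInd in auto)
 have "bij_betw Ph (carrier (dir_power n Vm)) (carrier (Ind G H Vm))"
  by (rule bij_betwI[of _ _ _ Ps]) (use PhInd PsD PsPh PhPs in auto)
 then show ?thesis using hom n_def unfolding grp_iso_def by blast
qed

text \<open>Coordinates with respect to a basis of K over F. They commute with H, since H acts on K
  by multiplication with elements of F.\<close>
theorem power_VF_iso:
 assumes fd: "set Us0 <= carrier K" "K.Span F Us0 = carrier K" and lamF: "\<And>h. h : H ==> lam h : F"
 shows "grp_iso (G\<lparr>carrier := H\<rparr>) Vm (dir_power (K.dim F (carrier K)) VF)"
proof -
 define n where "n = K.dim F (carrier K)"
 obtain y z where dp: "dual_pair n y z" by (rule ex_dual_basis[OF fd, folded n_def])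
 note y = dual_pairD(1)[OF dp] and z = dual_pairD(2)[OF dp] and zy = dual_pairD(3)[OF dp] and exp = dual_pairD(4)[OF dp]
  and dual = dual_pairD(5)[OF dp]
 define co where "co = (\<lambda>l a. u \<otimes> Tr (a \<otimes> z l))"
 note uF = u_F[OF nz]
 have uK: "u : carrier K" using F_in[OF uF] .
 have coF: "co l a : F" if "a : carrier K" "l < n" for l a
  using that z uF F_closed(3) Tr_F by (simp add: co_def)
 have co_lin: "co l (c \<otimes> a) = c \<otimes> co l a" if "c : F" "a : carrier K" "l < n" for c a l
  using that z uK F_in[of c] Tr_lin[of c "a \<otimes> z l"] by (simp add: co_def K.m_assoc K.m_lcomm)
 have co_add: "co l (a \<oplus> b) = co l a \<oplus> co l b" if "a : carrier K" "b : carrier K" "l < n" for a b l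
  using that z uK Tr_add[of "a \<otimes> z l" "b \<otimes> z l"] by (simp add: co_def K.l_distr K.r_distr)
 have co_0: "co l \<zero> = \<zero>" if "l < n" for l
  using co_lin[of "\<zero>" "\<zero>" l] that coF[of "\<zero>" l] F_in F_closed(1) by simp
 have co_sum: "co l (\<Oplus>i\<in>J. f i) = (\<Oplus>i\<in>J. co l (f i))" if "f : J \<rightarrow> carrier K" "l < n" for J f l
  using that(1)
 proof (induction J rule: infinite_finite_induct)
  case (insert j J)
  then show ?case using that(2) F_in[OF coF] by (simp add: co_add Pi_def K.finsum_closed)
 qed (use co_0 that in auto)
 have coy: "co l (\<Oplus>i\<in>{..<n}. y i \<otimes> f i) = f l" if f: "\<And>i. i < n ==> f i : F" and l: "l < n" for f l
 proof -
  have fK: "f i : carrier K" if "i < n" for i using f[OF that] F_in by blast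
  have "co l (\<Oplus>i\<in>{..<n}. y i \<otimes> f i) = (\<Oplus>i\<in>{..<n}. co l (y i \<otimes> f i))"
   by (rule co_sum) (use l fK y in auto)
  also have "\<dots> = (\<Oplus>i\<in>{..<n}. if l = i then f i else \<zero>)"
  proof (intro K.finsum_cong')
   fix i assume "i : {..<n}"
   then have i: "i < n" by simp
   have "co l (y i \<otimes> f i) = f i \<otimes> co l (y i)"
    using co_lin[OF f[OF i] y[OF i] l] K.m_comm[OF y[OF i] fK[OF i]] by simp
   then show "co l (y i \<otimes> f i) = (if l = i then f i else \<zero>)"
    using dual[OF i l] fK[OF i] by (auto simp: co_def)
  qed (use fK in auto)
  also have "\<dots> = f l" using K.finsum_singleton[of l "{..<n}" f] l fK by auto
  finally show ?thesis .
 qed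
 define Co where "Co a = (\<lambda>l\<in>{..<n}. co l a)" for a
 let ?D = "dir_power n VF"
 have wK: "w i : F" "w i : carrier K" if "w : carrier ?D" "i < n" for w i
  using that F_in by (auto simp: dir_power_def)
 have "Co : grp_hom (G\<lparr>carrier := H\<rparr>) Vm ?D"
 proof (rule grp_homI)
  show "Co a : carrier ?D" if "a : carrier Vm" for a using that coF by (auto simp: Co_def dir_power_def)
  show "Co (a \<oplus>\<^bsub>Vm\<^esub> b) = Co a \<oplus>\<^bsub>?D\<^esub> Co b" if "a : carrier Vm" "b : carrier Vm" for a b
   using that co_add by (simp add: Co_def dir_power_def fun_eq_iff)
  show "Co (c \<odot>\<^bsub>Vm\<^esub> a) = c \<odot>\<^bsub>?D\<^esub> Co a" if "a : carrier Vm" for c a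
   using that co_lin[OF F_closed(5)] by (simp add: Co_def dir_power_def fun_eq_iff)
  show "Co (act Vm h a) = act ?D h (Co a)" if "h : carrier (G\<lparr>carrier := H\<rparr>)" "a : carrier Vm" for h a
   using that co_lin[OF lamF] F_in[OF coF] by (simp add: Co_def dir_power_def fun_eq_iff A_def H_def)
 qed
 moreover have "bij_betw Co (carrier Vm) (carrier ?D)"
 proof (rule bij_betwI[of _ _ _ "\<lambda>w. \<Oplus>i\<in>{..<n}. y i \<otimes> w i"])
  show "Co : carrier Vm \<rightarrow> carrier ?D" using coF by (auto simp: Co_def dir_power_def)
  show "(\<lambda>w. \<Oplus>i\<in>{..<n}. y i \<otimes> w i) : carrier ?D \<rightarrow> carrier Vm"
   using wK y by (auto intro!: K.finsum_closed)
  show "Co (\<Oplus>i\<in>{..<n}. y i \<otimes> w i) = w" if w: "w : carrier ?D" for w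
   using coy[of w] wK[OF w] w by (auto simp: Co_def dir_power_def fun_eq_iff PiE_def extensional_def)
  show "(\<Oplus>i\<in>{..<n}. y i \<otimes> Co a i) = a" if "a : carrier Vm" for a
  proof -
   have "(\<Oplus>i\<in>{..<n}. y i \<otimes> Co a i) = (\<Oplus>i\<in>{..<n}. co i a \<otimes> y i)"
    by (intro K.finsum_cong') (use y F_in[OF coF] that in "auto simp: Co_def K.m_comm")
   then show ?thesis using exp[of a] that by (simp add: co_def)
  qed
 qed
 ultimately show ?thesis using n_def unfolding grp_iso_def by blast
qed

end

section \<open>Local rings over a perfect field\<close>

text \<open>Coefficients in a domain, not only in a field: a polynomial in two variables is
  evaluated as a polynomial whose coefficients are polynomials.\<close>
locale poly_eval = R?: cring R for R :: "('r, 'm) ring_scheme" (structure) +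
 fixes \<phi> :: "'a::idom => 'r"
 assumes ph_in [simp]: "\<phi> a : carrier R" and ph_add: "\<phi> (a + b) = \<phi> a \<oplus> \<phi> b"
  and ph_mult: "\<phi> (a * b) = \<phi> a \<otimes> \<phi> b" and ph_1 [simp]: "\<phi> 1 = \<one>"
begin

lemma ph_0 [simp]: "\<phi> 0 = \<zero>"
proof -
 have "\<phi> 0 = \<phi> 0 \<oplus> \<phi> 0" using ph_add[of 0 0] by simp
 then show ?thesis using R.add.l_cancel_one'[of "\<phi> 0" "\<phi> 0"] by simp
qed

lemma ph_minus: "\<phi> (- a) = \<ominus> \<phi> a"
 using ph_add[of "- a" a] R.minus_equality[of "\<phi> (- a)" "\<phi> a"] by simp

definition pev :: "'r => 'a poly => 'r" where
 "pev x p = fold_coeffs (\<lambda>a b. \<phi> a \<oplus> x \<otimes> b) p \<zero>"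

context
 fixes x assumes x [simp]: "x : carrier R"
begin

lemma pev_0 [simp]: "pev x 0 = \<zero>" by (simp add: pev_def)

lemma pev_pCons: "pev x (pCons a p) = \<phi> a \<oplus> x \<otimes> pev x p"
proof (cases "a = 0 \<and> p = 0")
 case False
 then show ?thesis by (cases "a = 0") (auto simp: pev_def)
qed (auto simp: pev_def)

lemma pev_in [simp]: "pev x p : carrier R"
 by (induction p) (auto simp: pev_pCons)

lemma pev_const [simp]: "pev x [:a:] = \<phi> a" by (simp add: pev_pCons)

lemma pev_add: "pev x (p + q) = pev x p \<oplus> pev x q"
proof (induction p q rule: poly_induct2)
 case (pCons a p b q)
 then show ?case by (simp add: pev_pCons ph_add R.r_distr R.a_ac)
qed simp

lemma pev_smult: "pev x (smult a p) = \<phi> a \<otimes> pev x p"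
 by (induction p) (auto simp: pev_pCons ph_mult R.r_distr R.m_ac)

lemma pev_mult: "pev x (p * q) = pev x p \<otimes> pev x q"
 by (induction p) (auto simp: pev_pCons mult_pCons_left pev_add pev_smult R.l_distr R.r_distr R.m_ac)

lemma pev_1 [simp]: "pev x 1 = \<one>" by (simp add: one_pCons)

lemma pev_uminus: "pev x (- p) = \<ominus> pev x p"
 using pev_smult[of "- 1" p] ph_minus[of 1] by (simp add: R.l_minus)

lemma pev_diff: "pev x (p - q) = pev x p \<ominus> pev x q"
 using pev_add[of p "- q"] by (simp add: pev_uminus a_minus_def)

lemma pev_poly_eval: "poly_eval R (pev x)"
 by unfold_locales (auto simp: pev_add pev_mult)

lemma pev_power: "pev x (p ^ n) = pev x p [^] n"
 by (induction n) (auto simp: pev_mult R.m_comm)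

end

lemma pev_Taylor:
 assumes x: "x : carrier R" and d: "d : carrier R"
 shows "\<exists>w\<in>carrier R. pev (x \<oplus> d) p = pev x p \<oplus> d \<otimes> pev x (pderiv p) \<oplus> (d \<otimes> d) \<otimes> w"
proof (induction p)
 case 0 show ?case using x d by (intro bexI[of _ "\<zero>"]) auto
next
 case (pCons a p)
 then obtain w where w: "w : carrier R"
  "pev (x \<oplus> d) p = pev x p \<oplus> d \<otimes> pev x (pderiv p) \<oplus> (d \<otimes> d) \<otimes> w" by blast
 let ?e = "pev x p" and ?f = "pev x (pderiv p)"
 have ef: "?e : carrier R" "?f : carrier R" using x by auto
 let ?v = "?f \<oplus> (x \<otimes> w \<oplus> d \<otimes> w)"
 have "pev (x \<oplus> d) (pCons a p) = \<phi> a \<oplus> (x \<oplus> d) \<otimes> (?e \<oplus> d \<otimes> ?f \<oplus> (d \<otimes> d) \<otimes> w)"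
  using x d w by (simp add: pev_pCons)
 also have "\<dots> = (\<phi> a \<oplus> x \<otimes> ?e) \<oplus> d \<otimes> (?e \<oplus> x \<otimes> ?f) \<oplus> (d \<otimes> d) \<otimes> ?v"
  using x d w(1) ef by (simp add: R.l_distr R.r_distr R.a_ac R.m_ac)
 also have "\<dots> = pev x (pCons a p) \<oplus> d \<otimes> pev x (pderiv (pCons a p)) \<oplus> (d \<otimes> d) \<otimes> ?v"
  using x by (simp add: pev_pCons pderiv_pCons pev_add)
 finally show ?case using x d w(1) ef by blast
qed

lemma pev_in_ideal:
 assumes "ideal q R" "x : carrier R" "\<And>i. \<phi> (Polynomial.coeff p i) : q"
 shows "pev x p : q"
 using assms(3)
proof (induction p)
 case 0 show ?case using additive_subgroup.zero_closed[OF ideal.axioms(1)[OF assms(1)]] assms(2) by simp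
next
 case (pCons a p)
 have "\<phi> a : q" using pCons.prems[of 0] by simp
 moreover have "pev x p : q" using pCons.IH pCons.prems[of "Suc i" for i] by simp
 ultimately show ?case
  using ideal.I_l_closed[OF assms(1)] additive_subgroup.a_closed[OF ideal.axioms(1)[OF assms(1)]] assms(2)
  by (simp add: pev_pCons)
qed

end

text \<open>q stands for the square of m; the arguments only use that q is an ideal containing all
  products of two elements of m.\<close>
locale local_ring_q = poly_eval R \<kappa> for R :: "('r, 'm) ring_scheme" (structure) and \<kappa> :: "'k::field => 'r" +
 fixes m q
 assumes m_def: "m = carrier R - Units R" and m_ideal: "ideal m R" and q_ideal: "ideal q R"
  and qm: "q <= m" and mm: "a : m ==> b : m ==> a \<otimes> b : q"
begin

lemma m_in: "a : m ==> a : carrier R" by (simp add: m_def)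
lemma q_in: "a : q ==> a : carrier R" using qm m_in by blast
lemma not_m: "a : carrier R ==> a \<notin> m ==> a : Units R" by (simp add: m_def)
lemma one_not_m: "\<one> \<notin> m" by (simp add: m_def)
lemma unit_not_m: "a : Units R ==> a \<notin> m" by (simp add: m_def)
lemmas m_add = additive_subgroup.a_closed[OF ideal.axioms(1)[OF m_ideal]]
lemmas q_add = additive_subgroup.a_closed[OF ideal.axioms(1)[OF q_ideal]]
lemmas m_0 = additive_subgroup.zero_closed[OF ideal.axioms(1)[OF m_ideal]]
lemmas q_0 = additive_subgroup.zero_closed[OF ideal.axioms(1)[OF q_ideal]]
lemmas m_neg = additive_subgroup.a_inv_closed[OF ideal.axioms(1)[OF m_ideal]]
lemmas q_neg = additive_subgroup.a_inv_closed[OF ideal.axioms(1)[OF q_ideal]]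
lemmas m_l = ideal.I_l_closed[OF m_ideal] and m_r = ideal.I_r_closed[OF m_ideal]
lemmas q_l = ideal.I_l_closed[OF q_ideal] and q_r = ideal.I_r_closed[OF q_ideal]

lemma m_diff: "a : m ==> b : m ==> a \<ominus> b : m" and q_diff: "a : q ==> b : q ==> a \<ominus> b : q"
 by (simp_all add: a_minus_def m_add m_neg q_add q_neg)

lemma m_prime: "a : carrier R ==> b : carrier R ==> a \<otimes> b : m ==> a : m \<or> b : m"
 using R.Units_m_closed not_m unit_not_m by blast

lemma unit_cancel_q: "a : carrier R ==> a \<notin> m ==> b : carrier R ==> a \<otimes> b : q ==> b : q"
proof -
 assume a: "a : carrier R" "a \<notin> m" "b : carrier R" "a \<otimes> b : q"
 then have u: "a : Units R" by (simp add: not_m)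
 have "inv\<^bsub>R\<^esub> a \<otimes> (a \<otimes> b) : q" by (rule q_l) (use a u in auto)
 then show ?thesis using a u by (simp add: R.m_assoc[symmetric])
qed

lemma add_cancel_m: "a : carrier R ==> b : carrier R ==> b : m ==> a \<oplus> b : m \<longleftrightarrow> a : m"
proof -
 assume ab: "a : carrier R" "b : carrier R" "b : m"
 have "a = a \<oplus> b \<ominus> b" using ab by (simp add: a_minus_def R.a_assoc R.r_neg)
 then show ?thesis using m_add[of a b] m_diff[of "a \<oplus> b" b] ab by metis
qed

lemma add_cancel_q: "a : carrier R ==> b : q ==> a \<oplus> b : q ==> a : q"
proof -
 assume ab: "a : carrier R" "b : q" "a \<oplus> b : q"
 have "a = a \<oplus> b \<ominus> b" using ab q_in by (simp add: a_minus_def R.a_assoc R.r_neg)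
 then show ?thesis using q_diff[of "a \<oplus> b" b] ab by metis
qed

lemma kap_not_m: "c \<noteq> 0 ==> \<kappa> c \<notin> m"
 using ph_mult[of c "inverse c"] m_r[of "\<kappa> c" "\<kappa> (inverse c)"] one_not_m by auto

lemma irred_dvd:
 assumes x: "x : carrier R" and f: "Factorial_Ring.irreducible f" "pev x f : m" and h: "pev x h : m"
 shows "f dvd h"
proof -
 let ?P = "\<lambda>g. g \<noteq> 0 \<and> pev x g : m"
 have "?P f" using f by (auto simp: irreducible_def)
 then obtain g where g: "?P g" and least: "\<And>g'. ?P g' ==> Polynomial.degree g \<le> Polynomial.degree g'"
  using ex_has_least_nat[of ?P f Polynomial.degree] by blast
 have gd: "g dvd p" if p: "pev x p : m" for p
 proof -
  have "p mod g = p - (p div g) * g" by (simp add: minus_div_mult_eq_mod)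
  then have "pev x (p mod g) = pev x p \<ominus> pev x (p div g) \<otimes> pev x g"
   using x by (simp add: pev_diff pev_mult)
  then have "pev x (p mod g) : m" using p g x m_diff m_l by simp
  then have "p mod g = 0" using least[of "p mod g"] degree_mod_less[of g p] g by fastforce
  then show ?thesis by (simp add: mod_eq_0_iff_dvd)
 qed
 obtain w where w: "f = g * w" using gd[OF f(2)] by (meson dvdE)
 have "\<not> is_unit g"
 proof
  assume "is_unit g"
  then obtain v where "1 = g * v" by (meson dvdE)
  then have "\<one> = pev x g \<otimes> pev x v" using x pev_1 pev_mult by metis
  then show False using g one_not_m m_r x by simp
 qed
 then have "is_unit w" using Factorial_Ring.irreducibleD[OF f(1) w] by blast
 then have "f dvd g" using w by simp
 then show ?thesis using gd[OF h] dvd_trans by blast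
qed

text \<open>K-linear forms on m/q, written as functions on m.\<close>
definition functional where
 "functional la \<longleftrightarrow> (\<forall>x\<in>m. la x : carrier (R Quot m) \<and> (\<forall>y\<in>m. la (x \<oplus> y) = la x \<oplus>\<^bsub>R Quot m\<^esub> la y) \<and>
  (\<forall>a\<in>carrier R. la (a \<otimes> x) = (m +> a) \<otimes>\<^bsub>R Quot m\<^esub> la x)) \<and> (\<forall>x\<in>q. la x = \<zero>\<^bsub>R Quot m\<^esub>)"

lemma functionalD:
 assumes "functional la"
 shows "x : m ==> la x : carrier (R Quot m)" "x : m ==> y : m ==> la (x \<oplus> y) = la x \<oplus>\<^bsub>R Quot m\<^esub> la y"
  "x : m ==> a : carrier R ==> la (a \<otimes> x) = (m +> a) \<otimes>\<^bsub>R Quot m\<^esub> la x"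
  "x : q ==> la x = \<zero>\<^bsub>R Quot m\<^esub>"
 using assms by (auto simp: functional_def)

lemma K_cring: "cring (R Quot m)"
 by (rule ideal.quotient_is_cring[OF m_ideal R.is_cring])

lemma pi_hom: "(\<lambda>a. m +> a) : ring_hom R (R Quot m)"
 using ideal.rcos_ring_hom[OF m_ideal] by simp

lemma K_carrier: "A : carrier (R Quot m) \<longleftrightarrow> (\<exists>a\<in>carrier R. A = m +> a)"
 by (auto simp: FactRing_def A_RCOSETS_def' )

lemma pi_eq_iff: "a : carrier R ==> b : carrier R ==> m +> a = m +> b \<longleftrightarrow> a \<ominus> b : m"
 using R.quotient_eq_iff_same_a_r_cos[OF m_ideal, of a b] by auto

lemma K_zero: "\<zero>\<^bsub>R Quot m\<^esub> = m" "m +> a = m \<longleftrightarrow> a : m" if "a : carrier R" for a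
proof -
 show z: "\<zero>\<^bsub>R Quot m\<^esub> = m" by (simp add: FactRing_def)
 have "m +> \<zero> = m" using z ring_hom_zero[OF pi_hom R.ring_axioms cring.axioms(1)[OF K_cring]] by simp
 then show "m +> a = m \<longleftrightarrow> a : m" using pi_eq_iff[OF that R.zero_closed] that by (simp add: a_minus_def)
qed

text \<open>By Zorn's lemma there is an ideal J maximal among those between N and m that avoid x. By
  maximality x lies in J + (y) for every y in m outside J, with a unit coefficient; so m/J is a line
  spanned by x, and the coordinate on it is the functional. No finiteness of m/q enters.\<close>
lemma ex_functional:
 assumes N: "ideal N R" "q <= N" "N <= m" and x: "x : m" "x \<notin> N"
 shows "\<exists>la. functional la \<and> (\<forall>y\<in>N. la y = \<zero>\<^bsub>R Quot m\<^esub>) \<and> la x = \<one>\<^bsub>R Quot m\<^esub>"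
proof -
 let ?F = "{J. ideal J R \<and> N <= J \<and> J <= m \<and> x \<notin> J}"
 have "\<exists>J\<in>?F. \<forall>J'\<in>?F. J <= J' --> J' = J"
 proof (rule subset_Zorn_nonempty)
  show "?F \<noteq> {}" using N x by auto
  fix Ch assume ne: "Ch \<noteq> {}" and ch: "subset.chain ?F Ch"
  have sub: "Ch <= ?F" using ch by (auto simp: subset_chain_def)
  have "ideal (\<Union>Ch) R"
  proof (rule idealI[OF R.ring_axioms])
   show "subgroup (\<Union>Ch) (add_monoid R)"
   proof (rule R.add.subgroupI)
    show "\<Union>Ch <= carrier R" using sub m_in by blast
    show "\<Union>Ch \<noteq> {}" using ne sub additive_subgroup.zero_closed[OF ideal.axioms(1)] by fastforce
    show "\<ominus> a : \<Union>Ch" if "a : \<Union>Ch" for a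
    proof -
     obtain J where J: "J : Ch" "a : J" using \<open>a : \<Union>Ch\<close> by blast
     then have "\<ominus> a : J" using sub additive_subgroup.a_inv_closed[OF ideal.axioms(1), of J R a] by blast
     then show ?thesis using J(1) by blast
    qed
    fix a b assume "a : \<Union>Ch" "b : \<Union>Ch"
    then obtain J J' where J: "J : Ch" "a : J" "J' : Ch" "b : J'" by blast
    then have "J <= J' \<or> J' <= J" using ch by (auto simp: subset_chain_def)
    then obtain L where L: "L : Ch" "a : L" "b : L" using J by blast
    then have "a \<oplus> b : L" using sub additive_subgroup.a_closed[OF ideal.axioms(1), of L R] by blast
    then show "a \<oplus> b : \<Union>Ch" using L by blast
   qed
   show "y \<otimes> a : \<Union>Ch" "a \<otimes> y : \<Union>Ch" if "a : \<Union>Ch" "y : carrier R" for a y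
   proof -
    obtain J where J: "J : Ch" "a : J" using \<open>a : \<Union>Ch\<close> by blast
    then have "ideal J R" using sub by blast
    then have "y \<otimes> a : J" "a \<otimes> y : J" using J(2) that(2) ideal.I_l_closed ideal.I_r_closed by metis+
    then show "y \<otimes> a : \<Union>Ch" "a \<otimes> y : \<Union>Ch" using J(1) by auto
   qed
  qed
  then show "\<Union>Ch : ?F" using sub ne by blast
 qed
 then obtain J where JF: "J : ?F" and maxF: "\<forall>J'\<in>?F. J <= J' --> J' = J" by (elim bexE)
 have J: "ideal J R" "N <= J" "J <= m" "x \<notin> J" using JF by auto
 have max: "J' = J" if "ideal J' R" "N <= J'" "J' <= m" "x \<notin> J'" "J <= J'" for J'
  using maxF that by simp
 note Ja = additive_subgroup.a_closed[OF ideal.axioms(1)[OF J(1)]] and Jn = additive_subgroup.a_inv_closed[OF ideal.axioms(1)[OF J(1)]]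
  and Jz = additive_subgroup.zero_closed[OF ideal.axioms(1)[OF J(1)]] and Jl = ideal.I_l_closed[OF J(1)]
 have JR: "J <= carrier R" using J(3) m_in by blast
 have xR: "x : carrier R" using x m_in by blast
 have ex: "\<exists>a\<in>carrier R. y \<ominus> a \<otimes> x : J" if y: "y : m" for y
 proof (cases "y : J")
  case True
  then show ?thesis using JR xR by (intro bexI[of _ "\<zero>"]) (auto simp: a_minus_def)
 next
  case False
  have yR: "y : carrier R" using y m_in by blast
  let ?J = "J <+>\<^bsub>R\<^esub> PIdl y"
  have id: "ideal ?J R" by (rule R.add_ideals[OF J(1) R.cgenideal_ideal[OF yR]])
  have mem: "z : ?J \<longleftrightarrow> (\<exists>j\<in>J. \<exists>b\<in>carrier R. z = j \<oplus> b \<otimes> y)" for z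
   by (auto simp: set_add_def' cgenideal_def)
  have JJ: "J <= ?J"
  proof
   fix j assume j: "j : J"
   then have "j = j \<oplus> \<zero> \<otimes> y" using yR JR by auto
   then show "j : ?J" using mem j R.zero_closed by blast
  qed
  have "y = \<zero> \<oplus> \<one> \<otimes> y" using yR by simp
  then have yJ: "y : ?J" using mem Jz by blast
  have Jm: "?J <= m"
  proof
   fix w assume "w : ?J"
   then obtain j b where "j : J" "b : carrier R" "w = j \<oplus> b \<otimes> y" using mem by blast
   then show "w : m" using J(3) m_add m_l[OF y] by blast
  qed
  have "?J \<noteq> J" using yJ False by auto
  then have "x : ?J" using max[OF id order_trans[OF J(2) JJ] Jm _ JJ] by auto
  then obtain j b where jb: "j : J" "b : carrier R" "x = j \<oplus> b \<otimes> y" using mem by blast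
  have "b \<notin> m"
  proof
   assume "b : m"
   then have "b \<otimes> y : J" using mm y N(2) J(2) by blast
   then show False using jb Ja J(4) by blast
  qed
  then have bU: "b : Units R" using jb not_m by blast
  let ?a = "inv\<^bsub>R\<^esub> b"
  have jR: "j : carrier R" using jb JR by blast
  have "y \<ominus> ?a \<otimes> x = \<ominus> (?a \<otimes> j)"
  proof -
   have "?a \<otimes> x = y \<oplus> ?a \<otimes> j"
    unfolding jb(3) using bU jb(2) jR yR by (simp add: R.r_distr R.m_assoc[symmetric] R.a_comm)
   then show ?thesis using bU jR yR by (simp add: a_minus_def R.minus_add R.r_neg2)
  qed
  then show ?thesis using Jn Jl jb(1) bU by (metis R.Units_inv_closed)
 qed
 have uniq: "m +> a = m +> b" if "a : carrier R" "b : carrier R" "y : m" "y \<ominus> a \<otimes> x : J" "y \<ominus> b \<otimes> x : J" for a b y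
 proof -
  have yR: "y : carrier R" using that m_in by blast
  have "(y \<ominus> b \<otimes> x) \<oplus> \<ominus> (y \<ominus> a \<otimes> x) : J" using that Ja Jn by blast
  moreover have "(y \<ominus> b \<otimes> x) \<oplus> \<ominus> (y \<ominus> a \<otimes> x) = (a \<ominus> b) \<otimes> x"
   using that(1,2) yR xR by (simp add: a_minus_def R.minus_add R.l_distr R.l_minus R.a_ac R.r_neg R.r_neg1 R.r_neg2)
  ultimately have d: "(a \<ominus> b) \<otimes> x : J" by simp
  have "a \<ominus> b : m"
  proof (rule ccontr)
   assume "a \<ominus> b \<notin> m"
   then have u: "a \<ominus> b : Units R" using that not_m by simp
   have "inv\<^bsub>R\<^esub> (a \<ominus> b) \<otimes> ((a \<ominus> b) \<otimes> x) : J" using Jl[OF d] u by simp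
   then show False using u xR J(4) that by (simp add: R.m_assoc[symmetric])
  qed
  then show ?thesis using pi_eq_iff that by simp
 qed
 define c where "c y = (SOME a. a : carrier R \<and> y \<ominus> a \<otimes> x : J)" for y
 have c: "c y : carrier R" "y \<ominus> c y \<otimes> x : J" if "y : m" for y
  using someI_ex[of "\<lambda>a. a : carrier R \<and> y \<ominus> a \<otimes> x : J"] ex[OF that] unfolding c_def by blast+
 define la where "la y = m +> c y" for y
 have laI: "la y = m +> a" if "y : m" "a : carrier R" "y \<ominus> a \<otimes> x : J" for y a
  unfolding la_def using uniq c that by blast
 have laJ: "la y = \<zero>\<^bsub>R Quot m\<^esub>" if "y : J" for y
 proof -
  have "la y = m +> \<zero>" by (rule laI) (use that J(3) JR xR in "auto simp: a_minus_def")
  then show ?thesis using ring_hom_zero[OF pi_hom R.ring_axioms cring.axioms(1)[OF K_cring]] by simp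
 qed
 have "functional la"
  unfolding functional_def
 proof (intro conjI ballI)
  show "la y : carrier (R Quot m)" if "y : m" for y using c[OF that] K_carrier by (auto simp: la_def)
  fix y z assume y: "y : m" and z: "z : m"
  have yz: "y : carrier R" "z : carrier R" using y z m_in by auto
  have "la (y \<oplus> z) = m +> (c y \<oplus> c z)"
  proof (rule laI)
   have "(y \<oplus> z) \<ominus> (c y \<oplus> c z) \<otimes> x = (y \<ominus> c y \<otimes> x) \<oplus> (z \<ominus> c z \<otimes> x)"
    using c(1)[OF y] c(1)[OF z] yz xR by (simp add: a_minus_def R.l_distr R.minus_add R.a_ac)
   then show "(y \<oplus> z) \<ominus> (c y \<oplus> c z) \<otimes> x : J" using Ja c(2)[OF y] c(2)[OF z] by simp
  qed (use y z m_add c in auto)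
  then show "la (y \<oplus> z) = la y \<oplus>\<^bsub>R Quot m\<^esub> la z"
   using ring_hom_add[OF pi_hom c(1)[OF y] c(1)[OF z]] by (simp add: la_def)
 next
  fix y a assume y: "y : m" and a: "a : carrier R"
  have "la (a \<otimes> y) = m +> (a \<otimes> c y)"
  proof (rule laI)
   have "(a \<otimes> y) \<ominus> (a \<otimes> c y) \<otimes> x = a \<otimes> (y \<ominus> c y \<otimes> x)"
    using c(1)[OF y] y m_in a xR by (simp add: a_minus_def R.r_distr R.r_minus R.m_assoc)
   then show "(a \<otimes> y) \<ominus> (a \<otimes> c y) \<otimes> x : J" using Jl[OF c(2)[OF y] a] by simp
  qed (use y a m_l c in auto)
  then show "la (a \<otimes> y) = (m +> a) \<otimes>\<^bsub>R Quot m\<^esub> la y"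
   using ring_hom_mult[OF pi_hom a c(1)[OF y]] by (simp add: la_def)
 next
  show "la y = \<zero>\<^bsub>R Quot m\<^esub>" if "y : q" for y using laJ that N(2) J(2) by blast
 qed
 moreover have "la x = \<one>\<^bsub>R Quot m\<^esub>"
 proof -
  have "la x = m +> \<one>" by (rule laI) (use x xR Jz in "auto simp: R.r_neg a_minus_def")
  then show ?thesis using ring_hom_one[OF pi_hom] by simp
 qed
 ultimately show ?thesis using laJ J(2) by blast
qed

end

locale local_alg = local_ring_q R \<kappa> m q for R :: "('r, 'm) ring_scheme" (structure) and \<kappa> :: "'k::field => 'r" and m q +
 assumes perfect: "Factorial_Ring.irreducible (f :: 'k poly) ==> coprime f (pderiv f)"
  and algebraic: "x : carrier R ==> \<exists>h. Factorial_Ring.irreducible h \<and> pev x h : m"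
begin

lemma separable_root:
 assumes x: "x : carrier R" and f: "Factorial_Ring.irreducible f" "pev x f : m"
 shows "pev x (pderiv f) \<notin> m"
proof
 assume "pev x (pderiv f) : m"
 then have "f dvd pderiv f" using irred_dvd[OF x f] by blast
 then have "is_unit f" using perfect[OF f(1)] by (metis coprime_common_divisor dvd_refl)
 then show False using f(1) Factorial_Ring.irreducible_not_unit by blast
qed

text \<open>Simple roots modulo q of polynomials over k. They form a subalgebra that contains q and
  maps onto the residue field with kernel q, that is, they give a lift of the residue field to R/q.
  This is Hensel's lemma, which needs no completeness because m/q has square zero.\<close>
definition Th where "Th = {r : carrier R. \<exists>h. pev r h : q \<and> pev r (pderiv h) \<notin> m}"

lemma Th_in: "r : Th ==> r : carrier R" by (simp add: Th_def)

text \<open>The irreducible f vanishing at r modulo m divides h; the cofactor is a unit at r because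
  the root is simple, so f already vanishes modulo q, and f divides g.\<close>
lemma Th_univariate:
 assumes r: "r : Th" and g: "pev r g : m"
 shows "pev r g : q"
proof -
 obtain h where h: "pev r h : q" "pev r (pderiv h) \<notin> m" and rR: "r : carrier R" using r by (auto simp: Th_def)
 obtain f where f: "Factorial_Ring.irreducible f" "pev r f : m" using algebraic[OF rR] by blast
 obtain w where w: "h = f * w" using irred_dvd[OF rR f] h(1) qm by (meson dvdE subsetD)
 have "pev r (pderiv h) = pev r f \<otimes> pev r (pderiv w) \<oplus> pev r w \<otimes> pev r (pderiv f)"
  using rR by (simp add: w pderiv_mult pev_add pev_mult)
 then have wm: "pev r w \<notin> m" using h(2) f(2) rR m_add m_r by auto
 have "pev r w \<otimes> pev r f : q" using h(1) rR by (simp add: w pev_mult R.m_comm)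
 then have fq: "pev r f : q" using unit_cancel_q[of "pev r w" "pev r f"] wm rR by simp
 obtain v where "g = f * v" using irred_dvd[OF rR f g] by (meson dvdE)
 then show ?thesis using fq rR by (simp add: pev_mult q_r)
qed

lemma Th_m: "r : Th ==> r : m ==> r : q"
 using Th_univariate[of r "[:0, 1:]"] by (simp add: pev_pCons Th_in)

text \<open>One Newton step.\<close>
lemma Th_lift:
 assumes r: "r : carrier R"
 shows "\<exists>t\<in>Th. r \<ominus> t : m"
proof -
 obtain f where f: "Factorial_Ring.irreducible f" "pev r f : m" using algebraic[OF r] by blast
 note nf = separable_root[OF r f]
 let ?b = "pev r (pderiv f)"
 have bU: "?b : Units R" using nf r by (simp add: not_m)
 let ?d = "\<ominus> (pev r f \<otimes> inv\<^bsub>R\<^esub> ?b)"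
 have dm: "?d : m" using f(2) bU by (simp add: m_neg m_r)
 have dR: "?d : carrier R" using dm m_in by blast
 obtain w where w: "w : carrier R" "pev (r \<oplus> ?d) f = pev r f \<oplus> ?d \<otimes> ?b \<oplus> (?d \<otimes> ?d) \<otimes> w"
  using pev_Taylor[OF r dR] by blast
 have "?d \<otimes> ?b = \<ominus> pev r f" using bU r by (simp add: R.l_minus R.m_assoc)
 then have "pev (r \<oplus> ?d) f = (?d \<otimes> ?d) \<otimes> w" using w r dR by (simp add: R.r_neg)
 then have 1: "pev (r \<oplus> ?d) f : q" using mm[OF dm dm] w(1) by (simp add: q_r)
 obtain v where v: "v : carrier R" "pev (r \<oplus> ?d) (pderiv f) = ?b \<oplus> ?d \<otimes> pev r (pderiv (pderiv f)) \<oplus> (?d \<otimes> ?d) \<otimes> v"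
  using pev_Taylor[OF r dR] by blast
 have "pev (r \<oplus> ?d) (pderiv f) = ?b \<oplus> (?d \<otimes> pev r (pderiv (pderiv f)) \<oplus> (?d \<otimes> ?d) \<otimes> v)"
  using v r dR by (simp add: R.a_assoc)
 moreover have "?d \<otimes> pev r (pderiv (pderiv f)) \<oplus> (?d \<otimes> ?d) \<otimes> v : m"
  using dm r dR v(1) by (simp add: m_add m_r)
 ultimately have 2: "pev (r \<oplus> ?d) (pderiv f) \<notin> m"
  using nf add_cancel_m r m_in by auto
 have "r \<oplus> ?d : Th" using 1 2 r dR by (auto simp: Th_def)
 moreover have "r \<ominus> (r \<oplus> ?d) = \<ominus> ?d"
  using r dR by (simp add: a_minus_def R.minus_add R.a_assoc[symmetric] R.r_neg)
 ultimately show ?thesis using m_neg[OF dm] by metis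
qed

text \<open>The same argument over k[r] in place of k, with t as the variable. A polynomial p of
  least degree in the second variable, with unit leading coefficient and value in m at t, replaces
  the minimal polynomial, and pseudo-division by p replaces divisibility; remainders have
  coefficients in m, hence in q because r is in Th. The simple root h of t gives p(t) in q, and then
  g(t) is in q.\<close>
lemma Th_bivariate:
 assumes r: "r : Th" and t: "t : Th" and g: "poly_eval.pev R (pev r) t g : m"
 shows "poly_eval.pev R (pev r) t g : q"
proof -
 have rR: "r : carrier R" and tR: "t : carrier R" using r t Th_in by auto
 interpret B: poly_eval R "pev r" by (rule pev_poly_eval[OF rR])
 let ?E = "B.pev t"
 note Bs = B.pev_add[OF tR] B.pev_mult[OF tR] B.pev_smult[OF tR] B.pev_in[OF tR]
 obtain h where h: "pev t h : q" "pev t (pderiv h) \<notin> m" using t by (auto simp: Th_def)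
 define h2 where "h2 = map_poly (\<lambda>c. [:c:]) h"
 have lift: "?E (map_poly (\<lambda>c. [:c:]) p) = pev t p" for p
  by (induction p) (auto simp: map_poly_pCons B.pev_pCons[OF tR] pev_pCons tR rR)
 have dlift: "pderiv (map_poly (\<lambda>c. [:c:]) p) = map_poly (\<lambda>c. [:c:]) (pderiv p)" for p :: "'k poly"
  by (intro poly_eqI) (simp add: coeff_pderiv coeff_map_poly of_nat_poly mult.commute)
 let ?S = "\<lambda>p. pev r (Polynomial.lead_coeff p) \<notin> m \<and> ?E p : m"
 have h0: "h \<noteq> 0" using h(2) tR m_0 by auto
 have dh2: "Polynomial.degree h2 = Polynomial.degree h" unfolding h2_def by (rule degree_map_poly) auto
 have "Polynomial.lead_coeff h2 = [:Polynomial.lead_coeff h:]" by (simp add: dh2) (simp add: h2_def coeff_map_poly)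
 then have "?S h2" using h(1) qm kap_not_m[of "Polynomial.lead_coeff h"] h0 rR by (auto simp: h2_def lift)
 then obtain p where p: "?S p" and least: "\<And>p'. ?S p' ==> Polynomial.degree p \<le> Polynomial.degree p'"
  using ex_has_least_nat[of ?S h2 Polynomial.degree] by blast
 have p0: "p \<noteq> 0" using p rR m_0 by auto
 have small: "pev r (Polynomial.coeff z i) : m" if "z = 0 \<or> Polynomial.degree z < Polynomial.degree p" "?E z : m" for z i
  using that
 proof (induction "Polynomial.degree z" arbitrary: z i rule: less_induct)
  case less
  show ?case
  proof (cases "z = 0")
   case True then show ?thesis using rR m_0 by simp
  next
   case False
   have lm: "pev r (Polynomial.lead_coeff z) : m" using least[of z] less.prems False by fastforce
   let ?M = "Polynomial.monom (Polynomial.lead_coeff z) (Polynomial.degree z)"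
   have EM: "?E ?M : m" by (rule B.pev_in_ideal[OF m_ideal tR]) (use lm m_0 rR in auto)
   define y where "y = z - ?M"
   have "?E y = ?E z \<ominus> ?E ?M" by (simp add: y_def B.pev_diff[OF tR])
   then have Ey: "?E y : m" using m_diff[OF less.prems(2) EM] by simp
   have "y = 0 \<or> Polynomial.degree y < Polynomial.degree z"
   proof (rule ccontr)
    assume n: "\<not> ?thesis"
    have "Polynomial.coeff y (Polynomial.degree z) = 0" by (simp add: y_def)
    moreover have "Polynomial.degree y \<le> Polynomial.degree z" unfolding y_def by (intro degree_diff_le) (auto simp: degree_monom_le)
    ultimately show False using n leading_coeff_0_iff[of y] by (metis le_neq_implies_less)
   qed
   then have "pev r (Polynomial.coeff y i) : m"
   proof
    assume "y = 0" then show ?thesis using rR m_0 by simp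
   next
    assume d: "Polynomial.degree y < Polynomial.degree z"
    then show ?thesis using less.hyps[OF d _ Ey] less.prems(1) False by simp
   qed
   moreover have "Polynomial.coeff z i = Polynomial.coeff y i + (if Polynomial.degree z = i then Polynomial.lead_coeff z else 0)" by (auto simp: y_def)
   moreover have "pev r (if Polynomial.degree z = i then Polynomial.lead_coeff z else 0) : m" using lm rR m_0 by (cases "Polynomial.degree z = i") auto
   ultimately show ?thesis using m_add by (simp only: pev_add[OF rR])
  qed
 qed
 have divide: "\<exists>k w z. smult (Polynomial.lead_coeff p ^ k) f = p * w + z \<and> (?E f : m --> (\<forall>i. pev r (Polynomial.coeff z i) : q))" for f
 proof -
  obtain w z where wz: "pseudo_divmod f p = (w, z)" by (meson surj_pair)
  note d = pseudo_divmod[OF p0 wz]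
  let ?k = "Suc (Polynomial.degree f) - Polynomial.degree p"
  have "pev r (Polynomial.coeff z i) : q" if f: "?E f : m" for i
  proof -
   have "?E (p * w + z) : m" using f rR by (simp add: d(1)[symmetric] Bs m_l)
   then have "?E z \<oplus> ?E p \<otimes> ?E w : m" by (simp add: Bs R.a_comm)
   moreover have "?E p \<otimes> ?E w : m" using p by (simp add: m_r Bs)
   ultimately have "?E z : m" using add_cancel_m Bs by simp
   then have "pev r (Polynomial.coeff z i) : m" using small d(2) by blast
   then show ?thesis by (rule Th_univariate[OF r])
  qed
  then show ?thesis using d(1) by blast
 qed
 have lcU: "pev r (Polynomial.lead_coeff p ^ k) \<notin> m" for k
 proof -
  have "pev r (Polynomial.lead_coeff p) : Units R" using p not_m rR by simp
  then have "pev r (Polynomial.lead_coeff p) [^] k : Units R" by (rule R.Units_pow_closed)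
  then show ?thesis using unit_not_m rR by (simp add: pev_power)
 qed
 have pq: "?E p : q"
 proof -
  have Eh: "?E h2 : q" using h(1) by (simp add: h2_def lift)
  then have "?E h2 : m" using qm by blast
  then obtain k w z where d: "smult (Polynomial.lead_coeff p ^ k) h2 = p * w + z" and z: "\<And>i. pev r (Polynomial.coeff z i) : q"
   using divide[of h2] by blast
  have Ez: "?E z : q" by (rule B.pev_in_ideal[OF q_ideal tR z])
  have Ez': "?E (pderiv z) : q"
   by (rule B.pev_in_ideal[OF q_ideal tR]) (use z rR in "auto simp: coeff_pderiv pev_mult q_l")
  have "smult (Polynomial.lead_coeff p ^ k) (pderiv h2) = p * pderiv w + w * pderiv p + pderiv z"
   using arg_cong[OF d, of pderiv] by (simp add: pderiv_smult pderiv_add pderiv_mult)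
  from arg_cong[OF this, of ?E]
  have e1: "pev r (Polynomial.lead_coeff p ^ k) \<otimes> ?E (pderiv h2) = ?E p \<otimes> ?E (pderiv w) \<oplus> ?E w \<otimes> ?E (pderiv p) \<oplus> ?E (pderiv z)"
   by (simp only: Bs)
  have n1: "pev r (Polynomial.lead_coeff p ^ k) \<otimes> ?E (pderiv h2) \<notin> m"
  proof
   assume "pev r (Polynomial.lead_coeff p ^ k) \<otimes> ?E (pderiv h2) : m"
   then have "pev r (Polynomial.lead_coeff p ^ k) : m \<or> ?E (pderiv h2) : m"
    by (intro m_prime) (use Bs rR in auto)
   then show False using lcU[of k] h(2) by (simp add: h2_def dlift lift)
  qed
  have wm: "?E w \<notin> m"
  proof
   assume "?E w : m"
   then have "?E p \<otimes> ?E (pderiv w) \<oplus> ?E w \<otimes> ?E (pderiv p) \<oplus> ?E (pderiv z) : m"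
    using p Ez' qm by (intro m_add m_r) (auto simp: Bs)
   then show False using n1 unfolding e1 by blast
  qed
  have e2: "pev r (Polynomial.lead_coeff p ^ k) \<otimes> ?E h2 = ?E p \<otimes> ?E w \<oplus> ?E z"
   using arg_cong[OF d, of ?E] by (simp only: Bs)
  have "pev r (Polynomial.lead_coeff p ^ k) \<otimes> ?E h2 : q" by (rule q_l[OF Eh]) (use rR in simp)
  then have "?E p \<otimes> ?E w : q" unfolding e2 by (rule add_cancel_q[OF _ Ez, rotated]) (simp add: Bs)
  then have "?E w \<otimes> ?E p : q" using R.m_comm[of "?E p" "?E w"] Bs(4) by simp
  then show ?thesis using unit_cancel_q wm Bs by blast
 qed
 obtain k w z where d: "smult (Polynomial.lead_coeff p ^ k) g = p * w + z" and z: "\<And>i. pev r (Polynomial.coeff z i) : q"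
  using divide[of g] g by blast
 have Ez: "?E z : q" by (rule B.pev_in_ideal[OF q_ideal tR z])
 have "pev r (Polynomial.lead_coeff p ^ k) \<otimes> ?E g = ?E p \<otimes> ?E w \<oplus> ?E z"
  using arg_cong[OF d, of ?E] by (simp only: Bs)
 also have "\<dots> : q" using pq Ez Bs by (simp add: q_add q_r)
 finally show ?thesis by (rule unit_cancel_q[rotated 3]) (use lcU rR Bs in auto)
qed

text \<open>For the irreducible h vanishing modulo m at the value of Q, h(Q) is again a polynomial
  in r and t and so vanishes modulo q; it is separable because k is perfect.\<close>
lemma Th_closed:
 assumes r: "r : Th" and t: "t : Th"
 shows "poly_eval.pev R (pev r) t Q : Th"
proof -
 have rR: "r : carrier R" and tR: "t : carrier R" using r t Th_in by auto
 interpret B: poly_eval R "pev r" by (rule pev_poly_eval[OF rR])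
 let ?E = "B.pev t"
 let ?x = "?E Q"
 have xR: "?x : carrier R" using B.pev_in[OF tR] .
 have ex: "\<exists>P. pev ?x h = ?E P" for h
 proof (induction h)
  case 0 show ?case using xR tR by (intro exI[of _ 0]) simp
 next
  case (pCons a h)
  then obtain P where "pev ?x h = ?E P" by blast
  then show ?case using xR tR rR
   by (intro exI[of _ "[:[:a:]:] + Q * P"]) (simp add: pev_pCons B.pev_add B.pev_mult)
 qed
 obtain h where h: "Factorial_Ring.irreducible h" "pev ?x h : m" using algebraic[OF xR] by blast
 have "pev ?x h : q" using ex[of h] Th_bivariate[OF r t] h(2) by metis
 then show ?thesis using separable_root[OF xR h] xR by (auto simp: Th_def)
qed

lemma Th_add: "r : Th ==> t : Th ==> r \<oplus> t : Th"
 and Th_mult: "r : Th ==> t : Th ==> r \<otimes> t : Th"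
proof -
 assume r: "r : Th" and t: "t : Th"
 have rR: "r : carrier R" and tR: "t : carrier R" using r t Th_in by auto
 interpret B: poly_eval R "pev r" by (rule pev_poly_eval[OF rR])
 show "r \<oplus> t : Th" using Th_closed[OF r t, of "[:[:0,1:],1:]"] rR tR by (simp add: B.pev_pCons pev_pCons)
 show "r \<otimes> t : Th" using Th_closed[OF r t, of "[:0,[:0,1:]:]"] rR tR by (simp add: B.pev_pCons pev_pCons R.m_comm)
qed

lemma Th_kap: "\<kappa> c : Th"
proof -
 have "pev (\<kappa> c) [:- c, 1:] = \<zero>" "pev (\<kappa> c) (pderiv [:- c, 1:]) = \<one>"
  by (simp_all add: pev_pCons ph_minus R.l_neg pderiv_pCons)
 then show ?thesis unfolding Th_def using q_0 one_not_m by (metis (mono_tags, lifting) mem_Collect_eq ph_in)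
qed

lemma Th_minus: "r : Th ==> \<ominus> r : Th"
 using Th_mult[OF Th_kap[of "-1"], of r] Th_in[of r] by (simp add: ph_minus R.l_minus)

lemma Th_diff: "r : Th ==> t : Th ==> r \<ominus> t : Th"
 by (simp add: a_minus_def Th_add Th_minus)

text \<open>Every element of R is the sum of an element of Th and one of m. The automorphism
  preserves Th, and an element of Th is determined modulo q by its residue.\<close>
lemma auto_trivial:
 assumes s: "s : ring_hom R R" and sk: "\<And>c. s (\<kappa> c) = \<kappa> c" and sq: "\<And>a. a : q ==> s a : q"
  and s1: "\<And>r. r : carrier R ==> s r \<ominus> r : m" and s2: "\<And>t. t : m ==> s t \<ominus> t : q"
  and r: "r : carrier R"
 shows "s r \<ominus> r : q"
proof -
 have sR: "s a : carrier R" if "a : carrier R" for a using ring_hom_closed[OF s that] .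
 have spev: "s (pev x h) = pev (s x) h" if "x : carrier R" for x h
  using that ring_hom_zero[OF s R.ring_axioms R.ring_axioms]
  by (induction h) (auto simp: pev_pCons sR ring_hom_add[OF s] ring_hom_mult[OF s] sk)
 have sTh: "s t : Th" if t: "t : Th" for t
 proof -
  obtain h where h: "pev t h : q" "pev t (pderiv h) \<notin> m" and tR: "t : carrier R" using t by (auto simp: Th_def)
  have "pev (s t) h : q" using sq[OF h(1)] spev[OF tR] by simp
  moreover have "pev (s t) (pderiv h) \<notin> m"
  proof
   assume a: "pev (s t) (pderiv h) : m"
   let ?b = "pev t (pderiv h)"
   have "s ?b : m" using a spev[OF tR] by simp
   then have "s ?b \<ominus> (s ?b \<ominus> ?b) : m" using s1[of ?b] tR m_diff by simp
   moreover have "s ?b \<ominus> (s ?b \<ominus> ?b) = ?b"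
    using sR[of ?b] tR by (simp add: a_minus_def R.minus_add R.a_assoc[symmetric] R.r_neg)
   ultimately show False using h(2) by simp
  qed
  ultimately show ?thesis using sR[OF tR] by (auto simp: Th_def)
 qed
 obtain t where t: "t : Th" "r \<ominus> t : m" using Th_lift[OF r] by blast
 have tR: "t : carrier R" using t Th_in by blast
 have 1: "s t \<ominus> t : q" using Th_m[OF Th_diff[OF sTh[OF t(1)] t(1)]] s1[OF tR] .
 let ?e = "r \<ominus> t"
 have eR: "?e : carrier R" using r tR by simp
 have rte: "r = t \<oplus> ?e" using r tR by (simp add: a_minus_def R.a_lcomm R.r_neg)
 have 2: "s ?e \<ominus> ?e : q" using s2[OF t(2)] .
 have "s r \<ominus> r = (s t \<oplus> s ?e) \<ominus> (t \<oplus> ?e)"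
  using rte ring_hom_add[OF s tR eR] by metis
 also have "\<dots> = (s t \<ominus> t) \<oplus> (s ?e \<ominus> ?e)"
  using sR[OF tR] sR[OF eR] tR eR by (simp only: a_minus_def R.minus_add R.a_ac R.add.inv_closed R.add.m_closed)
 finally show ?thesis using q_add[OF 1 2] by simp
qed

text \<open>Modulo q the ring is the direct sum of Th and m; the derivation is the projection to m
  followed by the functional. The choice of the representative in Th does not matter, because Th and
  m meet in q.\<close>
lemma ex_derivation:
 assumes la: "functional la"
 shows "\<exists>D\<in>carrier R \<rightarrow>\<^sub>E carrier (R Quot m).
  (\<forall>a\<in>carrier R. \<forall>b\<in>carrier R. D (a \<oplus> b) = D a \<oplus>\<^bsub>R Quot m\<^esub> D b \<and>
    D (a \<otimes> b) = ((m +> a) \<otimes>\<^bsub>R Quot m\<^esub> D b) \<oplus>\<^bsub>R Quot m\<^esub> ((m +> b) \<otimes>\<^bsub>R Quot m\<^esub> D a)) \<and>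
  (\<forall>c. D (\<kappa> c) = \<zero>\<^bsub>R Quot m\<^esub>) \<and> (\<forall>x\<in>m. D x = la x)"
proof -
 interpret K: cring "R Quot m" by (rule K_cring)
 note l = functionalD[OF la]
 define t where "t r = (SOME t. t : Th \<and> r \<ominus> t : m)" for r
 have t: "t r : Th" "r \<ominus> t r : m" if "r : carrier R" for r
  using someI_ex[of "\<lambda>t. t : Th \<and> r \<ominus> t : m"] Th_lift[OF that] unfolding t_def by blast+
 define D where "D = (\<lambda>r\<in>carrier R. la (r \<ominus> t r))"
 have DI: "D r = la (r \<ominus> w)" if r: "r : carrier R" and w: "w : Th" "r \<ominus> w : m" for r w
 proof -
  have wR: "w : carrier R" "t r : carrier R" using w t r Th_in by auto
  have "w \<ominus> t r = (r \<ominus> t r) \<ominus> (r \<ominus> w)"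
  proof -
   have "(r \<ominus> t r) \<ominus> (r \<ominus> w) = (r \<oplus> \<ominus> r) \<oplus> (w \<oplus> \<ominus> t r)"
    using wR r by (simp only: a_minus_def R.minus_add R.minus_minus R.a_ac R.add.inv_closed R.add.m_closed)
   then show ?thesis using wR r by (simp add: R.r_neg a_minus_def)
  qed
  then have "w \<ominus> t r : m" using m_diff t(2)[OF r] w(2) by simp
  then have dq: "w \<ominus> t r : q" using Th_m Th_diff[OF w(1) t(1)[OF r]] by blast
  have e: "r \<ominus> t r = (r \<ominus> w) \<oplus> (w \<ominus> t r)"
   using wR r by (simp add: a_minus_def R.a_ac R.r_neg R.r_neg1 R.r_neg2)
  have "la (r \<ominus> t r) = la (r \<ominus> w) \<oplus>\<^bsub>R Quot m\<^esub> la (w \<ominus> t r)"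
   unfolding e by (rule l(2)) (use w(2) dq qm in auto)
  then show ?thesis using l(4)[OF dq] l(1)[OF w(2)] r by (simp add: D_def)
 qed
 have DK: "D r : carrier (R Quot m)" if "r : carrier R" for r using that t[OF that] l(1) by (simp add: D_def)
 show ?thesis
 proof (intro bexI[of _ D] conjI ballI allI)
  show "D : carrier R \<rightarrow>\<^sub>E carrier (R Quot m)" using DK by (auto simp: D_def)
  show "D (\<kappa> c) = \<zero>\<^bsub>R Quot m\<^esub>" for c
   using DI[of "\<kappa> c" "\<kappa> c"] Th_kap m_0 l(4)[OF q_0] by (simp add: R.r_neg a_minus_def)
  show "D x = la x" if x: "x : m" for x
  proof -
   have "\<zero> : Th" using Th_kap[of 0] by simp
   then show ?thesis using DI[of x "\<zero>"] x m_in by (simp add: a_minus_def)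
  qed
  fix a b assume a: "a : carrier R" and b: "b : carrier R"
  let ?s = "t a" and ?u = "t b"
  let ?x = "a \<ominus> ?s" and ?y = "b \<ominus> ?u"
  have su: "?s : carrier R" "?u : carrier R" using t a b Th_in by auto
  have xy: "?x : m" "?y : m" "?x : carrier R" "?y : carrier R" using t a b m_in by auto
  show "D (a \<oplus> b) = D a \<oplus>\<^bsub>R Quot m\<^esub> D b"
  proof -
   have e: "(a \<oplus> b) \<ominus> (?s \<oplus> ?u) = ?x \<oplus> ?y" using a b su by (simp add: a_minus_def R.minus_add R.a_ac)
   have "D (a \<oplus> b) = la ((a \<oplus> b) \<ominus> (?s \<oplus> ?u))"
    by (rule DI) (use a b t Th_add m_add xy e in auto)
   then show ?thesis using l(2)[OF xy(1,2)] a b by (simp add: e D_def)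
  qed
  show "D (a \<otimes> b) = ((m +> a) \<otimes>\<^bsub>R Quot m\<^esub> D b) \<oplus>\<^bsub>R Quot m\<^esub> ((m +> b) \<otimes>\<^bsub>R Quot m\<^esub> D a)"
  proof -
   have as: "a = ?s \<oplus> ?x" using a su by (simp add: a_minus_def R.a_lcomm R.r_neg)
   have e: "(a \<otimes> b) \<ominus> (?s \<otimes> ?u) = a \<otimes> ?y \<oplus> ?u \<otimes> ?x"
    using a b su by (simp add: a_minus_def R.r_distr R.r_minus R.m_comm R.a_ac R.r_neg R.r_neg1 R.r_neg2)
   have mem: "a \<otimes> ?y : m" "?u \<otimes> ?x : m" using m_l xy a su by auto
   have "D (a \<otimes> b) = la ((a \<otimes> b) \<ominus> (?s \<otimes> ?u))"
    by (rule DI) (use a b t Th_mult m_add mem e in auto)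
   also have "\<dots> = la (a \<otimes> ?y) \<oplus>\<^bsub>R Quot m\<^esub> la (?u \<otimes> ?x)" unfolding e by (rule l(2)[OF mem])
   also have "la (?u \<otimes> ?x) = (m +> ?u) \<otimes>\<^bsub>R Quot m\<^esub> la ?x" by (rule l(3)[OF xy(1) su(2)])
   also have "m +> ?u = m +> b"
   proof -
    have "b \<ominus> ?u : m" by (rule xy(2))
    then show ?thesis using pi_eq_iff[OF b su(2)] by simp
   qed
   also have "la (a \<otimes> ?y) = (m +> a) \<otimes>\<^bsub>R Quot m\<^esub> la ?y" by (rule l(3)[OF xy(2) a])
   finally show ?thesis using a b by (simp add: D_def)
  qed
 qed
qed

end

section \<open>Induced modules and projective covers\<close>

lemma Ind_simps:
 "f : carrier (Ind G H V) \<longleftrightarrow> f : carrier G \<rightarrow>\<^sub>E carrier V \<and>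
  (\<forall>x\<in>carrier G. \<forall>h\<in>H. f (x \<otimes>\<^bsub>G\<^esub> h) = act V (inv\<^bsub>G\<^esub> h) (f x))"
 "\<zero>\<^bsub>Ind G H V\<^esub> = (\<lambda>x\<in>carrier G. \<zero>\<^bsub>V\<^esub>)"
 "f \<oplus>\<^bsub>Ind G H V\<^esub> f' = (\<lambda>x\<in>carrier G. f x \<oplus>\<^bsub>V\<^esub> f' x)"
 "c \<odot>\<^bsub>Ind G H V\<^esub> f = (\<lambda>x\<in>carrier G. c \<odot>\<^bsub>V\<^esub> f x)"
 "act (Ind G H V) g f = (\<lambda>x\<in>carrier G. f (inv\<^bsub>G\<^esub> g \<otimes>\<^bsub>G\<^esub> x))"
 by (simp_all add: Ind_def)

lemma Ind_iso:
 assumes G: "group G" and H: "subgroup H G" and V: "grp_module (G\<lparr>carrier := H\<rparr>) V"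
  and iso: "grp_iso (G\<lparr>carrier := H\<rparr>) V W"
 shows "grp_iso G (Ind G H V) (Ind G H W)"
proof -
 interpret group G by (rule G)
 obtain f where f: "f : grp_hom (G\<lparr>carrier := H\<rparr>) V W" "bij_betw f (carrier V) (carrier W)"
  using iso by (auto simp: grp_iso_def)
 note h = grp_homD[OF f(1)]
 note g = grp_hom_inv_into[OF V f] and gb = bij_betw_inv_into[OF f(2)]
 note k = grp_homD[OF g]
 let ?g = "inv_into (carrier V) f"
 have Hi: "inv\<^bsub>G\<^esub> x : H" if "x : H" for x using subgroup.m_inv_closed[OF H that] .
 let ?F = "\<lambda>u. \<lambda>x\<in>carrier G. f (u x)" and ?G = "\<lambda>u. \<lambda>x\<in>carrier G. ?g (u x)"
 have HG: "x : carrier G" if "x : H" for x using subgroup.subset[OF H] that by blast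
 have uV: "u x : carrier V" if "u : carrier (Ind G H V)" "x : carrier G" for u x
  using that by (auto simp: Ind_simps PiE_mem)
 have uW: "u x : carrier W" if "u : carrier (Ind G H W)" "x : carrier G" for u x
  using that by (auto simp: Ind_simps PiE_mem)
 have F: "?F u : carrier (Ind G H W)" if "u : carrier (Ind G H V)" for u
 proof -
  have uV: "u x : carrier V" if "x : carrier G" for x using \<open>u : carrier (Ind G H V)\<close> that by (auto simp: Ind_simps PiE_mem)
  show ?thesis using that h(1)[OF uV] h(4)[OF _ uV] Hi HG by (auto simp: Ind_simps)
 qed
 have G': "?G u : carrier (Ind G H V)" if "u : carrier (Ind G H W)" for u
 proof -
  have uV: "u x : carrier W" if "x : carrier G" for x using \<open>u : carrier (Ind G H W)\<close> that by (auto simp: Ind_simps PiE_mem)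
  show ?thesis using that k(1)[OF uV] k(4)[OF _ uV] Hi HG by (auto simp: Ind_simps)
 qed
 have fg: "f (?g y) = y" if "y : carrier W" for y using that f(2) by (simp add: bij_betw_def f_inv_into_f)
 have gf: "?g (f y) = y" if "y : carrier V" for y using that f(2) by (simp add: bij_betw_def)
 have hom: "?F : grp_hom G (Ind G H V) (Ind G H W)"
 proof (rule grp_homI)
  fix u w assume u: "u : carrier (Ind G H V)" and w: "w : carrier (Ind G H V)"
  show "?F (u \<oplus>\<^bsub>Ind G H V\<^esub> w) = ?F u \<oplus>\<^bsub>Ind G H W\<^esub> ?F w"
   unfolding Ind_simps(3) using h(2) uV[OF u] uV[OF w] by (simp add: fun_eq_iff)
 next
  fix c u assume u: "u : carrier (Ind G H V)"
  show "?F (c \<odot>\<^bsub>Ind G H V\<^esub> u) = c \<odot>\<^bsub>Ind G H W\<^esub> ?F u"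
   unfolding Ind_simps(4) using h(3) uV[OF u] by (simp add: fun_eq_iff)
 next
  fix g u assume g: "g : carrier G" and u: "u : carrier (Ind G H V)"
  show "?F (act (Ind G H V) g u) = act (Ind G H W) g (?F u)"
   unfolding Ind_simps(5) using g by (simp add: fun_eq_iff)
 qed (use F in blast)
 have "bij_betw ?F (carrier (Ind G H V)) (carrier (Ind G H W))"
 proof (rule bij_betwI[of _ _ _ ?G])
  show "?F : carrier (Ind G H V) \<rightarrow> carrier (Ind G H W)" using F by blast
  show "?G : carrier (Ind G H W) \<rightarrow> carrier (Ind G H V)" using G' by blast
  show "?G (?F u) = u" if "u : carrier (Ind G H V)" for u
   by (rule extensionalityI[of _ "carrier G"]) (use that gf uV[OF that] in "auto simp: Ind_simps(1) PiE_def")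
  show "?F (?G u) = u" if "u : carrier (Ind G H W)" for u
   by (rule extensionalityI[of _ "carrier G"]) (use that fg uW[OF that] in "auto simp: Ind_simps(1) PiE_def")
 qed
 then show ?thesis using hom unfolding grp_iso_def by blast
qed

lemma Ind_power:
 assumes G: "group G" and H: "subgroup H G"
 shows "grp_iso G (Ind G H (dir_power n V)) (dir_power n (Ind G H V))"
proof -
 interpret group G by (rule G)
 have HG: "h : carrier G" if "h : H" for h using subgroup.subset[OF H] that by blast
 let ?I = "Ind G H (dir_power n V)" and ?D = "dir_power n (Ind G H V)"
 let ?f = "\<lambda>u. \<lambda>i\<in>{..<n}. \<lambda>x\<in>carrier G. u x i" and ?g = "\<lambda>w. \<lambda>x\<in>carrier G. \<lambda>i\<in>{..<n}. w i x"
 have f: "?f u : carrier ?D" if "u : carrier ?I" for u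
  using that HG by (auto simp: dir_power_def Ind_simps PiE_iff)
 have g: "?g w : carrier ?I" if "w : carrier ?D" for w
  using that HG by (auto simp: dir_power_def Ind_simps PiE_iff fun_eq_iff)
 have "?f : grp_hom G ?I ?D"
  by (rule grp_homI) (use f in "auto simp: dir_power_def Ind_simps fun_eq_iff")
 moreover have "bij_betw ?f (carrier ?I) (carrier ?D)"
  by (rule bij_betwI[of _ _ _ ?g])
   (use f g in "auto simp: dir_power_def Ind_simps fun_eq_iff PiE_iff extensional_def")
 ultimately show ?thesis unfolding grp_iso_def by blast
qed

lemma grp_module_Ind:
 assumes G: "group G" and H: "subgroup H G" and V: "grp_module (G\<lparr>carrier := H\<rparr>) V"
 shows "grp_module G (Ind G H V)"
proof -
 let ?I = "Ind G H V"
 interpret group G by (rule G)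
 note v = grp_moduleD[OF V]
 interpret V: abelian_group V by (rule v(1))
 have Hi: "inv\<^bsub>G\<^esub> x : H" if "x : H" for x using subgroup.m_inv_closed[OF H that] .
 have HG: "x : carrier G" if "x : H" for x using subgroup.subset[OF H] that by blast
 have uV: "u x : carrier V" if "u : carrier ?I" "x : carrier G" for u x
  using that by (auto simp: Ind_simps PiE_mem)
 have uH: "u (x \<otimes>\<^bsub>G\<^esub> h) = act V (inv\<^bsub>G\<^esub> h) (u x)" if "u : carrier ?I" "x : carrier G" "h : H" for u x h
  using that by (auto simp: Ind_simps)
 have ux: "u : extensional (carrier G)" if "u : carrier ?I" for u
  using that by (auto simp: Ind_simps PiE_def)
 have I: "(\<lambda>x\<in>carrier G. w x) : carrier ?I"
  if "\<And>x. x : carrier G ==> w x : carrier V" "\<And>x h. x : carrier G ==> h : H ==> w (x \<otimes>\<^bsub>G\<^esub> h) = act V (inv\<^bsub>G\<^esub> h) (w x)" for w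
  using that HG by (auto simp: Ind_simps)
 have ext: "(\<lambda>x\<in>carrier G. w x) = u" if "u : carrier ?I" "\<And>x. x : carrier G ==> w x = u x" for u w
  using ux[OF that(1)] that(2) by (intro extensionalityI[of _ "carrier G"]) auto
 have act0: "act V h \<zero>\<^bsub>V\<^esub> = \<zero>\<^bsub>V\<^esub>" and actm: "w : carrier V ==> act V h (\<ominus>\<^bsub>V\<^esub> w) = \<ominus>\<^bsub>V\<^esub> act V h w" if "h : H" for h w
  using additive_finsum(1,3)[of V V "act V h"] v(1,7,8) that by simp_all
 have ab: "abelian_group ?I"
 proof (rule abelian_groupI)
  fix u w assume u: "u : carrier ?I" and w: "w : carrier ?I"
  show "u \<oplus>\<^bsub>?I\<^esub> w : carrier ?I" unfolding Ind_simps(3)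
   by (rule I) (use uV[OF u] uV[OF w] uH[OF u] uH[OF w] Hi v(8) in auto)
  show "u \<oplus>\<^bsub>?I\<^esub> w = w \<oplus>\<^bsub>?I\<^esub> u" unfolding Ind_simps(3)
   using uV[OF u] uV[OF w] V.a_comm by (auto simp: fun_eq_iff)
  fix z assume z: "z : carrier ?I"
  show "(u \<oplus>\<^bsub>?I\<^esub> w) \<oplus>\<^bsub>?I\<^esub> z = u \<oplus>\<^bsub>?I\<^esub> (w \<oplus>\<^bsub>?I\<^esub> z)" unfolding Ind_simps(3)
   using uV[OF u] uV[OF w] uV[OF z] V.a_assoc by (auto simp: fun_eq_iff)
 next
  show "\<zero>\<^bsub>?I\<^esub> : carrier ?I" unfolding Ind_simps(2)
   by (rule I) (use act0 Hi in auto)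
 next
  fix u assume u: "u : carrier ?I"
  show "\<zero>\<^bsub>?I\<^esub> \<oplus>\<^bsub>?I\<^esub> u = u" unfolding Ind_simps(2,3)
   by (rule ext[OF u]) (use uV[OF u] in auto)
  let ?n = "\<lambda>x\<in>carrier G. \<ominus>\<^bsub>V\<^esub> u x"
  have "?n : carrier ?I" by (rule I) (use uV[OF u] uH[OF u] actm Hi in auto)
  moreover have "?n \<oplus>\<^bsub>?I\<^esub> u = \<zero>\<^bsub>?I\<^esub>" unfolding Ind_simps(2,3)
   using uV[OF u] by (auto simp: fun_eq_iff V.l_neg)
  ultimately show "\<exists>y\<in>carrier ?I. y \<oplus>\<^bsub>?I\<^esub> u = \<zero>\<^bsub>?I\<^esub>" by blast
 qed
 show ?thesis
 proof (rule grp_moduleI[OF ab])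
  fix g u assume g: "g : carrier G" and u: "u : carrier ?I"
  show "act ?I g u : carrier ?I" unfolding Ind_simps(5)
  proof (rule I)
   fix x h assume x: "x : carrier G" and h: "h : H"
   have "inv\<^bsub>G\<^esub> g \<otimes>\<^bsub>G\<^esub> (x \<otimes>\<^bsub>G\<^esub> h) = (inv\<^bsub>G\<^esub> g \<otimes>\<^bsub>G\<^esub> x) \<otimes>\<^bsub>G\<^esub> h" using g x HG[OF h] by (simp add: m_assoc)
   then show "u (inv\<^bsub>G\<^esub> g \<otimes>\<^bsub>G\<^esub> (x \<otimes>\<^bsub>G\<^esub> h)) = act V (inv\<^bsub>G\<^esub> h) (u (inv\<^bsub>G\<^esub> g \<otimes>\<^bsub>G\<^esub> x))"
    using uH[OF u _ h] g x by simp
  qed (use g uV[OF u] in auto)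
  fix h assume h: "h : carrier G"
  show "act ?I (g \<otimes>\<^bsub>G\<^esub> h) u = act ?I g (act ?I h u)"
   using g h by (auto simp: Ind_simps fun_eq_iff inv_mult_group m_assoc)
 next
  fix c u assume u: "u : carrier ?I"
  show "c \<odot>\<^bsub>?I\<^esub> u : carrier ?I" unfolding Ind_simps(4)
   by (rule I) (use uV[OF u] uH[OF u] Hi v in auto)
  show "1 \<odot>\<^bsub>?I\<^esub> u = u" unfolding Ind_simps(4)
   by (rule ext[OF u]) (use uV[OF u] v in auto)
  show "act ?I \<one>\<^bsub>G\<^esub> u = u" unfolding Ind_simps(5)
   by (rule ext[OF u]) auto
 qed (use uV v in "auto simp: Ind_simps(3-5) fun_eq_iff")
qed

definition ksub :: "('k::field, 'm, 'g) gmod => 'm set => bool" where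
 "ksub V A \<longleftrightarrow> A <= carrier V \<and> \<zero>\<^bsub>V\<^esub> : A \<and> (\<forall>x\<in>A. \<forall>y\<in>A. x \<oplus>\<^bsub>V\<^esub> y : A) \<and> (\<forall>c. \<forall>x\<in>A. c \<odot>\<^bsub>V\<^esub> x : A)"

text \<open>k-subspaces of a projective module are subspaces of a finite power of k.\<close>
lemma projective_length:
 fixes W :: "('k::field, 'w, 'g) gmod"
 assumes W: "projective_module G W" and fin: "finite (carrier G)"
 obtains l :: "'w set => nat" where "\<And>A B. ksub W A ==> ksub W B ==> A \<subset> B ==> l A < l B"
proof -
 have gW: "grp_module G W" using W by (simp add: projective_module_def)
 note w = grp_moduleD[OF gW]
 interpret abelian_group W by (rule w(1))
 obtain n j where j: "kemb n (carrier G) W j" using projective_kemb[OF W] .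
 have jW: "inj_on j (carrier W)" "j ` carrier W <= pw {..<n} (pw (carrier G) UNIV)"
  "\<And>v x. v : carrier W ==> x : carrier W ==> j (v \<oplus>\<^bsub>W\<^esub> x) = j v + j x"
  "\<And>c v. v : carrier W ==> j (c \<odot>\<^bsub>W\<^esub> v) = kscal c (j v)"
  using j by (auto simp: kemb_def)
 have "finlen (kscal :: 'k => _) (pw {..<n} (pw (carrier G) UNIV))" by (rule finlen_kspace[OF fin])
 then obtain l :: "(nat => 'g => 'k) set => nat" where
  l: "\<And>A B. opmod kscal A ==> opmod kscal B ==> A \<subset> B ==> B <= pw {..<n} (pw (carrier G) UNIV) ==> l A < l B"
  unfolding finlen_def by metis
 have m: "opmod kscal (j ` A)" if A: "ksub W A" for A
  unfolding opmod_def
 proof (intro conjI ballI allI)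
  have AW: "A <= carrier W" using A by (simp add: ksub_def)
  have j0: "j \<zero>\<^bsub>W\<^esub> = 0" using jW(3)[of "\<zero>\<^bsub>W\<^esub>" "\<zero>\<^bsub>W\<^esub>"] by simp
  then show "0 : j ` A" using A by (force simp: ksub_def)
  show "kscal c x : j ` A" if x: "x : j ` A" for c x
  proof -
   obtain a where a: "a : A" "x = j a" using x by blast
   then have "kscal c x = j (c \<odot>\<^bsub>W\<^esub> a)" using AW jW(4)[of a c] by auto
   then show ?thesis using a A by (auto simp: ksub_def)
  qed
  show "kscal c (x - y) = kscal c x - kscal c y" for c and x y :: "nat => 'g => 'k"
   by (simp add: kscal_def pop_def fun_eq_iff algebra_simps)
  show "x - y : j ` A" if x: "x : j ` A" "y : j ` A" for x y
  proof -
   obtain a b where a: "a : A" "x = j a" "b : A" "y = j b" using x by blast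
   have "j ((-1) \<odot>\<^bsub>W\<^esub> b) = - j b" using jW(4)[of b "-1"] a AW by (auto simp: kscal_def pop_def fun_eq_iff)
   then have "x - y = j (a \<oplus>\<^bsub>W\<^esub> (-1) \<odot>\<^bsub>W\<^esub> b)" using jW(3)[of a "(-1) \<odot>\<^bsub>W\<^esub> b"] a AW w(2)[of b "-1"] by (simp add: subset_iff)
   then show ?thesis using a A by (auto simp: ksub_def)
  qed
 qed
 have "l (j ` A) < l (j ` B)" if "ksub W A" "ksub W B" "A \<subset> B" for A B
 proof (rule l[OF m[OF that(1)] m[OF that(2)]])
  have BW: "B <= carrier W" using that by (simp add: ksub_def)
  then show "j ` B <= pw {..<n} (pw (carrier G) UNIV)" using jW(2) by blast
  show "j ` A \<subset> j ` B" using image_strict_mono[OF inj_on_subset[OF jW(1) BW] that(3)] .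
 qed
 then show ?thesis using that[of "\<lambda>A. l (j ` A)"] by blast
qed

text \<open>Maschke's theorem. A k-subspace A of the cover that is maximal among those meeting the
  kernel trivially is mapped bijectively to M; the inverse is a k-linear section. Its average over G
  is an equivariant section, whose image is a submodule mapping onto M and hence the whole
  cover.\<close>
lemma cover_iso:
 fixes Cm :: "('k::field, 'c, 'g) gmod" (structure) and M :: "('k, 'm, 'g) gmod"
 assumes G: "group G" and fin: "finite (carrier G)" and M: "grp_module G M"
  and cov: "projective_cover G Cm M" and nz: "of_nat (card (carrier G)) \<noteq> (0::'k)"
 shows "grp_iso G Cm M"
proof -
 interpret group G by (rule G)
 have pC: "projective_module G Cm" using cov by (simp add: projective_cover_def)
 have gC: "grp_module G Cm" using pC by (simp add: projective_module_def)
 note c = grp_moduleD[OF gC] and mm = grp_moduleD[OF M]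
 interpret C: abelian_group Cm by (rule c(1))
 interpret M: abelian_group M by (rule mm(1))
 interpret Cmod: Module.module basefield Cm by (rule c(12))
 obtain f where f: "f : grp_hom G Cm M" "f ` carrier Cm = carrier M"
  and ess: "\<And>N. grp_submodule G Cm N ==> f ` N = carrier M ==> N = carrier Cm"
  using cov by (auto simp: projective_cover_def)
 note h = grp_homD[OF f(1)]
 note s0C = grp_module_null(1)[OF gC] and e0 = grp_module_null(2)[OF gC] and smC = grp_module_null(3)[OF gC]
  and s0M = grp_module_null(1)[OF M] and smM = grp_module_null(3)[OF M]
 note fn = additive_finsum(3)[OF c(1) mm(1) h(1,2)] and fsum = additive_finsum(2)[OF c(1) mm(1) h(1,2)]
 obtain l :: "'c set => nat" where l: "\<And>A B. ksub Cm A ==> ksub Cm B ==> A \<subset> B ==> l A < l B"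
  by (rule projective_length[OF pC fin]) (rule that)
 let ?P = "\<lambda>A. ksub Cm A \<and> (\<forall>x\<in>A. f x = \<zero>\<^bsub>M\<^esub> --> x = \<zero>)"
 have kC: "ksub Cm (carrier Cm)" using c by (simp add: ksub_def)
 have "?P {\<zero>}" using e0 by (simp add: ksub_def)
 moreover have "\<forall>A. ?P A --> l A < Suc (l (carrier Cm))"
 proof (intro allI impI)
  fix A assume A: "?P A"
  have "A <= carrier Cm" using A by (simp add: ksub_def)
  then show "l A < Suc (l (carrier Cm))" using l[of A "carrier Cm"] A kC by (cases "A = carrier Cm") (auto intro: less_SucI)
 qed
 ultimately have "\<exists>A. ?P A \<and> (\<forall>B. ?P B --> l B \<le> l A)" by (rule ex_has_greatest_nat)
 then obtain A where A: "?P A" and maxA: "\<forall>B. ?P B --> l B \<le> l A" by (elim exE) (erule conjE, rule that, assumption, assumption)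
 have max: "l B \<le> l A" if "?P B" for B using maxA that by (elim allE impE)
 have AC: "A <= carrier Cm" and A0: "\<zero> : A" and Aa: "\<And>x y. x : A ==> y : A ==> x \<oplus> y : A"
  and As: "\<And>e x. x : A ==> e \<odot> x : A" and Ak: "\<And>x. x : A ==> f x = \<zero>\<^bsub>M\<^esub> ==> x = \<zero>"
  using A by (auto simp: ksub_def)
 have An: "\<ominus> x : A" if "x : A" for x
  using As[OF that, of "-1"] smC[of x 1] c(6)[of x] that AC by auto
 have injA: "inj_on f A"
 proof (rule inj_onI)
  fix x y assume xy: "x : A" "y : A" "f x = f y"
  then have xC: "x : carrier Cm" "y : carrier Cm" using AC by auto
  have "f (x \<oplus> \<ominus> y) = \<zero>\<^bsub>M\<^esub>" using h(2)[OF xC(1), of "\<ominus> y"] fn xC xy(3) h(1) by (simp add: M.r_neg)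
  then have "x \<oplus> \<ominus> y = \<zero>" using Ak Aa An xy by blast
  then show "x = y" using xC C.minus_equality[of x "\<ominus> y"] by simp
 qed
 have fA: "f ` A = carrier M"
 proof (rule ccontr)
  assume "f ` A \<noteq> carrier M"
  then obtain w where w: "w : carrier M" "w \<notin> f ` A" using AC h(1) by blast
  moreover from w(1) have "w : f ` carrier Cm" by (simp only: f(2))
  ultimately obtain v where v: "v : carrier Cm" "f v = w" by (elim imageE) simp
  let ?B = "{x \<oplus> e \<odot> v |x e. x : A}"
  have kB: "ksub Cm ?B"
   unfolding ksub_def
  proof (intro conjI ballI allI)
   show "?B <= carrier Cm" using AC v c(2) by blast
   show "\<zero> : ?B" using A0 s0C[OF v(1)] by (intro CollectI exI[of _ "\<zero>"] exI[of _ 0]) auto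
   fix x assume "x : ?B"
   then obtain a e where a: "a : A" "x = a \<oplus> e \<odot> v" by blast
   have aC: "a : carrier Cm" using a AC by blast
   show "e' \<odot> x : ?B" for e'
   proof -
    have "e' \<odot> x = e' \<odot> a \<oplus> (e' * e) \<odot> v" using a(2) aC v c(2,4,5) by simp
    then show ?thesis using As[OF a(1)] by blast
   qed
   fix y assume "y : ?B"
   then obtain b e' where b: "b : A" "y = b \<oplus> e' \<odot> v" by blast
   have bC: "b : carrier Cm" using b AC by blast
   have "x \<oplus> y = (a \<oplus> b) \<oplus> (e + e') \<odot> v"
    using a(2) b(2) aC bC v(1) c(2,3) by (simp add: C.a_ac)
   then show "x \<oplus> y : ?B" using Aa[OF a(1) b(1)] by blast
  qed
  have kerB: "x = \<zero>" if x: "x : ?B" "f x = \<zero>\<^bsub>M\<^esub>" for x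
  proof -
   obtain a e where a: "a : A" "x = a \<oplus> e \<odot> v" using x by blast
   have aC: "a : carrier Cm" using a AC by blast
   have fx: "f a \<oplus>\<^bsub>M\<^esub> e \<odot>\<^bsub>M\<^esub> w = \<zero>\<^bsub>M\<^esub>" using x(2) a(2) aC v h c(2) by simp
   show ?thesis
   proof (cases "e = 0")
    case True
    then have "x = a" using a(2) aC s0C[OF v(1)] by simp
    then show ?thesis using Ak a x(2) by blast
   next
    case False
    have "\<ominus>\<^bsub>M\<^esub> (e \<odot>\<^bsub>M\<^esub> w) = f a" using fx M.minus_equality[of "f a" "e \<odot>\<^bsub>M\<^esub> w"] h(1)[OF aC] mm(2)[OF w(1)] by simp
    then have "(- e) \<odot>\<^bsub>M\<^esub> w = f a" using smM[OF w(1)] by simp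
    then have "(- inverse e) \<odot>\<^bsub>M\<^esub> ((- e) \<odot>\<^bsub>M\<^esub> w) = f ((- inverse e) \<odot> a)" using h(3)[OF aC] by simp
    then have "w = f ((- inverse e) \<odot> a)" using mm(5)[OF w(1), of "- inverse e" "- e", symmetric] mm(6)[OF w(1)] False by simp
    then show ?thesis using w(2) As[OF a(1)] by blast
   qed
  qed
  have AB: "A <= ?B"
  proof
   fix x assume x: "x : A"
   then have "x = x \<oplus> 0 \<odot> v" using AC s0C[OF v(1)] by auto
   then show "x : ?B" using x by blast
  qed
  have "v : ?B" using A0 v(1) c(6)[OF v(1)] by (intro CollectI exI[of _ "\<zero>"] exI[of _ 1]) auto
  then have "A \<subset> ?B" using AB v(2) w(2) by blast
  then have "l A < l ?B" using l[OF _ kB] A by blast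
  moreover have "l ?B \<le> l A" using max[of ?B] kB kerB by blast
  ultimately show False by simp
 qed
 define t where "t = inv_into A f"
 have t: "t w : A" "f (t w) = w" "t w : carrier Cm" if "w : carrier M" for w
  using that fA AC by (auto simp: t_def f_inv_into_f) (metis inv_into_into subsetD)+
 have tI: "t w = x" if "x : A" "f x = w" for x w using inv_into_f_f[OF injA that(1)] that(2) by (simp add: t_def)
 have ta: "t (x \<oplus>\<^bsub>M\<^esub> y) = t x \<oplus> t y" if "x : carrier M" "y : carrier M" for x y
  by (rule tI) (use t that Aa h in auto)
 have ts: "t (e \<odot>\<^bsub>M\<^esub> x) = e \<odot> t x" if "x : carrier M" for x e
  by (rule tI) (use t that As h in auto)
 let ?i = "inverse (of_nat (card (carrier G)) :: 'k)"
 define av where "av w = (\<Oplus>g\<in>carrier G. act Cm g (t (act M (inv\<^bsub>G\<^esub> g) w)))" for w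
 define s where "s w = ?i \<odot> av w" for w
 have tm: "act Cm g (t (act M (inv\<^bsub>G\<^esub> g) w)) : carrier Cm" if "g : carrier G" "w : carrier M" for g w
  using that t c(7) mm(7) by simp
 have av: "av w : carrier Cm" if "w : carrier M" for w
  unfolding av_def by (rule C.finsum_closed) (use tm that in auto)
 have sC: "s w : carrier Cm" if "w : carrier M" for w using av[OF that] c(2) by (simp add: s_def)
 have constsum: "(\<Oplus>\<^bsub>M\<^esub>g\<in>J. w) = of_nat (card J) \<odot>\<^bsub>M\<^esub> w" if w: "w : carrier M" and "finite J" for J :: "'g set" and w
  using that(2) by (induction J rule: finite_induct) (use w in "auto simp: s0M mm(3) mm(6) Pi_def")
 have fs: "f (s w) = w" if w: "w : carrier M" for w
 proof -
  have "f (av w) = (\<Oplus>\<^bsub>M\<^esub>g\<in>carrier G. f (act Cm g (t (act M (inv\<^bsub>G\<^esub> g) w))))"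
   unfolding av_def by (rule fsum) (use tm w in auto)
  also have "\<dots> = (\<Oplus>\<^bsub>M\<^esub>g\<in>carrier G. w)"
  proof (rule M.finsum_cong')
   fix g assume g: "g : carrier G"
   have "f (act Cm g (t (act M (inv\<^bsub>G\<^esub> g) w))) = act M g (act M (inv\<^bsub>G\<^esub> g) w)" using g w h(4) t mm(7) by simp
   also have "\<dots> = w" using mm(10)[of g "inv\<^bsub>G\<^esub> g" w] g w mm(11) by simp
   finally show "f (act Cm g (t (act M (inv\<^bsub>G\<^esub> g) w))) = w" .
  qed (use w in auto)
  also have "\<dots> = of_nat (card (carrier G)) \<odot>\<^bsub>M\<^esub> w" by (rule constsum[OF w fin])
  finally have "f (s w) = ?i \<odot>\<^bsub>M\<^esub> (of_nat (card (carrier G)) \<odot>\<^bsub>M\<^esub> w)" using h(3)[OF av[OF w]] by (simp add: s_def)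
  also have "\<dots> = (?i * of_nat (card (carrier G))) \<odot>\<^bsub>M\<^esub> w" using mm(5)[OF w] by simp
  also have "\<dots> = w" using nz mm(6)[OF w] by simp
  finally show ?thesis .
 qed
 have avadd: "av (x \<oplus>\<^bsub>M\<^esub> y) = av x \<oplus> av y" if xy: "x : carrier M" "y : carrier M" for x y
 proof -
  have "av (x \<oplus>\<^bsub>M\<^esub> y) = (\<Oplus>g\<in>carrier G. act Cm g (t (act M (inv\<^bsub>G\<^esub> g) x)) \<oplus> act Cm g (t (act M (inv\<^bsub>G\<^esub> g) y)))"
   unfolding av_def by (rule C.finsum_cong') (use xy mm ta c t in auto)
  then show ?thesis unfolding av_def using xy tm by (simp add: C.finsum_addf Pi_def)
 qed
 have actsum: "act Cm g (\<Oplus>k\<in>J. r k) = (\<Oplus>k\<in>J. act Cm g (r k))" if "g : carrier G" "r : J \<rightarrow> carrier Cm" for g r and J :: "'g set"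
  by (rule additive_finsum(2)[OF c(1,1)]) (use that c(7,8) in simp_all)
 note scalsum = additive_finsum(2)[OF c(1,1,2,4)]
 have avs: "av (e \<odot>\<^bsub>M\<^esub> x) = e \<odot> av x" if x: "x : carrier M" for x e
 proof -
  have "e \<odot> av x = (\<Oplus>g\<in>carrier G. e \<odot> act Cm g (t (act M (inv\<^bsub>G\<^esub> g) x)))"
   unfolding av_def by (rule scalsum) (use tm x in auto)
  also have "\<dots> = av (e \<odot>\<^bsub>M\<^esub> x)"
   unfolding av_def by (rule C.finsum_cong') (use x mm ts c t in auto)
  finally show ?thesis by simp
 qed
 have avg: "av (act M g x) = act Cm g (av x)" if g: "g : carrier G" and x: "x : carrier M" for g x
 proof -
  let ?r = "\<lambda>k. act Cm k (t (act M (inv\<^bsub>G\<^esub> k) (act M g x)))"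
  have "act Cm g (av x) = (\<Oplus>k\<in>carrier G. act Cm g (act Cm k (t (act M (inv\<^bsub>G\<^esub> k) x))))"
   unfolding av_def by (rule actsum[OF g]) (use tm x in auto)
  also have "\<dots> = (\<Oplus>k\<in>carrier G. ?r (g \<otimes>\<^bsub>G\<^esub> k))"
  proof (rule C.finsum_cong')
   fix k assume k: "k : carrier G"
   have "act M (inv\<^bsub>G\<^esub> (g \<otimes>\<^bsub>G\<^esub> k)) (act M g x) = act M (inv\<^bsub>G\<^esub> (g \<otimes>\<^bsub>G\<^esub> k) \<otimes>\<^bsub>G\<^esub> g) x" using mm(10) g k x by simp
   also have "inv\<^bsub>G\<^esub> (g \<otimes>\<^bsub>G\<^esub> k) \<otimes>\<^bsub>G\<^esub> g = inv\<^bsub>G\<^esub> k" using g k by (simp add: inv_mult_group m_assoc)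
   finally have e: "act M (inv\<^bsub>G\<^esub> (g \<otimes>\<^bsub>G\<^esub> k)) (act M g x) = act M (inv\<^bsub>G\<^esub> k) x" .
   show "act Cm g (act Cm k (t (act M (inv\<^bsub>G\<^esub> k) x))) = ?r (g \<otimes>\<^bsub>G\<^esub> k)"
    unfolding e using c(10) g k t(3)[of "act M (inv\<^bsub>G\<^esub> k) x"] x mm(7) by simp
  qed (use g x tm mm in auto)
  also have "\<dots> = (\<Oplus>k\<in>(\<lambda>k. g \<otimes>\<^bsub>G\<^esub> k) ` carrier G. ?r k)"
   by (rule C.finsum_reindex[symmetric]) (use g x tm mm in "auto simp: inj_on_def")
  also have "(\<lambda>k. g \<otimes>\<^bsub>G\<^esub> k) ` carrier G = carrier G" using surj_const_mult[OF g] by simp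
  finally show ?thesis by (simp add: av_def)
 qed
 have shom: "s : grp_hom G M Cm"
 proof (rule grp_homI)
  show "s (e \<odot>\<^bsub>M\<^esub> v) = e \<odot> s v" if "v : carrier M" for e v
   using avs[OF that] c(5)[OF av[OF that]] by (simp add: s_def) (metis c(5)[OF av[OF that]] mult.commute)
  show "s (act M g v) = act Cm g (s v)" if "g : carrier G" "v : carrier M" for g v
   using avg that av c(9) by (simp add: s_def)
 qed (use sC avadd av c(4) in "auto simp: s_def")
 note sh = grp_homD[OF shom]
 have "s ` carrier M = carrier Cm"
 proof (rule ess)
  show "f ` s ` carrier M = carrier M" using fs by (force simp: image_image)
  show "grp_submodule G Cm (s ` carrier M)"
   unfolding grp_submodule_def
  proof (intro conjI ballI)
   show "submodule (s ` carrier M) basefield Cm"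
   proof (rule Cmod.submoduleI)
    show "s ` carrier M <= carrier Cm" using sC by blast
    have "s \<zero>\<^bsub>M\<^esub> = \<zero>" by (rule additive_finsum(1)[OF mm(1) c(1) sh(1,2)])
    then show "\<zero> : s ` carrier M" by (metis M.zero_closed imageI)
    show "a \<oplus> b : s ` carrier M" if "a : s ` carrier M" "b : s ` carrier M" for a b
    proof -
     obtain x y where "x : carrier M" "a = s x" "y : carrier M" "b = s y"
      using \<open>a : s ` carrier M\<close> \<open>b : s ` carrier M\<close> by blast
     then show ?thesis using sh(2)[of x y] M.a_closed[of x y] by (metis imageI)
    qed
    show "a \<odot> b : s ` carrier M" if "b : s ` carrier M" for a b
     using that sh(3) mm(2) by (metis (no_types, lifting) imageE imageI)
    show "\<ominus> a : s ` carrier M" if "a : s ` carrier M" for a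
    proof -
     obtain w where w: "w : carrier M" "a = s w" using \<open>a : s ` carrier M\<close> by blast
     have "\<ominus> a = (-1) \<odot> s w" using smC[OF sC[OF w(1)], of 1] c(6)[OF sC[OF w(1)]] w(2) by simp
     then show ?thesis using sh(3)[OF w(1), of "-1"] mm(2)[OF w(1)] by (metis imageI)
    qed
   qed
   show "act Cm g ` s ` carrier M <= s ` carrier M" if "g : carrier G" for g
    using sh(4)[OF that] mm(7)[OF that] by (force simp: image_image)
  qed
 qed
 then have "bij_betw f (carrier Cm) (carrier M)"
  using fs f(2) by (auto simp: bij_betw_def inj_on_def) (metis imageE)+
 then show ?thesis using f(1) unfolding grp_iso_def by blast
qed

section \<open>The stabiliser of a point\<close>

locale point_action =
 fixes Cs :: "('k::field, 'p, 's) rspace" and Gs :: "('p, 's) morph set" and P :: 'p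
 assumes pe: "poly_eval (stalk Cs P) (stalk_scal Cs P)"
  and mid: "ideal (maxid Cs P) (stalk Cs P)"
  and grp: "group (decomp_grp Cs Gs P)" and finD: "finite (decomp Gs P)"
  and inv_eq: "\<And>g. g : decomp Gs P ==> inv\<^bsub>Aut Cs\<^esub> g = inv\<^bsub>decomp_grp Cs Gs P\<^esub> g"
  and al_hom: "\<And>g. g : decomp Gs P ==> stalk_act Cs P g : ring_hom (stalk Cs P) (stalk Cs P)"
  and al_mult: "\<And>g h r. g : decomp Gs P ==> h : decomp Gs P ==> r : carrier (stalk Cs P) ==>
    stalk_act Cs P (g \<otimes>\<^bsub>Aut Cs\<^esub> h) r = stalk_act Cs P g (stalk_act Cs P h r)"
  and al_one: "\<And>r. r : carrier (stalk Cs P) ==> stalk_act Cs P \<one>\<^bsub>Aut Cs\<^esub> r = r"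
  and al_kap: "\<And>g c. g : decomp Gs P ==> stalk_act Cs P g (stalk_scal Cs P c) = stalk_scal Cs P c"
begin

abbreviation "R \<equiv> stalk Cs P"
abbreviation "m \<equiv> maxid Cs P"
abbreviation "q \<equiv> maxid_pow Cs P 2"
abbreviation "kap \<equiv> stalk_scal Cs P"
abbreviation "K \<equiv> resfield Cs P"
abbreviation "T \<equiv> cotangent Cs P"
abbreviation "Gam \<equiv> decomp_grp Cs Gs P"
abbreviation "DD \<equiv> decomp Gs P"
abbreviation "al \<equiv> stalk_act Cs P"
abbreviation "s \<equiv> coset_act Cs P"

lemma pow1: "maxid_pow Cs P 1 = m"
proof -
 interpret poly_eval R kap by (rule pe)
 have "ideal_prod R (carrier R) m = m"
 proof (intro equalityI subsetI)
  fix x assume "x : ideal_prod R (carrier R) m"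
  then show "x : m"
   by (induction rule: ideal_prod.induct)
    (auto intro: ideal.I_l_closed[OF mid] additive_subgroup.a_closed[OF ideal.axioms(1)[OF mid]])
 next
  fix x assume x: "x : m"
  then have "\<one>\<^bsub>R\<^esub> \<otimes>\<^bsub>R\<^esub> x : ideal_prod R (carrier R) m" by (intro ideal_prod.prod) auto
  then show "x : ideal_prod R (carrier R) m" using x ideal.Icarr[OF mid] by simp
 qed
 then show ?thesis by simp
qed

lemma q_eq: "q = ideal_prod R m m"
 using pow1 by (simp add: numeral_2_eq_2)

sublocale L: local_ring_q R kap m q
proof (intro local_ring_q.intro local_ring_q_axioms.intro)
 interpret poly_eval R kap by (rule pe)
 show "poly_eval R kap" by (rule pe)
 show "m = carrier R - Units R" by (simp add: maxid_def)
 show "ideal m R" by (rule mid)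
 show "ideal q R" unfolding q_eq by (rule R.ideal_prod_is_ideal[OF mid mid])
 show "q <= m"
 proof
  fix x assume "x : q"
  then have "x : ideal_prod R m m" by (simp only: q_eq)
  then show "x : m"
   by (induction rule: ideal_prod.induct)
    (auto intro: ideal.I_l_closed[OF mid] ideal.Icarr[OF mid] additive_subgroup.a_closed[OF ideal.axioms(1)[OF mid]])
 qed
 show "a \<otimes>\<^bsub>R\<^esub> b : q" if "a : m" "b : m" for a b unfolding q_eq by (rule ideal_prod.prod[OF that])
qed

lemma K_def: "K = R Quot m" by (simp add: resfield_def)

lemma K_field: "field K"
proof -
 have "maximalideal m R"
 proof (rule maximalidealI[OF mid])
  show "carrier R \<noteq> m" using L.one_not_m by auto
  fix J assume J: "ideal J R" "m <= J" "J <= carrier R"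
  show "J = m \<or> J = carrier R"
  proof (cases "J <= m")
   case False
   then obtain u where u: "u : J" "u : Units R" using J(3) L.not_m by blast
   then have "inv\<^bsub>R\<^esub> u \<otimes>\<^bsub>R\<^esub> u : J" using ideal.I_l_closed[OF J(1)] by blast
   then have "\<one>\<^bsub>R\<^esub> : J" using u by simp
   then show ?thesis using ideal.one_imp_carrier[OF J(1)] by blast
  qed (use J in blast)
 qed
 then show ?thesis unfolding K_def by (rule maximalideal.quotient_is_field[OF _ L.R.is_cring])
qed

sublocale K: field K by (rule K_field)

text \<open>Residue of a germ.\<close>
definition pi where "pi a = m +>\<^bsub>R\<^esub> a"

lemma pi_K: "A : carrier K ==> \<exists>a\<in>carrier R. A = pi a" and pi_in [simp]: "a : carrier R ==> pi a : carrier K"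
 using L.K_carrier by (auto simp: K_def pi_def)

lemma pi_hom [simp]: "a : carrier R ==> b : carrier R ==> pi (a \<oplus>\<^bsub>R\<^esub> b) = pi a \<oplus>\<^bsub>K\<^esub> pi b"
 "a : carrier R ==> b : carrier R ==> pi (a \<otimes>\<^bsub>R\<^esub> b) = pi a \<otimes>\<^bsub>K\<^esub> pi b" "pi \<one>\<^bsub>R\<^esub> = \<one>\<^bsub>K\<^esub>"
 using ring_hom_add[OF L.pi_hom] ring_hom_mult[OF L.pi_hom] ring_hom_one[OF L.pi_hom] by (simp_all add: pi_def K_def)

lemma pi_eq: "a : carrier R ==> b : carrier R ==> pi a = pi b \<longleftrightarrow> a \<ominus>\<^bsub>R\<^esub> b : m"
 using L.pi_eq_iff by (simp add: pi_def)

lemma pi_0: "a : carrier R ==> pi a = \<zero>\<^bsub>K\<^esub> \<longleftrightarrow> a : m"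
 using L.K_zero by (simp add: pi_def K_def)

lemma al_in [simp]: "g : DD ==> r : carrier R ==> al g r : carrier R"
 using ring_hom_closed[OF al_hom] .

lemma Gam_simps [simp]: "carrier Gam = DD" "x \<otimes>\<^bsub>Gam\<^esub> y = x \<otimes>\<^bsub>Aut Cs\<^esub> y" "\<one>\<^bsub>Gam\<^esub> = \<one>\<^bsub>Aut Cs\<^esub>"
 by (simp_all add: decomp_grp_def)

sublocale Gm: group Gam by (rule grp)

lemma al_inv: "g : DD ==> r : carrier R ==> al g (al (inv\<^bsub>Gam\<^esub> g) r) = r"
 "g : DD ==> r : carrier R ==> al (inv\<^bsub>Gam\<^esub> g) (al g r) = r"
 "g : DD ==> inv\<^bsub>Gam\<^esub> g : DD"
proof -
 assume g: "g : DD"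
 show i: "inv\<^bsub>Gam\<^esub> g : DD" using Gm.inv_closed[of g] g by simp
 assume r: "r : carrier R"
 show "al g (al (inv\<^bsub>Gam\<^esub> g) r) = r" using al_mult[OF g i r] Gm.r_inv[of g] g al_one[OF r] by simp
 show "al (inv\<^bsub>Gam\<^esub> g) (al g r) = r" using al_mult[OF i g r] Gm.l_inv[of g] g al_one[OF r] by simp
qed

lemma al_unit: "g : DD ==> r : Units R ==> al g r : Units R"
proof -
 assume g: "g : DD" and r: "r : Units R"
 have "al g r \<otimes>\<^bsub>R\<^esub> al g (inv\<^bsub>R\<^esub> r) = \<one>\<^bsub>R\<^esub>"
  using ring_hom_mult[OF al_hom[OF g], of r "inv\<^bsub>R\<^esub> r"] ring_hom_one[OF al_hom[OF g]] r L.R.Units_closed[OF r] by simp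
 moreover have c: "al g r : carrier R" "al g (inv\<^bsub>R\<^esub> r) : carrier R" using g r L.R.Units_closed[OF r] by simp_all
 moreover have "al g (inv\<^bsub>R\<^esub> r) \<otimes>\<^bsub>R\<^esub> al g r = \<one>\<^bsub>R\<^esub>" using calculation(1) L.R.m_comm[OF c] by simp
 ultimately show ?thesis unfolding Units_def by blast
qed

lemma al_m: "g : DD ==> r : m ==> al g r : m"
proof -
 assume g: "g : DD" and r: "r : m"
 have rR: "r : carrier R" using r L.m_in by blast
 show ?thesis
 proof (rule ccontr)
  assume "al g r \<notin> m"
  then have "al g r : Units R" using L.not_m g rR by simp
  then have "r : Units R" using al_unit[OF al_inv(3)[OF g]] al_inv(2)[OF g rR] by metis
  then show False using L.unit_not_m r by blast
 qed
qed

lemma al_q: "g : DD ==> r : q ==> al g r : q"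
proof -
 assume g: "g : DD" and r: "r : q"
 have "r : ideal_prod R m m" using r by (simp only: q_eq)
 then show ?thesis
 proof (induction rule: ideal_prod.induct)
  case (prod i j)
  then show ?case using ring_hom_mult[OF al_hom[OF g]] al_m[OF g] L.mm L.m_in by simp
 next
  case (sum x y)
  have "x : q" "y : q" using sum by (simp_all only: q_eq)
  then show ?case using ring_hom_add[OF al_hom[OF g]] L.q_in L.q_add sum.IH by simp
 qed
qed

lemma coset_image:
 assumes g: "g : DD" and J: "J <= carrier R" "\<And>h r. h : DD ==> r : J ==> al h r : J" and a: "a : carrier R"
 shows "s g (J +>\<^bsub>R\<^esub> a) = J +>\<^bsub>R\<^esub> al g a"
proof -
 have e: "J +>\<^bsub>R\<^esub> b = {j \<oplus>\<^bsub>R\<^esub> b |j. j : J}" for b by (auto simp: a_r_coset_def r_coset_def)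
 show ?thesis
  unfolding coset_act_def e
 proof (intro equalityI subsetI)
  fix x assume "x : al g ` {j \<oplus>\<^bsub>R\<^esub> a |j. j : J}"
  then obtain j where j: "j : J" "x = al g (j \<oplus>\<^bsub>R\<^esub> a)" by blast
  then have "x = al g j \<oplus>\<^bsub>R\<^esub> al g a" using ring_hom_add[OF al_hom[OF g]] J(1) a by auto
  then show "x : {j \<oplus>\<^bsub>R\<^esub> al g a |j. j : J}" using J(2)[OF g j(1)] by blast
 next
  fix x assume "x : {j \<oplus>\<^bsub>R\<^esub> al g a |j. j : J}"
  then obtain j where j: "j : J" "x = j \<oplus>\<^bsub>R\<^esub> al g a" by blast
  let ?j = "al (inv\<^bsub>Gam\<^esub> g) j"
  have j': "?j : J" using J(2)[OF al_inv(3)[OF g] j(1)] .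
  have jR: "j : carrier R" "?j : carrier R" using j' j J(1) by blast+
  have "al g (?j \<oplus>\<^bsub>R\<^esub> a) = x" using ring_hom_add[OF al_hom[OF g] jR(2) a] j(2) al_inv(1)[OF g jR(1)] by simp
  then show "x : al g ` {j \<oplus>\<^bsub>R\<^esub> a |j. j : J}" using j' by blast
 qed
qed

lemma s_pi: "g : DD ==> a : carrier R ==> s g (pi a) = pi (al g a)"
 unfolding pi_def by (rule coset_image) (use L.m_in al_m in auto)

sublocale FA: field_action K Gam s
proof
 show "finite (carrier Gam)" using finD by simp
 fix g assume "g : carrier Gam"
 then have g: "g : DD" by simp
 show "s g : ring_hom K K"
 proof (rule ring_hom_memI)
  show "s g x : carrier K" if x: "x : carrier K" for x using pi_K[OF x] g s_pi by fastforce
  show "s g (x \<otimes>\<^bsub>K\<^esub> y) = s g x \<otimes>\<^bsub>K\<^esub> s g y" "s g (x \<oplus>\<^bsub>K\<^esub> y) = s g x \<oplus>\<^bsub>K\<^esub> s g y"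
   if xy: "x : carrier K" "y : carrier K" for x y
  proof -
   obtain a b where ab: "a : carrier R" "b : carrier R" "x = pi a" "y = pi b" using pi_K xy by metis
   show "s g (x \<otimes>\<^bsub>K\<^esub> y) = s g x \<otimes>\<^bsub>K\<^esub> s g y"
    using ab g s_pi[OF g, of "a \<otimes>\<^bsub>R\<^esub> b"] ring_hom_mult[OF al_hom[OF g]] by (simp add: s_pi)
   show "s g (x \<oplus>\<^bsub>K\<^esub> y) = s g x \<oplus>\<^bsub>K\<^esub> s g y"
    using ab g s_pi[OF g, of "a \<oplus>\<^bsub>R\<^esub> b"] ring_hom_add[OF al_hom[OF g]] by (simp add: s_pi)
  qed
  show "s g \<one>\<^bsub>K\<^esub> = \<one>\<^bsub>K\<^esub>" using s_pi[OF g L.R.one_closed] ring_hom_one[OF al_hom[OF g]] by simp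
 qed
 fix h a assume "h : carrier Gam" "a : carrier K"
 then have h: "h : DD" and a: "a : carrier K" by simp_all
 obtain r where r: "r : carrier R" "a = pi r" using pi_K[OF a] by blast
 have gh: "g \<otimes>\<^bsub>Aut Cs\<^esub> h : DD" using Gm.m_closed[of g h] g h by simp
 show "s (g \<otimes>\<^bsub>Gam\<^esub> h) a = s g (s h a)"
  using r g h gh al_mult[OF g h] by (simp add: s_pi)
next
 fix a assume "a : carrier K"
 then obtain r where r: "r : carrier R" "a = pi r" using pi_K by blast
 have "\<one>\<^bsub>Aut Cs\<^esub> : DD" using Gm.one_closed by simp
 then show "s \<one>\<^bsub>Gam\<^esub> a = a" using r al_one by (simp add: s_pi)
qed

lemma H_eq: "FA.H = inertia Cs Gs P"
 by (auto simp: FA.H_def inertia_def)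

definition kk where "kk c = pi (kap c)"

lemma kk: "kk c : carrier K" "kk (c + e) = kk c \<oplus>\<^bsub>K\<^esub> kk e" "kk (c * e) = kk c \<otimes>\<^bsub>K\<^esub> kk e" "kk 1 = \<one>\<^bsub>K\<^esub>"
 "g : DD ==> s g (kk c) = kk c" "kk 0 = \<zero>\<^bsub>K\<^esub>"
 using pi_0[of "kap 0"] L.m_0 by (simp_all add: kk_def L.ph_add L.ph_mult s_pi al_kap)

lemma kk_of_nat: "kk (of_nat n) = add_pow K n \<one>\<^bsub>K\<^esub>"
 by (induction n) (simp_all add: kk K.a_comm)

lemma kk_0_iff: "kk c = \<zero>\<^bsub>K\<^esub> \<longleftrightarrow> c = 0"
proof (cases "c = 0")
 case False
 have "pi (kap c) \<noteq> \<zero>\<^bsub>K\<^esub>" using L.kap_not_m[OF False] pi_0[of "kap c"] L.ph_in[of c] by blast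
 then show ?thesis using False by (simp add: kk_def)
qed (simp add: kk(6))

subsection \<open>The cotangent space\<close>

definition tq where "tq x = q +>\<^bsub>R\<^esub> x"

lemma qR: "q <= carrier R" using L.q_in by blast

lemma tq_eq: "x : carrier R ==> y : carrier R ==> tq x = tq y \<longleftrightarrow> x \<ominus>\<^bsub>R\<^esub> y : q"
 using L.R.quotient_eq_iff_same_a_r_cos[OF L.q_ideal, of x y] by (auto simp: tq_def)

lemma T_carrier: "A : carrier T \<longleftrightarrow> (\<exists>x\<in>m. A = tq x)"
 by (auto simp: cotangent_def tq_def)

lemma T_add: "x : m ==> y : m ==> tq x \<oplus>\<^bsub>T\<^esub> tq y = tq (x \<oplus>\<^bsub>R\<^esub> y)"
 using abelian_subgroup.a_rcos_sum[OF abelian_subgroupI3[OF ideal.axioms(1)[OF L.q_ideal] L.R.abelian_group_axioms]] L.m_in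
 by (simp add: cotangent_def tq_def)

lemma T_smult: "a : carrier R ==> x : m ==> pi a \<odot>\<^bsub>T\<^esub> tq x = tq (a \<otimes>\<^bsub>R\<^esub> x)"
proof -
 assume a: "a : carrier R" and x: "x : m"
 have xR: "x : carrier R" using x L.m_in by blast
 have el: "J +>\<^bsub>R\<^esub> b = {j \<oplus>\<^bsub>R\<^esub> b |j. j : J}" for J b by (auto simp: a_r_coset_def r_coset_def)
 have same: "tq (a' \<otimes>\<^bsub>R\<^esub> x') = tq (a \<otimes>\<^bsub>R\<^esub> x)" if h: "a' : pi a" "x' : tq x" for a' x'
 proof -
  obtain j i where j: "j : m" "a' = j \<oplus>\<^bsub>R\<^esub> a" and i: "i : q" "x' = i \<oplus>\<^bsub>R\<^esub> x"
   using h unfolding pi_def tq_def el by blast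
  have jR: "j : carrier R" "i : carrier R" using j i L.m_in L.q_in by auto
  have e: "a' \<otimes>\<^bsub>R\<^esub> x' = (j \<otimes>\<^bsub>R\<^esub> i \<oplus>\<^bsub>R\<^esub> j \<otimes>\<^bsub>R\<^esub> x \<oplus>\<^bsub>R\<^esub> a \<otimes>\<^bsub>R\<^esub> i) \<oplus>\<^bsub>R\<^esub> a \<otimes>\<^bsub>R\<^esub> x"
   using j(2) i(2) jR a xR by (simp add: L.R.l_distr L.R.r_distr L.R.a_ac)
  have "j \<otimes>\<^bsub>R\<^esub> i \<oplus>\<^bsub>R\<^esub> j \<otimes>\<^bsub>R\<^esub> x \<oplus>\<^bsub>R\<^esub> a \<otimes>\<^bsub>R\<^esub> i : q"
   using L.q_add[OF L.q_add[OF L.q_l[OF i(1) jR(1)] L.mm[OF j(1) x]] L.q_l[OF i(1) a]] .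
  then have "a' \<otimes>\<^bsub>R\<^esub> x' \<ominus>\<^bsub>R\<^esub> a \<otimes>\<^bsub>R\<^esub> x : q"
   unfolding e using jR a xR L.q_in by (simp add: a_minus_def L.R.a_assoc L.R.r_neg)
  then show ?thesis using tq_eq j(2) i(2) jR a xR by simp
 qed
 have "a : pi a"
 proof -
  have "a = \<zero>\<^bsub>R\<^esub> \<oplus>\<^bsub>R\<^esub> a" using a by simp
  then show ?thesis unfolding pi_def el using L.m_0 by blast
 qed
 moreover have "x : tq x"
 proof -
  have "x = \<zero>\<^bsub>R\<^esub> \<oplus>\<^bsub>R\<^esub> x" using xR by simp
  then show ?thesis unfolding tq_def el using L.q_0 by blast
 qed
 moreover have "pi a \<odot>\<^bsub>T\<^esub> tq x = (\<Union>a'\<in>pi a. \<Union>x'\<in>tq x. tq (a' \<otimes>\<^bsub>R\<^esub> x'))"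
  by (simp add: cotangent_def tq_def)
 ultimately show ?thesis using same by blast
qed

lemma s_tq: "g : DD ==> x : carrier R ==> s g (tq x) = tq (al g x)"
 unfolding tq_def by (rule coset_image) (use qR al_q in auto)

text \<open>The linear form on m/q, as a set of cosets, induced by a functional on m.\<close>
definition lt where "lt la B = la (SOME x. x : m \<and> B = tq x)"

lemma lt_tq:
 assumes la: "L.functional la" and x: "x : m"
 shows "lt la (tq x) = la x"
proof -
 let ?y = "SOME y. y : m \<and> tq x = tq y"
 have y: "?y : m" "tq x = tq ?y" using someI[of "\<lambda>y. y : m \<and> tq x = tq y" x] x by auto
 have R: "x : carrier R" "?y : carrier R" using x y(1) L.m_in by auto
 then have d: "?y \<ominus>\<^bsub>R\<^esub> x : q" using tq_eq[of ?y x] y(2) by simp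
 have e: "?y = (?y \<ominus>\<^bsub>R\<^esub> x) \<oplus>\<^bsub>R\<^esub> x" using R by (simp add: a_minus_def L.R.a_assoc L.R.l_neg)
 have "la ?y = la (?y \<ominus>\<^bsub>R\<^esub> x) \<oplus>\<^bsub>K\<^esub> la x"
  using L.functionalD(2)[OF la, of "?y \<ominus>\<^bsub>R\<^esub> x" x] d L.qm x e K_def by auto
 also have "\<dots> = la x" using L.functionalD(4)[OF la d] L.functionalD(1)[OF la x] by (simp add: K_def[symmetric])
 finally show ?thesis by (simp add: lt_def)
qed

lemma lt_in: "L.functional la ==> B : carrier T ==> lt la B : carrier K"
proof -
 assume la: "L.functional la" and "B : carrier T"
 then obtain x where x: "x : m" "B = tq x" using T_carrier by blast
 then show ?thesis using L.functionalD(1)[OF la x(1)] lt_tq[OF la x(1)] by (simp add: K_def[symmetric])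
qed

lemma lt_add: "L.functional la ==> A : carrier T ==> B : carrier T ==> lt la (A \<oplus>\<^bsub>T\<^esub> B) = lt la A \<oplus>\<^bsub>K\<^esub> lt la B"
proof -
 assume la: "L.functional la" and A: "A : carrier T" and B: "B : carrier T"
 obtain x where "x : m" "A = tq x" using A T_carrier by blast
 moreover obtain y where "y : m" "B = tq y" using B T_carrier by blast
 ultimately show ?thesis using T_add L.m_add lt_tq[OF la] L.functionalD(2)[OF la] by (simp add: K_def[symmetric])
qed

lemma lt_smult: "L.functional la ==> a : carrier K ==> B : carrier T ==> lt la (a \<odot>\<^bsub>T\<^esub> B) = a \<otimes>\<^bsub>K\<^esub> lt la B"
proof -
 assume la: "L.functional la" and "a : carrier K" "B : carrier T"
 then obtain r x where "r : carrier R" "a = pi r" "x : m" "B = tq x" using T_carrier pi_K by metis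
 then show ?thesis using T_smult L.m_l lt_tq[OF la] L.functionalD(3)[OF la] by (simp add: K_def[symmetric] pi_def)
qed

lemma T_closed: "A : carrier T ==> B : carrier T ==> A \<oplus>\<^bsub>T\<^esub> B : carrier T"
 "a : carrier K ==> B : carrier T ==> a \<odot>\<^bsub>T\<^esub> B : carrier T"
 "g : DD ==> B : carrier T ==> s g B : carrier T"
proof -
 show "A \<oplus>\<^bsub>T\<^esub> B : carrier T" if "A : carrier T" "B : carrier T"
  using that T_add L.m_add by (auto simp: T_carrier)
 show "a \<odot>\<^bsub>T\<^esub> B : carrier T" if "a : carrier K" "B : carrier T"
 proof -
  obtain r x where "r : carrier R" "a = pi r" "x : m" "B = tq x" using pi_K[OF \<open>a : carrier K\<close>] \<open>B : carrier T\<close> T_carrier by blast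
  then show ?thesis using T_smult L.m_l unfolding T_carrier by (metis)
 qed
 show "s g B : carrier T" if "g : DD" "B : carrier T"
 proof -
  obtain x where x: "x : m" "B = tq x" using \<open>B : carrier T\<close> T_carrier by blast
  have "s g B = tq (al g x)" using s_tq[OF that(1) L.m_in[OF x(1)]] x(2) by simp
  then show ?thesis using al_m[OF that(1) x(1)] T_carrier by blast
 qed
qed

lemma s_smult: "g : DD ==> a : carrier K ==> B : carrier T ==> s g (a \<odot>\<^bsub>T\<^esub> B) = s g a \<odot>\<^bsub>T\<^esub> s g B"
proof -
 assume g: "g : DD" and "a : carrier K" "B : carrier T"
 then obtain r x where r: "r : carrier R" "a = pi r" "x : m" "B = tq x" using T_carrier pi_K by metis
 then have "s g (a \<odot>\<^bsub>T\<^esub> B) = tq (al g r \<otimes>\<^bsub>R\<^esub> al g x)"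
  using g T_smult s_tq L.m_in ring_hom_mult[OF al_hom[OF g]] by simp
 then show ?thesis using g r T_smult s_tq s_pi L.m_in al_m by simp
qed

lemma s_comp_T: "g : DD ==> h : DD ==> B : carrier T ==> s (g \<otimes>\<^bsub>Aut Cs\<^esub> h) B = s g (s h B)"
proof -
 assume g: "g : DD" and h: "h : DD" and "B : carrier T"
 then obtain x where x: "x : m" "B = tq x" using T_carrier by blast
 have xR: "x : carrier R" using x L.m_in by blast
 have gh: "g \<otimes>\<^bsub>Aut Cs\<^esub> h : DD" using Gm.m_closed[of g h] g h by simp
 have "s (g \<otimes>\<^bsub>Aut Cs\<^esub> h) B = tq (al (g \<otimes>\<^bsub>Aut Cs\<^esub> h) x)" using s_tq[OF gh xR] x(2) by simp
 also have "\<dots> = s g (tq (al h x))" using s_tq[OF g, of "al h x"] al_mult[OF g h xR] al_in[OF h xR] by simp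
 also have "\<dots> = s g (s h B)" using s_tq[OF h xR] x(2) by simp
 finally show ?thesis .
qed

end

text \<open>What the geometry contributes. The description of the residue field below is conditional
  on an element of trace 1; that one exists is known only after the order of the inertia group has
  been shown to be invertible.\<close>
locale tame_point = point_action Cs Gs P for Cs :: "('k::field, 'p, 's) rspace" and Gs :: "('p, 's) morph set" and P :: 'p +
 assumes base: "\<And>c. c : carrier (resfield Cs P) ==>
    (\<Oplus>\<^bsub>resfield Cs P\<^esub>g\<in>decomp Gs P. coset_act Cs P g c) = \<one>\<^bsub>resfield Cs P\<^esub> ==>
    base_resfield Cs Gs P = {a : carrier (resfield Cs P). \<forall>g\<in>decomp Gs P. coset_act Cs P g a = a}"
  and ram1: "ram_group Cs Gs P 1 = {\<one>\<^bsub>Aut Cs\<^esub>}"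
  and smooth: "\<exists>D0\<in>derivations Cs P. \<forall>D\<in>derivations Cs P. \<exists>c\<in>carrier (resfield Cs P).
     \<forall>a\<in>carrier (stalk Cs P). D a = c \<otimes>\<^bsub>resfield Cs P\<^esub> D0 a"
  and perf: "\<And>f :: 'k poly. Factorial_Ring.irreducible f ==> coprime f (pderiv f)"
begin

text \<open>If m = q, the inertia group is the first ramification group and so trivial, and there is
  no d between 1 and e_P^t - 1.\<close>
lemma cotangent_nonzero:
 assumes "1 \<le> d" "d < tame_index Cs Gs P"
 shows "\<exists>e\<in>m. e \<notin> q"
proof (rule ccontr)
 assume "\<not> ?thesis"
 then have mq: "m = q" using L.qm by blast
 have "ram_group Cs Gs P 0 = ram_group Cs Gs P 1"
  using pow1 mq by (simp add: ram_group_def)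
 then have r: "ram_group Cs Gs P 0 = {\<one>\<^bsub>Aut Cs\<^esub>}" using ram1 by simp
 have "carrier (((Aut Cs)\<lparr>carrier := ram_group Cs Gs P 0\<rparr>) Mod ram_group Cs Gs P 1) <= {{\<one>\<^bsub>Aut Cs\<^esub> \<otimes>\<^bsub>Aut Cs\<^esub> \<one>\<^bsub>Aut Cs\<^esub>}}"
  by (auto simp: FactGroup_def RCOSETS_def r_coset_def r ram1)
 then have "tame_index Cs Gs P \<le> card {{\<one>\<^bsub>Aut Cs\<^esub> \<otimes>\<^bsub>Aut Cs\<^esub> \<one>\<^bsub>Aut Cs\<^esub>}}"
  unfolding tame_index_def Coset.order_def by (intro card_mono) auto
 then show False using assms by simp
qed

end

section \<open>Linear forms on the cotangent space\<close>

text \<open>e represents a nonzero class of m/q, and la is a linear form with value 1 on it.\<close>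
locale tame_cover = tame_point Cs Gs P for Cs :: "('k::field, 'p, 's) rspace" and Gs P +
 fixes e la d and Cm :: "('k, 'c, ('p, 's) morph) gmod"
 assumes e: "e : m" and la: "L.functional la" and la_e: "la e = \<one>\<^bsub>K\<^esub>"
  and cover: "projective_cover (inertia_grp Cs Gs P) Cm (cotangent_neg_pow Cs P d)"
begin

abbreviation "V \<equiv> cotangent_neg_pow Cs P d"

definition E where "E = {..<d} \<rightarrow>\<^sub>E carrier T"

definition multilinear where
 "multilinear b \<longleftrightarrow> (\<forall>v\<in>E. \<forall>i<d. \<forall>x\<in>carrier T.
    (\<forall>y\<in>carrier T. b (v(i := x \<oplus>\<^bsub>T\<^esub> y)) = b (v(i := x)) \<oplus>\<^bsub>K\<^esub> b (v(i := y))) \<and>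
    (\<forall>a\<in>carrier K. b (v(i := a \<odot>\<^bsub>T\<^esub> x)) = a \<otimes>\<^bsub>K\<^esub> b (v(i := x))))"

lemma V_simps: "b : carrier V \<longleftrightarrow> b : E \<rightarrow>\<^sub>E carrier K \<and> multilinear b"
 "\<zero>\<^bsub>V\<^esub> = (\<lambda>v\<in>E. \<zero>\<^bsub>K\<^esub>)" "b \<oplus>\<^bsub>V\<^esub> b' = (\<lambda>v\<in>E. b v \<oplus>\<^bsub>K\<^esub> b' v)" "c \<odot>\<^bsub>V\<^esub> b = (\<lambda>v\<in>E. kk c \<otimes>\<^bsub>K\<^esub> b v)"
 "act V g b = (\<lambda>v\<in>E. s g (b (\<lambda>i\<in>{..<d}. s (inv\<^bsub>Aut Cs\<^esub> g) (v i))))"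
 by (simp_all add: cotangent_neg_pow_def Let_def E_def kk_def pi_def reduct_def multilinear_def)

text \<open>The d-th tensor power of la, a vector of V; bb is the K-line through it, which later
  turns out to be all of V. Already now it embeds K in V.\<close>
definition bet where "bet v = finprod K (\<lambda>i. lt la (v i)) {..<d}"

lemma E_upd: "v : E ==> i < d ==> x : carrier T ==> v(i := x) : E"
 unfolding E_def by (auto simp: PiE_iff extensional_def)

lemma E_in: "v : E ==> i < d ==> v i : carrier T"
 unfolding E_def by auto

lemma lt_E: "v : E ==> (\<lambda>i. lt la (v i)) : {..<d} \<rightarrow> carrier K"
 using E_in lt_in[OF la] by auto

lemma bet_in: "v : E ==> bet v : carrier K"
 unfolding bet_def by (rule K.finprod_closed[OF lt_E])

lemma bet_upd:
 assumes v: "v : E" and i: "i < d" and x: "x : carrier T"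
 shows "bet (v(i := x)) = lt la x \<otimes>\<^bsub>K\<^esub> finprod K (\<lambda>j. lt la (v j)) ({..<d} - {i})"
  "finprod K (\<lambda>j. lt la (v j)) ({..<d} - {i}) : carrier K"
proof -
 have f: "(\<lambda>j. lt la (v j)) : ({..<d} - {i}) \<rightarrow> carrier K" using lt_E[OF v] by blast
 show "finprod K (\<lambda>j. lt la (v j)) ({..<d} - {i}) : carrier K" by (rule K.finprod_closed[OF f])
 have "{..<d} = insert i ({..<d} - {i})" using i by blast
 then have "bet (v(i := x)) = finprod K (\<lambda>j. lt la ((v(i := x)) j)) (insert i ({..<d} - {i}))"
  by (simp add: bet_def)
 also have "\<dots> = lt la ((v(i := x)) i) \<otimes>\<^bsub>K\<^esub> finprod K (\<lambda>j. lt la ((v(i := x)) j)) ({..<d} - {i})"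
  by (rule K.finprod_insert) (use f lt_in[OF la x] in "auto simp: Pi_iff")
 also have "finprod K (\<lambda>j. lt la ((v(i := x)) j)) ({..<d} - {i}) = finprod K (\<lambda>j. lt la (v j)) ({..<d} - {i})"
  by (rule K.finprod_cong') (use f in auto)
 finally show "bet (v(i := x)) = lt la x \<otimes>\<^bsub>K\<^esub> finprod K (\<lambda>j. lt la (v j)) ({..<d} - {i})" by (simp only: fun_upd_same)
qed

definition bb where "bb a = (\<lambda>v\<in>E. a \<otimes>\<^bsub>K\<^esub> bet v)"

lemma bb_apply: "v : E ==> bb a v = a \<otimes>\<^bsub>K\<^esub> bet v"
 by (simp add: bb_def)

lemma bb_in: assumes a: "a : carrier K" shows "bb a : carrier V"
 unfolding V_simps
proof
 show "bb a : E \<rightarrow>\<^sub>E carrier K" unfolding bb_def using a bet_in by auto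
 show "multilinear (bb a)"
  unfolding multilinear_def
 proof (intro ballI allI impI conjI)
  fix v i x assume v: "v : E" and i: "i < d" and x: "x : carrier T"
  note b = bet_upd[OF v i] and u = E_upd[OF v i]
  show "bb a (v(i := x \<oplus>\<^bsub>T\<^esub> y)) = bb a (v(i := x)) \<oplus>\<^bsub>K\<^esub> bb a (v(i := y))" if y: "y : carrier T" for y
   using b(1)[OF x] b(1)[OF y] b(1)[OF T_closed(1)[OF x y]] b(2)[OF x] u[OF x] u[OF y] u[OF T_closed(1)[OF x y]]
    lt_add[OF la x y] lt_in[OF la x] lt_in[OF la y] a
   by (simp add: bb_apply K.l_distr K.r_distr)
  show "bb a (v(i := c \<odot>\<^bsub>T\<^esub> x)) = c \<otimes>\<^bsub>K\<^esub> bb a (v(i := x))" if c: "c : carrier K" for c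
   using b(1)[OF x] b(1)[OF T_closed(2)[OF c x]] b(2)[OF x] u[OF x] u[OF T_closed(2)[OF c x]]
    lt_smult[OF la c x] lt_in[OF la x] c a
   by (simp add: bb_apply K.m_ac)
 qed
qed

definition eb where "eb = (\<lambda>i\<in>{..<d}. tq e)"

lemma te: "tq e : carrier T" using e T_carrier by blast

lemma lt_te: "lt la (tq e) = \<one>\<^bsub>K\<^esub>" using lt_tq[OF la e] la_e by simp

lemma eb_E: "eb : E" unfolding eb_def E_def using te by auto

lemma bet_eb: "bet eb = \<one>\<^bsub>K\<^esub>"
proof -
 have "bet eb = finprod K (\<lambda>i. \<one>\<^bsub>K\<^esub>) {..<d}"
  unfolding bet_def by (rule K.finprod_cong') (auto simp: eb_def lt_te)
 then show ?thesis by simp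
qed

lemma bb_eb: "a : carrier K ==> bb a eb = a"
 by (simp add: bb_apply eb_E bet_eb)

lemma bb_add: "a : carrier K ==> b : carrier K ==> bb (a \<oplus>\<^bsub>K\<^esub> b) = bb a \<oplus>\<^bsub>V\<^esub> bb b"
 unfolding V_simps by (rule extensionalityI[of _ E]) (auto simp: bb_def bet_in K.l_distr)

lemma bb_smult: "a : carrier K ==> bb (kk c \<otimes>\<^bsub>K\<^esub> a) = c \<odot>\<^bsub>V\<^esub> bb a"
 unfolding V_simps by (rule extensionalityI[of _ E]) (auto simp: bb_def bet_in kk K.m_assoc)

definition ksK where
 "ksK A \<longleftrightarrow> A <= carrier K \<and> \<zero>\<^bsub>K\<^esub> : A \<and> (\<forall>x\<in>A. \<forall>y\<in>A. x \<oplus>\<^bsub>K\<^esub> y : A) \<and> (\<forall>c. \<forall>x\<in>A. kk c \<otimes>\<^bsub>K\<^esub> x : A)"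

lemma H_sub: "inertia Cs Gs P <= DD" by (auto simp: inertia_def)

text \<open>The cover maps onto V, and V contains the line bb; so the rank of the preimage of a
  k-subspace of K in the cover is a bounded rank on such subspaces.\<close>
lemma ex_length:
 obtains l :: "('p, 's) germs set set => nat" where "\<And>A B. ksK A ==> ksK B ==> A \<subset> B ==> l A < l B"
proof -
 have C: "projective_module (inertia_grp Cs Gs P) Cm" using cover by (simp add: projective_cover_def)
 have CM: "grp_module (inertia_grp Cs Gs P) Cm" using C by (simp add: projective_module_def)
 obtain f where f: "f : grp_hom (inertia_grp Cs Gs P) Cm V" "f ` carrier Cm = carrier V"
  using cover by (auto simp: projective_cover_def)
 have fin: "finite (carrier (inertia_grp Cs Gs P))"
  using finite_subset[OF H_sub finD] by (simp add: inertia_grp_def)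
 obtain l :: "'c set => nat" where l: "\<And>A B. ksub Cm A ==> ksub Cm B ==> A \<subset> B ==> l A < l B"
  using projective_length[OF C fin] by metis
 define pre where "pre A = {c : carrier Cm. f c : bb ` A}" for A
 have zC: "\<zero>\<^bsub>Cm\<^esub> : carrier Cm" using abelian_group.axioms(1)[OF grp_moduleD(1)[OF CM]] by (rule abelian_monoid.zero_closed)
 interpret Cm: abelian_group Cm by (rule grp_moduleD(1)[OF CM])
 have f0: "f \<zero>\<^bsub>Cm\<^esub> = bb \<zero>\<^bsub>K\<^esub>"
 proof -
  obtain a where a: "a : carrier Cm" "f a = bb \<zero>\<^bsub>K\<^esub>"
   using bb_in[OF K.zero_closed] unfolding f(2)[symmetric] by (rule imageE) (rule that, simp_all)
  have "(0::'k) \<odot>\<^bsub>Cm\<^esub> a = \<zero>\<^bsub>Cm\<^esub>" by (rule grp_module_null(1)[OF CM a(1)])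
  then have "f \<zero>\<^bsub>Cm\<^esub> = 0 \<odot>\<^bsub>V\<^esub> bb \<zero>\<^bsub>K\<^esub>" using grp_homD(3)[OF f(1) a(1), of 0] a(2) by simp
  also have "\<dots> = bb (kk 0 \<otimes>\<^bsub>K\<^esub> \<zero>\<^bsub>K\<^esub>)" by (simp only: bb_smult[OF K.zero_closed])
  finally show ?thesis by (simp add: kk)
 qed
 have ks: "ksub Cm (pre A)" if A: "ksK A" for A
  unfolding ksub_def
 proof (intro conjI ballI allI)
  show "pre A <= carrier Cm" by (auto simp: pre_def)
  show "\<zero>\<^bsub>Cm\<^esub> : pre A" using f0 A by (simp add: pre_def ksK_def)
 next
  fix x y assume x: "x : pre A" and y: "y : pre A"
  obtain a where a: "a : A" "f x = bb a" "x : carrier Cm" using x by (auto simp: pre_def)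
  obtain b where b: "b : A" "f y = bb b" "y : carrier Cm" using y by (auto simp: pre_def)
  have "a : carrier K" "b : carrier K" "a \<oplus>\<^bsub>K\<^esub> b : A" using A a b by (auto simp: ksK_def)
  then have "f (x \<oplus>\<^bsub>Cm\<^esub> y) = bb (a \<oplus>\<^bsub>K\<^esub> b)" using grp_homD(2)[OF f(1)] a b bb_add by simp
  then show "x \<oplus>\<^bsub>Cm\<^esub> y : pre A" using a b \<open>a \<oplus>\<^bsub>K\<^esub> b : A\<close> by (simp add: pre_def)
 next
  fix x c assume x: "x : pre A"
  obtain a where a: "a : A" "f x = bb a" "x : carrier Cm" using x by (auto simp: pre_def)
  have "a : carrier K" "kk c \<otimes>\<^bsub>K\<^esub> a : A" using A a by (auto simp: ksK_def)
  then have "f (c \<odot>\<^bsub>Cm\<^esub> x) = bb (kk c \<otimes>\<^bsub>K\<^esub> a)" using grp_homD(3)[OF f(1)] a bb_smult by simp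
  then show "c \<odot>\<^bsub>Cm\<^esub> x : pre A" using a \<open>kk c \<otimes>\<^bsub>K\<^esub> a : A\<close> grp_moduleD(2)[OF CM] by (simp add: pre_def)
 qed
 show thesis
 proof (rule that[of "\<lambda>A. l (pre A)"])
  fix A B assume A: "ksK A" and B: "ksK B" and AB: "A \<subset> B"
  obtain b where b: "b : B" "b \<notin> A" using AB by blast
  have bK: "b : carrier K" using b B by (auto simp: ksK_def)
  obtain c where c: "c : carrier Cm" "f c = bb b" using f(2) bb_in[OF bK] by (metis image_iff)
  have "c \<notin> pre A"
  proof
   assume "c : pre A"
   then obtain a where a: "a : A" "bb b = bb a" using c by (auto simp: pre_def)
   then have "b = a" using bb_eb[OF bK] bb_eb[of a] A by (auto simp: ksK_def)
   then show False using a b by simp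
  qed
  moreover have "c : pre B" using c b by (simp add: pre_def)
  moreover have "pre A <= pre B" using AB by (auto simp: pre_def)
  ultimately show "l (pre A) < l (pre B)" using l[OF ks[OF A] ks[OF B]] by blast
 qed
qed

lemma ksK_K: "ksK (carrier K)" by (auto simp: ksK_def kk)

lemma length_le:
 fixes l :: "('p, 's) germs set set => nat"
 assumes "\<And>A B. ksK A ==> ksK B ==> A \<subset> B ==> l A < l B" and A: "ksK A"
 shows "l A \<le> l (carrier K)"
proof (cases "A = carrier K")
 case False
 then have "A \<subset> carrier K" using A by (auto simp: ksK_def)
 then show ?thesis using assms(1)[OF A ksK_K] by simp
qed simp

text \<open>Otherwise the polynomials in x of degree below n would form an infinite strictly
  increasing chain of k-subspaces of K. The polynomial of least degree vanishing at x modulo m is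
  irreducible, as m is prime.\<close>
lemma algebraic:
 assumes x: "x : carrier R"
 shows "\<exists>h. Factorial_Ring.irreducible h \<and> L.pev x h : m"
proof -
 obtain l :: "('p, 's) germs set set => nat" where l: "\<And>A B. ksK A ==> ksK B ==> A \<subset> B ==> l A < l B"
  using ex_length by metis
 have le: "l A \<le> l (carrier K)" if "ksK A" for A
  by (rule length_le[OF l that])
 have ex: "\<exists>p. p \<noteq> 0 \<and> L.pev x p : m"
 proof (rule ccontr)
  assume no: "\<not> ?thesis"
  define B where "B n = (\<lambda>p. pi (L.pev x p)) ` {p. \<forall>i\<ge>n. Polynomial.coeff p i = 0}" for n :: nat
  have ks: "ksK (B n)" for n
   unfolding ksK_def
  proof (intro conjI ballI allI)
   show "B n <= carrier K" using x by (auto simp: B_def)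
   have "pi (L.pev x 0) = \<zero>\<^bsub>K\<^esub>" using x L.m_0 pi_0 by simp
   then show "\<zero>\<^bsub>K\<^esub> : B n" unfolding B_def by (intro image_eqI[of _ _ 0]) auto
  next
   fix a b assume a: "a : B n" and b: "b : B n"
   obtain p where p: "a = pi (L.pev x p)" "\<forall>i\<ge>n. Polynomial.coeff p i = 0" using a by (auto simp: B_def)
   obtain p' where p': "b = pi (L.pev x p')" "\<forall>i\<ge>n. Polynomial.coeff p' i = 0" using b by (auto simp: B_def)
   show "a \<oplus>\<^bsub>K\<^esub> b : B n" unfolding B_def
    by (rule image_eqI[of _ _ "p + p'"]) (use p p' x in "simp_all add: L.pev_add")
  next
   fix c a assume a: "a : B n"
   obtain p where p: "a = pi (L.pev x p)" "\<forall>i\<ge>n. Polynomial.coeff p i = 0" using a by (auto simp: B_def)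
   show "kk c \<otimes>\<^bsub>K\<^esub> a : B n" unfolding B_def
    by (rule image_eqI[of _ _ "Polynomial.smult c p"]) (use p x in "simp_all add: L.pev_smult kk_def")
  qed
  have strict: "B n \<subset> B (Suc n)" for n
  proof -
   let ?a = "pi (L.pev x (Polynomial.monom 1 n))"
   have "?a : B (Suc n)" by (auto simp: B_def)
   moreover have "?a \<notin> B n"
   proof
    assume "?a : B n"
    then obtain p where p: "?a = pi (L.pev x p)" "\<forall>i\<ge>n. Polynomial.coeff p i = 0" by (auto simp: B_def)
    have "L.pev x (Polynomial.monom 1 n - p) : m" using p(1) pi_eq x by (simp add: L.pev_diff)
    then have "Polynomial.monom 1 n - p = 0" using no by blast
    then have "Polynomial.coeff (Polynomial.monom 1 n - p) n = 0" by simp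
    then show False using p(2) by simp
   qed
   moreover have "B n <= B (Suc n)" by (auto simp: B_def)
   ultimately show ?thesis by blast
  qed
  have "n \<le> l (B n)" for n
  proof (induction n)
   case (Suc n) then show ?case using l[OF ks ks strict, of n] by simp
  qed simp
  then have "Suc (l (carrier K)) \<le> l (B (Suc (l (carrier K))))" .
  moreover have "l (B n) \<le> l (carrier K)" for n
   by (rule le[OF ks])
  ultimately show False using not_less_eq_eq by blast
 qed
 define p where "p = arg_min Polynomial.degree (\<lambda>p. p \<noteq> 0 \<and> L.pev x p : m)"
 have p: "p \<noteq> 0" "L.pev x p : m" "\<And>h. h \<noteq> 0 ==> L.pev x h : m ==> Polynomial.degree p \<le> Polynomial.degree h"
 proof -
  obtain p0 where p0: "p0 \<noteq> 0 \<and> L.pev x p0 : m" using ex by blast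
  show "p \<noteq> 0" "L.pev x p : m" using arg_min_natI[of "\<lambda>p. p \<noteq> 0 \<and> L.pev x p : m", OF p0] by (auto simp: p_def)
  show "Polynomial.degree p \<le> Polynomial.degree h" if "h \<noteq> 0" "L.pev x h : m" for h
   unfolding p_def by (rule arg_min_nat_le) (use that in simp)
 qed
 have unit: "h dvd 1" if "h \<noteq> 0" "Polynomial.degree h = 0" for h :: "'k poly"
  using that by (metis dvd_field_iff is_unit_iff_degree)
 have "Factorial_Ring.irreducible p"
 proof (rule Factorial_Ring.irreducibleI)
  show "p \<noteq> 0" by (rule p)
  show "\<not> p dvd 1"
  proof
   assume "p dvd 1"
   then have "Polynomial.degree p = 0" using p(1) is_unit_iff_degree by blast
   then obtain c where c: "p = [:c:]" using degree_0_id by (metis degree_eq_zeroE)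
   then have "L.pev x p = kap c" "c \<noteq> 0" using p(1) x by auto
   then show False using p(2) L.kap_not_m by auto
  qed
  fix a b assume ab: "p = a * b"
  then have nz: "a \<noteq> 0" "b \<noteq> 0" using p(1) by auto
  have dg: "Polynomial.degree p = Polynomial.degree a + Polynomial.degree b" using ab nz by (simp add: degree_mult_eq)
  have "L.pev x a : m \<or> L.pev x b : m" using L.m_prime[of "L.pev x a" "L.pev x b"] p(2) x by (simp add: ab L.pev_mult)
  then show "a dvd 1 \<or> b dvd 1" using p(3)[OF nz(1)] p(3)[OF nz(2)] dg unit nz by fastforce
 qed
 then show ?thesis using p(2) by blast
qed

sublocale LA: local_alg R kap m q
 by unfold_locales (use perf algebraic in auto)

lemma kk_F: "kk c : FA.F" by (simp add: FA.F_def kk)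

text \<open>A finite set whose F-span has the largest possible rank spans K.\<close>
lemma finite_span: "\<exists>Us. set Us <= carrier K \<and> K.Span FA.F Us = carrier K"
proof -
 obtain l :: "('p, 's) germs set set => nat" where l: "\<And>A B. ksK A ==> ksK B ==> A \<subset> B ==> l A < l B"
  using ex_length by metis
 have ks: "ksK (K.Span FA.F Us)" if U: "set Us <= carrier K" for Us
  unfolding ksK_def
 proof (intro conjI ballI allI)
  show i: "K.Span FA.F Us <= carrier K" by (rule K.Span_in_carrier[OF subfieldE(3)[OF FA.subfield_F] U])
  have sg: "subgroup (K.Span FA.F Us) (add_monoid K)" by (rule K.Span_is_add_subgroup[OF FA.subfield_F U])
  show "\<zero>\<^bsub>K\<^esub> : K.Span FA.F Us" using subgroup.one_closed[OF sg] by simp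
  show "x \<oplus>\<^bsub>K\<^esub> y : K.Span FA.F Us" if "x : K.Span FA.F Us" "y : K.Span FA.F Us" for x y
   using subgroup.m_closed[OF sg that] by simp
  show "kk c \<otimes>\<^bsub>K\<^esub> x : K.Span FA.F Us" if "x : K.Span FA.F Us" for x c
   by (rule K.Span_smult_closed[OF FA.subfield_F U kk_F that])
 qed
 have le: "l A \<le> l (carrier K)" if "ksK A" for A
  by (rule length_le[OF l that])
 define Us where "Us = arg_min (\<lambda>Us. l (carrier K) - l (K.Span FA.F Us)) (\<lambda>Us. set Us <= carrier K)"
 have U: "set Us <= carrier K"
  using arg_min_natI[of "\<lambda>Us. set Us <= carrier K" "[]"] by (simp add: Us_def)
 have mn: "l (carrier K) - l (K.Span FA.F Us) \<le> l (carrier K) - l (K.Span FA.F Us')" if "set Us' <= carrier K" for Us'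
  unfolding Us_def by (rule arg_min_nat_le) (rule that)
 have "carrier K <= K.Span FA.F Us"
 proof (rule ccontr)
  assume "\<not> ?thesis"
  then obtain x where x: "x : carrier K" "x \<notin> K.Span FA.F Us" by blast
  have U': "set (x # Us) <= carrier K" using U x by simp
  have "x : K.Span FA.F (x # Us)" using K.Span_base_incl[OF FA.subfield_F U'] by simp
  moreover have "K.Span FA.F Us <= K.Span FA.F (x # Us)"
   by (rule K.mono_Span_subset[OF FA.subfield_F]) (use U' K.Span_base_incl[OF FA.subfield_F U'] in auto)
  ultimately have "l (K.Span FA.F Us) < l (K.Span FA.F (x # Us))" using l[OF ks[OF U] ks[OF U']] x(2) by blast
  then show False using mn[OF U'] le[OF ks[OF U']] by linarith
 qed
 then show ?thesis using U ks[OF U] by (auto simp: ksK_def)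
qed

end

section \<open>The cotangent space is a line\<close>

context tame_cover begin

lemma derivation_extends:
 assumes "L.functional f"
 shows "\<exists>D\<in>derivations Cs P. \<forall>x\<in>m. D x = f x"
proof -
 obtain D where D: "D : carrier R \<rightarrow>\<^sub>E carrier K"
  "\<forall>a\<in>carrier R. \<forall>b\<in>carrier R. D (a \<oplus>\<^bsub>R\<^esub> b) = D a \<oplus>\<^bsub>K\<^esub> D b \<and>
    D (a \<otimes>\<^bsub>R\<^esub> b) = (pi a \<otimes>\<^bsub>K\<^esub> D b) \<oplus>\<^bsub>K\<^esub> (pi b \<otimes>\<^bsub>K\<^esub> D a)"
  "\<forall>c. D (kap c) = \<zero>\<^bsub>K\<^esub>" "\<forall>x\<in>m. D x = f x"
  using LA.ex_derivation[OF assms] unfolding K_def[symmetric] pi_def[symmetric] by (elim bexE conjE)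
 have "D : derivations Cs P"
  unfolding derivations_def Let_def reduct_def pi_def[symmetric] using D by simp
 then show ?thesis using D(4) by blast
qed

text \<open>If y were not in q + (e), some functional f would vanish on e and take the value 1 at y.
  Both la and f extend to derivations, which are multiples of one derivation D0 by smoothness; la(e)
  = 1 gives D0(e) nonzero, so f is the zero multiple of D0, against f(y) = 1.\<close>
lemma cotangent_one_dim:
 assumes y: "y : m"
 shows "\<exists>a\<in>carrier R. y \<ominus>\<^bsub>R\<^esub> a \<otimes>\<^bsub>R\<^esub> e : q"
proof -
 define N where "N = q <+>\<^bsub>R\<^esub> PIdl\<^bsub>R\<^esub> e"
 have eR: "e : carrier R" using e L.m_in by blast
 have Ni: "ideal N R" unfolding N_def by (rule L.R.add_ideals[OF L.q_ideal L.R.cgenideal_ideal[OF eR]])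
 have N_el: "x : N \<longleftrightarrow> (\<exists>i\<in>q. \<exists>a\<in>carrier R. x = i \<oplus>\<^bsub>R\<^esub> a \<otimes>\<^bsub>R\<^esub> e)" for x
  unfolding N_def set_add_def' cgenideal_def by blast
 have qN: "q <= N"
 proof
  fix x assume x: "x : q"
  have "x = x \<oplus>\<^bsub>R\<^esub> \<zero>\<^bsub>R\<^esub> \<otimes>\<^bsub>R\<^esub> e" using x L.q_in eR by simp
  then show "x : N" using N_el x L.R.zero_closed by blast
 qed
 have Nm: "N <= m"
 proof
  fix x assume "x : N"
  then obtain i a where "i : q" "a : carrier R" "x = i \<oplus>\<^bsub>R\<^esub> a \<otimes>\<^bsub>R\<^esub> e" using N_el by blast
  then show "x : m" using L.m_add L.m_l[OF e] L.qm by blast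
 qed
 have eN: "e : N"
 proof -
  have "e = \<zero>\<^bsub>R\<^esub> \<oplus>\<^bsub>R\<^esub> \<one>\<^bsub>R\<^esub> \<otimes>\<^bsub>R\<^esub> e" using eR by simp
  then show ?thesis using N_el L.q_0 L.R.one_closed by blast
 qed
 have "y : N"
 proof (rule ccontr)
  assume "y \<notin> N"
  then obtain f where f: "L.functional f" "\<forall>x\<in>N. f x = \<zero>\<^bsub>K\<^esub>" "f y = \<one>\<^bsub>K\<^esub>"
   using L.ex_functional[OF Ni qN Nm y] unfolding K_def[symmetric] by blast
  obtain D0 where D0: "D0 : derivations Cs P"
   "\<forall>D\<in>derivations Cs P. \<exists>c\<in>carrier K. \<forall>a\<in>carrier R. D a = c \<otimes>\<^bsub>K\<^esub> D0 a" using smooth by blast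
  have D0K: "D0 a : carrier K" if "a : carrier R" for a
   using D0(1) that unfolding derivations_def Let_def by auto
  obtain D1 where D1: "D1 : derivations Cs P" "\<forall>x\<in>m. D1 x = la x" using derivation_extends[OF la] by blast
  obtain D2 where D2: "D2 : derivations Cs P" "\<forall>x\<in>m. D2 x = f x" using derivation_extends[OF f(1)] by blast
  obtain c1 where c1: "c1 : carrier K" "\<forall>a\<in>carrier R. D1 a = c1 \<otimes>\<^bsub>K\<^esub> D0 a" using D0(2) D1(1) by blast
  obtain c2 where c2: "c2 : carrier K" "\<forall>a\<in>carrier R. D2 a = c2 \<otimes>\<^bsub>K\<^esub> D0 a" using D0(2) D2(1) by blast
  have "c1 \<otimes>\<^bsub>K\<^esub> D0 e = \<one>\<^bsub>K\<^esub>" using bspec[OF c1(2) eR] bspec[OF D1(2) e] la_e by simp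
  then have "D0 e \<noteq> \<zero>\<^bsub>K\<^esub>" using c1(1) by auto
  moreover have "c2 \<otimes>\<^bsub>K\<^esub> D0 e = \<zero>\<^bsub>K\<^esub>" using bspec[OF c2(2) eR] bspec[OF D2(2) e] bspec[OF f(2) eN] by simp
  ultimately have "c2 = \<zero>\<^bsub>K\<^esub>" using K.integral[of c2 "D0 e"] c2(1) D0K[OF eR] by blast
  then have "f y = \<zero>\<^bsub>K\<^esub>" using c2(2) D2(2) y L.m_in[OF y] D0K by auto
  then show False using f(3) by simp
 qed
 then obtain i a where ia: "i : q" "a : carrier R" "y = i \<oplus>\<^bsub>R\<^esub> a \<otimes>\<^bsub>R\<^esub> e" using N_el by blast
 have "y \<ominus>\<^bsub>R\<^esub> a \<otimes>\<^bsub>R\<^esub> e = i" using ia eR L.q_in by (simp add: a_minus_def L.R.a_assoc L.R.r_neg)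
 then show ?thesis using ia(1,2) by (intro bexI[of _ a]) simp_all
qed

lemma T_e: "B : carrier T ==> B = lt la B \<odot>\<^bsub>T\<^esub> tq e"
proof -
 assume "B : carrier T"
 then obtain y where y: "y : m" "B = tq y" using T_carrier by blast
 obtain a where a: "a : carrier R" "y \<ominus>\<^bsub>R\<^esub> a \<otimes>\<^bsub>R\<^esub> e : q" using cotangent_one_dim[OF y(1)] by blast
 have "B = tq (a \<otimes>\<^bsub>R\<^esub> e)" using tq_eq[of y "a \<otimes>\<^bsub>R\<^esub> e"] y a L.m_in e by simp
 then have B: "B = pi a \<odot>\<^bsub>T\<^esub> tq e" using T_smult[OF a(1) e] by simp
 then have "lt la B = pi a" using lt_smult[OF la pi_in[OF a(1)] te] lt_te a(1) by simp
 then show ?thesis using B by simp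
qed

text \<open>As T is a line, the arguments can be replaced one after the other by scalar multiples of
  the basis vector.\<close>
lemma multilinear_eq:
 assumes b: "b : E \<rightarrow>\<^sub>E carrier K" "multilinear b" and v: "v : E"
 shows "b v = b eb \<otimes>\<^bsub>K\<^esub> bet v"
proof -
 define w where "w n = (\<lambda>i\<in>{..<d}. if i < n then tq e else v i)" for n
 have wE: "w n : E" for n using v te unfolding w_def E_def by (auto simp: PiE_iff)
 have bK: "b x : carrier K" if "x : E" for x using b(1) that by auto
 have "b v = finprod K (\<lambda>i. lt la (v i)) {..<n} \<otimes>\<^bsub>K\<^esub> b (w n)" if "n \<le> d" for n
  using that
 proof (induction n)
  case 0
  have "w 0 = v" using v unfolding w_def E_def by (auto simp: PiE_iff extensional_def fun_eq_iff)
  then show ?case using bK[OF v] by simp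
 next
  case (Suc n)
  have n: "n < d" using Suc.prems by simp
  have vn: "v n : carrier T" by (rule E_in[OF v n])
  have f: "(\<lambda>i. lt la (v i)) : {..<n} \<rightarrow> carrier K" using lt_E[OF v] n by auto
  have w1: "(w n)(n := lt la (v n) \<odot>\<^bsub>T\<^esub> tq e) = w n"
   using T_e[OF vn] n by (auto simp: w_def fun_eq_iff)
  have w2: "(w n)(n := tq e) = w (Suc n)" using n by (auto simp: w_def fun_eq_iff)
  have "b ((w n)(n := lt la (v n) \<odot>\<^bsub>T\<^esub> tq e)) = lt la (v n) \<otimes>\<^bsub>K\<^esub> b ((w n)(n := tq e))"
   using b(2) wE[of n] n te lt_in[OF la vn] unfolding multilinear_def by blast
  then have "b (w n) = lt la (v n) \<otimes>\<^bsub>K\<^esub> b (w (Suc n))" unfolding w1 w2 .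
  moreover have "finprod K (\<lambda>i. lt la (v i)) {..<Suc n} = lt la (v n) \<otimes>\<^bsub>K\<^esub> finprod K (\<lambda>i. lt la (v i)) {..<n}"
   unfolding lessThan_Suc by (rule K.finprod_insert) (use f lt_in[OF la vn] in auto)
  ultimately show ?case
   using Suc.IH n bK[OF wE[of "Suc n"]] K.finprod_closed[OF f] lt_in[OF la vn] by (simp add: K.m_ac)
 qed
 from this[OF order_refl] have "b v = bet v \<otimes>\<^bsub>K\<^esub> b (w d)" by (simp add: bet_def)
 moreover have "w d = eb" unfolding w_def eb_def by (rule ext) simp
 ultimately show ?thesis using bK[OF eb_E] bet_in[OF v] by (simp add: K.m_comm)
qed

lemma bb_bij: "bij_betw bb (carrier K) (carrier V)"
proof (rule bij_betwI[of _ _ _ "\<lambda>b. b eb"])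
 show "bb : carrier K \<rightarrow> carrier V" using bb_in by blast
 show "(\<lambda>b. b eb) : carrier V \<rightarrow> carrier K" using eb_E by (auto simp only: V_simps PiE_iff Pi_iff)
 show "bb a eb = a" if "a : carrier K" for a by (rule bb_eb[OF that])
 show "bb (b eb) = b" if b: "b : carrier V" for b
  by (rule extensionalityI[of _ E]) (use b multilinear_eq in "auto simp: V_simps bb_def PiE_iff")
qed

text \<open>The cocycles of the dual line of T and of its d-th power V with respect to the basis
  vectors la and bet.\<close>
definition nu where "nu g = s g (lt la (s (inv\<^bsub>Gam\<^esub> g) (tq e)))"
definition lam where "lam g = nu g [^]\<^bsub>K\<^esub> d"

lemma nu: "g : DD ==> B : carrier T ==> s g (lt la (s (inv\<^bsub>Gam\<^esub> g) B)) = nu g \<otimes>\<^bsub>K\<^esub> lt la B"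
 and nu_in: "g : DD ==> nu g : carrier K"
proof -
 assume g: "g : DD"
 note gi = al_inv(3)[OF g]
 have l: "lt la (s (inv\<^bsub>Gam\<^esub> g) (tq e)) : carrier K" by (rule lt_in[OF la T_closed(3)[OF gi te]])
 then show "nu g : carrier K" using g unfolding nu_def by simp
 assume B: "B : carrier T"
 have b: "lt la B : carrier K" by (rule lt_in[OF la B])
 have "s (inv\<^bsub>Gam\<^esub> g) B = s (inv\<^bsub>Gam\<^esub> g) (lt la B) \<odot>\<^bsub>T\<^esub> s (inv\<^bsub>Gam\<^esub> g) (tq e)"
  using s_smult[OF gi b te] T_e[OF B] by simp
 then have "lt la (s (inv\<^bsub>Gam\<^esub> g) B) = s (inv\<^bsub>Gam\<^esub> g) (lt la B) \<otimes>\<^bsub>K\<^esub> lt la (s (inv\<^bsub>Gam\<^esub> g) (tq e))"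
  using lt_smult[OF la _ T_closed(3)[OF gi te]] b gi by simp
 then show "s g (lt la (s (inv\<^bsub>Gam\<^esub> g) B)) = nu g \<otimes>\<^bsub>K\<^esub> lt la B"
  using g gi l b FA.s_inv(1)[of g "lt la B"] by (simp add: nu_def K.m_comm)
qed

lemma nu_mult: "g : DD ==> h : DD ==> nu (g \<otimes>\<^bsub>Aut Cs\<^esub> h) = nu g \<otimes>\<^bsub>K\<^esub> s g (nu h)"
proof -
 assume g: "g : DD" and h: "h : DD"
 note gi = al_inv(3)[OF g] and hi = al_inv(3)[OF h]
 have gT: "s (inv\<^bsub>Gam\<^esub> g) (tq e) : carrier T" by (rule T_closed(3)[OF gi te])
 have i: "inv\<^bsub>Gam\<^esub> (g \<otimes>\<^bsub>Aut Cs\<^esub> h) = inv\<^bsub>Gam\<^esub> h \<otimes>\<^bsub>Aut Cs\<^esub> inv\<^bsub>Gam\<^esub> g"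
  using Gm.inv_mult_group[of g h] g h by simp
 have "nu (g \<otimes>\<^bsub>Aut Cs\<^esub> h) = s (g \<otimes>\<^bsub>Aut Cs\<^esub> h) (lt la (s (inv\<^bsub>Gam\<^esub> h) (s (inv\<^bsub>Gam\<^esub> g) (tq e))))"
  unfolding nu_def i using s_comp_T[OF hi gi te] by simp
 also have "\<dots> = s g (s h (lt la (s (inv\<^bsub>Gam\<^esub> h) (s (inv\<^bsub>Gam\<^esub> g) (tq e)))))"
  using FA.s_mult[of g h] g h lt_in[OF la T_closed(3)[OF hi gT]] by simp
 also have "\<dots> = s g (nu h \<otimes>\<^bsub>K\<^esub> lt la (s (inv\<^bsub>Gam\<^esub> g) (tq e)))" using nu[OF h gT] by simp
 also have "\<dots> = nu g \<otimes>\<^bsub>K\<^esub> s g (nu h)" using g nu_in[OF h] lt_in[OF la gT] by (simp add: nu_def K.m_comm)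
 finally show ?thesis .
qed

lemma nu_1: "nu \<one>\<^bsub>Aut Cs\<^esub> = \<one>\<^bsub>K\<^esub>"
proof -
 have i: "inv\<^bsub>Gam\<^esub> \<one>\<^bsub>Aut Cs\<^esub> = \<one>\<^bsub>Aut Cs\<^esub>" using Gm.inv_one by simp
 have D: "\<one>\<^bsub>Aut Cs\<^esub> : DD" using Gm.one_closed by simp
 have "s \<one>\<^bsub>Aut Cs\<^esub> (tq e) = tq e" using s_tq[OF D L.m_in[OF e]] al_one[OF L.m_in[OF e]] by simp
 then show ?thesis using i lt_te FA.s_one[OF K.one_closed] by (simp add: nu_def)
qed

lemma s_pow: "g : DD ==> a : carrier K ==> s g (a [^]\<^bsub>K\<^esub> (n::nat)) = s g a [^]\<^bsub>K\<^esub> n"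
 by (induction n) simp_all

lemma act_bb:
 assumes g: "g : DD" and a: "a : carrier K"
 shows "act V g (bb a) = bb (lam g \<otimes>\<^bsub>K\<^esub> s g a)"
proof (rule extensionalityI[of _ E])
 show "act V g (bb a) : extensional E" "bb (lam g \<otimes>\<^bsub>K\<^esub> s g a) : extensional E"
  by (auto simp: V_simps bb_def)
 fix v assume v: "v : E"
 note gi = al_inv(3)[OF g]
 define w where "w = (\<lambda>i\<in>{..<d}. s (inv\<^bsub>Aut Cs\<^esub> g) (v i))"
 have w_i: "w i = s (inv\<^bsub>Gam\<^esub> g) (v i)" if "i < d" for i using that inv_eq[OF g] by (simp add: w_def)
 have wE: "w : E" using T_closed(3)[OF gi E_in[OF v]] inv_eq[OF g] unfolding w_def E_def by auto
 have "s g (finprod K (\<lambda>i. lt la (w i)) {..<n}) = nu g [^]\<^bsub>K\<^esub> n \<otimes>\<^bsub>K\<^esub> finprod K (\<lambda>i. lt la (v i)) {..<n}" if "n \<le> d" for n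
  using that
 proof (induction n)
  case 0 then show ?case using g by simp
 next
  case (Suc n)
  have n: "n < d" using Suc.prems by simp
  have fw: "(\<lambda>i. lt la (w i)) : {..<n} \<rightarrow> carrier K" and fv: "(\<lambda>i. lt la (v i)) : {..<n} \<rightarrow> carrier K"
   using lt_E[OF wE] lt_E[OF v] n by auto
  have lw: "lt la (w n) : carrier K" and lv: "lt la (v n) : carrier K"
   using lt_in[OF la E_in[OF wE n]] lt_in[OF la E_in[OF v n]] by auto
  have pw: "finprod K (\<lambda>i. lt la (w i)) {..<Suc n} = lt la (w n) \<otimes>\<^bsub>K\<^esub> finprod K (\<lambda>i. lt la (w i)) {..<n}"
   unfolding lessThan_Suc by (rule K.finprod_insert) (use fw lw in auto)
  have pv: "finprod K (\<lambda>i. lt la (v i)) {..<Suc n} = lt la (v n) \<otimes>\<^bsub>K\<^esub> finprod K (\<lambda>i. lt la (v i)) {..<n}"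
   unfolding lessThan_Suc by (rule K.finprod_insert) (use fv lv in auto)
  have "s g (lt la (w n)) = nu g \<otimes>\<^bsub>K\<^esub> lt la (v n)" using nu[OF g E_in[OF v n]] w_i[OF n] by simp
  then show ?case unfolding pw pv
   using Suc.IH n g lw lv K.finprod_closed[OF fw] K.finprod_closed[OF fv] nu_in[OF g] by (simp add: K.m_ac)
 qed
 from this[OF order_refl] have "s g (bet w) = lam g \<otimes>\<^bsub>K\<^esub> bet v" by (simp add: bet_def lam_def)
 then have "s g (a \<otimes>\<^bsub>K\<^esub> bet w) = (lam g \<otimes>\<^bsub>K\<^esub> s g a) \<otimes>\<^bsub>K\<^esub> bet v"
  using g a bet_in[OF wE] bet_in[OF v] nu_in[OF g] by (simp add: K.m_ac lam_def)
 moreover have "act V g (bb a) v = s g (bb a w)" using v by (simp add: V_simps w_def)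
 ultimately show "act V g (bb a) v = bb (lam g \<otimes>\<^bsub>K\<^esub> s g a) v" using v wE by (simp add: bb_apply)
qed

lemma pow_zero: "a : carrier K ==> a [^]\<^bsub>K\<^esub> (n::nat) = \<zero>\<^bsub>K\<^esub> ==> a = \<zero>\<^bsub>K\<^esub>"
proof (induction n)
 case (Suc n)
 then show ?case using K.integral[of "a [^]\<^bsub>K\<^esub> n" a] by auto
qed simp

text \<open>An element h of order p = char k in the inertia group would satisfy nu(h)^p = 1, as nu
  is multiplicative on H; then (nu(h) - 1)^p = 0 and nu(h) = 1. So h acts trivially on the residue
  field and on T, hence trivially modulo q, and lies in the first ramification group.\<close>
lemma inertia_order_nonzero: "of_nat (card (inertia Cs Gs P)) \<noteq> (0::'k)"
proof
 let ?H = "inertia Cs Gs P"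
 assume z: "of_nat (card ?H) = (0::'k)"
 have sH: "subgroup ?H Gam" using FA.H_subgroup by (simp add: H_eq)
 define GH where "GH = Gam\<lparr>carrier := ?H\<rparr>"
 interpret GH: group GH unfolding GH_def by (rule Gm.subgroup_imp_group[OF sH])
 have cH [simp]: "carrier GH = ?H" "x \<otimes>\<^bsub>GH\<^esub> y = x \<otimes>\<^bsub>Aut Cs\<^esub> y" "\<one>\<^bsub>GH\<^esub> = \<one>\<^bsub>Aut Cs\<^esub>" for x y by (simp_all add: GH_def)
 have finH: "finite ?H" by (rule finite_subset[OF H_sub finD])
 have "card ?H > 0" using finH GH.one_closed by (auto simp: card_gt_0_iff)
 define p where "p = CHAR('k)"
 have pd: "p dvd card ?H" using z by (simp add: p_def of_nat_eq_0_iff_char_dvd)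
 then have "p > 0" using \<open>card ?H > 0\<close> by (cases p) auto
 then have pp: "Factorial_Ring.prime p" unfolding p_def by (rule prime_CHAR_semidom)
 obtain n where n: "card ?H = p * n" using pd by (auto simp: dvd_def)
 have "Coset.order GH = p ^ 1 * n" by (simp add: Coset.order_def n)
 then obtain S where S: "subgroup S GH" "card S = p ^ 1"
  using sylow_thm[OF pp GH.is_group _ ] finH by (metis cH(1))
 interpret S: group "GH\<lparr>carrier := S\<rparr>" by (rule GH.subgroup_imp_group[OF S(1)])
 have SH: "S <= ?H" using subgroup.subset[OF S(1)] by simp
 have "\<not> S <= {\<one>\<^bsub>Aut Cs\<^esub>}"
 proof
  assume "S <= {\<one>\<^bsub>Aut Cs\<^esub>}"
  then have "card S \<le> 1" using card_mono[of "{\<one>\<^bsub>Aut Cs\<^esub>}" S] by simp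
  then show False using S(2) prime_gt_1_nat[OF pp] by simp
 qed
 then obtain h where h: "h : S" "h \<noteq> \<one>\<^bsub>Aut Cs\<^esub>" by blast
 have hH: "h : ?H" using h SH by blast
 have hD: "h : DD" using hH H_sub by blast
 have hp: "h [^]\<^bsub>GH\<^esub> p = \<one>\<^bsub>Aut Cs\<^esub>"
  using S.pow_order_eq_1[of h] h(1) S(2) by (simp add: Coset.order_def GH.nat_pow_consistent[symmetric])
 have triv: "s h a = a" if "a : carrier K" for a using hH that by (auto simp: inertia_def)
 have pw: "h [^]\<^bsub>GH\<^esub> k : ?H \<and> nu (h [^]\<^bsub>GH\<^esub> k) = nu h [^]\<^bsub>K\<^esub> k" for k :: nat
 proof (induction k)
  case 0 then show ?case using GH.one_closed nu_1 by simp
 next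
  case (Suc k)
  have d: "h [^]\<^bsub>GH\<^esub> k : DD" using Suc H_sub by blast
  have t: "s (h [^]\<^bsub>GH\<^esub> k) (nu h) = nu h" using Suc nu_in[OF hD] by (auto simp: inertia_def)
  show ?case using Suc nu_mult[OF d hD] t hH GH.m_closed[of "h [^]\<^bsub>GH\<^esub> k" h] by simp
 qed
 have mu: "nu h [^]\<^bsub>K\<^esub> p = \<one>\<^bsub>K\<^esub>" using pw[of p] hp nu_1 by simp
 interpret pK: poly_eval K kk by unfold_locales (simp_all add: kk)
 have muK: "nu h : carrier K" by (rule nu_in[OF hD])
 have "[:0, 1:] = ([:- 1, 1:] :: 'k poly) + 1" by (simp add: one_pCons)
 then have "[:0, 1:] ^ p = ([:- 1, 1:] :: 'k poly) ^ p + 1"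
  using freshmans_dream[where x = "[:- 1, 1:] :: 'k poly" and y = 1] pp by (simp add: p_def)
 then have "pK.pev (nu h) ([:0, 1:] ^ p) = pK.pev (nu h) ([:- 1, 1:] ^ p + 1)" by (rule arg_cong)
 then have "nu h [^]\<^bsub>K\<^esub> p = (nu h \<ominus>\<^bsub>K\<^esub> \<one>\<^bsub>K\<^esub>) [^]\<^bsub>K\<^esub> p \<oplus>\<^bsub>K\<^esub> \<one>\<^bsub>K\<^esub>"
  using muK by (simp add: pK.pev_power pK.pev_add pK.pev_pCons pK.ph_minus kk a_minus_def K.a_comm)
 then have "(nu h \<ominus>\<^bsub>K\<^esub> \<one>\<^bsub>K\<^esub>) [^]\<^bsub>K\<^esub> p = \<zero>\<^bsub>K\<^esub>"
  using mu muK by (simp add: K.add.r_cancel_one')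
 then have "nu h \<ominus>\<^bsub>K\<^esub> \<one>\<^bsub>K\<^esub> = \<zero>\<^bsub>K\<^esub>"
  by (rule pow_zero[OF K.minus_closed[OF muK K.one_closed]])
 then have nu1: "nu h = \<one>\<^bsub>K\<^esub>" using muK by simp
 have hT: "s h B = B" if B: "B : carrier T" for B
 proof -
  have "s (inv\<^bsub>Gam\<^esub> h) (s h B) = s (inv\<^bsub>Gam\<^esub> h \<otimes>\<^bsub>Aut Cs\<^esub> h) B"
   using s_comp_T[OF al_inv(3)[OF hD] hD B] by simp
  also have "\<dots> = B"
  proof -
   obtain x where x: "x : m" "B = tq x" using B T_carrier by blast
   have "inv\<^bsub>Gam\<^esub> h \<otimes>\<^bsub>Aut Cs\<^esub> h = \<one>\<^bsub>Aut Cs\<^esub>" using Gm.l_inv[of h] hD by simp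
   moreover have "\<one>\<^bsub>Aut Cs\<^esub> : DD" using Gm.one_closed by simp
   ultimately show ?thesis using s_tq[OF _ L.m_in[OF x(1)]] al_one[OF L.m_in[OF x(1)]] x(2) by simp
  qed
  finally have "lt la (s h B) = lt la B"
   using nu[OF hD T_closed(3)[OF hD B]] nu1 triv[OF lt_in[OF la B]] lt_in[OF la T_closed(3)[OF hD B]] by simp
  then show ?thesis using T_e[OF B] T_e[OF T_closed(3)[OF hD B]] by simp
 qed
 have "al h r \<ominus>\<^bsub>R\<^esub> r : q" if r: "r : carrier R" for r
 proof (rule LA.auto_trivial[OF al_hom[OF hD] _ _ _ _ r])
  show "al h (kap c) = kap c" for c by (rule al_kap[OF hD])
  show "al h a : q" if "a : q" for a by (rule al_q[OF hD that])
  show "al h r \<ominus>\<^bsub>R\<^esub> r : m" if r: "r : carrier R" for r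
   using triv[OF pi_in[OF r]] s_pi[OF hD r] pi_eq[OF al_in[OF hD r] r] by simp
  show "al h t \<ominus>\<^bsub>R\<^esub> t : q" if t: "t : m" for t
  proof -
   have tR: "t : carrier R" using t L.m_in by blast
   have "tq t : carrier T" using t T_carrier by blast
   then show ?thesis using hT s_tq[OF hD tR] tq_eq[OF al_in[OF hD tR] tR] by simp
  qed
 qed
 then have "h : ram_group Cs Gs P 1" using hD by (simp add: ram_group_def numeral_2_eq_2)
 then show False using h ram1 by simp
qed

end

section \<open>Identification of the projective module\<close>

lemma grp_module_restrict:
 assumes "grp_module G V" "subgroup H G"
 shows "grp_module (G\<lparr>carrier := H\<rparr>) V"
proof -
 have H: "g : carrier G" if "g : H" for g using that subgroup.subset[OF assms(2)] by blast
 show ?thesis by (rule grp_moduleI) (use grp_moduleD[OF assms(1)] H in simp_all)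
qed

lemma grp_hom_restrict: "f : grp_hom G V W ==> H <= carrier G ==> f : grp_hom (G\<lparr>carrier := H\<rparr>) V W"
 unfolding grp_hom_def by auto

lemma grp_iso_restrict: "grp_iso G V W ==> H <= carrier G ==> grp_iso (G\<lparr>carrier := H\<rparr>) V W"
 unfolding grp_iso_def using grp_hom_restrict by blast

lemma projective_cover_iso:
 assumes C: "projective_cover G Cm M" and iso: "grp_iso G M N"
 shows "projective_cover G Cm N"
proof -
 obtain f where f: "f : grp_hom G M N" "bij_betw f (carrier M) (carrier N)" using iso by (auto simp: grp_iso_def)
 obtain h where h: "h : grp_hom G Cm M" "h ` carrier Cm = carrier M"
  "\<forall>S. grp_submodule G Cm S \<and> h ` S = carrier M --> S = carrier Cm"
  using C unfolding projective_cover_def by (elim conjE bexE) (rule that)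
 have "(\<lambda>v. f (h v)) ` carrier Cm = carrier N"
  using h(2) bij_betw_imp_surj_on[OF f(2)] by (simp add: image_image[symmetric, of f h])
 moreover have "S = carrier Cm" if S: "grp_submodule G Cm S" "(\<lambda>v. f (h v)) ` S = carrier N" for S
 proof (rule h(3)[rule_format, OF conjI[OF S(1)]])
  have "S <= carrier Cm" using subgroup.subset[OF submodule.axioms(1), of S basefield Cm] S(1) by (simp add: grp_submodule_def)
  then have hs: "h ` S <= carrier M" using h(2) by blast
  have "f ` (h ` S) = f ` carrier M" using S(2) bij_betw_imp_surj_on[OF f(2)] by (simp add: image_image)
  then show "h ` S = carrier M" using inj_on_image_eq_iff[OF bij_betw_imp_inj_on[OF f(2)] hs subset_refl] by blast
 qed
 ultimately show ?thesis
  using C grp_hom_comp[OF h(1) f(1)] unfolding projective_cover_def by (intro conjI bexI[of _ "\<lambda>v. f (h v)"]) auto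
qed

lemma grp_module_image:
 fixes W :: "('k::field, 'w, 'g) gmod"
 assumes V: "grp_module G V" and W: "grp_module G W" and f: "f : grp_hom G V W"
 shows "grp_module G (W\<lparr>carrier := f ` carrier V\<rparr>)"
proof -
 interpret V: abelian_group V by (rule grp_moduleD(1)[OF V])
 interpret W: abelian_group W by (rule grp_moduleD(1)[OF W])
 note h = grp_homD[OF f]
 have sub: "f ` carrier V <= carrier W" using h(1) by blast
 have f0: "f \<zero>\<^bsub>V\<^esub> = \<zero>\<^bsub>W\<^esub>" by (rule additive_finsum(1)[OF grp_moduleD(1)[OF V] grp_moduleD(1)[OF W] h(1,2)])
 have cl: "a \<oplus>\<^bsub>W\<^esub> b : f ` carrier V" if a: "a : f ` carrier V" and b: "b : f ` carrier V" for a b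
 proof -
  obtain x where x: "x : carrier V" "a = f x" using a by blast
  obtain y where y: "y : carrier V" "b = f y" using b by blast
  show ?thesis by (rule image_eqI[of _ _ "x \<oplus>\<^bsub>V\<^esub> y"]) (use x y h(2) in auto)
 qed
 have ab: "abelian_group (W\<lparr>carrier := f ` carrier V\<rparr>)"
 proof (rule abelian_groupI; (simp only: ring.simps partial_object.simps monoid.simps)?)
  show "\<zero>\<^bsub>W\<lparr>carrier := f ` carrier V\<rparr>\<^esub> : carrier (W\<lparr>carrier := f ` carrier V\<rparr>)"
   using imageI[OF V.zero_closed, of f] f0 by simp
 next
  fix x assume "x : carrier (W\<lparr>carrier := f ` carrier V\<rparr>)"
  then obtain a where a: "a : carrier V" "x = f a" by auto
  have "f (\<ominus>\<^bsub>V\<^esub> a) \<oplus>\<^bsub>W\<^esub> f a = \<zero>\<^bsub>W\<^esub>" using h(2)[of "\<ominus>\<^bsub>V\<^esub> a" a] a f0 by (simp add: V.l_neg)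
  then show "\<exists>y\<in>carrier (W\<lparr>carrier := f ` carrier V\<rparr>). y \<oplus>\<^bsub>W\<lparr>carrier := f ` carrier V\<rparr>\<^esub> x = \<zero>\<^bsub>W\<lparr>carrier := f ` carrier V\<rparr>\<^esub>"
   using a by (intro bexI[of _ "f (\<ominus>\<^bsub>V\<^esub> a)"]) auto
 qed (use cl sub in "auto simp: subset_iff W.a_ac")
 show ?thesis
 proof (rule grp_moduleI[OF ab])
  fix c x assume "x : carrier (W\<lparr>carrier := f ` carrier V\<rparr>)"
  then obtain a where a: "a : carrier V" "x = f a" by auto
  show "c \<odot>\<^bsub>W\<lparr>carrier := f ` carrier V\<rparr>\<^esub> x : carrier (W\<lparr>carrier := f ` carrier V\<rparr>)"
   using imageI[OF grp_moduleD(2)[OF V a(1), of c], of f] h(3)[OF a(1), of c] a by simp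
 next
  fix g x assume g: "g : carrier G" and "x : carrier (W\<lparr>carrier := f ` carrier V\<rparr>)"
  then obtain a where a: "a : carrier V" "x = f a" by auto
  show "act (W\<lparr>carrier := f ` carrier V\<rparr>) g x : carrier (W\<lparr>carrier := f ` carrier V\<rparr>)"
   using imageI[OF grp_moduleD(7)[OF V g a(1)], of f] h(4)[OF g a(1)] a by simp
 qed (use sub grp_moduleD(3-11)[OF W] in "auto simp: subset_iff")
qed

locale tame_W = tame_cover Cs Gs P e la d Cm
 for Cs :: "('k::field, 'p, 's) rspace" and Gs P e la d and Cm :: "('k, 'c, ('p, 's) morph) gmod" +
 fixes W :: "('k, 'w, ('p, 's) morph) gmod"
 assumes W: "projective_module (decomp_grp Cs Gs P) W"
  and IndW: "grp_iso (decomp_grp Cs Gs P) (Ind (decomp_grp Cs Gs P) (inertia Cs Gs P) Cm) (dir_power (res_degree Cs Gs P) W)"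
begin

lemma nH_nonzero: "FA.nH \<noteq> \<zero>\<^bsub>K\<^esub>"
 using inertia_order_nonzero kk_0_iff kk_of_nat unfolding FA.nH_def H_eq by metis

sublocale TW: twisted K Gam s kk lam
proof
 show "FA.nH \<noteq> \<zero>\<^bsub>K\<^esub>" by (rule nH_nonzero)
 fix g assume g: "g : carrier Gam"
 then show "lam g : carrier K" using nu_in by (simp add: lam_def)
 fix h assume h: "h : carrier Gam"
 show "lam (g \<otimes>\<^bsub>Gam\<^esub> h) = lam g \<otimes>\<^bsub>K\<^esub> s g (lam h)"
  using g h nu_mult nu_in s_pow by (simp add: lam_def K.nat_pow_distrib)
qed (use kk in "auto simp: lam_def nu_1")

lemma Vm_iso_V: "grp_iso Gam TW.Vm V"
 unfolding grp_iso_def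
proof (rule bexI)
 show "bij_betw bb (carrier TW.Vm) (carrier V)" using bb_bij by (simp add: TW.Vm_simps)
 show "bb : grp_hom Gam TW.Vm V"
  by (rule grp_homI) (simp_all add: bb_in bb_add bb_smult act_bb TW.A_def TW.Vm_simps)
qed

lemma base_eq: "base_resfield Cs Gs P = FA.F"
proof -
 obtain c where c: "c : carrier K" "FA.Tr c = \<one>\<^bsub>K\<^esub>" using FA.ex_trace_one[OF nH_nonzero] by blast
 have "(\<Oplus>\<^bsub>K\<^esub>g\<in>DD. s g c) = \<one>\<^bsub>K\<^esub>" using c(2) by (simp add: FA.Tr_def)
 from base[OF c(1) this] show ?thesis by (simp add: FA.F_def)
qed

lemma degree_eq: "res_degree Cs Gs P = K.dim FA.F (carrier K)"
 by (simp add: res_degree_def base_eq)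

lemma inertia_grp_eq: "inertia_grp Cs Gs P = Gam\<lparr>carrier := FA.H\<rparr>"
 unfolding inertia_grp_def H_eq by (simp add: decomp_grp_def)

lemma Ind_Vm: "grp_iso Gam (Ind Gam FA.H TW.Vm) (dir_power (K.dim FA.F (carrier K)) W)"
 and degree_pos: "K.dim FA.F (carrier K) > 0"
proof -
 obtain Us where Us: "set Us <= carrier K" "K.Span FA.F Us = carrier K" using finite_span by blast
 show "K.dim FA.F (carrier K) > 0" by (rule TW.ex_dual_basis[OF Us])
 let ?H = "Gam\<lparr>carrier := FA.H\<rparr>"
 have HG: "FA.H <= carrier Gam" by (rule FA.H_sub)
 have Vm: "grp_module ?H TW.Vm" by (rule grp_module_restrict[OF TW.grp_module_Vm FA.H_subgroup])
 have cov: "projective_cover ?H Cm V" using cover by (simp add: inertia_grp_eq)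
 have "projective_cover ?H Cm TW.Vm"
  by (rule projective_cover_iso[OF cov grp_iso_sym[OF Vm grp_iso_restrict[OF Vm_iso_V HG]]])
 then have "grp_iso ?H Cm TW.Vm"
  by (rule cover_iso[rotated 3]) (use Gm.subgroup_imp_group[OF FA.H_subgroup] FA.H_sub(2) Vm inertia_order_nonzero H_eq in auto)
 moreover have Cg: "grp_module ?H Cm" using cov by (simp add: projective_cover_def projective_module_def)
 ultimately have i: "grp_iso ?H TW.Vm Cm" using grp_iso_sym by blast
 have "grp_iso Gam (Ind Gam FA.H TW.Vm) (Ind Gam FA.H Cm)"
  by (rule Ind_iso[OF grp FA.H_subgroup Vm i])
 then show "grp_iso Gam (Ind Gam FA.H TW.Vm) (dir_power (K.dim FA.F (carrier K)) W)"
  by (rule grp_iso_trans) (use IndW in "simp add: degree_eq H_eq")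
qed

lemma Vm_iso_W: "grp_iso Gam TW.Vm W"
proof -
 obtain Us where Us: "set Us <= carrier K" "K.Span FA.F Us = carrier K" using finite_span by blast
 show ?thesis
  by (rule power_cancel[OF W _ TW.grp_module_Vm degree_pos grp_iso_trans[OF TW.power_iso_Ind[OF Us] Ind_Vm]])
   (simp add: finD)
qed

theorem W_iso_V: "grp_iso Gam W V"
 by (rule grp_iso_trans[OF grp_iso_sym[OF TW.grp_module_Vm Vm_iso_W] Vm_iso_V])

text \<open>If g and h commute, comparing nu(g h) with nu(h g) gives s_g(nu h) = nu h, as h acts
  trivially on K.\<close>
lemma central_lam:
 assumes cen: "inertia_central Cs Gs P" and h: "h : FA.H"
 shows "lam h : FA.F"
proof -
 have hI: "h : inertia Cs Gs P" and hD: "h : DD" using h H_eq H_sub by auto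
 have "s g (nu h) = nu h" if g: "g : DD" for g
 proof -
  note gi = al_inv(3)[OF g]
  have "nu g \<otimes>\<^bsub>K\<^esub> s g (nu (inv\<^bsub>Gam\<^esub> g)) = \<one>\<^bsub>K\<^esub>"
   using nu_mult[OF g gi] Gm.r_inv[of g] g nu_1 by simp
  then have nz: "nu g \<noteq> \<zero>\<^bsub>K\<^esub>" using nu_in[OF gi] g by auto
  have "g \<otimes>\<^bsub>Aut Cs\<^esub> h = h \<otimes>\<^bsub>Aut Cs\<^esub> g" using cen hI g by (simp add: inertia_central_def)
  then have "nu g \<otimes>\<^bsub>K\<^esub> s g (nu h) = nu h \<otimes>\<^bsub>K\<^esub> s h (nu g)" using nu_mult[OF g hD] nu_mult[OF hD g] by simp
  also have "s h (nu g) = nu g" using h nu_in[OF g] by (simp add: FA.H_def)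
  finally have "nu g \<otimes>\<^bsub>K\<^esub> s g (nu h) = nu g \<otimes>\<^bsub>K\<^esub> nu h" using nu_in[OF g] nu_in[OF hD] by (simp add: K.m_comm)
  then show ?thesis using K.m_lcancel[OF nz nu_in[OF g]] nu_in[OF hD] g by simp
 qed
 then show ?thesis using nu_in[OF hD] s_pow by (simp add: FA.F_def lam_def)
qed

text \<open>VF is the required module up to isomorphism; it is transported into W along the
  isomorphism of V with W so as to live on the type of W.\<close>
theorem W_induced:
 assumes cen: "inertia_central Cs Gs P"
 shows "\<exists>\<chi> :: ('k, 'w, ('p, 's) morph) gmod. fg_module (inertia_grp Cs Gs P) \<chi> \<and>
     grp_iso Gam W (Ind Gam (inertia Cs Gs P) \<chi>)"
proof -
 obtain Us where Us: "set Us <= carrier K" "K.Span FA.F Us = carrier K" using finite_span by blast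
 let ?H = "Gam\<lparr>carrier := FA.H\<rparr>"
 note lF = central_lam[OF cen]
 have VF: "grp_module ?H TW.VF" by (rule TW.grp_module_VF[OF lF])
 have IVF: "grp_module Gam (Ind Gam FA.H TW.VF)" by (rule grp_module_Ind[OF grp FA.H_subgroup VF])
 have Vm: "grp_module ?H TW.Vm" by (rule grp_module_restrict[OF TW.grp_module_Vm FA.H_subgroup])
 have "grp_iso Gam (Ind Gam FA.H TW.Vm) (dir_power (K.dim FA.F (carrier K)) (Ind Gam FA.H TW.VF))"
  by (rule grp_iso_trans[OF Ind_iso[OF grp FA.H_subgroup Vm TW.power_VF_iso[OF Us lF]] Ind_power[OF grp FA.H_subgroup]])
 note grp_iso_sym[OF grp_module_Ind[OF grp FA.H_subgroup Vm] this]
 then have iV: "grp_iso Gam (Ind Gam FA.H TW.VF) W"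
  by (intro power_cancel[OF W _ IVF degree_pos grp_iso_trans[OF _ Ind_Vm]]) (simp_all add: finD)
 have Wg: "grp_module Gam W" using W by (simp add: projective_module_def)
 have WH: "grp_module ?H W" by (rule grp_module_restrict[OF Wg FA.H_subgroup])
 obtain w where w: "w : grp_hom Gam TW.Vm W" "bij_betw w (carrier TW.Vm) (carrier W)"
  using Vm_iso_W by (auto simp: grp_iso_def)
 have FK: "FA.F <= carrier K" using FA.F_in by blast
 have wF: "w : grp_hom ?H TW.VF W"
  by (rule grp_homI) (use grp_homD[OF w(1)] FK FA.H_sub(1) in "auto simp: subset_iff TW.VF_simps TW.Vm_simps")
 define \<chi> where "\<chi> = W\<lparr>carrier := w ` carrier TW.VF\<rparr>"
 have chi: "grp_module ?H \<chi>" unfolding \<chi>_def by (rule grp_module_image[OF VF WH wF])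
 have "grp_iso ?H TW.VF \<chi>"
  unfolding grp_iso_def
 proof (rule bexI)
  have "inj_on w FA.F" using inj_on_subset[OF bij_betw_imp_inj_on[OF w(2)]] FK by (simp add: TW.Vm_simps)
  then show "bij_betw w (carrier TW.VF) (carrier \<chi>)" by (simp add: \<chi>_def bij_betw_def TW.VF_simps)
  show "w : grp_hom ?H TW.VF \<chi>" by (rule grp_homI) (use grp_homD[OF wF] in "auto simp: \<chi>_def")
 qed
 then have "grp_iso Gam (Ind Gam FA.H TW.VF) (Ind Gam FA.H \<chi>)" by (rule Ind_iso[OF grp FA.H_subgroup VF])
 then have i: "grp_iso Gam W (Ind Gam FA.H \<chi>)" by (rule grp_iso_trans[OF grp_iso_sym[OF IVF iV]])
 obtain n j where j: "kemb n (carrier Gam) W j" by (rule projective_kemb[OF W])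
 have "w ` FA.F <= carrier W" using grp_homD(1)[OF wF] by (auto simp: TW.VF_simps)
 then have "kemb n (carrier Gam) \<chi> j"
  using j unfolding kemb_def \<chi>_def by (auto simp: subset_iff inj_on_def TW.VF_simps)
 then have "fg_module ?H \<chi>" by (rule kemb_finitely_generated[OF chi]) (simp add: finD)
 then show ?thesis using i unfolding inertia_grp_eq H_eq by blast
qed

end

context tame_point begin

theorem W_at_tame_point:
 fixes Cm :: "('k, 'c, ('p, 's) morph) gmod" and W :: "('k, 'w, ('p, 's) morph) gmod"
 assumes d: "1 \<le> d" "d < tame_index Cs Gs P" and W: "is_W Cs Gs P d Cm W"
 shows "grp_iso Gam W (cotangent_neg_pow Cs P d)"
  "inertia_central Cs Gs P ==> \<exists>\<chi> :: ('k, 'w, ('p, 's) morph) gmod. fg_module (inertia_grp Cs Gs P) \<chi> \<and>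
     grp_iso Gam W (Ind Gam (inertia Cs Gs P) \<chi>)"
proof -
 obtain e where e: "e : m" "e \<notin> q" using cotangent_nonzero[OF d] by blast
 obtain la where la: "L.functional la" "la e = \<one>\<^bsub>K\<^esub>"
  using L.ex_functional[OF L.q_ideal subset_refl L.qm e] unfolding K_def[symmetric] by blast
 interpret tame_W Cs Gs P e la d Cm W
  by unfold_locales (use e la W in "auto simp: is_W_def")
 show "grp_iso Gam W (cotangent_neg_pow Cs P d)" by (rule W_iso_V)
 show "inertia_central Cs Gs P ==> \<exists>\<chi> :: ('k, 'w, ('p, 's) morph) gmod. fg_module (inertia_grp Cs Gs P) \<chi> \<and>
     grp_iso Gam W (Ind Gam (inertia Cs Gs P) \<chi>)" by (rule W_induced)
qed

end

section \<open>Stalks\<close>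

locale presheaf =
 fixes C :: "('k::field, 'p, 's) rspace"
 assumes sec_cring: "openin (tspace C) U ==> cring (sec C U)"
  and res_hom: "openin (tspace C) U ==> openin (tspace C) V ==> V <= U ==> res C U V : ring_hom (sec C U) (sec C V)"
  and res_comp: "openin (tspace C) U ==> openin (tspace C) V ==> openin (tspace C) W ==> W <= V ==> V <= U ==>
    t : carrier (sec C U) ==> res C V W (res C U V t) = res C U W t"
  and res_id: "openin (tspace C) U ==> t : carrier (sec C U) ==> res C U U t = t"
  and scal_in: "openin (tspace C) U ==> scal C U c : carrier (sec C U)"
  and scal_add: "openin (tspace C) U ==> scal C U (c + e) = scal C U c \<oplus>\<^bsub>sec C U\<^esub> scal C U e"
  and scal_mult: "openin (tspace C) U ==> scal C U (c * e) = scal C U c \<otimes>\<^bsub>sec C U\<^esub> scal C U e"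
  and scal_1: "openin (tspace C) U ==> scal C U 1 = \<one>\<^bsub>sec C U\<^esub>"
  and scal_res: "openin (tspace C) U ==> openin (tspace C) V ==> V <= U ==> res C U V (scal C U c) = scal C V c"
begin

abbreviation "opn \<equiv> openin (tspace C)"
abbreviation "Sec U \<equiv> carrier (sec C U)"
abbreviation amult (infixl "\<cdot>" 70) where "\<sigma> \<cdot> \<tau> \<equiv> \<sigma> \<otimes>\<^bsub>Aut C\<^esub> \<tau>"

definition sect where "sect P U t \<longleftrightarrow> opn U \<and> P : U \<and> t : Sec U"

definition agree where
 "agree P U t V t' \<longleftrightarrow> (\<exists>W. opn W \<and> P : W \<and> W <= U \<inter> V \<and> res C U W t = res C V W t')"

lemma sectD: "sect P U t ==> opn U" "sect P U t ==> P : U" "sect P U t ==> t : Sec U"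
 by (simp_all add: sect_def)

lemma germ_def': "germ C P U t = {(V, t'). sect P V t' \<and> agree P U t V t'}"
 unfolding germ_def sect_def agree_def by (simp add: conj_assoc)

lemma res_in: "opn U ==> opn V ==> V <= U ==> t : Sec U ==> res C U V t : Sec V"
 using ring_hom_closed[OF res_hom] .

lemma sect_res: "sect P U t ==> opn V ==> P : V ==> V <= U ==> sect P V (res C U V t)"
 unfolding sect_def using res_in by blast

lemma agree_refl: "sect P U t ==> agree P U t U t"
 unfolding agree_def sect_def by (intro exI[of _ U]) simp

lemma agree_sym: "agree P U t V t' ==> agree P V t' U t"
proof -
 assume "agree P U t V t'"
 then obtain W where W: "opn W" "P : W" "W <= U \<inter> V" "res C U W t = res C V W t'" unfolding agree_def by blast
 show ?thesis unfolding agree_def by (rule exI[of _ W]) (use W in auto)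
qed

lemma agree_trans:
 assumes s: "sect P U t" "sect P V t'" "sect P Z t''" and 1: "agree P U t V t'" and 2: "agree P V t' Z t''"
 shows "agree P U t Z t''"
proof -
 obtain W where W: "opn W" "P : W" "W <= U \<inter> V" "res C U W t = res C V W t'" using 1 unfolding agree_def by blast
 obtain W' where W': "opn W'" "P : W'" "W' <= V \<inter> Z" "res C V W' t' = res C Z W' t''" using 2 unfolding agree_def by blast
 have o: "opn (W \<inter> W')" using W(1) W'(1) by (rule openin_Int)
 have sub: "W <= U" "W <= V" "W' <= V" "W' <= Z" using W(3) W'(3) by auto
 note S = sectD[OF s(1)] sectD[OF s(2)] sectD[OF s(3)]
 have "res C U (W \<inter> W') t = res C W (W \<inter> W') (res C U W t)" using res_comp[OF S(1) W(1) o _ sub(1) S(3)] by simp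
 also have "\<dots> = res C V (W \<inter> W') t'" unfolding W(4) using res_comp[OF S(4) W(1) o _ sub(2) S(6)] by simp
 also have "\<dots> = res C W' (W \<inter> W') (res C V W' t')" using res_comp[OF S(4) W'(1) o _ sub(3) S(6)] by simp
 also have "\<dots> = res C Z (W \<inter> W') t''" unfolding W'(4) using res_comp[OF S(7) W'(1) o _ sub(4) S(9)] by simp
 finally have e: "res C U (W \<inter> W') t = res C Z (W \<inter> W') t''" .
 show ?thesis unfolding agree_def by (rule exI[of _ "W \<inter> W'"]) (use e o W(2) W'(2) sub in auto)
qed

lemma in_germ: "(V, t') : germ C P U t \<longleftrightarrow> sect P V t' \<and> agree P U t V t'"
 by (simp add: germ_def')

lemma germ_eq:
 assumes "sect P U t" "sect P V t'"
 shows "germ C P U t = germ C P V t' \<longleftrightarrow> agree P U t V t'"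
proof
 assume "germ C P U t = germ C P V t'"
 moreover have "(V, t') : germ C P V t'" using assms(2) agree_refl by (simp add: in_germ)
 ultimately show "agree P U t V t'" by (metis in_germ)
next
 assume a: "agree P U t V t'"
 show "germ C P U t = germ C P V t'"
  unfolding germ_def'
 proof (rule Collect_cong, clarify)
  fix Z z
  show "(sect P Z z \<and> agree P U t Z z) = (sect P Z z \<and> agree P V t' Z z)"
   using agree_trans[OF assms _ a] agree_trans[OF assms(2,1) _ agree_sym[OF a]] by blast
 qed
qed

lemma germ_res: "sect P U t ==> opn V ==> P : V ==> V <= U ==> germ C P V (res C U V t) = germ C P U t"
proof -
 assume s: "sect P U t" and V: "opn V" "P : V" "V <= U"
 have "res C V V (res C U V t) = res C U V t" by (rule res_id[OF V(1) res_in[OF sectD(1)[OF s] V(1,3) sectD(3)[OF s]]])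
 then have "agree P V (res C U V t) U t" unfolding agree_def by (intro exI[of _ V]) (use V in auto)
 then show ?thesis using germ_eq[OF sect_res[OF s V] s] by simp
qed

lemma germ_self: "sect P U t ==> (U, t) : germ C P U t"
 by (simp add: in_germ agree_refl)

text \<open>The stalk operations are defined through chosen representatives; this computes them on
  any representatives over a common open set.\<close>
lemma germ_op:
 fixes f :: "'p set => 's => 's => 's"
 assumes cl: "\<And>U a b. opn U ==> a : Sec U ==> b : Sec U ==> f U a b : Sec U"
  and rs: "\<And>U V a b. opn U ==> opn V ==> V <= U ==> a : Sec U ==> b : Sec U ==>
   res C U V (f U a b) = f V (res C U V a) (res C U V b)"
  and a: "sect P U a" and b: "sect P U b"
 shows "(\<Union>(V, t)\<in>germ C P U a. \<Union>(V', t')\<in>germ C P U b.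
   germ C P (V \<inter> V') (f (V \<inter> V') (res C V (V \<inter> V') t) (res C V' (V \<inter> V') t'))) = germ C P U (f U a b)"
proof -
 have key: "germ C P (V \<inter> V') (f (V \<inter> V') (res C V (V \<inter> V') t) (res C V' (V \<inter> V') t')) = germ C P U (f U a b)"
  if V: "(V, t) : germ C P U a" and V': "(V', t') : germ C P U b" for V t V' t'
 proof -
  have s: "sect P V t" "sect P V' t'" "agree P U a V t" "agree P U b V' t'" using V V' by (simp_all add: in_germ)
  obtain W where W: "opn W" "P : W" "W <= U \<inter> V" "res C U W a = res C V W t" using s(3) unfolding agree_def by blast
  obtain W' where W': "opn W'" "P : W'" "W' <= U \<inter> V'" "res C U W' b = res C V' W' t'" using s(4) unfolding agree_def by blast
  define Z where "Z = W \<inter> W'"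
  have Z: "opn Z" "P : Z" using W W' by (auto simp: Z_def)
  have sub: "Z <= W" "Z <= W'" "W <= U" "W <= V" "W' <= U" "W' <= V'" "Z <= V \<inter> V'" "Z <= U" using W W' by (auto simp: Z_def)
  have o: "opn U" "opn V" "opn V'" "opn (V \<inter> V')"
   using sectD(1)[OF a] sectD(1)[OF s(1)] sectD(1)[OF s(2)] by auto
  note S = sectD(3)[OF a] sectD(3)[OF b] sectD(3)[OF s(1)] sectD(3)[OF s(2)]
  have ea: "res C U Z a = res C V Z t"
   using res_comp[OF o(1) W(1) Z(1) sub(1,3) S(1)] res_comp[OF o(2) W(1) Z(1) sub(1,4) S(3)] W(4) by simp
  have eb: "res C U Z b = res C V' Z t'"
   using res_comp[OF o(1) W'(1) Z(1) sub(2,5) S(2)] res_comp[OF o(3) W'(1) Z(1) sub(2,6) S(4)] W'(4) by simp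
  have i: "res C V (V \<inter> V') t : Sec (V \<inter> V')" "res C V' (V \<inter> V') t' : Sec (V \<inter> V')"
   using res_in[OF o(2,4) _ S(3)] res_in[OF o(3,4) _ S(4)] by auto
  let ?x = "f (V \<inter> V') (res C V (V \<inter> V') t) (res C V' (V \<inter> V') t')"
  have "res C (V \<inter> V') Z ?x = f Z (res C (V \<inter> V') Z (res C V (V \<inter> V') t)) (res C (V \<inter> V') Z (res C V' (V \<inter> V') t'))"
   by (rule rs[OF o(4) Z(1) sub(7) i])
  also have "\<dots> = f Z (res C V Z t) (res C V' Z t')"
   using res_comp[OF o(2,4) Z(1) sub(7) _ S(3)] res_comp[OF o(3,4) Z(1) sub(7) _ S(4)] by simp
  also have "\<dots> = res C U Z (f U a b)" using rs[OF o(1) Z(1) sub(8) S(1,2)] ea eb by simp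
  finally have e: "res C (V \<inter> V') Z ?x = res C U Z (f U a b)" .
  have "agree P (V \<inter> V') ?x U (f U a b)" unfolding agree_def by (intro exI[of _ Z]) (use Z e sub in auto)
  moreover have "sect P (V \<inter> V') ?x" unfolding sect_def using o(4) cl[OF o(4) i] sectD(2)[OF s(1)] sectD(2)[OF s(2)] by simp
  moreover have "sect P U (f U a b)" unfolding sect_def using o(1) cl[OF o(1) S(1,2)] sectD(2)[OF a] by simp
  ultimately show ?thesis using germ_eq by blast
 qed
 have "(\<Union>(V, t)\<in>germ C P U a. \<Union>(V', t')\<in>germ C P U b.
   germ C P (V \<inter> V') (f (V \<inter> V') (res C V (V \<inter> V') t) (res C V' (V \<inter> V') t'))) =
  (\<Union>x\<in>germ C P U a. \<Union>y\<in>germ C P U b. germ C P U (f U a b))"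
  by (intro SUP_cong refl) (use key in "auto simp only: split_beta prod.collapse")
 also have "\<dots> = germ C P U (f U a b)" using germ_self[OF a] germ_self[OF b] by blast
 finally show ?thesis .
qed

lemma germ_mult: "sect P U a ==> sect P U b ==> germ C P U a \<otimes>\<^bsub>stalk C P\<^esub> germ C P U b = germ C P U (a \<otimes>\<^bsub>sec C U\<^esub> b)"
 and germ_add: "sect P U a ==> sect P U b ==> germ C P U a \<oplus>\<^bsub>stalk C P\<^esub> germ C P U b = germ C P U (a \<oplus>\<^bsub>sec C U\<^esub> b)"
proof -
 assume a: "sect P U a" and b: "sect P U b"
 show "germ C P U a \<otimes>\<^bsub>stalk C P\<^esub> germ C P U b = germ C P U (a \<otimes>\<^bsub>sec C U\<^esub> b)"
  unfolding stalk_def monoid.simps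
  by (rule germ_op[where f = "\<lambda>U a b. a \<otimes>\<^bsub>sec C U\<^esub> b", OF _ _ a b])
   (simp_all add: monoid.m_closed[OF ring.is_monoid[OF cring.axioms(1)[OF sec_cring]]] ring_hom_mult[OF res_hom])
 show "germ C P U a \<oplus>\<^bsub>stalk C P\<^esub> germ C P U b = germ C P U (a \<oplus>\<^bsub>sec C U\<^esub> b)"
  unfolding stalk_def ring.simps
  by (rule germ_op[where f = "\<lambda>U a b. a \<oplus>\<^bsub>sec C U\<^esub> b", OF _ _ a b])
   (simp_all add: abelian_monoid.a_closed[OF abelian_group.axioms(1)[OF ring.is_abelian_group[OF cring.axioms(1)[OF sec_cring]]]] ring_hom_add[OF res_hom])
qed

lemma stalk_carrier: "A : carrier (stalk C P) \<longleftrightarrow> (\<exists>U t. sect P U t \<and> A = germ C P U t)"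
 unfolding stalk_def sect_def by auto

lemma germ_in: "sect P U t ==> germ C P U t : carrier (stalk C P)"
 using stalk_carrier by blast

lemma common_sections:
 assumes "A : carrier (stalk C P)" "B : carrier (stalk C P)" "D : carrier (stalk C P)"
 obtains U a b c where "sect P U a" "sect P U b" "sect P U c" "A = germ C P U a" "B = germ C P U b" "D = germ C P U c"
proof -
 obtain U1 a where a: "sect P U1 a" "A = germ C P U1 a" using assms(1) stalk_carrier by blast
 obtain U2 b where b: "sect P U2 b" "B = germ C P U2 b" using assms(2) stalk_carrier by blast
 obtain U3 c where c: "sect P U3 c" "D = germ C P U3 c" using assms(3) stalk_carrier by blast
 define U where "U = U1 \<inter> U2 \<inter> U3"
 have U: "opn U" "P : U" "U <= U1" "U <= U2" "U <= U3" using a b c sectD by (auto simp: U_def intro!: openin_Int)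
 show thesis
  by (rule that[of U "res C U1 U a" "res C U2 U b" "res C U3 U c"])
   (simp_all add: sect_res germ_res a b c U)
qed

lemma germ_const:
 assumes P: "P : U" "opn U"
 shows "\<one>\<^bsub>stalk C P\<^esub> = germ C P U \<one>\<^bsub>sec C U\<^esub>" "\<zero>\<^bsub>stalk C P\<^esub> = germ C P U \<zero>\<^bsub>sec C U\<^esub>"
  "stalk_scal C P c = germ C P U (scal C U c)"
proof -
 let ?X = "topspace (tspace C)"
 have o: "opn ?X" "U <= ?X" "P : ?X" using P openin_subset[OF P(2)] by auto
 interpret X: cring "sec C ?X" by (rule sec_cring[OF o(1)])
 interpret U: cring "sec C U" by (rule sec_cring[OF P(2)])
 have h: "res C ?X U : ring_hom (sec C ?X) (sec C U)" by (rule res_hom[OF o(1) P(2) o(2)])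
 have s: "sect P ?X \<one>\<^bsub>sec C ?X\<^esub>" "sect P ?X \<zero>\<^bsub>sec C ?X\<^esub>" "sect P ?X (scal C ?X c)" using o scal_in by (auto simp: sect_def)
 show "\<one>\<^bsub>stalk C P\<^esub> = germ C P U \<one>\<^bsub>sec C U\<^esub>"
  using germ_res[OF s(1) P(2,1) o(2)] ring_hom_one[OF h] by (simp add: stalk_def)
 show "\<zero>\<^bsub>stalk C P\<^esub> = germ C P U \<zero>\<^bsub>sec C U\<^esub>"
  using germ_res[OF s(2) P(2,1) o(2)] ring_hom_zero[OF h X.ring_axioms U.ring_axioms] by (simp add: stalk_def)
 show "stalk_scal C P c = germ C P U (scal C U c)"
  using germ_res[OF s(3) P(2,1) o(2)] scal_res[OF o(1) P(2) o(2)] by (simp add: stalk_scal_def)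
qed

lemma sect_closed:
 assumes "sect P U a" "sect P U b"
 shows "sect P U (a \<otimes>\<^bsub>sec C U\<^esub> b)" "sect P U (a \<oplus>\<^bsub>sec C U\<^esub> b)" "sect P U (\<ominus>\<^bsub>sec C U\<^esub> a)" "sect P U \<one>\<^bsub>sec C U\<^esub>" "sect P U \<zero>\<^bsub>sec C U\<^esub>"
proof -
 interpret U: cring "sec C U" by (rule sec_cring[OF sectD(1)[OF assms(1)]])
 show "sect P U (a \<otimes>\<^bsub>sec C U\<^esub> b)" "sect P U (a \<oplus>\<^bsub>sec C U\<^esub> b)" "sect P U (\<ominus>\<^bsub>sec C U\<^esub> a)" "sect P U \<one>\<^bsub>sec C U\<^esub>" "sect P U \<zero>\<^bsub>sec C U\<^esub>"
  using assms by (simp_all add: sect_def)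
qed

lemma stalk_cring:
 assumes P: "P : topspace (tspace C)"
 shows "cring (stalk C P)"
proof (rule cringI)
 let ?S = "stalk C P"
 have X: "P : topspace (tspace C)" "opn (topspace (tspace C))" using P by auto
 interpret X: cring "sec C (topspace (tspace C))" by (rule sec_cring[OF X(2)])
 have one: "\<one>\<^bsub>?S\<^esub> : carrier ?S" and zero: "\<zero>\<^bsub>?S\<^esub> : carrier ?S"
  unfolding germ_const[OF X] using X by (auto intro!: germ_in simp: sect_def)
 have cl: "A \<otimes>\<^bsub>?S\<^esub> B : carrier ?S \<and> A \<oplus>\<^bsub>?S\<^esub> B : carrier ?S \<and> A \<otimes>\<^bsub>?S\<^esub> B = B \<otimes>\<^bsub>?S\<^esub> A \<and> A \<oplus>\<^bsub>?S\<^esub> B = B \<oplus>\<^bsub>?S\<^esub> A \<and>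
   \<one>\<^bsub>?S\<^esub> \<otimes>\<^bsub>?S\<^esub> A = A \<and> \<zero>\<^bsub>?S\<^esub> \<oplus>\<^bsub>?S\<^esub> A = A \<and> (\<exists>Z\<in>carrier ?S. Z \<oplus>\<^bsub>?S\<^esub> A = \<zero>\<^bsub>?S\<^esub>) \<and>
   (A \<otimes>\<^bsub>?S\<^esub> B) \<otimes>\<^bsub>?S\<^esub> D = A \<otimes>\<^bsub>?S\<^esub> (B \<otimes>\<^bsub>?S\<^esub> D) \<and> (A \<oplus>\<^bsub>?S\<^esub> B) \<oplus>\<^bsub>?S\<^esub> D = A \<oplus>\<^bsub>?S\<^esub> (B \<oplus>\<^bsub>?S\<^esub> D) \<and>
   (A \<oplus>\<^bsub>?S\<^esub> B) \<otimes>\<^bsub>?S\<^esub> D = A \<otimes>\<^bsub>?S\<^esub> D \<oplus>\<^bsub>?S\<^esub> B \<otimes>\<^bsub>?S\<^esub> D"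
  if ABD: "A : carrier ?S" "B : carrier ?S" "D : carrier ?S" for A B D
 proof -
  obtain U a b c where s: "sect P U a" "sect P U b" "sect P U c" and e: "A = germ C P U a" "B = germ C P U b" "D = germ C P U c"
   by (rule common_sections[OF ABD]) (rule that)
  interpret U: cring "sec C U" by (rule sec_cring[OF sectD(1)[OF s(1)]])
  note S = sectD(3)[OF s(1)] sectD(3)[OF s(2)] sectD(3)[OF s(3)]
  note k = germ_const[OF sectD(2,1)[OF s(1)]]
  have inv: "germ C P U (\<ominus>\<^bsub>sec C U\<^esub> a) : carrier ?S" "germ C P U (\<ominus>\<^bsub>sec C U\<^esub> a) \<oplus>\<^bsub>?S\<^esub> A = \<zero>\<^bsub>?S\<^esub>"
   unfolding e k using germ_in[OF sect_closed(3)[OF s(1) s(1)]] germ_add[OF sect_closed(3)[OF s(1) s(1)] s(1)] S(1)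
   by (simp_all add: U.l_neg)
  show ?thesis
  proof (intro conjI)
   show "\<exists>Z\<in>carrier ?S. Z \<oplus>\<^bsub>?S\<^esub> A = \<zero>\<^bsub>?S\<^esub>" using inv by blast
  qed (use S in "simp_all add: e k germ_mult germ_add germ_in sect_closed[OF s(1) s(2)] sect_closed[OF s(1) s(3)]
    sect_closed[OF s(2) s(3)] s U.m_ac U.a_ac U.r_distr")
 qed
 note cl3 = cl[THEN conjunct2, THEN conjunct2, THEN conjunct2, THEN conjunct2, THEN conjunct2, THEN conjunct2, THEN conjunct2]
 note cl2 = cl[OF _ _ one, THEN conjunct1] cl[OF _ _ one, THEN conjunct2, THEN conjunct1]
  cl[OF _ _ one, THEN conjunct2, THEN conjunct2, THEN conjunct1] cl[OF _ _ one, THEN conjunct2, THEN conjunct2, THEN conjunct2, THEN conjunct1]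
 note cl1 = cl[OF _ one one, THEN conjunct2, THEN conjunct2, THEN conjunct2, THEN conjunct2, THEN conjunct1]
  cl[OF _ one one, THEN conjunct2, THEN conjunct2, THEN conjunct2, THEN conjunct2, THEN conjunct2, THEN conjunct1]
  cl[OF _ one one, THEN conjunct2, THEN conjunct2, THEN conjunct2, THEN conjunct2, THEN conjunct2, THEN conjunct2, THEN conjunct1]
 show "abelian_group ?S"
  by (rule abelian_groupI) (rule cl1 cl2(1,2,4) cl3[THEN conjunct2, THEN conjunct1] zero; assumption)+
 show "Group.comm_monoid ?S"
  by (rule comm_monoidI) (rule cl1 cl2(1,2,3) cl3[THEN conjunct1] one; assumption)+
 show "(x \<oplus>\<^bsub>?S\<^esub> y) \<otimes>\<^bsub>?S\<^esub> z = x \<otimes>\<^bsub>?S\<^esub> z \<oplus>\<^bsub>?S\<^esub> y \<otimes>\<^bsub>?S\<^esub> z"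
  if "x : carrier ?S" "y : carrier ?S" "z : carrier ?S" for x y z using cl[OF that] by blast
qed

lemma stalk_poly_eval:
 assumes P: "P : topspace (tspace C)"
 shows "poly_eval (stalk C P) (stalk_scal C P)"
proof (intro poly_eval.intro poly_eval_axioms.intro)
 show "cring (stalk C P)" by (rule stalk_cring[OF P])
 let ?X = "topspace (tspace C)"
 have X: "P : ?X" "opn ?X" using P by auto
 note k = germ_const[OF X]
 have s: "sect P ?X (scal C ?X a)" for a using X scal_in by (simp add: sect_def)
 fix a b
 show "stalk_scal C P a : carrier (stalk C P)" unfolding k by (rule germ_in[OF s])
 show "stalk_scal C P (a + b) = stalk_scal C P a \<oplus>\<^bsub>stalk C P\<^esub> stalk_scal C P b" unfolding k germ_add[OF s s] scal_add[OF X(2)] ..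
 show "stalk_scal C P (a * b) = stalk_scal C P a \<otimes>\<^bsub>stalk C P\<^esub> stalk_scal C P b" unfolding k germ_mult[OF s s] scal_mult[OF X(2)] ..
 show "stalk_scal C P 1 = \<one>\<^bsub>stalk C P\<^esub>" unfolding k scal_1[OF X(2)] ..
qed

lemma germ_ring_hom:
 assumes "opn U" "P : U"
 shows "germ C P U : ring_hom (sec C U) (stalk C P)"
 by (rule ring_hom_memI) (use assms in "simp_all add: germ_in germ_add germ_mult germ_const[OF assms(2,1)] sect_def")

text \<open>The same for the map of stalks induced by a morphism, where the target space may be
  another one, such as a quotient.\<close>
lemma stalk_map_germ:
 fixes C' :: "('k, 'q, 's) rspace"
 assumes mor: "\<And>U. openin (tspace C') U ==> opn (preim C \<phi> U)"
  "\<And>U t. openin (tspace C') U ==> t : carrier (sec C' U) ==> \<psi> U t : Sec (preim C \<phi> U)"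
  "\<And>U V t. openin (tspace C') U ==> openin (tspace C') V ==> V <= U ==> t : carrier (sec C' U) ==>
    \<psi> V (res C' U V t) = res C (preim C \<phi> U) (preim C \<phi> V) (\<psi> U t)"
  and P: "P : topspace (tspace C)" and U: "openin (tspace C') U" "\<phi> P : U" "t : carrier (sec C' U)"
 shows "stalk_map C P \<phi> \<psi> (germ C' (\<phi> P) U t) = germ C P (preim C \<phi> U) (\<psi> U t)"
proof -
 have key: "germ C P (preim C \<phi> V) (\<psi> V t') = germ C P (preim C \<phi> U) (\<psi> U t)" if V: "(V, t') : germ C' (\<phi> P) U t" for V t'
 proof -
  from V obtain W where v: "openin (tspace C') V" "\<phi> P : V" "t' : carrier (sec C' V)"
   and W: "openin (tspace C') W" "\<phi> P : W" "W <= U" "W <= V" "res C' U W t = res C' V W t'"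
   by (auto simp: germ_def)
  have s: "sect P (preim C \<phi> U) (\<psi> U t)" "sect P (preim C \<phi> V) (\<psi> V t')"
   using mor(1,2) U v P by (auto simp: sect_def preim_def)
  have "res C (preim C \<phi> U) (preim C \<phi> W) (\<psi> U t) = res C (preim C \<phi> V) (preim C \<phi> W) (\<psi> V t')"
   using mor(3)[OF U(1) W(1,3) U(3)] mor(3)[OF v(1) W(1,4) v(3)] W(5) by simp
  moreover have "preim C \<phi> W <= preim C \<phi> V \<inter> preim C \<phi> U" "P : preim C \<phi> W" using W P by (auto simp: preim_def)
  ultimately have "agree P (preim C \<phi> V) (\<psi> V t') (preim C \<phi> U) (\<psi> U t)"
   unfolding agree_def by (intro exI[of _ "preim C \<phi> W"]) (simp add: mor(1)[OF W(1)])
  then show ?thesis using germ_eq s by blast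
 qed
 have "stalk_map C P \<phi> \<psi> (germ C' (\<phi> P) U t) = (\<Union>x\<in>germ C' (\<phi> P) U t. germ C P (preim C \<phi> U) (\<psi> U t))"
  unfolding stalk_map_def by (intro SUP_cong refl) (use key in "auto simp only: split_beta prod.collapse")
 moreover have "(U, t) : germ C' (\<phi> P) U t" using U by (auto simp: germ_def)
 ultimately show ?thesis by blast
qed

end

section \<open>Automorphisms\<close>

context presheaf begin

abbreviation "Xs \<equiv> topspace (tspace C)"
abbreviation "sm \<sigma> P \<equiv> stalk_map C P (fst \<sigma>) (snd \<sigma>)"

lemma autD:
 assumes "\<sigma> : carrier (Aut C)"
 shows "fst \<sigma> : extensional Xs" "homeomorphic_map (tspace C) (tspace C) (fst \<sigma>)" "snd \<sigma> : extensional {U. opn U}"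
  "\<And>U. opn U ==> snd \<sigma> U : extensional (Sec U)"
  "\<And>U. opn U ==> snd \<sigma> U : ring_iso (sec C U) (sec C (preim C (fst \<sigma>) U))"
  "\<And>U c. opn U ==> snd \<sigma> U (scal C U c) = scal C (preim C (fst \<sigma>) U) c"
  "\<And>U V t. opn U ==> opn V ==> V <= U ==> t : Sec U ==>
    snd \<sigma> V (res C U V t) = res C (preim C (fst \<sigma>) U) (preim C (fst \<sigma>) V) (snd \<sigma> U t)"
 using assms by (simp_all add: Aut_def is_aut_def split_beta)

lemma aut_point: "\<sigma> : carrier (Aut C) ==> P : Xs ==> fst \<sigma> P : Xs"
 using homeomorphic_imp_surjective_map[OF autD(2)] by blast

lemma aut_open: "\<sigma> : carrier (Aut C) ==> opn U ==> opn (preim C (fst \<sigma>) U)"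
 unfolding preim_def using openin_continuous_map_preimage[OF homeomorphic_imp_continuous_map[OF autD(2)]] .

lemma aut_hom: "\<sigma> : carrier (Aut C) ==> opn U ==> snd \<sigma> U : ring_hom (sec C U) (sec C (preim C (fst \<sigma>) U))"
 using autD(5) by (simp add: ring_iso_def)

lemma aut_in: "\<sigma> : carrier (Aut C) ==> opn U ==> t : Sec U ==> snd \<sigma> U t : Sec (preim C (fst \<sigma>) U)"
 using ring_hom_closed[OF aut_hom] .

lemma aut_eqI:
 assumes s: "\<sigma> : carrier (Aut C)" and t: "\<tau> : carrier (Aut C)"
  and 1: "\<And>P. P : Xs ==> fst \<sigma> P = fst \<tau> P"
  and 2: "\<And>U a. opn U ==> a : Sec U ==> snd \<sigma> U a = snd \<tau> U a"
 shows "\<sigma> = \<tau>"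
proof (rule prod_eqI)
 show "fst \<sigma> = fst \<tau>" by (rule extensionalityI[OF autD(1)[OF s] autD(1)[OF t] 1])
 show "snd \<sigma> = snd \<tau>"
 proof (rule extensionalityI[OF autD(3)[OF s] autD(3)[OF t]])
  fix U assume "U : {U. opn U}"
  then have U: "opn U" by simp
  show "snd \<sigma> U = snd \<tau> U" by (rule extensionalityI[OF autD(4)[OF s U] autD(4)[OF t U] 2[OF U]])
 qed
qed

lemma aut_mult:
 "P : Xs ==> fst (\<sigma> \<cdot> \<tau>) P = fst \<sigma> (fst \<tau> P)"
 "opn U ==> a : Sec U ==> snd (\<sigma> \<cdot> \<tau>) U a = snd \<tau> (preim C (fst \<sigma>) U) (snd \<sigma> U a)"
 by (simp_all add: Aut_def split_beta compose_def)

lemma preim_mult: "\<tau> : carrier (Aut C) ==> preim C (fst (\<sigma> \<cdot> \<tau>)) U = preim C (fst \<tau>) (preim C (fst \<sigma>) U)"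
 using aut_point aut_mult(1) unfolding preim_def by (simp cong: conj_cong)

lemma aut_one: "P : Xs ==> fst \<one>\<^bsub>Aut C\<^esub> P = P"
 "opn U ==> a : Sec U ==> snd \<one>\<^bsub>Aut C\<^esub> U a = a"
 by (simp_all add: Aut_def)

lemma preim_one: "opn U ==> preim C (fst \<one>\<^bsub>Aut C\<^esub>) U = U"
 using openin_subset[of "tspace C" U] by (auto simp: preim_def aut_one)

lemma aut_cancel:
 assumes s: "\<sigma> : carrier (Aut C)" "\<sigma>' : carrier (Aut C)" and t: "\<tau> : carrier (Aut C)"
  and e: "\<sigma> \<cdot> \<tau> = \<sigma>' \<cdot> \<tau>"
 shows "\<sigma> = \<sigma>'"
proof (rule aut_eqI[OF s])
 show p: "fst \<sigma> P = fst \<sigma>' P" if P: "P : Xs" for P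
 proof -
  have "P : fst \<tau> ` Xs" using homeomorphic_imp_surjective_map[OF autD(2)[OF t]] P by simp
  then obtain Q where "P = fst \<tau> Q" "Q : Xs" by (rule imageE)
  then show ?thesis using aut_mult(1)[of Q \<sigma> \<tau>] aut_mult(1)[of Q \<sigma>' \<tau>] e by simp
 qed
 fix U a assume U: "opn U" and a: "a : Sec U"
 have pe: "preim C (fst \<sigma>) U = preim C (fst \<sigma>') U" using p by (auto simp: preim_def)
 have o: "opn (preim C (fst \<sigma>) U)" by (rule aut_open[OF s(1) U])
 have "inj_on (snd \<tau> (preim C (fst \<sigma>) U)) (Sec (preim C (fst \<sigma>) U))"
  using autD(5)[OF t o] by (simp add: ring_iso_def bij_betw_def)
 moreover have "snd \<tau> (preim C (fst \<sigma>) U) (snd \<sigma> U a) = snd \<tau> (preim C (fst \<sigma>) U) (snd \<sigma>' U a)"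
  using aut_mult(2)[OF U a, of \<sigma> \<tau>] aut_mult(2)[OF U a, of \<sigma>' \<tau>] e pe by simp
 ultimately show "snd \<sigma> U a = snd \<sigma>' U a"
  using inj_onD[OF _ _ aut_in[OF s(1) U a] aut_in[OF s(2) U a, folded pe]] by blast
qed

text \<open>Automorphisms are cancellable, so translations of a finite submonoid are injective and
  therefore bijective. The inverse taken in the submonoid agrees with the one in the monoid of all
  automorphisms.\<close>
lemma finite_submonoid_group:
 assumes S: "S <= carrier (Aut C)" "finite S" "\<one>\<^bsub>Aut C\<^esub> : S"
  and cl: "\<And>\<sigma> \<tau>. \<sigma> : S ==> \<tau> : S ==> \<sigma> \<cdot> \<tau> : S"
 shows "group ((Aut C)\<lparr>carrier := S\<rparr>)"
  and "\<sigma> : S ==> inv\<^bsub>Aut C\<^esub> \<sigma> = inv\<^bsub>(Aut C)\<lparr>carrier := S\<rparr>\<^esub> \<sigma>"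
proof -
 let ?G = "(Aut C)\<lparr>carrier := S\<rparr>"
 have in_Aut: "\<sigma> : carrier (Aut C)" if "\<sigma> : S" for \<sigma> using S that by blast
 show G: "group ?G"
 proof (rule groupI; (simp only: partial_object.simps monoid.simps)?)
  show "x \<otimes>\<^bsub>?G\<^esub> y : carrier ?G" if "x : carrier ?G" "y : carrier ?G" for x y using that cl by simp
  show "\<one>\<^bsub>?G\<^esub> : carrier ?G" using S by simp
  show "(x \<otimes>\<^bsub>?G\<^esub> y) \<otimes>\<^bsub>?G\<^esub> z = x \<otimes>\<^bsub>?G\<^esub> (y \<otimes>\<^bsub>?G\<^esub> z)" if h: "x : carrier ?G" "y : carrier ?G" "z : carrier ?G" for x y z
  proof -
   have xyz: "x : S" "y : S" "z : S" using h by simp_all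
   note a = in_Aut[OF xyz(1)] in_Aut[OF xyz(2)] in_Aut[OF xyz(3)]
   have "(x \<cdot> y) \<cdot> z = x \<cdot> (y \<cdot> z)"
   proof (rule aut_eqI)
    show "(x \<cdot> y) \<cdot> z : carrier (Aut C)" "x \<cdot> (y \<cdot> z) : carrier (Aut C)"
     using in_Aut cl xyz by blast+
    show "fst ((x \<cdot> y) \<cdot> z) P = fst (x \<cdot> (y \<cdot> z)) P" if "P : Xs" for P
     using that by (simp add: aut_mult(1) aut_point a)
    show "snd ((x \<cdot> y) \<cdot> z) U b = snd (x \<cdot> (y \<cdot> z)) U b"
     if U: "opn U" and b: "b : Sec U" for U b
     by (simp add: aut_mult(2)[OF U b] preim_mult[OF a(2)] aut_mult(2)[OF aut_open[OF a(1) U] aut_in[OF a(1) U b]])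
   qed
   then show ?thesis by simp
  qed
  show "\<one>\<^bsub>?G\<^esub> \<otimes>\<^bsub>?G\<^esub> x = x" if h: "x : carrier ?G" for x
  proof -
   have x: "x : S" using h by simp
   have "\<one>\<^bsub>Aut C\<^esub> \<cdot> x = x"
    by (rule aut_eqI[OF in_Aut[OF cl[OF S(3) x]] in_Aut[OF x]])
     (simp_all add: aut_mult aut_one preim_one aut_point[OF in_Aut[OF x]])
   then show ?thesis by simp
  qed
  show "\<exists>y\<in>carrier ?G. y \<otimes>\<^bsub>?G\<^esub> x = \<one>\<^bsub>?G\<^esub>" if h: "x : carrier ?G" for x
  proof -
   have x: "x : S" using h by simp
   have "inj_on (\<lambda>y. y \<cdot> x) S"
    by (rule inj_onI) (rule aut_cancel[OF in_Aut in_Aut in_Aut[OF x]])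
   moreover have "(\<lambda>y. y \<cdot> x) ` S <= S" by (rule image_subsetI) (rule cl[OF _ x])
   ultimately have "(\<lambda>y. y \<cdot> x) ` S = S" by (intro endo_inj_surj[OF S(2)])
   then have "\<one>\<^bsub>Aut C\<^esub> : (\<lambda>y. y \<cdot> x) ` S" using S(3) by simp
   then obtain y where "\<one>\<^bsub>Aut C\<^esub> = y \<cdot> x" "y : S" by (rule imageE)
   then show ?thesis by (intro bexI[of _ y]) simp_all
  qed
 qed
 interpret G: group ?G by (rule G)
 assume x: "\<sigma> : S"
 let ?y = "inv\<^bsub>?G\<^esub> \<sigma>"
 have y: "?y : S" "?y \<cdot> \<sigma> = \<one>\<^bsub>Aut C\<^esub>" "\<sigma> \<cdot> ?y = \<one>\<^bsub>Aut C\<^esub>"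
  using G.inv_closed[of \<sigma>] G.l_inv[of \<sigma>] G.r_inv[of \<sigma>] x by simp_all
 have "(THE y. y : carrier (Aut C) \<and> \<sigma> \<cdot> y = \<one>\<^bsub>Aut C\<^esub> \<and> y \<cdot> \<sigma> = \<one>\<^bsub>Aut C\<^esub>) = ?y"
 proof (rule the_equality)
  show "?y : carrier (Aut C) \<and> \<sigma> \<cdot> ?y = \<one>\<^bsub>Aut C\<^esub> \<and> ?y \<cdot> \<sigma> = \<one>\<^bsub>Aut C\<^esub>" using y in_Aut by blast
  show "z = ?y" if "z : carrier (Aut C) \<and> \<sigma> \<cdot> z = \<one>\<^bsub>Aut C\<^esub> \<and> z \<cdot> \<sigma> = \<one>\<^bsub>Aut C\<^esub>" for z
   using aut_cancel[of z ?y \<sigma>] that in_Aut[OF y(1)] in_Aut[OF x] y(2) by simp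
 qed
 then show "inv\<^bsub>Aut C\<^esub> \<sigma> = ?y" by (simp add: m_inv_def)
qed

lemma sm_germ:
 assumes s: "\<sigma> : carrier (Aut C)" and P: "P : Xs" and t: "sect (fst \<sigma> P) U t"
 shows "sm \<sigma> P (germ C (fst \<sigma> P) U t) = germ C P (preim C (fst \<sigma>) U) (snd \<sigma> U t)"
  "sect P (preim C (fst \<sigma>) U) (snd \<sigma> U t)"
proof -
 note S = sectD[OF t]
 show "sm \<sigma> P (germ C (fst \<sigma> P) U t) = germ C P (preim C (fst \<sigma>) U) (snd \<sigma> U t)"
  by (rule stalk_map_germ[where C' = C and U = U and t = t]) (simp_all add: S P s aut_open aut_in autD(7))
 show "sect P (preim C (fst \<sigma>) U) (snd \<sigma> U t)"
  using S P aut_open[OF s S(1)] aut_in[OF s S(1) S(3)] by (simp add: sect_def preim_def)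
qed

lemma sm_hom:
 assumes s: "\<sigma> : carrier (Aut C)" and P: "P : Xs"
 shows "sm \<sigma> P : ring_hom (stalk C (fst \<sigma> P)) (stalk C P)"
proof (rule ring_hom_memI)
 let ?Q = "fst \<sigma> P"
 show "sm \<sigma> P x : carrier (stalk C P)" if x: "x : carrier (stalk C ?Q)" for x
 proof -
  obtain U t where t: "sect ?Q U t" "x = germ C ?Q U t" using x stalk_carrier by blast
  show ?thesis using sm_germ[OF s P t(1)] germ_in t(2) by simp
 qed
 fix x y assume x: "x : carrier (stalk C ?Q)" and y: "y : carrier (stalk C ?Q)"
 obtain U a b c where ab: "sect ?Q U a" "sect ?Q U b" "x = germ C ?Q U a" "y = germ C ?Q U b"
  by (rule common_sections[OF x y y])
 note h = aut_hom[OF s sectD(1)[OF ab(1)]]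
 note g = sm_germ[OF s P ab(1)] sm_germ[OF s P ab(2)]
 show "sm \<sigma> P (x \<otimes>\<^bsub>stalk C ?Q\<^esub> y) = sm \<sigma> P x \<otimes>\<^bsub>stalk C P\<^esub> sm \<sigma> P y"
  using sm_germ(1)[OF s P sect_closed(1)[OF ab(1,2)]] ring_hom_mult[OF h sectD(3)[OF ab(1)] sectD(3)[OF ab(2)]]
  by (simp add: ab(3,4) germ_mult[OF ab(1,2)] g germ_mult)
 show "sm \<sigma> P (x \<oplus>\<^bsub>stalk C ?Q\<^esub> y) = sm \<sigma> P x \<oplus>\<^bsub>stalk C P\<^esub> sm \<sigma> P y"
  using sm_germ(1)[OF s P sect_closed(2)[OF ab(1,2)]] ring_hom_add[OF h sectD(3)[OF ab(1)] sectD(3)[OF ab(2)]]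
  by (simp add: ab(3,4) germ_add[OF ab(1,2)] g germ_add)
next
 have X: "fst \<sigma> P : Xs" "opn Xs" using aut_point[OF s P] by auto
 interpret X: cring "sec C Xs" by (rule sec_cring[OF X(2)])
 have 1: "sect (fst \<sigma> P) Xs \<one>\<^bsub>sec C Xs\<^esub>" using X by (simp add: sect_def)
 show "sm \<sigma> P \<one>\<^bsub>stalk C (fst \<sigma> P)\<^esub> = \<one>\<^bsub>stalk C P\<^esub>"
  unfolding germ_const(1)[OF X] sm_germ(1)[OF s P 1] ring_hom_one[OF aut_hom[OF s X(2)]]
  using germ_const(1)[OF sectD(2,1)[OF sm_germ(2)[OF s P 1]]] by simp
qed

lemma sm_comp:
 assumes s: "\<sigma> : carrier (Aut C)" "\<tau> : carrier (Aut C)" "\<sigma> \<cdot> \<tau> : carrier (Aut C)" and P: "P : Xs"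
  and A: "A : carrier (stalk C (fst \<sigma> (fst \<tau> P)))"
 shows "sm (\<sigma> \<cdot> \<tau>) P A = sm \<tau> P (sm \<sigma> (fst \<tau> P) A)"
proof -
 let ?Q = "fst \<sigma> (fst \<tau> P)"
 obtain U t where t: "sect ?Q U t" "A = germ C ?Q U t" using A stalk_carrier by blast
 have e: "fst (\<sigma> \<cdot> \<tau>) P = ?Q" by (rule aut_mult(1)[OF P])
 note 1 = sm_germ[OF s(1) aut_point[OF s(2) P] t(1)]
 note 2 = sm_germ[OF s(2) P 1(2)]
 have t': "sect (fst (\<sigma> \<cdot> \<tau>) P) U t" using t(1) e by simp
 show ?thesis using sm_germ(1)[OF s(3) P t'] 1 2 aut_mult(2)[OF sectD(1,3)[OF t(1)]] preim_mult[OF s(2)]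
  by (simp add: t(2) e)
qed

lemma sm_one: "\<one>\<^bsub>Aut C\<^esub> : carrier (Aut C) ==> P : Xs ==> A : carrier (stalk C P) ==> sm \<one>\<^bsub>Aut C\<^esub> P A = A"
proof -
 assume 1: "\<one>\<^bsub>Aut C\<^esub> : carrier (Aut C)" and P: "P : Xs" and "A : carrier (stalk C P)"
 then obtain U t where t: "sect P U t" "A = germ C P U t" using stalk_carrier by blast
 have t': "sect (fst \<one>\<^bsub>Aut C\<^esub> P) U t" using t(1) P by (simp add: aut_one)
 show ?thesis using sm_germ(1)[OF 1 P t'] P sectD(1,3)[OF t(1)] by (simp add: t(2) aut_one preim_one)
qed

lemma sm_scal: "\<sigma> : carrier (Aut C) ==> P : Xs ==> sm \<sigma> P (stalk_scal C (fst \<sigma> P) c) = stalk_scal C P c"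
proof -
 assume s: "\<sigma> : carrier (Aut C)" and P: "P : Xs"
 have X: "fst \<sigma> P : Xs" "opn Xs" using aut_point[OF s P] by auto
 have 1: "sect (fst \<sigma> P) Xs (scal C Xs c)" using X scal_in by (simp add: sect_def)
 show ?thesis unfolding germ_const(3)[OF X] sm_germ(1)[OF s P 1] autD(6)[OF s X(2)]
  using germ_const(3)[OF sectD(2,1)[OF sm_germ(2)[OF s P 1]]] by simp
qed

end

section \<open>Invariants of a finite group\<close>

text \<open>Besides local stalks, the only property of a projective scheme used for its quotients is
  that sections can be prescribed by residues at finitely many closed points.\<close>
locale space_action = presheaf C for C :: "('k::field, 'p, 's) rspace" +
 fixes G :: "('p, 's) morph set"
 assumes G: "subgroup G (Aut C)" and finG: "finite G"
  and local_stalks: "P : topspace (tspace C) ==> ideal (maxid C P) (stalk C P)"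
  and separation: "finite S ==> (\<And>Q. Q : S ==> closed_point C Q) ==> P : S ==> A : carrier (stalk C P) ==>
    \<exists>U t. openin (tspace C) U \<and> S <= U \<and> t : carrier (sec C U) \<and> germ C P U t \<ominus>\<^bsub>stalk C P\<^esub> A : maxid C P \<and>
     (\<forall>Q\<in>S - {P}. germ C Q U t : maxid C Q)"
begin

lemma G_Aut: "\<sigma> : G ==> \<sigma> : carrier (Aut C)"
 using subgroup.mem_carrier[OF G] .

lemmas G_mult = subgroup.m_closed[OF G] and G_one = subgroup.one_closed[OF G]

sublocale GG: group "(Aut C)\<lparr>carrier := G\<rparr>"
 by (rule finite_submonoid_group(1)[OF subgroup.subset[OF G] finG G_one G_mult])

context fixes P assumes P: "closed_point C P"
begin

lemma PX: "P : Xs" using P by (simp add: closed_point_def)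

lemma decompD: "\<sigma> : decomp G P ==> \<sigma> : G" "\<sigma> : decomp G P ==> \<sigma> : carrier (Aut C)" "\<sigma> : decomp G P ==> fst \<sigma> P = P"
 using G_Aut by (simp_all add: decomp_def)

lemma decomp_closed: "\<sigma> : decomp G P ==> \<tau> : decomp G P ==> \<sigma> \<cdot> \<tau> : decomp G P"
 "\<one>\<^bsub>Aut C\<^esub> : decomp G P"
 using G_mult G_one PX by (simp_all add: decomp_def aut_mult aut_one)

lemma decomp_finite: "finite (decomp G P)"
 by (rule finite_subset[OF _ finG]) (simp add: decomp_def Collect_conj_eq)

lemma decomp_sub: "decomp G P <= carrier (Aut C)"
 by (rule subsetI) (rule decompD(2))

lemma decomp_group: "group (decomp_grp C G P)"
 "\<sigma> : decomp G P ==> inv\<^bsub>Aut C\<^esub> \<sigma> = inv\<^bsub>decomp_grp C G P\<^esub> \<sigma>"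
 unfolding decomp_grp_def
 by (rule finite_submonoid_group[OF decomp_sub decomp_finite decomp_closed(2,1)]; assumption)+

lemma decomp_inv: "\<sigma> : decomp G P ==> inv\<^bsub>Aut C\<^esub> \<sigma> : decomp G P"
 using group.inv_closed[OF decomp_group(1), of \<sigma>] decomp_group(2) by (simp add: decomp_grp_def)

lemma act_def': "stalk_act C P \<sigma> = sm (inv\<^bsub>Aut C\<^esub> \<sigma>) P"
 by (simp add: stalk_act_def)

lemma act_hom: "\<sigma> : decomp G P ==> stalk_act C P \<sigma> : ring_hom (stalk C P) (stalk C P)"
 unfolding act_def' using sm_hom[OF decompD(2)[OF decomp_inv] PX] decompD(3)[OF decomp_inv] by simp

lemma act_mult:
 assumes s: "\<sigma> : decomp G P" and t: "\<tau> : decomp G P" and A: "A : carrier (stalk C P)"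
 shows "stalk_act C P (\<sigma> \<cdot> \<tau>) A = stalk_act C P \<sigma> (stalk_act C P \<tau> A)"
proof -
 have "inv\<^bsub>Aut C\<^esub> (\<sigma> \<cdot> \<tau>) = inv\<^bsub>Aut C\<^esub> \<tau> \<cdot> inv\<^bsub>Aut C\<^esub> \<sigma>"
  using group.inv_mult_group[OF decomp_group(1), of \<sigma> \<tau>] s t decomp_group(2) decomp_closed(1)[OF s t]
  by (simp add: decomp_grp_def)
 note i = this decomp_inv[OF s] decomp_inv[OF t]
 show ?thesis
  unfolding act_def' i(1)
  using sm_comp[OF decompD(2)[OF i(3)] decompD(2)[OF i(2)] decompD(2)[OF decomp_closed(1)[OF i(3,2)]] PX, of A] A
   decompD(3)[OF i(2)] decompD(3)[OF i(3)] by simp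
qed

lemma act_one: "A : carrier (stalk C P) ==> stalk_act C P \<one>\<^bsub>Aut C\<^esub> A = A"
proof -
 assume A: "A : carrier (stalk C P)"
 have "inv\<^bsub>Aut C\<^esub> \<one>\<^bsub>Aut C\<^esub> = \<one>\<^bsub>Aut C\<^esub>"
  using group.is_monoid[OF decomp_group(1), THEN monoid.inv_one] decomp_group(2)[OF decomp_closed(2)] by (simp add: decomp_grp_def)
 then show ?thesis unfolding act_def' using sm_one[OF decompD(2)[OF decomp_closed(2)] PX A] by simp
qed

lemma act_scal: "\<sigma> : decomp G P ==> stalk_act C P \<sigma> (stalk_scal C P c) = stalk_scal C P c"
 unfolding act_def' using sm_scal[OF decompD(2)[OF decomp_inv] PX] decompD(3)[OF decomp_inv] by metis

end

lemma orbit_eq: "\<sigma> : G ==> Q : Xs ==> orbit_of G (fst \<sigma> Q) = orbit_of G Q"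
proof -
 assume s: "\<sigma> : G" and Q: "Q : Xs"
 have 1: "orbit_of G (fst \<tau> Z) <= orbit_of G Z" if "\<tau> : G" "Z : Xs" for \<tau> Z
  unfolding orbit_of_def
 proof (rule image_subsetI)
  fix \<rho> assume r: "\<rho> : G"
  show "fst \<rho> (fst \<tau> Z) : (\<lambda>\<sigma>. fst \<sigma> Z) ` G"
   by (rule image_eqI[of _ _ "\<rho> \<cdot> \<tau>"]) (use aut_mult(1)[OF that(2)] G_mult[OF r that(1)] in simp_all)
 qed
 let ?i = "inv\<^bsub>(Aut C)\<lparr>carrier := G\<rparr>\<^esub> \<sigma>"
 have i: "?i : G" "?i \<cdot> \<sigma> = \<one>\<^bsub>Aut C\<^esub>"
  using GG.inv_closed[of \<sigma>] GG.l_inv[of \<sigma>] s by simp_all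
 have "fst ?i (fst \<sigma> Q) = Q" using aut_mult(1)[OF Q, of ?i \<sigma>] i(2) aut_one(1)[OF Q] by simp
 then have "orbit_of G Q <= orbit_of G (fst \<sigma> Q)" using 1[OF i(1) aut_point[OF G_Aut[OF s] Q]] by simp
 then show ?thesis using 1[OF s Q] by blast
qed

lemma in_orbit: "Q : Xs ==> Q : orbit_of G Q"
 unfolding orbit_of_def using aut_one(1) G_one by (intro image_eqI[of _ _ "\<one>\<^bsub>Aut C\<^esub>"]) simp_all

lemma stable_preim: "\<sigma> : G ==> preim C (fst \<sigma>) (preim C (orbit_of G) V) = preim C (orbit_of G) V"
 using orbit_eq aut_point[OF G_Aut] unfolding preim_def by (simp cong: conj_cong)

text \<open>The intersection of the conjugates of U.\<close>
lemma stable_open: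
 assumes U: "opn U" "orbit_of G P <= U" and P: "P : Xs"
 obtains V where "openin (quot_top C G) V" "orbit_of G P : V" "preim C (orbit_of G) V <= U"
proof -
 define U1 where "U1 = \<Inter> ((\<lambda>\<sigma>. preim C (fst \<sigma>) U) ` G)"
 have U1o: "opn U1"
  unfolding U1_def by (rule openin_Inter) (use finG G_one aut_open[OF G_Aut U(1)] in "auto simp only: finite_imageI image_is_empty empty_iff image_iff")
 have el: "Q : U1 \<longleftrightarrow> Q : Xs \<and> orbit_of G Q <= U" for Q
 proof
  assume Q: "Q : U1"
  have "Q : preim C (fst \<sigma>) U" if "\<sigma> : G" for \<sigma> using Q that unfolding U1_def by simp
  then show "Q : Xs \<and> orbit_of G Q <= U" using G_one unfolding preim_def orbit_of_def by auto
 next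
  assume "Q : Xs \<and> orbit_of G Q <= U"
  then show "Q : U1" unfolding U1_def preim_def orbit_of_def by auto
 qed
 define V where "V = orbit_of G ` U1"
 have pV: "preim C (orbit_of G) V = U1"
 proof (intro equalityI subsetI)
  fix Q assume "Q : preim C (orbit_of G) V"
  then obtain Q' where "Q : Xs" "Q' : U1" "orbit_of G Q = orbit_of G Q'" unfolding preim_def V_def by auto
  then show "Q : U1" using el by simp
 next
  fix Q assume "Q : U1"
  then show "Q : preim C (orbit_of G) V" using el unfolding preim_def V_def by blast
 qed
 show thesis
 proof (rule that[of V])
  show "openin (quot_top C G) V" unfolding openin_quot_top pV using U1o openin_subset[OF U1o] by (auto simp: V_def)
  show "orbit_of G P : V" unfolding V_def by (rule imageI) (simp add: el P U)
  show "preim C (orbit_of G) V <= U" unfolding pV using el in_orbit by blast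
 qed
qed

lemma sm_maxid:
 assumes s: "\<sigma> : G" and P: "P : Xs" and A: "A : maxid C (fst \<sigma> P)"
 shows "sm \<sigma> P A : maxid C P"
proof -
 let ?Q = "fst \<sigma> P" and ?i = "inv\<^bsub>(Aut C)\<lparr>carrier := G\<rparr>\<^esub> \<sigma>"
 have i: "?i : G" "\<sigma> \<cdot> ?i = \<one>\<^bsub>Aut C\<^esub>" "?i \<cdot> \<sigma> = \<one>\<^bsub>Aut C\<^esub>"
  using GG.inv_closed[of \<sigma>] GG.l_inv[of \<sigma>] GG.r_inv[of \<sigma>] s by simp_all
 have Q: "?Q : Xs" by (rule aut_point[OF G_Aut[OF s] P])
 have iQ: "fst ?i ?Q = P" using aut_mult(1)[OF P, of ?i \<sigma>] i(3) aut_one(1)[OF P] by simp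
 have AR: "A : carrier (stalk C ?Q)" "A \<notin> Units (stalk C ?Q)" using A by (simp_all add: maxid_def)
 note h = sm_hom[OF G_Aut[OF s] P]
 have h': "sm ?i ?Q : ring_hom (stalk C P) (stalk C ?Q)" using sm_hom[OF G_Aut[OF i(1)] Q] iQ by simp
 have round: "sm ?i ?Q (sm \<sigma> P A) = A"
 proof -
  have A': "A : carrier (stalk C (fst \<sigma> (fst ?i ?Q)))" using AR(1) iQ by simp
  have c: "\<sigma> \<cdot> ?i : carrier (Aut C)" using G_Aut[OF G_one] i(2) by simp
  note sm_comp[OF G_Aut[OF s] G_Aut[OF i(1)] c Q A']
  then show ?thesis using i(2) iQ sm_one[OF G_Aut[OF G_one] Q AR(1)] by simp
 qed
 interpret P: cring "stalk C P" by (rule stalk_cring[OF P])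
 interpret Q: cring "stalk C ?Q" by (rule stalk_cring[OF Q])
 have "sm \<sigma> P A \<notin> Units (stalk C P)"
 proof
  assume u: "sm \<sigma> P A : Units (stalk C P)"
  let ?B = "inv\<^bsub>stalk C P\<^esub> (sm \<sigma> P A)"
  have B: "?B : carrier (stalk C P)" using u by simp
  have e: "A \<otimes>\<^bsub>stalk C ?Q\<^esub> sm ?i ?Q ?B = \<one>\<^bsub>stalk C ?Q\<^esub>"
   using ring_hom_mult[OF h' _ B, of "sm \<sigma> P A"] ring_hom_closed[OF h AR(1)] round ring_hom_one[OF h'] u by simp
  have B': "sm ?i ?Q ?B : carrier (stalk C ?Q)" by (rule ring_hom_closed[OF h' B])
  have "A : Units (stalk C ?Q)"
   unfolding Units_def by (rule CollectI) (use e B' AR(1) Q.m_comm[OF AR(1) B'] in \<open>intro conjI bexI[of _ "sm ?i ?Q ?B"], simp_all\<close>)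
  then show False using AR(2) by simp
 qed
 then show ?thesis using ring_hom_closed[OF h AR(1)] by (simp add: maxid_def)
qed

lemma closed_orbit: "closed_point C P ==> \<sigma> : G ==> closed_point C (fst \<sigma> P)"
 using homeomorphic_map_closedness_eq[OF autD(2)[OF G_Aut], of \<sigma> "{P}"] aut_point[OF G_Aut]
 by (auto simp: closed_point_def)

end

context space_action begin

lemma point_action_at:
 assumes P: "closed_point C P"
 shows "point_action C G P"
 by (rule point_action.intro)
  (use stalk_poly_eval[OF PX[OF P]] local_stalks[OF PX[OF P]] decomp_group[OF P] decomp_finite[OF P]
    act_hom[OF P] act_mult[OF P] act_one[OF P] act_scal[OF P] in "simp_all")

lemma quot_stalk_map:
 assumes V: "openin (quot_top C G) V" "orbit_of G P : V" and P: "P : Xs"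
  and t: "t : Sec (preim C (orbit_of G) V)" "\<And>\<sigma>. \<sigma> : G ==> snd \<sigma> (preim C (orbit_of G) V) t = t"
 shows "stalk_map C P (orbit_of G) (\<lambda>U s. s) (germ (quot_space C G) (orbit_of G P) V t) = germ C P (preim C (orbit_of G) V) t"
proof (rule stalk_map_germ[where C' = "quot_space C G"])
 show "opn (preim C (orbit_of G) U)" if "openin (tspace (quot_space C G)) U" for U
  using that by (simp add: quot_space_def openin_quot_top)
 show "openin (tspace (quot_space C G)) V" "t : carrier (sec (quot_space C G) V)" using V t by (simp_all add: quot_space_def)
qed (use V P in "simp_all add: quot_space_def")

lemma quot_stalk:
 assumes P: "P : Xs"
 shows "A : carrier (stalk (quot_space C G) (orbit_of G P)) \<longleftrightarrow> (\<exists>V t. openin (quot_top C G) V \<and> orbit_of G P : V \<and>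
  t : Sec (preim C (orbit_of G) V) \<and> (\<forall>\<sigma>\<in>G. snd \<sigma> (preim C (orbit_of G) V) t = t) \<and>
  A = germ (quot_space C G) (orbit_of G P) V t)"
proof -
 have "tspace (quot_space C G) = quot_top C G" "carrier (sec (quot_space C G) V) = {t : Sec (preim C (orbit_of G) V).
   \<forall>\<sigma>\<in>G. snd \<sigma> (preim C (orbit_of G) V) t = t}" for V
  by (simp_all add: quot_space_def)
 then show ?thesis
  unfolding stalk_def partial_object.simps mem_Collect_eq by (simp only: mem_Collect_eq conj_ac)
qed

lemma invariant_germ:
 assumes P: "closed_point C P" and g: "g : decomp G P" and U: "opn U" "P : U" "preim C (fst (inv\<^bsub>Aut C\<^esub> g)) U = U"
  and t: "t : Sec U" "snd (inv\<^bsub>Aut C\<^esub> g) U t = t"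
 shows "stalk_act C P g (germ C P U t) = germ C P U t"
proof -
 note i = decomp_inv[OF P g]
 have "sect (fst (inv\<^bsub>Aut C\<^esub> g) P) U t" using U t decompD(3)[OF P i] by (simp add: sect_def)
 from sm_germ(1)[OF decompD(2)[OF P i] PX[OF P] this] show ?thesis
  unfolding act_def'[OF P] using decompD(3)[OF P i] U(3) t(2) by simp
qed

text \<open>Residues of invariant sections are fixed by the stabiliser. Conversely, for a fixed a
  take a section with residue a c at P that vanishes on the rest of the orbit, and sum its
  conjugates. At P only the conjugates by the stabiliser contribute, and they add up to a times the
  trace of c.\<close>
lemma base_resfield_eq:
 assumes P: "closed_point C P" and c: "c : carrier (resfield C P)"
  and tr: "(\<Oplus>\<^bsub>resfield C P\<^esub>g\<in>decomp G P. coset_act C P g c) = \<one>\<^bsub>resfield C P\<^esub>"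
 shows "base_resfield C G P = {a : carrier (resfield C P). \<forall>g\<in>decomp G P. coset_act C P g a = a}"
proof (intro equalityI subsetI)
 interpret PA: point_action C G P by (rule point_action_at[OF P])
 note PX = PX[OF P]
 have red: "reduct C P x = PA.pi x" for x by (simp add: reduct_def PA.pi_def)
 {
  fix x assume "x : base_resfield C G P"
  then obtain A where A: "A : carrier (stalk (quot_space C G) (orbit_of G P))"
   "x = PA.pi (stalk_map C P (orbit_of G) (\<lambda>U s. s) A)" unfolding base_resfield_def red by (rule imageE)
  obtain V t where V: "openin (quot_top C G) V" "orbit_of G P : V" and t: "t : Sec (preim C (orbit_of G) V)"
   "\<forall>\<sigma>\<in>G. snd \<sigma> (preim C (orbit_of G) V) t = t" "A = germ (quot_space C G) (orbit_of G P) V t"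
   using A(1) unfolding quot_stalk[OF PX] by (elim exE conjE) (rule that, assumption+)
  let ?U = "preim C (orbit_of G) V"
  have U: "opn ?U" "P : ?U" using V PX by (auto simp: openin_quot_top preim_def)
  have s: "sect P ?U t" using U t by (simp add: sect_def)
  have x: "x = PA.pi (germ C P ?U t)" using A(2) t(3) quot_stalk_map[OF V PX t(1)] t(2) by simp
  have "coset_act C P g x = x" if g: "g : decomp G P" for g
  proof -
   have i: "inv\<^bsub>Aut C\<^esub> g : G" by (rule decompD(1)[OF P decomp_inv[OF P g]])
   have "stalk_act C P g (germ C P ?U t) = germ C P ?U t"
    by (rule invariant_germ[OF P g U stable_preim[OF i] t(1)]) (use t(2) i in simp)
   then show ?thesis using PA.s_pi[OF g germ_in[OF s]] x by simp
  qed
  then show "x : {a : carrier (resfield C P). \<forall>g\<in>decomp G P. coset_act C P g a = a}"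
   using x PA.pi_in[OF germ_in[OF s]] by simp
 }
 {
  fix a assume "a : {a : carrier (resfield C P). \<forall>g\<in>decomp G P. coset_act C P g a = a}"
  then have a: "a : carrier (resfield C P)" "\<And>g. g : decomp G P ==> coset_act C P g a = a" by simp_all
  have "a \<otimes>\<^bsub>resfield C P\<^esub> c : carrier (resfield C P)" using a(1) c by simp
  then obtain b where b: "b : carrier (stalk C P)" "a \<otimes>\<^bsub>resfield C P\<^esub> c = PA.pi b" using PA.pi_K by blast
  let ?S = "orbit_of G P"
  have S: "finite ?S" "P : ?S" using finG in_orbit[OF PX] by (simp_all add: orbit_of_def)
  have Sc: "closed_point C Q" if Q: "Q : ?S" for Q
   using Q closed_orbit[OF P] unfolding orbit_of_def by (elim imageE) simp
  obtain U0 t0 where U0: "opn U0" "?S <= U0" and t0: "t0 : Sec U0"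
   "germ C P U0 t0 \<ominus>\<^bsub>stalk C P\<^esub> b : maxid C P" "\<forall>Q\<in>?S - {P}. germ C Q U0 t0 : maxid C Q"
   using separation[OF S(1) Sc S(2) b(1), simplified] by (elim exE conjE) (rule that, assumption+)
  obtain V where V: "openin (quot_top C G) V" "?S : V" "preim C (orbit_of G) V <= U0"
   by (rule stable_open[OF U0 PX]) (rule that, assumption+)
  define U where "U = preim C (orbit_of G) V"
  have U: "opn U" "U <= U0" using V by (auto simp: openin_quot_top U_def)
  have SU: "Q : U" if Q: "Q : ?S" for Q
  proof -
   obtain \<sigma> where s: "Q = fst \<sigma> P" "\<sigma> : G" using Q unfolding orbit_of_def by (rule imageE)
   then show ?thesis using orbit_eq[OF s(2) PX] V(2) aut_point[OF G_Aut[OF s(2)] PX] by (simp add: U_def preim_def)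
  qed
  have st: "preim C (fst \<sigma>) U = U" if "\<sigma> : G" for \<sigma> unfolding U_def by (rule stable_preim[OF that])
  define t1 where "t1 = res C U0 U t0"
  have t1: "t1 : Sec U" unfolding t1_def by (rule res_in[OF U0(1) U t0(1)])
  have g1: "germ C Q U t1 = germ C Q U0 t0" if Q: "Q : ?S" for Q
   unfolding t1_def by (rule germ_res[OF _ U(1) SU[OF Q] U(2)]) (use U0 t0(1) Q in "auto simp: sect_def")
  interpret U: cring "sec C U" by (rule sec_cring[OF U(1)])
  have hom: "snd \<sigma> U : ring_hom (sec C U) (sec C U)" if "\<sigma> : G" for \<sigma>
   using aut_hom[OF G_Aut[OF that] U(1)] st[OF that] by simp
  have cl: "snd \<sigma> U x : Sec U" if "\<sigma> : G" "x : Sec U" for \<sigma> x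
   using ring_hom_closed[OF hom[OF that(1)] that(2)] .
  define t where "t = (\<Oplus>\<^bsub>sec C U\<^esub>\<sigma>\<in>G. snd \<sigma> U t1)"
  have f1: "(\<lambda>\<sigma>. snd \<sigma> U t1) : G \<rightarrow> Sec U" by (rule funcsetI) (rule cl[OF _ t1])
  have tU: "t : Sec U" unfolding t_def by (rule U.finsum_closed[OF f1])
  have inv: "snd \<tau> U t = t" if tau: "\<tau> : G" for \<tau>
  proof -
   interpret h: ring_hom_cring "sec C U" "sec C U" "snd \<tau> U"
    by (intro ring_hom_cring.intro U.is_cring ring_hom_cring_axioms.intro hom[OF tau])
   have inj: "inj_on (\<lambda>\<sigma>. \<sigma> \<cdot> \<tau>) G"
    by (rule inj_onI) (rule aut_cancel[OF G_Aut G_Aut G_Aut[OF tau]])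
   have im: "(\<lambda>\<sigma>. \<sigma> \<cdot> \<tau>) ` G = G"
    by (rule endo_inj_surj[OF finG _ inj]) (rule image_subsetI, rule G_mult[OF _ tau])
   have "snd \<tau> U t = (\<Oplus>\<^bsub>sec C U\<^esub>\<sigma>\<in>G. snd \<tau> U (snd \<sigma> U t1))"
    unfolding t_def using h.hom_finsum[OF f1] by (simp add: comp_def)
   also have "\<dots> = (\<Oplus>\<^bsub>sec C U\<^esub>\<sigma>\<in>G. snd (\<sigma> \<cdot> \<tau>) U t1)"
    by (rule U.finsum_cong') (use aut_mult(2)[OF U(1) t1] st cl[OF G_mult[OF _ tau] t1] in auto)
   also have "\<dots> = (\<Oplus>\<^bsub>sec C U\<^esub>\<sigma>\<in>(\<lambda>\<sigma>. \<sigma> \<cdot> \<tau>) ` G. snd \<sigma> U t1)"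
    by (rule U.finsum_reindex[symmetric, OF _ inj]) (use im f1 in simp)
   finally show ?thesis unfolding im t_def .
  qed
  have PU: "P : U" by (rule SU[OF S(2)])
  define A where "A = germ (quot_space C G) ?S V t"
  have "A : carrier (stalk (quot_space C G) ?S)"
   unfolding quot_stalk[OF PX] A_def by (intro exI[of _ V] exI[of _ t]) (use V tU inv in "simp add: U_def")
  moreover have "stalk_map C P (orbit_of G) (\<lambda>U s. s) A = germ C P U t"
   unfolding A_def U_def by (rule quot_stalk_map[OF V(1,2) PX]) (use tU inv in "simp_all add: U_def")
  moreover have "PA.pi (germ C P U t) = a"
  proof -
   define h where "h x = PA.pi (germ C P U x)" for x
   have "(\<lambda>x. PA.pi x) : ring_hom (stalk C P) (resfield C P)" by (rule ring_hom_memI) simp_all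
   then have hh: "h : ring_hom (sec C U) (resfield C P)"
    using ring_hom_trans[OF germ_ring_hom[OF U(1) PU]] unfolding h_def comp_def by blast
   interpret h: ring_hom_cring "sec C U" "resfield C P" h
    by (intro ring_hom_cring.intro U.is_cring ring_hom_cring_axioms.intro hh PA.K.is_cring)
   (* A conjugate by an element moving P is evaluated at another point of the orbit, where the
      section vanishes. *)
   have val: "h (snd \<sigma> U t1) = (if \<sigma> : decomp G P then a \<otimes>\<^bsub>resfield C P\<^esub> coset_act C P (inv\<^bsub>decomp_grp C G P\<^esub> \<sigma>) c else \<zero>\<^bsub>resfield C P\<^esub>)"
    if s: "\<sigma> : G" for \<sigma>
   proof -
    have QS: "fst \<sigma> P : ?S" unfolding orbit_of_def by (rule imageI[OF s])
    have sc: "sect (fst \<sigma> P) U t1" using U(1) t1 SU[OF QS] by (simp add: sect_def)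
    have g: "germ C P U (snd \<sigma> U t1) = sm \<sigma> P (germ C (fst \<sigma> P) U t1)"
     using sm_germ(1)[OF G_Aut[OF s] PX sc] st[OF s] by simp
    show ?thesis
    proof (cases "\<sigma> : decomp G P")
     case True
     note i = decomp_inv[OF P True] and d = decomp_group(2)[OF P True]
     have ii: "inv\<^bsub>Aut C\<^esub> (inv\<^bsub>Aut C\<^esub> \<sigma>) = \<sigma>"
      using PA.Gm.inv_inv[of \<sigma>] True d decomp_group(2)[OF P i] by simp
     have e: "germ C P U (snd \<sigma> U t1) = stalk_act C P (inv\<^bsub>Aut C\<^esub> \<sigma>) (germ C P U0 t0)"
      using g g1[OF S(2)] decompD(3)[OF P True] ii by (simp add: act_def'[OF P])
     have gR: "germ C P U0 t0 : carrier (stalk C P)"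
      by (rule germ_in) (use U0 S(2) t0(1) in "auto simp: sect_def")
     have "h (snd \<sigma> U t1) = coset_act C P (inv\<^bsub>Aut C\<^esub> \<sigma>) (a \<otimes>\<^bsub>resfield C P\<^esub> c)"
      unfolding h_def e using PA.s_pi[OF i gR] PA.pi_eq[OF gR b(1)] t0(2) b(2) by simp
     then show ?thesis using PA.FA.s_m[of "inv\<^bsub>Aut C\<^esub> \<sigma>" a c] i a c True d by simp
    next
     case False
     have ne: "fst \<sigma> P \<noteq> P" using False s by (simp add: decomp_def)
     have "germ C P U (snd \<sigma> U t1) : maxid C P"
      unfolding g by (rule sm_maxid[OF s PX]) (use t0(3) QS ne g1[OF QS] in simp)
     then show ?thesis using False PA.pi_0[OF PA.L.m_in] by (simp add: h_def)
    qed
   qed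
   have ac: "(\<lambda>\<sigma>. a \<otimes>\<^bsub>resfield C P\<^esub> coset_act C P (inv\<^bsub>decomp_grp C G P\<^esub> \<sigma>) c) : decomp G P \<rightarrow> carrier (resfield C P)"
    using a(1) c PA.al_inv(3) by simp
   have "h t = (\<Oplus>\<^bsub>resfield C P\<^esub>\<sigma>\<in>G. h (snd \<sigma> U t1))"
    unfolding t_def using h.hom_finsum[OF f1] by (simp add: comp_def)
   also have "\<dots> = (\<Oplus>\<^bsub>resfield C P\<^esub>\<sigma>\<in>decomp G P. a \<otimes>\<^bsub>resfield C P\<^esub> coset_act C P (inv\<^bsub>decomp_grp C G P\<^esub> \<sigma>) c)"
    by (rule PA.K.add.finprod_mono_neutral_cong_right[OF finG])
     (use val decompD(1)[OF P] ac in "auto simp: Pi_iff subset_iff")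
   also have "\<dots> = a \<otimes>\<^bsub>resfield C P\<^esub> (\<Oplus>\<^bsub>resfield C P\<^esub>\<sigma>\<in>decomp G P. coset_act C P (inv\<^bsub>decomp_grp C G P\<^esub> \<sigma>) c)"
    by (rule PA.K.finsum_rdistr[symmetric]) (use PA.finD a(1) c PA.al_inv(3) in simp_all)
   also have "\<dots> = a \<otimes>\<^bsub>resfield C P\<^esub> (\<Oplus>\<^bsub>resfield C P\<^esub>\<sigma>\<in>decomp G P. coset_act C P \<sigma> c)"
    using PA.FA.finsum_inv[of "\<lambda>\<sigma>. coset_act C P \<sigma> c"] c by simp
   finally show ?thesis using tr a(1) by (simp add: h_def)
  qed
  ultimately show "a : base_resfield C G P" unfolding base_resfield_def red by (metis image_eqI)
 }
qed

lemma tame_point_at: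
 assumes P: "closed_point C P" and tame: "tamely_ramified C G" and smooth: "smooth_dim1 C"
  and perf: "perfect_field TYPE('k)"
 shows "tame_point C G P"
proof (intro tame_point.intro tame_point_axioms.intro)
 show "point_action C G P" by (rule point_action_at[OF P])
 show "ram_group C G P 1 = {\<one>\<^bsub>Aut C\<^esub>}" using tame P by (simp add: tamely_ramified_def)
 show "coprime f (pderiv f)" if "Factorial_Ring.irreducible f" for f :: "'k poly" using perf that by (simp add: perfect_field_def)
 show "\<exists>D0\<in>derivations C P. \<forall>D\<in>derivations C P. \<exists>c\<in>carrier (resfield C P).
     \<forall>a\<in>carrier (stalk C P). D a = c \<otimes>\<^bsub>resfield C P\<^esub> D0 a"
  using smooth PX[OF P] unfolding smooth_dim1_def by meson
qed (rule base_resfield_eq[OF P])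

end

section \<open>Ideals of a ring type\<close>

lemma type_ring_simps [simp]:
 "carrier (ring_of_type_algebra :: 'a::comm_ring_1 ring) = UNIV" "a \<otimes>\<^bsub>(ring_of_type_algebra :: 'a ring)\<^esub> b = a * b"
 "a \<oplus>\<^bsub>(ring_of_type_algebra :: 'a ring)\<^esub> b = a + b" "\<one>\<^bsub>(ring_of_type_algebra :: 'a ring)\<^esub> = 1" "\<zero>\<^bsub>(ring_of_type_algebra :: 'a ring)\<^esub> = 0"
 by (simp_all add: ring_of_type_algebra_def)

lemma type_idealD:
 fixes J :: "'a::comm_ring_1 set"
 assumes J: "ideal J ring_of_type_algebra"
 shows "0 : J" "a : J ==> b : J ==> a + b : J" "a : J ==> r * a : J" "a : J ==> a * r : J"
  "a : J ==> - a : J" "a : J ==> b : J ==> a - b : J"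
proof -
 note s = ideal.axioms(1)[OF J]
 show 0: "0 : J" using additive_subgroup.zero_closed[OF s] by simp
 show add: "a : J ==> b : J ==> a + b : J" for a b using additive_subgroup.a_closed[OF s, of a b] by simp
 show l: "a : J ==> r * a : J" for a r using ideal.I_l_closed[OF J, of a r] by simp
 then show "a : J ==> a * r : J" by (simp add: mult.commute)
 show neg: "a : J ==> - a : J" for a using l[of a "- 1"] by simp
 show "a : J ==> b : J ==> a - b : J" using add[of a "- b"] neg by simp
qed

lemma type_primeD:
 fixes J :: "'a::comm_ring_1 set"
 assumes J: "primeideal J ring_of_type_algebra"
 shows "ideal J ring_of_type_algebra" "1 \<notin> J" "a * b : J \<longleftrightarrow> a : J \<or> b : J"
proof -
 show i: "ideal J ring_of_type_algebra" by (rule primeideal.axioms(1)[OF J])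
 show "1 \<notin> J" using primeideal.I_notcarr[OF J] type_idealD(3)[OF i, of 1] by auto
 show "a * b : J \<longleftrightarrow> a : J \<or> b : J" using primeideal.I_prime[OF J, of a b] type_idealD(3,4)[OF i] by auto
qed

section \<open>Homogeneous polynomials\<close>

lemma homog_0 [simp]: "homog d 0" and homog_1 [simp]: "homog 0 1" and homog_mconst [simp]: "homog 0 (mconst c)"
 and homog_mvar: "homog 1 (mvar i)"
 by (auto simp: homog_def mconst_def mvar_def lookup_single when_def single_one[symmetric] simp del: single_one split: if_splits)

lemma mconst_add: "mconst (c + e) = mconst c + mconst e" and mconst_mult: "mconst (c * e) = mconst c * mconst e"
 by (simp_all add: mconst_def single_add mult_single)

lemma homog_add: "homog d f ==> homog d g ==> homog d (f + g)"
 unfolding homog_def using Poly_Mapping.keys_add[of f g] by blast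

lemma homog_uminus: "homog d f ==> homog d (- f)"
 by (simp add: homog_def)

lemma homog_diff: "homog d f ==> homog d g ==> homog d (f - g)"
 using homog_add[of d f "- g"] homog_uminus[of d g] by simp

lemma homog_mult:
 assumes "homog d f" "homog e g" shows "homog (d + e) (f * g)"
 unfolding homog_def
proof
 fix m assume "m : Poly_Mapping.keys (f * g)"
 then obtain a b where ab: "a : Poly_Mapping.keys f" "b : Poly_Mapping.keys g" "m = a + b" using keys_mult[of f g] by blast
 then have "(\<Sum>i\<in>UNIV. Poly_Mapping.lookup a i) = d" "(\<Sum>i\<in>UNIV. Poly_Mapping.lookup b i) = e" using assms by (auto simp: homog_def)
 then show "(\<Sum>i\<in>UNIV. Poly_Mapping.lookup m i) = d + e" by (simp add: ab(3) lookup_add sum.distrib)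
qed

lemma homog_power: "homog d f ==> homog (n * d) (f ^ n)"
 by (induction n) (auto intro: homog_mult)

lemma homog_sum: "(\<And>i. i : A ==> homog d (f i)) ==> homog d (\<Sum>i\<in>A. f i)"
 by (induction A rule: infinite_finite_induct) (auto intro: homog_add)

definition hpair where "hpair a f \<longleftrightarrow> (\<exists>d. homog d a \<and> homog d f)"

lemma hpair_ops: "hpair a f ==> hpair b g ==> hpair (a * b) (f * g)"
 "hpair a f ==> hpair b g ==> hpair (a * g + b * f) (f * g)"
 "hpair a f ==> hpair (- a) f" "hpair a f ==> hpair f a" "hpair 1 1" "hpair 0 1" "hpair (mconst c) 1"
proof -
 assume 1: "hpair a f"
 then obtain d where d: "homog d a" "homog d f" by (auto simp: hpair_def)
 show "hpair (- a) f" "hpair f a" using d homog_uminus by (auto simp: hpair_def)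
 assume "hpair b g"
 then obtain e where e: "homog e b" "homog e g" by (auto simp: hpair_def)
 have "homog (d + e) (a * g)" "homog (d + e) (b * f)" using homog_mult[OF d(1) e(2)] homog_mult[OF d(2) e(1)] by (simp_all add: mult.commute)
 then show "hpair (a * b) (f * g)" "hpair (a * g + b * f) (f * g)" using homog_mult[OF d(1) e(1)] homog_mult[OF d(2) e(2)] homog_add by (auto simp: hpair_def)
qed (auto simp: hpair_def intro: homog_0 homog_1 homog_mconst)

section \<open>The homogeneous localisation\<close>

locale proj =
 fixes I :: "('k::field, 'n::finite) mpoly set"
 assumes I: "ideal I polyring"
begin

definition hrel where "hrel p a f b g \<longleftrightarrow> (\<exists>h e. homog e h \<and> h \<notin> p \<and> h * (a * g - b * f) : I)"

lemma hfrac_def': "hfrac I p a f = {(b, g). hpair b g \<and> g \<notin> p \<and> hrel p a f b g}"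
 by (simp add: hfrac_def hpair_def hrel_def)

lemmas ID = type_idealD[OF I]

definition valid where "valid p a f \<longleftrightarrow> hpair a f \<and> f \<notin> p"

context fixes p assumes p: "p : proj_points I"
begin

lemma p_prime: "primeideal p polyring" and Ip: "I <= p" using p by (auto simp: proj_points_def)

lemmas pD = type_idealD[OF type_primeD(1)[OF p_prime]] and p1 = type_primeD(2)[OF p_prime] and pm = type_primeD(3)[OF p_prime]

lemma valid_ops: "valid p a f ==> valid p b g ==> valid p (a * b) (f * g)" "valid p a f ==> valid p b g ==> valid p (a * g + b * f) (f * g)"
 "valid p a f ==> valid p (- a) f" "valid p 1 1" "valid p 0 1" "valid p (mconst c) 1"
 by (auto simp: valid_def hpair_ops pm p1)

lemma hrelI: "a * g = b * f ==> hrel p a f b g"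
 unfolding hrel_def by (intro exI[of _ 1] exI[of _ 0]) (simp add: p1 ID(1))

lemma hrel_sym: "hrel p a f b g ==> hrel p b g a f"
proof -
 assume "hrel p a f b g"
 then obtain h e where h: "homog e h" "h \<notin> p" "h * (a * g - b * f) : I" unfolding hrel_def by blast
 have "h * (b * f - a * g) = - (h * (a * g - b * f))" by (simp add: algebra_simps)
 then show ?thesis using ID(5)[OF h(3)] h(1,2) unfolding hrel_def by metis
qed

lemma hrel_trans:
 assumes g: "valid p b g" and 1: "hrel p a f b g" and 2: "hrel p b g c k" shows "hrel p a f c k"
proof -
 obtain h e where h: "homog e h" "h \<notin> p" "h * (a * g - b * f) : I" using 1 unfolding hrel_def by blast
 obtain h' e' where h': "homog e' h'" "h' \<notin> p" "h' * (b * k - c * g) : I" using 2 unfolding hrel_def by blast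
 obtain d where d: "homog d g" "g \<notin> p" using g by (auto simp: valid_def hpair_def)
 have "(h * h' * g) * (a * k - c * f) = (h' * k) * (h * (a * g - b * f)) + (h * f) * (h' * (b * k - c * g))" by (simp add: algebra_simps)
 then have "(h * h' * g) * (a * k - c * f) : I" using ID(2)[OF ID(3)[OF h(3)] ID(3)[OF h'(3)]] by simp
 then show ?thesis unfolding hrel_def using homog_mult[OF homog_mult[OF h(1) h'(1)] d(1)] h(2) h'(2) d(2) pm by blast
qed

lemma hrel_mult:
 assumes 1: "hrel p a f a' f'" and 2: "hrel p b g b' g'"
 shows "hrel p (a * b) (f * g) (a' * b') (f' * g')" "hrel p (a * g + b * f) (f * g) (a' * g' + b' * f') (f' * g')"
proof -
 obtain h e where h: "homog e h" "h \<notin> p" "h * (a * f' - a' * f) : I" using 1 unfolding hrel_def by blast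
 obtain k e' where k: "homog e' k" "k \<notin> p" "k * (b * g' - b' * g) : I" using 2 unfolding hrel_def by blast
 have hk: "homog (e + e') (h * k)" "h * k \<notin> p" using homog_mult h k pm by auto
 have "(h * k) * (a * b * (f' * g') - a' * b' * (f * g)) = (k * b * g') * (h * (a * f' - a' * f)) + (h * a' * f) * (k * (b * g' - b' * g))"
  by (simp add: algebra_simps)
 then have "(h * k) * (a * b * (f' * g') - a' * b' * (f * g)) : I" using ID(2)[OF ID(3)[OF h(3)] ID(3)[OF k(3)]] by simp
 then show "hrel p (a * b) (f * g) (a' * b') (f' * g')" unfolding hrel_def using hk by blast
 have "(h * k) * ((a * g + b * f) * (f' * g') - (a' * g' + b' * f') * (f * g)) =
   (k * g * g') * (h * (a * f' - a' * f)) + (h * f * f') * (k * (b * g' - b' * g))"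
  by (simp add: algebra_simps)
 then have "(h * k) * ((a * g + b * f) * (f' * g') - (a' * g' + b' * f') * (f * g)) : I" using ID(2)[OF ID(3)[OF h(3)] ID(3)[OF k(3)]] by simp
 then show "hrel p (a * g + b * f) (f * g) (a' * g' + b' * f') (f' * g')" unfolding hrel_def using hk by blast
qed

lemma in_hfrac: "(b, g) : hfrac I p a f \<longleftrightarrow> valid p b g \<and> hrel p a f b g"
 by (simp add: hfrac_def' valid_def)

lemma hfrac_eq:
 assumes f: "valid p a f" and g: "valid p b g"
 shows "hfrac I p a f = hfrac I p b g \<longleftrightarrow> hrel p a f b g"
proof
 assume "hfrac I p a f = hfrac I p b g"
 moreover have "(b, g) : hfrac I p b g" using g hrelI[of b g b g] by (simp add: in_hfrac)
 ultimately show "hrel p a f b g" using in_hfrac by metis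
next
 assume r: "hrel p a f b g"
 show "hfrac I p a f = hfrac I p b g"
  unfolding hfrac_def' using hrel_trans[OF g r] hrel_trans[OF f hrel_sym[OF r]] by blast
qed

lemma hfrac_eqI: "valid p a f ==> valid p b g ==> a * g = b * f ==> hfrac I p a f = hfrac I p b g"
 using hfrac_eq hrelI by blast

lemma hfrac_op:
 assumes v: "valid p a f" "valid p b g" and vo: "\<And>a f b g. valid p a f ==> valid p b g ==> valid p (n a f b g) (f * g)"
  and r: "\<And>a f b g a' f' b' g'. hrel p a f a' f' ==> hrel p b g b' g' ==> hrel p (n a f b g) (f * g) (n a' f' b' g') (f' * g')"
 shows "(\<Union>(a', f')\<in>hfrac I p a f. \<Union>(b', g')\<in>hfrac I p b g. hfrac I p (n a' f' b' g') (f' * g')) = hfrac I p (n a f b g) (f * g)"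
proof -
 have key: "hfrac I p (n a' f' b' g') (f' * g') = hfrac I p (n a f b g) (f * g)"
  if "(a', f') : hfrac I p a f" "(b', g') : hfrac I p b g" for a' f' b' g'
  using that hfrac_eq[OF vo vo] v r[OF hrel_sym hrel_sym] by (simp add: in_hfrac)
 have "(\<Union>(a', f')\<in>hfrac I p a f. \<Union>(b', g')\<in>hfrac I p b g. hfrac I p (n a' f' b' g') (f' * g')) =
   (\<Union>x\<in>hfrac I p a f. \<Union>y\<in>hfrac I p b g. hfrac I p (n a f b g) (f * g))"
  by (intro SUP_cong refl) (use key in "auto simp only: split_beta prod.collapse")
 moreover have "(a, f) : hfrac I p a f" "(b, g) : hfrac I p b g" using v hrelI by (auto simp: in_hfrac)
 ultimately show ?thesis by blast
qed

lemma hom_loc_mult: "valid p a f ==> valid p b g ==> hfrac I p a f \<otimes>\<^bsub>hom_loc I p\<^esub> hfrac I p b g = hfrac I p (a * b) (f * g)"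
 unfolding hom_loc_def monoid.simps
 by (rule hfrac_op[where n = "\<lambda>a f b g. a * b"]) (simp_all add: valid_ops hrel_mult)

lemma hom_loc_add: "valid p a f ==> valid p b g ==> hfrac I p a f \<oplus>\<^bsub>hom_loc I p\<^esub> hfrac I p b g = hfrac I p (a * g + b * f) (f * g)"
 unfolding hom_loc_def ring.simps
 by (rule hfrac_op[where n = "\<lambda>a f b g. a * g + b * f"]) (simp_all add: valid_ops hrel_mult)

lemma hom_loc_carrier: "x : carrier (hom_loc I p) \<longleftrightarrow> (\<exists>a f. valid p a f \<and> x = hfrac I p a f)"
 by (auto simp: hom_loc_def valid_def hpair_def)

lemma hom_loc_const: "\<one>\<^bsub>hom_loc I p\<^esub> = hfrac I p 1 1" "\<zero>\<^bsub>hom_loc I p\<^esub> = hfrac I p 0 1"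
 by (simp_all add: hom_loc_def)

lemma hom_loc_cring: "cring (hom_loc I p)"
proof (rule cringI)
 let ?S = "hom_loc I p"
 show "abelian_group ?S"
 proof (rule abelian_groupI)
  fix x y z assume "x : carrier ?S" "y : carrier ?S" "z : carrier ?S"
  then obtain a f b g c k where v: "valid p a f" "valid p b g" "valid p c k" and e: "x = hfrac I p a f" "y = hfrac I p b g" "z = hfrac I p c k"
   using hom_loc_carrier by metis
  show "x \<oplus>\<^bsub>?S\<^esub> y : carrier ?S" using hom_loc_carrier hom_loc_add valid_ops(2) v e by metis
  show "(x \<oplus>\<^bsub>?S\<^esub> y) \<oplus>\<^bsub>?S\<^esub> z = x \<oplus>\<^bsub>?S\<^esub> (y \<oplus>\<^bsub>?S\<^esub> z)"
   unfolding e by (simp only: hom_loc_add valid_ops v) (rule hfrac_eqI, (intro valid_ops v)[1], (intro valid_ops v)[1], simp add: algebra_simps)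
  show "x \<oplus>\<^bsub>?S\<^esub> y = y \<oplus>\<^bsub>?S\<^esub> x"
   unfolding e by (simp only: hom_loc_add valid_ops v) (rule hfrac_eqI, (intro valid_ops v)[1], (intro valid_ops v)[1], simp add: algebra_simps)
 next
  show "\<zero>\<^bsub>?S\<^esub> : carrier ?S" using hom_loc_carrier valid_ops(5) hom_loc_const(2) by metis
  fix x assume "x : carrier ?S"
  then obtain a f where v: "valid p a f" and e: "x = hfrac I p a f" using hom_loc_carrier by blast
  show "\<zero>\<^bsub>?S\<^esub> \<oplus>\<^bsub>?S\<^esub> x = x" unfolding e hom_loc_const by (simp add: hom_loc_add valid_ops v)
  have "hfrac I p (- a) f \<oplus>\<^bsub>?S\<^esub> x = \<zero>\<^bsub>?S\<^esub>"
   unfolding e hom_loc_const hom_loc_add[OF valid_ops(3)[OF v] v]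
   by (rule hfrac_eqI) (use valid_ops(2)[OF valid_ops(3)[OF v] v] valid_ops(5) in "simp_all add: algebra_simps")
  then show "\<exists>y\<in>carrier ?S. y \<oplus>\<^bsub>?S\<^esub> x = \<zero>\<^bsub>?S\<^esub>" using hom_loc_carrier valid_ops(3)[OF v] by metis
 qed
 show "Group.comm_monoid ?S"
 proof (rule comm_monoidI)
  fix x y z assume "x : carrier ?S" "y : carrier ?S" "z : carrier ?S"
  then obtain a f b g c k where v: "valid p a f" "valid p b g" "valid p c k" and e: "x = hfrac I p a f" "y = hfrac I p b g" "z = hfrac I p c k"
   using hom_loc_carrier by metis
  show "x \<otimes>\<^bsub>?S\<^esub> y : carrier ?S" using hom_loc_carrier hom_loc_mult valid_ops(1) v e by metis
  show "(x \<otimes>\<^bsub>?S\<^esub> y) \<otimes>\<^bsub>?S\<^esub> z = x \<otimes>\<^bsub>?S\<^esub> (y \<otimes>\<^bsub>?S\<^esub> z)"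
   unfolding e by (simp add: hom_loc_mult valid_ops v mult.assoc)
  show "x \<otimes>\<^bsub>?S\<^esub> y = y \<otimes>\<^bsub>?S\<^esub> x"
   unfolding e by (simp add: hom_loc_mult valid_ops v mult.commute)
 next
  show "\<one>\<^bsub>?S\<^esub> : carrier ?S" using hom_loc_carrier valid_ops(4) hom_loc_const(1) by metis
  fix x assume "x : carrier ?S"
  then obtain a f where v: "valid p a f" and e: "x = hfrac I p a f" using hom_loc_carrier by blast
  show "\<one>\<^bsub>?S\<^esub> \<otimes>\<^bsub>?S\<^esub> x = x" unfolding e hom_loc_const by (simp add: hom_loc_mult valid_ops v)
 qed
 fix x y z assume "x : carrier ?S" "y : carrier ?S" "z : carrier ?S"
 then obtain a f b g c k where v: "valid p a f" "valid p b g" "valid p c k" and e: "x = hfrac I p a f" "y = hfrac I p b g" "z = hfrac I p c k"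
  using hom_loc_carrier by metis
 show "(x \<oplus>\<^bsub>?S\<^esub> y) \<otimes>\<^bsub>?S\<^esub> z = x \<otimes>\<^bsub>?S\<^esub> z \<oplus>\<^bsub>?S\<^esub> y \<otimes>\<^bsub>?S\<^esub> z"
  unfolding e by (simp only: hom_loc_add hom_loc_mult valid_ops v) (rule hfrac_eqI, (intro valid_ops v)[1], (intro valid_ops v)[1], simp add: algebra_simps)
qed

lemma hfrac_numerator: "valid p a f ==> valid p b g ==> hfrac I p a f = hfrac I p b g ==> a : p \<longleftrightarrow> b : p"
proof -
 assume v: "valid p a f" "valid p b g" and "hfrac I p a f = hfrac I p b g"
 then obtain h where "h \<notin> p" "h * (a * g - b * f) : I" using hfrac_eq unfolding hrel_def by blast
 then have d: "a * g - b * f : p" using Ip pm by blast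
 then have "a * g : p \<longleftrightarrow> b * f : p" using pD(2)[OF d, of "b * f"] pD(6)[OF _ d, of "a * g"] by auto
 then show ?thesis using pm v by (simp add: valid_def)
qed

end

end

section \<open>Sections over projective schemes\<close>

context proj begin

abbreviation "T \<equiv> proj_top I"
definition D where "D f = {p : proj_points I. f \<notin> p}"

lemma open_D: "homog d f ==> openin T (D f)"
 unfolding proj_top_def D_def by (rule topology_generated_by_Basis) blast

lemma topspace_T: "topspace T = proj_points I"
proof
 show "topspace T <= proj_points I" unfolding proj_top_def topology_generated_by_topspace by auto
 show "proj_points I <= topspace T"
 proof
  fix p assume p: "p : proj_points I"
  then obtain i where "mvar i \<notin> p" unfolding proj_points_def by auto
  then have "p : D (mvar i)" using p by (simp add: D_def)
  then show "p : topspace T" using subsetD[OF openin_subset[OF open_D[OF homog_mvar]]] by simp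
 qed
qed

lemma open_points: "openin T U ==> p : U ==> p : proj_points I"
 using openin_subset[of T U] topspace_T by blast

text \<open>The basic open sets are given by forms outside the prime ideal, so they contain with Q
  every prime inside Q.\<close>
lemma generization:
 assumes "openin T V" "p : V" "p' : proj_points I" "p' <= p"
 shows "p' : V"
proof -
 have "generate_topology_on {{p : proj_points I. f \<notin> p} |f. \<exists>d. homog d f} V"
  using assms(1) unfolding proj_top_def by (rule openin_topology_generated_by)
 then show ?thesis using assms(2)
 proof (induction rule: generate_topology_on.induct)
  case (Basis S)
  then show ?case using assms(3,4) by auto
 qed auto
qed

text \<open>The fraction a/f defines a section over U.\<close>
definition good where "good U a f \<longleftrightarrow> hpair a f \<and> (\<forall>p\<in>U. f \<notin> p)"

lemma good_valid: "good U a f ==> p : U ==> valid p a f"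
 by (simp add: good_def valid_def)

lemma good_mono: "good U a f ==> V <= U ==> good V a f"
 by (auto simp: good_def)

lemma good_ops:
 assumes U: "openin T U" and f: "good U a f"
 shows "good U b g ==> good U (a * b) (f * g)" "good U b g ==> good U (a * g + b * f) (f * g)" "good U (- a) f"
 using f hpair_ops(1)[of a f b g] hpair_ops(2)[of a f b g] hpair_ops(3)[of a f] pm[OF open_points[OF U]] by (simp_all add: good_def)

lemma good_const: "openin T U ==> good U 1 1" "openin T U ==> good U 0 1" "openin T U ==> good U (mconst c) 1"
 using hpair_ops(5-7) p1[OF open_points] by (auto simp: good_def)

definition fr where "fr U a f = (\<lambda>p\<in>U. hfrac I p a f)"

lemma sec_carrier:
 assumes U: "openin T U"
 shows "t : carrier (proj_sec I U) \<longleftrightarrow> t : extensional U \<and>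
  (\<forall>p\<in>U. \<exists>V a f. openin T V \<and> p : V \<and> V <= U \<and> good V a f \<and> (\<forall>q\<in>V. t q = hfrac I q a f))"
proof -
 have "(t : (\<Pi>\<^sub>E p\<in>U. carrier (hom_loc I p)) \<and> (\<forall>p\<in>U. \<exists>V a f. openin T V \<and> p : V \<and> V <= U \<and> (\<exists>d. homog d a \<and> homog d f) \<and>
     (\<forall>q\<in>V. f \<notin> q \<and> t q = hfrac I q a f))) \<longleftrightarrow> t : extensional U \<and>
  (\<forall>p\<in>U. \<exists>V a f. openin T V \<and> p : V \<and> V <= U \<and> good V a f \<and> (\<forall>q\<in>V. t q = hfrac I q a f))" (is "?L \<longleftrightarrow> ?R")
 proof
  assume ?L then show ?R unfolding good_def hpair_def PiE_iff by meson
 next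
  assume R: ?R
  have "t p : carrier (hom_loc I p)" if p: "p : U" for p
  proof -
   obtain V a f where V: "p : V" "good V a f" "\<forall>q\<in>V. t q = hfrac I q a f" using bspec[OF conjunct2[OF R] p] by (elim exE conjE) (rule that)
   then have "t p = hfrac I p a f" by simp
   then show ?thesis using hom_loc_carrier[OF open_points[OF U p]] good_valid[OF V(2,1)] by metis
  qed
  then show ?L using R unfolding good_def hpair_def PiE_iff by meson
 qed
 then show ?thesis unfolding proj_sec_def by simp
qed

lemma sec_in: "openin T U ==> t : carrier (proj_sec I U) ==> p : U ==> t p : carrier (hom_loc I p)"
 unfolding proj_sec_def by auto

lemma sec_localE:
 assumes "openin T U" "t : carrier (proj_sec I U)" "p : U"
 obtains V a f where "openin T V" "p : V" "V <= U" "good V a f" "\<forall>q\<in>V. t q = hfrac I q a f"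
 using bspec[OF conjunct2[OF iffD1[OF sec_carrier[OF assms(1)] assms(2)]] assms(3)] by (elim exE conjE) (rule that)

lemma fr_in: "openin T U ==> good U a f ==> fr U a f : carrier (proj_sec I U)"
 unfolding sec_carrier
 by (intro conjI ballI exI[of _ U] exI[of _ a] exI[of _ f]) (simp_all add: fr_def)

lemma sec_op:
 assumes U: "openin T U" and s: "s : carrier (proj_sec I U)" and t: "t : carrier (proj_sec I U)"
  and n: "\<And>V a f b g. openin T V ==> good V a f ==> good V b g ==> good V (n a f b g) (f * g)"
  and o: "\<And>p a f b g. p : proj_points I ==> valid p a f ==> valid p b g ==> oper p (hfrac I p a f) (hfrac I p b g) = hfrac I p (n a f b g) (f * g)"
 shows "(\<lambda>p\<in>U. oper p (s p) (t p)) : carrier (proj_sec I U)"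
 unfolding sec_carrier[OF U]
proof (intro conjI ballI)
 fix p assume p: "p : U"
 obtain V a f where V: "openin T V" "p : V" "V <= U" "good V a f" "\<forall>q\<in>V. s q = hfrac I q a f"
  by (rule sec_localE[OF U s p])
 obtain V' b g where V': "openin T V'" "p : V'" "V' <= U" "good V' b g" "\<forall>q\<in>V'. t q = hfrac I q b g"
  by (rule sec_localE[OF U t p])
 have o': "openin T (V \<inter> V')" by (rule openin_Int[OF V(1) V'(1)])
 have g: "good (V \<inter> V') a f" "good (V \<inter> V') b g" using good_mono[OF V(4)] good_mono[OF V'(4)] by auto
 show "\<exists>V a f. openin T V \<and> p : V \<and> V <= U \<and> good V a f \<and> (\<forall>q\<in>V. (\<lambda>p\<in>U. oper p (s p) (t p)) q = hfrac I q a f)"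
 proof (intro exI conjI ballI)
  show "openin T (V \<inter> V')" "p : V \<inter> V'" "V \<inter> V' <= U" using o' V V' by auto
  show "good (V \<inter> V') (n a f b g) (f * g)" by (rule n[OF o' g])
  fix q assume q: "q : V \<inter> V'"
  show "(\<lambda>p\<in>U. oper p (s p) (t p)) q = hfrac I q (n a f b g) (f * g)"
   using q subsetD[OF V(3), of q] V(5) V'(5) o[OF open_points[OF o' q] good_valid[OF g(1) q] good_valid[OF g(2) q]] by simp
 qed
qed simp

lemma sec_simps: "s \<otimes>\<^bsub>proj_sec I U\<^esub> t = (\<lambda>p\<in>U. s p \<otimes>\<^bsub>hom_loc I p\<^esub> t p)" "s \<oplus>\<^bsub>proj_sec I U\<^esub> t = (\<lambda>p\<in>U. s p \<oplus>\<^bsub>hom_loc I p\<^esub> t p)"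
 "\<one>\<^bsub>proj_sec I U\<^esub> = fr U 1 1" "\<zero>\<^bsub>proj_sec I U\<^esub> = fr U 0 1"
 by (simp_all add: proj_sec_def fr_def hom_loc_def)

lemma fr_mult: "openin T U ==> good U a f ==> good U b g ==> fr U a f \<otimes>\<^bsub>proj_sec I U\<^esub> fr U b g = fr U (a * b) (f * g)"
 and fr_add: "openin T U ==> good U a f ==> good U b g ==> fr U a f \<oplus>\<^bsub>proj_sec I U\<^esub> fr U b g = fr U (a * g + b * f) (f * g)"
 unfolding sec_simps fr_def
 by (auto intro!: restrict_ext simp: hom_loc_mult hom_loc_add good_valid open_points)

lemma fr_eqI: "openin T U ==> good U a f ==> good U b g ==> a * g = b * f ==> fr U a f = fr U b g"
 unfolding fr_def by (intro restrict_ext hfrac_eqI) (auto simp: good_valid open_points)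

lemma sec_ext: "openin T U ==> t : carrier (proj_sec I U) ==> t : extensional U"
 using conjunct1[OF iffD1[OF sec_carrier]] .

lemma proj_sec_cring:
 assumes U: "openin T U"
 shows "cring (proj_sec I U)"
proof -
 let ?S = "proj_sec I U"
 have L: "cring (hom_loc I p)" if "p : U" for p by (rule hom_loc_cring[OF open_points[OF U that]])
 note L' = cring.axioms(1)[OF L]
 note m = ring.is_monoid[OF L'] and A = ring.is_abelian_group[OF L']
 note A' = abelian_group.axioms(1)[OF A]
 have add: "x \<oplus>\<^bsub>?S\<^esub> y : carrier ?S" and mult: "x \<otimes>\<^bsub>?S\<^esub> y : carrier ?S" if "x : carrier ?S" "y : carrier ?S" for x y
  unfolding sec_simps
  by (rule sec_op[OF U that, where n = "\<lambda>a f b g. a * g + b * f"]; simp add: good_ops hom_loc_add)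
   (rule sec_op[OF U that, where n = "\<lambda>a f b g. a * b"]; simp add: good_ops hom_loc_mult)
 have one: "\<one>\<^bsub>?S\<^esub> : carrier ?S" and zero: "\<zero>\<^bsub>?S\<^esub> : carrier ?S" unfolding sec_simps using fr_in[OF U] good_const[OF U] by auto
 note i = sec_in[OF U]
 have k: "fr U 1 1 p = \<one>\<^bsub>hom_loc I p\<^esub>" "fr U 0 1 p = \<zero>\<^bsub>hom_loc I p\<^esub>" if "p : U" for p
  using that by (simp_all add: fr_def hom_loc_def)
 have ext: "x = y" if "x : carrier ?S" "y : carrier ?S" "\<And>p. p : U ==> x p = y p" for x y
  by (rule extensionalityI[OF sec_ext[OF U that(1)] sec_ext[OF U that(2)] that(3)])
 show ?thesis
 proof (rule cringI)
  show "abelian_group ?S"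
  proof (rule abelian_groupI)
   fix x y z assume x: "x : carrier ?S" and y: "y : carrier ?S" and z: "z : carrier ?S"
   show "x \<oplus>\<^bsub>?S\<^esub> y : carrier ?S" by (rule add[OF x y])
   show "(x \<oplus>\<^bsub>?S\<^esub> y) \<oplus>\<^bsub>?S\<^esub> z = x \<oplus>\<^bsub>?S\<^esub> (y \<oplus>\<^bsub>?S\<^esub> z)"
    by (rule ext[OF add[OF add[OF x y] z] add[OF x add[OF y z]]])
     (simp add: sec_simps abelian_monoid.a_assoc[OF A' i[OF x] i[OF y] i[OF z]])
   show "x \<oplus>\<^bsub>?S\<^esub> y = y \<oplus>\<^bsub>?S\<^esub> x"
    by (rule ext[OF add[OF x y] add[OF y x]]) (simp add: sec_simps abelian_monoid.a_comm[OF A' i[OF x] i[OF y]])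
  next
   show "\<zero>\<^bsub>?S\<^esub> : carrier ?S" by (rule zero)
   fix x assume x: "x : carrier ?S"
   show "\<zero>\<^bsub>?S\<^esub> \<oplus>\<^bsub>?S\<^esub> x = x"
    by (rule ext[OF add[OF zero x] x]) (simp add: sec_simps k abelian_monoid.l_zero[OF A' i[OF x]])
   have n1: "fr U (- 1) 1 : carrier ?S" by (rule fr_in[OF U good_ops(3)[OF U good_const(1)[OF U]]])
   have "fr U (- 1) 1 \<otimes>\<^bsub>?S\<^esub> x \<oplus>\<^bsub>?S\<^esub> x = \<zero>\<^bsub>?S\<^esub>"
   proof (rule ext[OF add[OF mult[OF n1 x] x] zero])
    fix p assume p: "p : U"
    interpret Lp: cring "hom_loc I p" by (rule L[OF p])
    note v = valid_ops(4)[OF open_points[OF U p]] valid_ops(5)[OF open_points[OF U p]]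
    note v1 = valid_ops(3)[OF open_points[OF U p] v(1)]
    have s: "hfrac I p (- 1) 1 \<oplus>\<^bsub>hom_loc I p\<^esub> \<one>\<^bsub>hom_loc I p\<^esub> = \<zero>\<^bsub>hom_loc I p\<^esub>"
     unfolding hom_loc_const[OF open_points[OF U p]] hom_loc_add[OF open_points[OF U p] v1 v(1)] by simp
    have n: "hfrac I p (- 1) 1 : carrier (hom_loc I p)" using hom_loc_carrier[OF open_points[OF U p]] v1 by blast
    have "hfrac I p (- 1) 1 \<otimes>\<^bsub>hom_loc I p\<^esub> x p \<oplus>\<^bsub>hom_loc I p\<^esub> x p = (hfrac I p (- 1) 1 \<oplus>\<^bsub>hom_loc I p\<^esub> \<one>\<^bsub>hom_loc I p\<^esub>) \<otimes>\<^bsub>hom_loc I p\<^esub> x p"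
     using n i[OF x p] by (simp add: Lp.l_distr)
    then show "(fr U (- 1) 1 \<otimes>\<^bsub>?S\<^esub> x \<oplus>\<^bsub>?S\<^esub> x) p = \<zero>\<^bsub>?S\<^esub> p"
     using p s i[OF x p] k(2)[OF p] by (simp add: sec_simps) (simp add: fr_def)
   qed
   then show "\<exists>y\<in>carrier ?S. y \<oplus>\<^bsub>?S\<^esub> x = \<zero>\<^bsub>?S\<^esub>" using mult[OF n1 x] by blast
  qed
  show "Group.comm_monoid ?S"
  proof (rule comm_monoidI)
   fix x y z assume x: "x : carrier ?S" and y: "y : carrier ?S" and z: "z : carrier ?S"
   show "x \<otimes>\<^bsub>?S\<^esub> y : carrier ?S" by (rule mult[OF x y])
   show "(x \<otimes>\<^bsub>?S\<^esub> y) \<otimes>\<^bsub>?S\<^esub> z = x \<otimes>\<^bsub>?S\<^esub> (y \<otimes>\<^bsub>?S\<^esub> z)"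
    by (rule ext[OF mult[OF mult[OF x y] z] mult[OF x mult[OF y z]]])
     (simp add: sec_simps monoid.m_assoc[OF m i[OF x] i[OF y] i[OF z]])
   show "x \<otimes>\<^bsub>?S\<^esub> y = y \<otimes>\<^bsub>?S\<^esub> x"
    by (rule ext[OF mult[OF x y] mult[OF y x]])
     (simp add: sec_simps comm_monoid.m_comm[OF cring.axioms(2)[OF L] i[OF x] i[OF y]])
  next
   show "\<one>\<^bsub>?S\<^esub> : carrier ?S" by (rule one)
   fix x assume x: "x : carrier ?S"
   show "\<one>\<^bsub>?S\<^esub> \<otimes>\<^bsub>?S\<^esub> x = x"
    by (rule ext[OF mult[OF one x] x]) (simp add: sec_simps k monoid.l_one[OF m i[OF x]])
  qed
  fix x y z assume x: "x : carrier ?S" and y: "y : carrier ?S" and z: "z : carrier ?S"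
  show "(x \<oplus>\<^bsub>?S\<^esub> y) \<otimes>\<^bsub>?S\<^esub> z = x \<otimes>\<^bsub>?S\<^esub> z \<oplus>\<^bsub>?S\<^esub> y \<otimes>\<^bsub>?S\<^esub> z"
   by (rule ext[OF mult[OF add[OF x y] z] add[OF mult[OF x z] mult[OF y z]]])
    (simp add: sec_simps ring.ring_simprules(13)[OF L' i[OF x] i[OF y] i[OF z]])
 qed
qed

lemma restrict_sec:
 assumes U: "openin T U" and V: "openin T V" "V <= U" and t: "t : carrier (proj_sec I U)"
 shows "restrict t V : carrier (proj_sec I V)"
 unfolding sec_carrier[OF V(1)]
proof (intro conjI ballI)
 fix p assume p: "p : V"
 then have pU: "p : U" using V by blast
 obtain W a f where W: "openin T W" "p : W" "W <= U" "good W a f" "\<forall>q\<in>W. t q = hfrac I q a f"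
  by (rule sec_localE[OF U t pU])
 show "\<exists>V' a f. openin T V' \<and> p : V' \<and> V' <= V \<and> good V' a f \<and> (\<forall>q\<in>V'. restrict t V q = hfrac I q a f)"
  by (intro exI[of _ "W \<inter> V"] exI[of _ a] exI[of _ f]) (use W V(1) p good_mono[OF W(4), of "W \<inter> V"] openin_Int[OF W(1) V(1)] in simp_all)
qed simp

lemma restrict_fr: "V <= U ==> restrict (fr U a f) V = fr V a f"
 unfolding fr_def by (rule ext) (auto simp: restrict_def)

lemma Proj_simps [simp]: "tspace (Proj I) = T" "sec (Proj I) = proj_sec I" "res (Proj I) U V t = restrict t V"
 "scal (Proj I) U c = fr U (mconst c) 1"
 by (simp_all add: Proj_def fr_def)

lemma presheaf_Proj: "presheaf (Proj I)"
proof (rule presheaf.intro)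
 fix U assume "openin (tspace (Proj I)) U"
 then have U: "openin T U" by simp
 show "cring (sec (Proj I) U)" using proj_sec_cring[OF U] by simp
 show "res (Proj I) U U t = t" if "t : carrier (sec (Proj I) U)" for t
  using sec_ext[OF U, of t] that by (simp add: extensional_restrict)
 note g = good_const[OF U]
 fix c e
 show "scal (Proj I) U c : carrier (sec (Proj I) U)" using fr_in[OF U g(3)] by simp
 show "scal (Proj I) U (c + e) = scal (Proj I) U c \<oplus>\<^bsub>sec (Proj I) U\<^esub> scal (Proj I) U e"
  by (simp add: fr_add[OF U g(3) g(3)] mconst_add)
 show "scal (Proj I) U (c * e) = scal (Proj I) U c \<otimes>\<^bsub>sec (Proj I) U\<^esub> scal (Proj I) U e"
  by (simp add: fr_mult[OF U g(3) g(3)] mconst_mult)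
 show "scal (Proj I) U 1 = \<one>\<^bsub>sec (Proj I) U\<^esub>" by (simp add: sec_simps mconst_def)
next
 fix U V assume "openin (tspace (Proj I)) U" "openin (tspace (Proj I)) V" "V <= U"
 then have U: "openin T U" and V: "openin T V" "V <= U" by simp_all
 show "res (Proj I) U V (scal (Proj I) U c) = scal (Proj I) V c" for c by (simp add: restrict_fr V)
 show "res (Proj I) U V : ring_hom (sec (Proj I) U) (sec (Proj I) V)"
 proof (rule ring_hom_memI)
  show "res (Proj I) U V \<one>\<^bsub>sec (Proj I) U\<^esub> = \<one>\<^bsub>sec (Proj I) V\<^esub>" by (simp add: sec_simps restrict_fr V)
 qed (use restrict_sec[OF U V] V in "auto simp: sec_simps restrict_def fun_eq_iff")
next
 show "res (Proj I) V W (res (Proj I) U V t) = res (Proj I) U W t" if "W <= V" for U V W t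
  using that by (auto simp: restrict_def fun_eq_iff)
qed

end

sublocale proj \<subseteq> PS: presheaf "Proj I" by (rule presheaf_Proj)

section \<open>Stalks of projective schemes\<close>

context proj begin

abbreviation "gfr P U a f \<equiv> germ (Proj I) P U (fr U a f)"
abbreviation "R P \<equiv> stalk (Proj I) P"
abbreviation "m P \<equiv> maxid (Proj I) P"

lemma germ_fraction:
 assumes "A : carrier (R P)"
 obtains U a f where "openin T U" "P : U" "good U a f" "A = gfr P U a f"
proof -
 obtain W t where W: "PS.sect P W t" "A = germ (Proj I) P W t" using assms PS.stalk_carrier by blast
 have w: "openin T W" "P : W" "t : carrier (proj_sec I W)" using PS.sectD[OF W(1)] by simp_all
 obtain U a f where U: "openin T U" "P : U" "U <= W" "good U a f" "\<forall>q\<in>U. t q = hfrac I q a f"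
  by (rule sec_localE[OF w(1,3,2)])
 have "restrict t U = fr U a f" unfolding fr_def by (rule restrict_ext) (use U(5) in simp)
 then have "A = gfr P U a f" using PS.germ_res[OF W(1) _ U(2,3)] U(1) W(2) by simp
 then show thesis using that U by blast
qed

lemma sect_fr: "openin T U ==> P : U ==> good U a f ==> PS.sect P U (fr U a f)"
 by (simp add: PS.sect_def fr_in)

lemma germ_fr_restrict:
 assumes "openin T U" "P : U" "good U a f" "openin T V" "P : V" "V <= U"
 shows "gfr P U a f = gfr P V a f"
 using PS.germ_res[OF sect_fr[OF assms(1-3)], of V] assms by (simp add: restrict_fr)

lemma germ_fr_value:
 assumes "openin T U" "P : U" "good U a f" "good U b g" "gfr P U a f = gfr P U b g"
 shows "hfrac I P a f = hfrac I P b g"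
proof -
 have "PS.agree P U (fr U a f) U (fr U b g)" using PS.germ_eq[OF sect_fr sect_fr] assms by blast
 then obtain W where W: "P : W" "W <= U \<inter> U" "restrict (fr U a f) W = restrict (fr U b g) W"
  unfolding PS.agree_def by auto
 have "restrict (fr U a f) W P = restrict (fr U b g) W P" using W(3) by simp
 then show ?thesis using W(1) assms(2) by (simp add: fr_def)
qed

lemma maxid_fr:
 assumes U: "openin T U" "P : U" and f: "good U a f"
 shows "gfr P U a f : m P \<longleftrightarrow> a : P"
proof -
 let ?R = "R P"
 have P: "P : proj_points I" by (rule open_points[OF U])
 interpret R: cring ?R by (rule PS.stalk_cring) (simp add: topspace_T P)
 have inR: "gfr P U a f : carrier ?R" by (rule PS.germ_in[OF sect_fr[OF U f]])
 have "gfr P U a f : Units ?R \<longleftrightarrow> a \<notin> P"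
 proof
  assume "gfr P U a f : Units ?R"
  then obtain B where B: "B : carrier ?R" "gfr P U a f \<otimes>\<^bsub>?R\<^esub> B = \<one>\<^bsub>?R\<^esub>" using R.Units_r_inv_ex by blast
  obtain W b g where W: "openin T W" "P : W" "good W b g" "B = gfr P W b g" by (rule germ_fraction[OF B(1)])
  let ?V = "U \<inter> W"
  have V: "openin T ?V" "P : ?V" using openin_Int[OF U(1) W(1)] U W by auto
  have g: "good ?V a f" "good ?V b g" using good_mono[OF f] good_mono[OF W(3)] by auto
  have "gfr P ?V (a * b) (f * g) = gfr P ?V 1 1"
   using B(2) PS.germ_mult[OF sect_fr[OF V g(1)] sect_fr[OF V g(2)]] PS.germ_const(1)[of P ?V] V
   by (simp add: W(4) germ_fr_restrict[OF U f V] germ_fr_restrict[OF W(1-3) V] fr_mult[OF V(1) g] sec_simps(3))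
  then have e: "hfrac I P (a * b) (f * g) = hfrac I P 1 1"
   by (rule germ_fr_value[OF V good_ops(1)[OF V(1) g] good_const(1)[OF V(1)]])
  have "a * b : P \<longleftrightarrow> 1 : P"
   by (rule hfrac_numerator[OF P good_valid[OF good_ops(1)[OF V(1) g] V(2)] valid_ops(4)[OF P] e])
  then show "a \<notin> P" using p1[OF P] pm[OF P] by blast
 next
  assume a: "a \<notin> P"
  obtain d where d: "homog d a" using f by (auto simp: good_def hpair_def)
  let ?V = "U \<inter> D a"
  have V: "openin T ?V" "P : ?V" using openin_Int[OF U(1) open_D[OF d]] U(2) P a by (auto simp: D_def)
  have g: "good ?V a f" "good ?V f a" using good_mono[OF f, of ?V] by (auto simp: good_def D_def hpair_ops(4))
  have e: "fr ?V (a * f) (f * a) = fr ?V 1 1"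
   by (rule fr_eqI[OF V(1) good_ops(1)[OF V(1) g] good_const(1)[OF V(1)]]) simp
  have 1: "gfr P ?V a f \<otimes>\<^bsub>?R\<^esub> gfr P ?V f a = \<one>\<^bsub>?R\<^esub>"
   using PS.germ_mult[OF sect_fr[OF V g(1)] sect_fr[OF V g(2)]] PS.germ_const(1)[of P ?V] V
   by (simp add: fr_mult[OF V(1) g] e sec_simps(3))
  have i: "gfr P ?V a f : carrier ?R" "gfr P ?V f a : carrier ?R"
   using PS.germ_in[OF sect_fr[OF V]] g by auto
  have "gfr P ?V a f : Units ?R"
   unfolding Units_def by (rule CollectI) (use 1 i R.m_comm[OF i] in \<open>intro conjI bexI[of _ "gfr P ?V f a"], simp_all\<close>)
  then show "gfr P U a f : Units ?R" using germ_fr_restrict[OF U f V] by simp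
 qed
 then show ?thesis using inR by (simp add: maxid_def)
qed

lemma two_fractions:
 assumes "A : carrier (R P)" "B : carrier (R P)"
 obtains U a f b g where "openin T U" "P : U" "good U a f" "good U b g" "A = gfr P U a f" "B = gfr P U b g"
proof -
 obtain U a f where U: "openin T U" "P : U" "good U a f" "A = gfr P U a f" by (rule germ_fraction[OF assms(1)])
 obtain W b g where W: "openin T W" "P : W" "good W b g" "B = gfr P W b g" by (rule germ_fraction[OF assms(2)])
 have V: "openin T (U \<inter> W)" "P : U \<inter> W" using openin_Int[OF U(1) W(1)] U W by auto
 show thesis
  by (rule that[OF V good_mono[OF U(3)] good_mono[OF W(3)]])
   (use germ_fr_restrict[OF U(1-3) V] germ_fr_restrict[OF W(1-3) V] U(4) W(4) in simp_all)
qed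

lemma maxid_ideal:
 assumes P: "P : proj_points I"
 shows "ideal (m P) (R P)"
proof -
 let ?R = "R P" and ?m = "m P"
 interpret R: cring ?R by (rule PS.stalk_cring) (simp add: topspace_T P)
 have sub: "?m <= carrier ?R" by (simp add: maxid_def)
 have mult: "x \<otimes>\<^bsub>?R\<^esub> y : ?m" if x: "x : carrier ?R" and y: "y : ?m" for x y
 proof -
  have yR: "y : carrier ?R" using y sub by blast
  obtain U a f b g where U: "openin T U" "P : U" and g: "good U a f" "good U b g"
   and e: "x = gfr P U a f" "y = gfr P U b g" by (rule two_fractions[OF x yR])
  have "b : P" using y maxid_fr[OF U g(2)] e by simp
  then have "a * b : P" using pm[OF P] by simp
  moreover have "x \<otimes>\<^bsub>?R\<^esub> y = gfr P U (a * b) (f * g)"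
   using PS.germ_mult[OF sect_fr[OF U g(1)] sect_fr[OF U g(2)]] by (simp add: e fr_mult[OF U(1) g])
  ultimately show ?thesis using maxid_fr[OF U good_ops(1)[OF U(1) g]] by simp
 qed
 have add: "x \<oplus>\<^bsub>?R\<^esub> y : ?m" if x: "x : ?m" and y: "y : ?m" for x y
 proof -
  have xR: "x : carrier ?R" and yR: "y : carrier ?R" using x y sub by blast+
  obtain U a f b g where U: "openin T U" "P : U" and g: "good U a f" "good U b g"
   and e: "x = gfr P U a f" "y = gfr P U b g" by (rule two_fractions[OF xR yR])
  have "a : P" "b : P" using x y maxid_fr[OF U g(1)] maxid_fr[OF U g(2)] e by simp_all
  then have "a * g + b * f : P" using pD(2)[OF P] pm[OF P] by simp
  moreover have "x \<oplus>\<^bsub>?R\<^esub> y = gfr P U (a * g + b * f) (f * g)"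
   using PS.germ_add[OF sect_fr[OF U g(1)] sect_fr[OF U g(2)]] by (simp add: e fr_add[OF U(1) g])
  ultimately show ?thesis using maxid_fr[OF U good_ops(2)[OF U(1) g]] by simp
 qed
 have zero: "\<zero>\<^bsub>?R\<^esub> : ?m"
 proof -
  have "\<zero>\<^bsub>?R\<^esub> \<notin> Units ?R"
  proof
   assume "\<zero>\<^bsub>?R\<^esub> : Units ?R"
   have X: "openin T (proj_points I)" "P : proj_points I" using openin_topspace[of T] P by (simp_all add: topspace_T)
   have "germ (Proj I) P (proj_points I) (fr (proj_points I) 0 1) : ?m"
    using maxid_fr[OF X good_const(2)[OF X(1)]] pD(1)[OF P] by simp
   then have "\<zero>\<^bsub>?R\<^esub> : ?m" using PS.germ_const(2)[of P "proj_points I"] X by (simp add: sec_simps)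
   then show False using \<open>\<zero>\<^bsub>?R\<^esub> : Units ?R\<close> by (simp add: maxid_def)
  qed
  then show ?thesis by (simp add: maxid_def)
 qed
 have neg: "\<ominus>\<^bsub>?R\<^esub> x : ?m" if x: "x : ?m" for x
 proof -
  have xR: "x : carrier ?R" using x sub by blast
  have "\<ominus>\<^bsub>?R\<^esub> x = (\<ominus>\<^bsub>?R\<^esub> \<one>\<^bsub>?R\<^esub>) \<otimes>\<^bsub>?R\<^esub> x" using xR by (simp add: R.l_minus)
  then show ?thesis using mult[of "\<ominus>\<^bsub>?R\<^esub> \<one>\<^bsub>?R\<^esub>", OF _ x] by simp
 qed
 show ?thesis
 proof (rule idealI[OF R.ring_axioms])
  show "subgroup ?m (add_monoid ?R)"
   by (rule R.add.subgroupI) (use sub zero add neg in auto)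
  show "x \<otimes>\<^bsub>?R\<^esub> a : ?m" if "a : ?m" "x : carrier ?R" for a x by (rule mult[OF that(2,1)])
  show "a \<otimes>\<^bsub>?R\<^esub> x : ?m" if a: "a : ?m" and x: "x : carrier ?R" for a x
   using mult[OF x a] R.m_comm[OF x subsetD[OF sub a]] by simp
 qed
qed

section \<open>Separating closed points\<close>

text \<open>Otherwise Q contains all forms of Q', hence Q', and every open set around Q contains Q';
  so Q is in the closure of the closed point Q'.\<close>
lemma homog_separation:
 assumes c: "closed_point (Proj I) Q'" and Q: "Q : proj_points I" and ne: "Q \<noteq> Q'"
 shows "\<exists>w d. homog d w \<and> w : Q' \<and> w \<notin> Q"
proof (rule ccontr)
 assume "\<not> ?thesis"
 then have no: "\<And>w d. homog d w ==> w : Q' ==> w : Q" by blast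
 have Q': "Q' : proj_points I" "closedin T {Q'}" using c by (auto simp: closed_point_def topspace_T)
 have id: "ideal Q polyring" by (rule type_primeD(1)[OF p_prime[OF Q]])
 have h: "homog_ideal Q'" using Q'(1) by (simp add: proj_points_def)
 have "{f : Q'. \<exists>d. homog d f} <= Q" using no by blast
 then have "genideal polyring {f : Q'. \<exists>d. homog d f} <= Q" unfolding genideal_def using id by blast
 then have sub: "Q' <= Q" using h by (simp add: homog_ideal_def)
 have "openin T (proj_points I - {Q'})" using Q'(2) by (simp add: closedin_def topspace_T)
 then have "Q' : proj_points I - {Q'}" by (rule generization) (use Q Q'(1) ne sub in auto)
 then show False by simp
qed

lemma homog_separation_finite:
 assumes "finite S" "\<And>Q'. Q' : S ==> closed_point (Proj I) Q'" and Q: "Q : proj_points I" "Q \<notin> S"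
 shows "\<exists>w d. homog d w \<and> w \<notin> Q \<and> (\<forall>Q'\<in>S. w : Q')"
 using assms
proof (induction S rule: finite_induct)
 case empty
 then show ?case using p1[OF Q(1)] homog_1 by (intro exI[of _ 1] exI[of _ 0]) simp
next
 case (insert Z S)
 obtain w d where w: "homog d w" "w \<notin> Q" "\<forall>Q'\<in>S. w : Q'" using insert by auto
 obtain v e where v: "homog e v" "v : Z" "v \<notin> Q" using homog_separation[OF insert.prems(1)[of Z] Q(1)] insert.prems by auto
 have "v * w : Q'" if Q': "Q' : insert Z S" for Q'
 proof -
  have "Q' : proj_points I" using insert.prems(1)[OF Q'] by (simp add: closed_point_def topspace_T)
  then show ?thesis using pm Q' v w by blast
 qed
 then show ?case using homog_mult[OF v(1) w(1)] pm[OF Q(1)] w v by (intro exI[of _ "v * w"] exI[of _ "e + d"]) simp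
qed

text \<open>Let w_Q be a form vanishing at all points of S but Q, with f0 as an additional factor at
  P. Powers of a variable that does not vanish at Q bring these forms to one degree N, and f' is
  their sum: modulo each Q a single term survives, so f' vanishes nowhere on S, and modulo P it
  agrees with its term c f0.\<close>
lemma homog_partition:
 assumes S: "finite S" "\<And>Q. Q : S ==> closed_point (Proj I) Q" and P: "P : S" and f0: "homog d0 f0" "f0 \<notin> P"
 shows "\<exists>c f' e N. homog e c \<and> homog N f' \<and> d0 + e = N \<and> (\<forall>Q\<in>S. f' \<notin> Q) \<and> c * f0 - f' : P \<and> (\<forall>Q\<in>S - {P}. c : Q)"
proof -
 have SX: "Q : proj_points I" if "Q : S" for Q using S(2)[OF that] by (simp add: closed_point_def topspace_T)
 have "\<forall>Q\<in>S. \<exists>w d. homog d w \<and> w \<notin> Q \<and> (\<forall>Q'\<in>S - {Q}. w : Q')"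
  by (rule ballI) (rule homog_separation_finite, use S SX in simp_all)
 from bchoice[OF this] obtain w where "\<forall>Q\<in>S. \<exists>d. homog d (w Q) \<and> w Q \<notin> Q \<and> (\<forall>Q'\<in>S - {Q}. w Q : Q')" by (rule exE)
 from bchoice[OF this] obtain d where wd: "\<forall>Q\<in>S. homog (d Q) (w Q) \<and> w Q \<notin> Q \<and> (\<forall>Q'\<in>S - {Q}. w Q : Q')" by (rule exE)
 have w: "\<And>Q. Q : S ==> homog (d Q) (w Q)" "\<And>Q. Q : S ==> w Q \<notin> Q" "\<And>Q Q'. Q : S ==> Q' : S - {Q} ==> w Q : Q'"
  using wd by simp_all
 have "\<forall>Q\<in>S. \<exists>i. mvar i \<notin> Q" using SX unfolding proj_points_def by blast
 then obtain i where i: "\<And>Q. Q : S ==> mvar (i Q) \<notin> Q" unfolding bchoice_iff by blast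
 define w' where "w' Q = (if Q = P then w P * f0 else w Q)" for Q
 define D' where "D' Q = (if Q = P then d P + d0 else d Q)" for Q
 define N where "N = (\<Sum>Q\<in>S. D' Q)"
 have DN: "D' Q \<le> N" if "Q : S" for Q unfolding N_def by (rule member_le_sum[OF that]) (use S(1) in auto)
 define u where "u Q = w' Q * mvar (i Q) ^ (N - D' Q)" for Q
 define f' where "f' = (\<Sum>Q\<in>S. u Q)"
 define c where "c = w P * mvar (i P) ^ (N - D' P)"
 have pw: "mvar (i Q) ^ n \<notin> Q" if "Q : S" for Q n
  by (induction n) (use p1[OF SX[OF that]] pm[OF SX[OF that]] i[OF that] in auto)
 have w'h: "homog (D' Q) (w' Q)" if "Q : S" for Q
  using w(1)[OF that] homog_mult[OF w(1)[OF P] f0(1)] by (simp add: w'_def D'_def)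
 have uh: "homog N (u Q)" if "Q : S" for Q
  using homog_mult[OF w'h[OF that] homog_power[OF homog_mvar, of "N - D' Q" "i Q"]] DN[OF that] by (simp add: u_def)
 have uQ: "u Q \<notin> Q" if "Q : S" for Q
  using pm[OF SX[OF that]] pw[OF that] w(2)[OF that] f0(2) by (auto simp: u_def w'_def)
 have uQ': "u Q' : Q" if "Q : S" "Q' : S - {Q}" for Q Q'
  using pm[OF SX[OF that(1)]] w(3)[of Q' Q] that by (auto simp: u_def w'_def)
 have rest: "(\<Sum>Q'\<in>S - {Q}. u Q') : Q" if Q: "Q : S" for Q
 proof -
  have "(\<Sum>Q'\<in>A. u Q') : Q" if "A <= S - {Q}" for A
   using that by (induction A rule: infinite_finite_induct) (use pD[OF SX[OF Q]] uQ'[OF Q] in auto)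
  then show ?thesis by simp
 qed
 have sp: "f' = u Q + (\<Sum>Q'\<in>S - {Q}. u Q')" if "Q : S" for Q unfolding f'_def by (rule sum.remove[OF S(1) that])
 have "f' \<notin> Q" if Q: "Q : S" for Q
  using pD(6)[OF SX[OF Q], of f' "\<Sum>Q'\<in>S - {Q}. u Q'"] rest[OF Q] uQ[OF Q] sp[OF Q] by auto
 moreover have "homog N f'" unfolding f'_def by (rule homog_sum[OF uh])
 moreover have "homog (d P + (N - D' P)) c"
  using homog_mult[OF w(1)[OF P] homog_power[OF homog_mvar, of "N - D' P" "i P"]] by (simp add: c_def)
 moreover have "d0 + (d P + (N - D' P)) = N" using DN[OF P] by (simp add: D'_def)
 moreover have "c * f0 - f' : P"
 proof -
  have "c * f0 = u P" by (simp add: c_def u_def w'_def algebra_simps)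
  then have "c * f0 - f' = - (\<Sum>Q'\<in>S - {P}. u Q')" using sp[OF P] by simp
  then show ?thesis using pD(5)[OF SX[OF P] rest[OF P]] by simp
 qed
 moreover have "c : Q" if "Q : S - {P}" for Q
  using w(3)[OF P that] pm[OF SX] that by (simp add: c_def)
 ultimately show ?thesis by blast
qed

text \<open>If A = a/f at P, then a c / f' with the form c and the denominator f' for f0 = f agrees
  with a/f at P and vanishes at the other points.\<close>
lemma proj_separation:
 assumes S: "finite S" "\<And>Q. Q : S ==> closed_point (Proj I) Q" and P: "P : S" and A: "A : carrier (R P)"
 shows "\<exists>U t. openin T U \<and> S <= U \<and> t : carrier (proj_sec I U) \<and>
  germ (Proj I) P U t \<ominus>\<^bsub>R P\<^esub> A : m P \<and> (\<forall>Q\<in>S - {P}. germ (Proj I) Q U t : m Q)"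
proof -
 let ?R = "R P"
 have SX: "Q : proj_points I" if "Q : S" for Q using S(2)[OF that] by (simp add: closed_point_def topspace_T)
 note PX = SX[OF P]
 interpret R: cring ?R by (rule PS.stalk_cring) (simp add: topspace_T PX)
 obtain W a f where W: "openin T W" "P : W" "good W a f" "A = gfr P W a f" by (rule germ_fraction[OF A])
 obtain d where d: "homog d a" "homog d f" and fP: "f \<notin> P" using W by (auto simp: good_def hpair_def)
 obtain c f' e N where c: "homog e c" "homog N f'" "d + e = N" "\<forall>Q\<in>S. f' \<notin> Q" "c * f - f' : P" "\<forall>Q\<in>S - {P}. c : Q"
  using homog_partition[OF S P d(2) fP] by blast
 let ?U = "D f'" and ?V = "D f' \<inter> W"
 have U: "openin T ?U" by (rule open_D[OF c(2)])
 have SU: "Q : ?U" if "Q : S" for Q using SX[OF that] c(4) that by (simp add: D_def)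
 have gU: "good ?U (a * c) f'"
  using homog_mult[OF d(1) c(1)] c(2,3) by (auto simp: good_def D_def hpair_def)
 have V: "openin T ?V" "P : ?V" using openin_Int[OF U W(1)] SU[OF P] W(2) by auto
 note gV = good_mono[OF gU, of ?V] good_mono[OF W(3), of ?V]
 have gd: "good ?V (a * (c * f - f')) (f' * f)"
 proof -
  have "homog (d + N) (a * (c * f - f'))"
   by (rule homog_mult[OF d(1) homog_diff[OF _ c(2)]]) (use homog_mult[OF c(1) d(2)] c(3) in "simp add: add.commute")
  moreover have "homog (d + N) (f' * f)" using homog_mult[OF c(2) d(2)] by (simp add: add.commute)
  moreover have "f' * f \<notin> q" if "q : ?V" for q
   using gV that pm[OF open_points[OF V(1) that]] by (auto simp: good_def)
  ultimately show ?thesis unfolding good_def hpair_def by blast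
 qed
 let ?t = "gfr P ?V (a * c) f'" and ?A = "gfr P ?V a f"
  and ?d = "gfr P ?V (a * (c * f - f')) (f' * f)"
 have i: "?t : carrier ?R" "?A : carrier ?R" "?d : carrier ?R" using PS.germ_in[OF sect_fr[OF V]] gV gd by auto
 have "?A \<oplus>\<^bsub>?R\<^esub> ?d = ?t"
 proof -
  have g2: "good ?V a f" using gV(2) by simp
  have "fr ?V (a * (f' * f) + (a * (c * f - f')) * f) (f * (f' * f)) = fr ?V (a * c) f'"
   by (rule fr_eqI[OF V(1) good_ops(2)[OF V(1) g2 gd]]) (use gV(1) in "simp_all add: algebra_simps")
  then show ?thesis using PS.germ_add[OF sect_fr[OF V g2] sect_fr[OF V gd]] by (simp add: fr_add[OF V(1) g2 gd])
 qed
 then have "?t \<ominus>\<^bsub>?R\<^esub> ?A = ?d" using i by (metis R.a_comm R.add.inv_solve_right R.minus_eq)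
 moreover have "?d : m P" using maxid_fr[OF V gd] c(5) pm[OF PX] by simp
 moreover have "gfr P ?U (a * c) f' = ?t" by (rule germ_fr_restrict[OF U SU[OF P] gU V]) simp
 moreover have "A = ?A" unfolding W(4) by (rule germ_fr_restrict[OF W(1-3) V]) simp
 ultimately have 1: "gfr P ?U (a * c) f' \<ominus>\<^bsub>?R\<^esub> A : m P" by simp
 have 2: "gfr Q ?U (a * c) f' : m Q" if Q: "Q : S - {P}" for Q
  using maxid_fr[OF U SU gU, of Q] c(6) Q pm[OF SX, of Q] by simp
 show ?thesis
  by (intro exI[of _ ?U] exI[of _ "fr ?U (a * c) f'"] conjI ballI) (use U SU fr_in[OF U gU] 1 2 in auto)
qed

end

theorem proposition3p5:
  fixes I :: "('k::field, 'n::finite) mpoly set"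
    and \<C> :: "('k, ('k, 'n) mpoly set, ('k, 'n) proj_section) rspace"
    and G :: "(('k, 'n) mpoly set, ('k, 'n) proj_section) morph set"
    and P :: "('k, 'n) mpoly set"
    and d :: nat
    and C :: "('k, 'c, (('k, 'n) mpoly set, ('k, 'n) proj_section) morph) gmod"
    and W :: "('k, 'w, (('k, 'n) mpoly set, ('k, 'n) proj_section) morph) gmod"
  assumes "perfect_field TYPE('k)"
    and "smooth_proj_geom_irred_curve I"
    and "\<C> = Proj I"
    and "subgroup G (Aut \<C>)" and "finite G"
    and "tamely_ramified \<C> G"
    and "closed_point \<C> P"
    and "1 \<le> d" and "d < tame_index \<C> G P"
    and "is_W \<C> G P d C W"
  shows
    "(comm_group (res_gal \<C> G P) \<longrightarrow>
        grp_iso (decomp_grp \<C> G P) W (cotangent_neg_pow \<C> P d)) \<and>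
     (inertia_central \<C> G P \<longrightarrow>
        (\<exists>\<chi> :: ('k, 'w, (('k, 'n) mpoly set, ('k, 'n) proj_section) morph) gmod.
           fg_module (inertia_grp \<C> G P) \<chi> \<and>
           grp_iso (decomp_grp \<C> G P) W (Ind (decomp_grp \<C> G P) (inertia \<C> G P) \<chi>)) \<and>
        (decomp_splits \<C> G P \<longrightarrow>
           grp_iso (decomp_grp \<C> G P) W (cotangent_neg_pow \<C> P d)))"
proof -
  have I: "ideal I polyring" and smooth: "smooth_dim1 (Proj I)"
    using assms(2) by (simp_all add: smooth_proj_geom_irred_curve_def homog_ideal_def)
  interpret proj I by (rule proj.intro[OF I])
  interpret space_action "Proj I" G
    by (intro space_action.intro presheaf_Proj space_action_axioms.intro)
       (use assms(3-5) maxid_ideal proj_separation in "simp_all add: topspace_T")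
  interpret TP: tame_point "Proj I" G P
    by (rule tame_point_at) (use assms smooth in simp_all)
  show ?thesis
    using TP.W_at_tame_point[OF assms(8)] assms(9,10) unfolding assms(3) by blast
qed

end
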